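(* Let $n\ge2$ and $\sigma=(n-1)/2$. (1) (Weak type.) There is a constant $C_n>0$ depending only on $n$ such that for every $1<k\le 3/2$, every Radon measure $\mu$ on $\mathbb{R}^n$, every $f\in L^1(\mu)$ and every $\lambda>0$, $$\mu\{x: M_{k,\mu}f(x)>\lambda\}\le\frac{C_n(k-1)^{-\sigma}}{\lambda}\int|f|\,d\mu.$$ The factor $(k-1)^{-\sigma}$ is sharp up to dimensional constants: there is $c_n>0$ depending only on $n$ such that for every $1<k\le3/2$ the supremum over Radon measures $\mu$ on $\mathbb{R}^n$ of the smallest constant $K\in[0,\infty]$ for which $\mu\{M_{k,\mu}f>\lambda\}\le K\lambda^{-1}\int|f|\,d\mu$ holds for all $f\in L^1(\mu)$, $\lambda>0$, is at least $c_n(k-1)^{-\sigma}$. (2) (Strong type.) For every $1<p<\infty$ there are constants $0<c_{n,p}\le C_{n,p}<\infty$ depending only on $n,p$ such that for every $1<k\le3/2$, $$c_{n,p}(k-1)^{-\sigma/p}\le\sup_\mu\|M_{k,\mu}\|_{L^p(\mu)\to L^p(\mu)}\le C_{n,p}(k-1)^{-\sigma/p},$$ where the supremum runs over all Radon measures $\mu$ on $\mathbb{R}^n$. (3) (Fefferman--Stein inequality.) For every $1<p<\infty$ there is a constant $C_{n,p}>0$ depending only on $n,p$ such that for every $1<k\le3/2$, every Radon measure $\mu$ on $\mathbb{R}^n$, and all $f,g\in L^1_{\mathrm{loc}}(\mu)$ with $g\ge0$, $$\int(M_{k,\mu}f)^p\,g\,d\mu\le C_{n,p}(k-1)^{-\sigma}\int|f|^p\,M_{\sqrt{k},\mu}g\,d\mu.$$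 The power $\sigma$ here is optimal: for each $1<p<\infty$, the inequality fails to hold (uniformly over all such $k,\mu,f,g$) if $C_{n,p}(k-1)^{-\sigma}$ is replaced by $C(k-1)^{-\tau}$ with any $\tau<\sigma$ and any constant $C$. (4) The lower bounds in (1), (2), (3) hold for a single measure: there are a constant $C_n$ depending only on $n$ and a probability measure $d\mu=w\,dx$ on $\mathbb{R}^n$ with $w\in C^\infty(\mathbb{R}^n)$ and $0<w\le C_n$, independent of $k$ and $p$, such that (with constants $c_n,c_{n,p}>0$ depending only on $n$, respectively on $n,p$) for every $1<k\le3/2$ and $1<p<\infty$ the best weak-type $(1,1)$ constant of $M_{k,\mu}$ with respect to this $\mu$ is at least $c_n(k-1)^{-\sigma}$ and $\|M_{k,\mu}\|_{L^p(\mu)\to L^p(\mu)}\ge c_{n,p}(k-1)^{-\sigma/p}$; and the optimality of the power $\sigma$ in (3) already holds when the inequality is considered for this $\mu$ only.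
   Context: All balls are open Euclidean balls $B(c,r)$ in $\mathbb{R}^n$ with positive radii, and $aB(c,r)=B(c,ar)$ for $a>0$. For a Radon measure $\mu$ on $\mathbb{R}^n$ and $k>1$, the modified uncentered maximal operator is $$M_{k,\mu}f(x)=\sup_{B\ni x}\frac{1}{\mu(kB)}\int_B|f|\,d\mu,$$ where the supremum is over all balls $B$ containing $x$, with the convention $0/0=0$. The notation $\|M_{k,\mu}\|_{L^p(\mu)\to L^p(\mu)}$ denotes the smallest constant $K\in[0,\infty]$ with $\|M_{k,\mu}f\|_{L^p(\mu)}\le K\|f\|_{L^p(\mu)}$ for all $f\in L^p(\mu)$. The best weak-type $(1,1)$ constant of $M_{k,\mu}$ is the smallest $K\in[0,\infty]$ with $\mu\{M_{k,\mu}f>\lambda\}\le K\lambda^{-1}\int|f|\,d\mu$ for all $f\in L^1(\mu)$ and $\lambda>0$. *)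

theory Defs
  imports "HOL-Probability.Probability"
begin

(* On R^n the two regularity clauses follow from the first two; they are part of the
   usual definition of a Radon measure and are kept for that reason. *)
definition radon_measure :: "(real ^ 'n) measure \<Rightarrow> bool" where
  "radon_measure \<mu> \<longleftrightarrow>
     sets \<mu> = sets borel \<and>
     (\<forall>K. compact K \<longrightarrow> emeasure \<mu> K < \<infinity>) \<and>
     (\<forall>B\<in>sets borel. emeasure \<mu> B = (INF U\<in>{U. open U \<and> B \<subseteq> U}. emeasure \<mu> U)) \<and>
     (\<forall>U. open U \<longrightarrow> emeasure \<mu> U = (SUP K\<in>{K. compact K \<and> K \<subseteq> U}. emeasure \<mu> K))"

(* The convention 0/0 = 0 holds for division on ennreal, where 0/0 = 0 * \<infinity> = 0. *)
definition maximal_op :: "real \<Rightarrow> (real ^ 'n) measure \<Rightarrow> (real ^ 'n \<Rightarrow> real) \<Rightarrow> real ^ 'n \<Rightarrow> ennreal" where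
  "maximal_op k \<mu> f x =
     (SUP (c, r)\<in>{(c, r). 0 < r \<and> x \<in> ball c r}.
        (\<integral>\<^sup>+y\<in>ball c r. ennreal \<bar>f y\<bar> \<partial>\<mu>) / emeasure \<mu> (ball c (k * r)))"

(* Intended for exponents p > 0 only. *)
definition ennreal_powr :: "ennreal \<Rightarrow> real \<Rightarrow> ennreal" where
  "ennreal_powr a p = (if a = \<infinity> then \<infinity> else ennreal (enn2real a powr p))"

definition Lp_norm :: "(real ^ 'n) measure \<Rightarrow> real \<Rightarrow> (real ^ 'n \<Rightarrow> ennreal) \<Rightarrow> ennreal" where
  "Lp_norm \<mu> p h = ennreal_powr (\<integral>\<^sup>+x. ennreal_powr (h x) p \<partial>\<mu>) (1 / p)"

definition in_Lp :: "(real ^ 'n) measure \<Rightarrow> real \<Rightarrow> (real ^ 'n \<Rightarrow> real) \<Rightarrow> bool" where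
  "in_Lp \<mu> p f \<longleftrightarrow> f \<in> borel_measurable \<mu> \<and> Lp_norm \<mu> p (\<lambda>x. ennreal \<bar>f x\<bar>) < \<infinity>"

definition in_L1_loc :: "(real ^ 'n) measure \<Rightarrow> (real ^ 'n \<Rightarrow> real) \<Rightarrow> bool" where
  "in_L1_loc \<mu> f \<longleftrightarrow> f \<in> borel_measurable \<mu> \<and> (\<forall>K. compact K \<longrightarrow> set_integrable \<mu> K f)"

(* In the next two definitions the set of admissible constants contains \<infinity> and is closed
   under infima, so the infimum is the smallest admissible constant in [0, \<infinity>].
   (On ennreal, \<infinity> * 0 = 0; if f = 0 almost everywhere, its maximal function is 0.) *)
definition maximal_weak_const :: "real \<Rightarrow> (real ^ 'n) measure \<Rightarrow> ennreal" where
  "maximal_weak_const k \<mu> =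
     Inf {K. \<forall>f l. integrable \<mu> f \<longrightarrow> 0 < l \<longrightarrow>
            emeasure \<mu> {x. ennreal l < maximal_op k \<mu> f x}
              \<le> K * ennreal (1 / l) * (\<integral>\<^sup>+x. ennreal \<bar>f x\<bar> \<partial>\<mu>)}"

definition maximal_op_norm :: "real \<Rightarrow> (real ^ 'n) measure \<Rightarrow> real \<Rightarrow> ennreal" where
  "maximal_op_norm k \<mu> p =
     Inf {K. \<forall>f. in_Lp \<mu> p f \<longrightarrow>
            Lp_norm \<mu> p (maximal_op k \<mu> f) \<le> K * Lp_norm \<mu> p (\<lambda>x. ennreal \<bar>f x\<bar>)}"

definition fefferman_stein_ineq :: "real \<Rightarrow> (real ^ 'n) measure \<Rightarrow> real \<Rightarrow> real \<Rightarrow> bool" where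
  "fefferman_stein_ineq k \<mu> p K \<longleftrightarrow>
     (\<forall>f g. in_L1_loc \<mu> f \<longrightarrow> in_L1_loc \<mu> g \<longrightarrow> (\<forall>x. 0 \<le> g x) \<longrightarrow>
        (\<integral>\<^sup>+x. ennreal_powr (maximal_op k \<mu> f x) p * ennreal (g x) \<partial>\<mu>)
          \<le> ennreal K * (\<integral>\<^sup>+x. ennreal (\<bar>f x\<bar> powr p) * maximal_op (sqrt k) \<mu> g x \<partial>\<mu>))"

(* C^m on the whole space: f is differentiable and all directional derivatives are C^(m-1). *)
primrec C_times :: "nat \<Rightarrow> ('a::real_normed_vector \<Rightarrow> real) \<Rightarrow> bool" where
  "C_times 0 f \<longleftrightarrow> continuous_on UNIV f"
| "C_times (Suc m) f \<longleftrightarrow>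
     (\<forall>x. f differentiable (at x)) \<and> (\<forall>v. C_times m (\<lambda>x. frechet_derivative f (at x) v))"

definition C_infinity :: "('a::real_normed_vector \<Rightarrow> real) \<Rightarrow> bool" where
  "C_infinity f \<longleftrightarrow> (\<forall>m. C_times m f)"

end

theory Submission
  imports Defs
begin

text \<open>
  The upper bounds rest on a covering lemma: from finitely many balls one can select some whose dilates
  by \<open>1 + d\<close> still cover, while the selected balls themselves overlap at most \<open>C d powr (- \<sigma>)\<close> times.
  The selection is greedy, from large to small dyadic scales; a point \<open>y\<close> not yet covered selects the ball of
  the current scale with least power \<open>|y - c|\<^sup>2 - r\<^sup>2\<close>. To count the selected balls containing a given point, fix the
  relative depth \<open>T \<ge> d\<close> of the points \<open>y\<close> in their balls. Within one scale, minimality of the power and the gap \<open>T\<close>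
  make the points, expanded along their unit normals, separated at distance of order \<open>sqrt T\<close>, and they lie near a
  hypersurface; packing gives \<open>T powr (- \<sigma>)\<close>. Across scales the counts decay geometrically, except for balls that
  barely stick out of the larger ones. In the plane, after restriction to boundedly many directions, these force the
  slopes of the centres to move monotonically from scale to scale, so that the counts telescope; in higher
  dimensions an integral over the centres telescopes instead.

  Applied with \<open>1 + d = sqrt k\<close> to a cover of a superlevel set, the lemma gives the weak-type inequality with
  the weight \<open>g\<close> on the left and its maximal function for the dilation \<open>sqrt k\<close> on the right, since a \<open>sqrt k\<close>-dilate of the ball \<open>sqrt k B\<close> is \<open>k B\<close>. A dyadic
  layer-cake argument turns it into the Fefferman--Stein inequality, and \<open>g = 1\<close> yields the rest.

  For the lower bounds the mass sits near a hyperplane \<open>x \<bullet> e = 0\<close>, in a slab whose width \<open>1 / T\<^sup>2\<close> shrinks along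
  a second axis \<open>e'\<close>. Where the width is \<open>k - 1\<close>, every point of the slab lies in a ball of radius \<open>1/2\<close> almost tangent to
  the hyperplane, and the dilate by \<open>k\<close> meets the slab only in a cap of radius about \<open>sqrt (k - 1)\<close>. All these balls
  contain a common smaller ball, whose indicator is the test function; the second summand of the weight
  gives that ball the mass of one cap.
\<close>

section \<open>Packing\<close>

text \<open>The difference of the powers of two balls is affine in the point. The minimality
  conditions of two selected points therefore add up to a monotonicity relation between points and
  centres with a surplus of order \<open>T\<close>, and this is the source of the spacing
  \<open>sqrt T\<close>. Across scales the obstacle is a logarithm: the radii of the balls through
  one point may spread over a factor of order \<open>1 / d\<close>, hence over about log (1 / d)
  scales, and the bound for one scale cannot be paid for each of them. What telescopes is linear in
  the relative size \<open>X\<close> of the part that sticks out. If only the points are localised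
  to size \<open>X\<close>, one scale holds at most of order \<open>(X / T) powr \<sigma>\<close> of
  them; from dimension three on, \<sigma> is at least 1 and this is at most \<open>X\<close> times
  \<open>T powr (- \<sigma>)\<close>. In the plane \<sigma> is 1/2 and the comparison fails, so
  there the normals are localised to size \<open>X\<close> as well, and
  \<open>(X * X / T) powr \<sigma>\<close> is linear in \<open>X\<close> again.\<close>

lemma packing_card:
  fixes f :: "'i \<Rightarrow> 'a::euclidean_space"
  assumes fin: "finite I" and L: "\<And>i. i \<in> I \<Longrightarrow> dist z (f i) \<le> L"
    and sep: "\<And>i j. i \<in> I \<Longrightarrow> j \<in> I \<Longrightarrow> i \<noteq> j \<Longrightarrow> s \<le> dist (f i) (f j)"
    and s: "0 < s" "s \<le> L"
  shows "real (card I) \<le> (3 * L / s) ^ DIM('a)"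
proof -
  let ?B = "\<lambda>i. ball (f i) (s/2)" and ?v = "unit_ball_vol (real DIM('a))"
  have disj: "disjoint_family_on ?B I"
    unfolding disjoint_family_on_def using sep by (auto intro!: disjoint_ballI)
  have "real (card I) * (?v * (s/2) ^ DIM('a)) = (\<Sum>i\<in>I. measure lborel (?B i))"
    using s by (simp add: content_ball)
  also have "\<dots> = measure lborel (\<Union>i\<in>I. ?B i)"
    using disj fin emeasure_lborel_ball_finite
    by (intro measure_finite_Union[symmetric]) (auto simp: less_le)
  also have "\<dots> \<le> measure lborel (ball z (L + s/2))"
  proof (rule measure_mono_fmeasurable)
    show "(\<Union>i\<in>I. ?B i) \<subseteq> ball z (L + s/2)"
    proof safe
      fix i x assume "i \<in> I" "x \<in> ?B i"
      with L[of i] dist_triangle[of z x "f i"] show "x \<in> ball z (L + s/2)" by simp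
    qed
  next
    have "open (\<Union>i\<in>I. ?B i)" by auto
    then show "(\<Union>i\<in>I. ?B i) \<in> sets lborel" by simp
    show "ball z (L + s/2) \<in> fmeasurable lborel"
      using emeasure_lborel_ball_finite[of z "L + s/2"] by (simp add: fmeasurable_def)
  qed
  also have "\<dots> = ?v * (L + s/2) ^ DIM('a)" using s by (simp add: content_ball)
  finally have "real (card I) * (s/2) ^ DIM('a) \<le> (L + s/2) ^ DIM('a)"
    using unit_ball_vol_pos[of "real DIM('a)"] by (simp add: mult.left_commute)
  then have "real (card I) \<le> ((L + s/2) / (s/2)) ^ DIM('a)"
    using s by (simp only: power_divide) (subst pos_le_divide_eq, auto simp: power_divide)
  also have "\<dots> \<le> (3 * L / s) ^ DIM('a)"
    using s by (intro power_mono) (auto simp: field_simps)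
  finally show ?thesis .
qed

lemma exists_maximal_separated:
  fixes w :: "'i \<Rightarrow> 'a::metric_space"
  assumes "finite I"
  shows "\<exists>J\<subseteq>I. (\<forall>i\<in>J. \<forall>j\<in>J. i \<noteq> j \<longrightarrow> s \<le> dist (w i) (w j)) \<and> (\<forall>i\<in>I. \<exists>j\<in>J. i = j \<or> dist (w i) (w j) < s)"
  using assms
proof (induction I rule: finite_induct)
  case empty then show ?case by auto
next
  case (insert x I)
  then obtain J where J: "J \<subseteq> I" "\<forall>i\<in>J. \<forall>j\<in>J. i \<noteq> j \<longrightarrow> s \<le> dist (w i) (w j)"
    "\<forall>i\<in>I. \<exists>j\<in>J. i = j \<or> dist (w i) (w j) < s" by auto
  have J: "J \<subseteq> I" "\<And>i j. i \<in> J \<Longrightarrow> j \<in> J \<Longrightarrow> i \<noteq> j \<Longrightarrow> s \<le> dist (w i) (w j)"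
    "\<And>i. i \<in> I \<Longrightarrow> \<exists>j\<in>J. i = j \<or> dist (w i) (w j) < s" using J by auto
  show ?case
  proof (cases "\<exists>j\<in>J. dist (w x) (w j) < s")
    case True then show ?thesis using J by (intro exI[of _ J]) blast
  next
    case False then show ?thesis using J
      by (intro exI[of _ "insert x J"]) (auto simp: dist_commute not_less)
  qed
qed

text \<open>Packing bounds the number of cells around a maximal \<open>e / 2\<close>-separated
  family, and the most populous cell keeps a fixed share of \<open>I\<close>. In this way normals,
  directions and distances from the centre are made nearly constant at the price of a constant
  factor.\<close>

lemma pigeonhole_cell:
  fixes w :: "'i \<Rightarrow> 'a::euclidean_space"
  assumes fin: "finite I" and L: "\<And>i. i \<in> I \<Longrightarrow> dist z (w i) \<le> L" and e: "0 < e" "e \<le> 2 * L"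
  shows "\<exists>J\<subseteq>I. real (card I) \<le> (6 * L / e) ^ DIM('a) * real (card J) \<and> (\<forall>i\<in>J. \<forall>j\<in>J. dist (w i) (w j) \<le> e)"
proof (cases "I = {}")
  case True then show ?thesis by auto
next
  case False
  obtain K where K: "K \<subseteq> I" "\<forall>i\<in>K. \<forall>j\<in>K. i \<noteq> j \<longrightarrow> e/2 \<le> dist (w i) (w j)"
    "\<forall>i\<in>I. \<exists>j\<in>K. i = j \<or> dist (w i) (w j) < e/2"
    using exists_maximal_separated[OF fin, of "e/2" w] by (elim exE conjE)
  have finK: "finite K" using K(1) fin finite_subset by blast
  have Kne: "K \<noteq> {}" using K(3) False by blast
  define C where "C j = {i\<in>I. i = j \<or> dist (w i) (w j) < e/2}" for j
  have finC: "finite (C j)" for j using fin by (simp add: C_def)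
  have "Max ((\<lambda>k. card (C k)) ` K) \<in> (\<lambda>k. card (C k)) ` K" using finK Kne by (intro Max_in) auto
  then obtain j where "j \<in> K" "card (C j) = Max ((\<lambda>k. card (C k)) ` K)" by force
  then have j: "j \<in> K" "\<And>k. k \<in> K \<Longrightarrow> card (C k) \<le> card (C j)" using finK by auto
  have cK: "real (card K) \<le> (3 * L / (e/2)) ^ DIM('a)"
    using K e L finK by (intro packing_card[of K z w]) auto
  have "I \<subseteq> (\<Union>k\<in>K. C k)" using K(3) by (auto simp: C_def)
  then have "card I \<le> card (\<Union>k\<in>K. C k)" using finC finK by (intro card_mono) auto
  also have "\<dots> \<le> (\<Sum>k\<in>K. card (C k))" using finK by (rule card_UN_le)
  also have "\<dots> \<le> card K * card (C j)" using j(2) using sum_bounded_above[of K "\<lambda>k. card (C k)" "card (C j)"] by simp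
  finally have "real (card I) \<le> real (card K) * real (card (C j))"
    by (metis of_nat_le_iff of_nat_mult)
  also have "\<dots> \<le> (6 * L / e) ^ DIM('a) * real (card (C j))"
    using cK by (intro mult_right_mono) (auto simp: field_simps)
  finally have 1: "real (card I) \<le> (6 * L / e) ^ DIM('a) * real (card (C j))" .
  have 2: "dist (w a) (w b) \<le> e" if "a \<in> C j" "b \<in> C j" for a b
  proof -
    have "dist (w a) (w j) \<le> e/2" "dist (w b) (w j) \<le> e/2" using that e by (auto simp: C_def)
    then show ?thesis using dist_triangle2[of "w a" "w b" "w j"] by simp
  qed
  show ?thesis using 1 2 by (intro exI[of _ "C j"]) (auto simp: C_def)
qed

text \<open>Translating along \<open>e\<close> turns the flat configuration into a separated one of full dimension.\<close>
lemma flat_packing: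
  fixes f :: "'i \<Rightarrow> 'a::euclidean_space"
  assumes fin: "finite I" and b: "\<And>i j. i \<in> I \<Longrightarrow> j \<in> I \<Longrightarrow> dist (f i) (f j) \<le> b"
    and sep: "\<And>i j. i \<in> I \<Longrightarrow> j \<in> I \<Longrightarrow> i \<noteq> j \<Longrightarrow> s \<le> dist (f i) (f j)"
    and flat: "\<And>i j. i \<in> I \<Longrightarrow> j \<in> I \<Longrightarrow> \<bar>(f i - f j) \<bullet> e\<bar> \<le> norm (f i - f j) / 4"
    and e: "norm e = 1" and s: "0 < s" "s \<le> b"
  shows "real (card I) \<le> 12 ^ DIM('a) * (b / s) ^ (DIM('a) - 1)"
proof (cases "I = {}")
  case True then show ?thesis using s by simp
next
  case False
  then obtain i0 where i0: "i0 \<in> I" by auto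
  \<comment> \<open>The \<open>Q + 1\<close> copies spaced by \<open>s\<close> fill the length
    \<open>b\<close>. The enlarged family has at least \<open>b / s\<close> times as many members,
    which lowers the exponent in the packing bound by one.\<close>
  define Q where "Q = nat \<lfloor>b / s\<rfloor>"
  have Q: "real Q \<le> b / s" "b / s \<le> real Q + 1"
    using s by (auto simp: Q_def)
  let ?g = "\<lambda>(i,q). f i + (real q * s) *\<^sub>R e"
  let ?J = "I \<times> {..Q}"
  have "real (card ?J) \<le> (3 * (2*b) / (s/2)) ^ DIM('a)"
  proof (rule packing_card[of _ "f i0" ?g])
    show "finite ?J" using fin by simp
    show "0 < s/2" "s/2 \<le> 2*b" using s by auto
    fix x assume "x \<in> ?J"
    then obtain i q where x: "x = (i,q)" "i \<in> I" "q \<le> Q" by auto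
    have "real q * s \<le> b" using x Q(1) s by (smt (verit) mult_imp_le_div_pos of_nat_mono pos_le_divide_eq)
    then have "norm (f i0 - f i) + norm ((real q * s) *\<^sub>R e) \<le> b + b"
      using b[OF i0 x(2)] e s by (intro add_mono) (auto simp: dist_norm)
    then have "norm ((f i0 - f i) - (real q * s) *\<^sub>R e) \<le> b + b"
      using norm_triangle_ineq4 order_trans by blast
    then show "dist (f i0) (?g x) \<le> 2 * b" by (simp add: x dist_norm algebra_simps)
  next
    fix x x' assume "x \<in> ?J" "x' \<in> ?J" and ne: "x \<noteq> x'"
    then obtain i q i' q' where x: "x = (i,q)" "i \<in> I" "x' = (i',q')" "i' \<in> I" by auto
    define d where "d = f i - f i'"
    define g where "g = (real q - real q') * s"
    have eq: "?g x - ?g x' = d + g *\<^sub>R e" by (simp add: x d_def g_def algebra_simps)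
    \<comment> \<open>Flatness makes \<open>d\<close> nearly orthogonal to the shift, so the squared
      distance of two copies is at least three quarters of the Pythagorean sum.\<close>
    have "\<bar>d \<bullet> e\<bar> \<le> norm d / 4" using flat x by (simp add: d_def)
    then have "\<bar>g\<bar> * \<bar>d \<bullet> e\<bar> \<le> \<bar>g\<bar> * (norm d / 4)" by (intro mult_left_mono) auto
    then have "2 * (g * (d \<bullet> e)) \<ge> - (\<bar>g\<bar> * norm d / 2)"
      using abs_ge_minus_self[of "g * (d \<bullet> e)"] by (simp add: abs_mult)
    moreover have "(norm (d + g *\<^sub>R e))\<^sup>2 = (norm d)\<^sup>2 + 2 * (g * (d \<bullet> e)) + \<bar>g\<bar>\<^sup>2"
      using e by (simp only: power2_norm_eq_inner) (simp add: inner_simps inner_commute algebra_simps norm_eq_1 power2_eq_square)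
    moreover have "\<bar>g\<bar> * norm d \<le> (\<bar>g\<bar>\<^sup>2 + (norm d)\<^sup>2) / 2"
      using sum_squares_bound[of "\<bar>g\<bar>" "norm d"] by simp
    ultimately have "(norm (d + g *\<^sub>R e))\<^sup>2 \<ge> (3/4) * ((norm d)\<^sup>2 + \<bar>g\<bar>\<^sup>2)" by argo
    then have ge: "(norm (d + g *\<^sub>R e))\<^sup>2 \<ge> (3/4) * ((norm d)\<^sup>2 + g\<^sup>2)" by simp
    have "(norm d)\<^sup>2 + g\<^sup>2 \<ge> s\<^sup>2"
    proof (cases "i = i'")
      case True
      then have "q \<noteq> q'" using ne x by auto
      then have "1 \<le> \<bar>real q - real q'\<bar>" by linarith
      then have "s \<le> \<bar>g\<bar>" using s by (simp add: g_def abs_mult)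
      then have "s\<^sup>2 \<le> g\<^sup>2" using s by (metis abs_le_square_iff abs_of_pos)
      then show ?thesis using zero_le_power2[of "norm d"] by linarith
    next
      case False
      then have "s \<le> norm d" using sep x by (auto simp: d_def dist_norm)
      then have "s\<^sup>2 \<le> (norm d)\<^sup>2" using s by (intro power_mono) auto
      then show ?thesis by (simp add: add_increasing2)
    qed
    moreover have "(s/2)\<^sup>2 = s\<^sup>2 / 4" by (simp add: power_divide)
    ultimately have "(norm (d + g *\<^sub>R e))\<^sup>2 \<ge> (s/2)\<^sup>2" using ge zero_le_power2[of s] by argo
    then have "s/2 \<le> norm (d + g *\<^sub>R e)" by (rule power2_le_imp_le) simp
    moreover have "dist (?g x) (?g x') = norm (d + g *\<^sub>R e)" by (simp only: dist_norm eq)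
    ultimately show "s/2 \<le> dist (?g x) (?g x')" by linarith
  qed
  then have "real (card I) * (real Q + 1) \<le> (12 * (b / s)) ^ DIM('a)"
    by (simp add: card_cartesian_product algebra_simps)
  moreover have "real (card I) * (b / s) \<le> real (card I) * (real Q + 1)"
    using Q by (intro mult_left_mono) auto
  moreover have "(12 * (b / s)) ^ DIM('a) = 12 ^ DIM('a) * (b / s) ^ DIM('a)"
    by (rule power_mult_distrib)
  ultimately have "real (card I) * (b / s) \<le> 12 ^ DIM('a) * (b / s) ^ DIM('a)"
    by linarith
  also have "(b / s) ^ DIM('a) = (b / s) ^ (DIM('a) - 1) * (b / s)"
    by (metis DIM_positive One_nat_def Suc_pred power_Suc2)
  finally have "real (card I) * (b / s) \<le> (12 ^ DIM('a) * (b / s) ^ (DIM('a) - 1)) * (b / s)"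
    by (simp only: mult.assoc)
  then show ?thesis using s by (elim mult_right_le_imp_le) simp
qed

text \<open>Taking out the largest term leaves a family of the same kind with \<open>B / 2\<close>
  in place of \<open>B\<close>, and a geometric series results. The index set carries no order
  related to the size of the terms; hence the induction on the cardinality.\<close>

lemma sum_lacunary_powr_le:
  fixes f :: "'k \<Rightarrow> real"
  assumes "finite K" and "\<And>k. k \<in> K \<Longrightarrow> 0 < f k" "\<And>k. k \<in> K \<Longrightarrow> f k \<le> B"
    and "\<And>k l. k \<in> K \<Longrightarrow> l \<in> K \<Longrightarrow> k \<noteq> l \<Longrightarrow> 2 * f k \<le> f l \<or> 2 * f l \<le> f k"
    and "0 < g" "0 \<le> B"
  shows "(\<Sum>k\<in>K. f k powr g) \<le> B powr g / (1 - 2 powr (- g))"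
  using assms
proof (induction "card K" arbitrary: K B rule: nat_less_induct)
  case 1
  have pos: "0 < 1 - 2 powr (-g)" using \<open>0 < g\<close> by (simp add: powr_less_one)
  show ?case
  proof (cases "K = {}")
    case True then show ?thesis using pos by simp
  next
    case False
    have "Max (f ` K) \<in> f ` K" using 1(2) False by (intro Max_in) auto
    then obtain k where k: "k \<in> K" "f k = Max (f ` K)" by force
    then have k: "k \<in> K" "\<And>l. l \<in> K \<Longrightarrow> f l \<le> f k" using 1(2) by auto
    have B: "0 < B" using 1(3,4) k by force
    have "(\<Sum>l\<in>K-{k}. f l powr g) \<le> (B/2) powr g / (1 - 2 powr (- g))"
    proof (rule 1(1)[rule_format, of "card (K - {k})" "K - {k}"])
      show "card (K - {k}) < card K" using 1(2) k(1) by (rule card_Diff1_less)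
      fix l assume l: "l \<in> K - {k}"
      then have "2 * f l \<le> f k" using 1(5)[of l k] k 1(3)[of k] 1(3)[of l] by force
      then show "f l \<le> B/2" using 1(4)[OF k(1)] by simp
    qed (use 1 B in auto)
    moreover have "f k powr g \<le> B powr g" using 1(3,4,6) k by (intro powr_mono2) (auto simp: less_imp_le)
    moreover have "(\<Sum>l\<in>K. f l powr g) = f k powr g + (\<Sum>l\<in>K-{k}. f l powr g)"
      using 1(2) k by (simp add: sum.remove)
    moreover have "(B/2) powr g = B powr g * 2 powr (-g)" using B by (simp add: powr_divide powr_minus divide_simps)
    moreover have "B powr g * 2 powr (-g) / (1 - 2 powr (- g)) + B powr g = B powr g / (1 - 2 powr (- g))"
      using pos \<open>0 < g\<close> by (simp add: divide_simps) (simp add: algebra_simps)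
    moreover have "(B/2) powr g / (1 - 2 powr (- g)) = B powr g * 2 powr (-g) / (1 - 2 powr (- g))"
      using B by (simp add: powr_divide powr_minus divide_simps)
    ultimately show ?thesis by linarith
  qed
qed

text \<open>Discrete form of the argument that one bounded quantity, monotone from scale to scale,
  pays for all scales at once: \<open>hi k - lo k\<close> is the part used up at scale
  \<open>k\<close>.\<close>

lemma sum_telescoping_le:
  fixes lo hi :: "'k::linorder \<Rightarrow> real"
  assumes "finite K" and "\<And>k. k \<in> K \<Longrightarrow> 0 \<le> lo k" "\<And>k. k \<in> K \<Longrightarrow> hi k \<le> B"
    and "\<And>k l. k \<in> K \<Longrightarrow> l \<in> K \<Longrightarrow> k < l \<Longrightarrow> hi k \<le> lo l" and "0 \<le> B"
  shows "(\<Sum>k\<in>K. hi k - lo k) \<le> B"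
  using assms
proof (induction K arbitrary: B rule: finite_linorder_max_induct)
  case empty then show ?case by simp
next
  case (insert b A)
  have "(\<Sum>k\<in>A. hi k - lo k) \<le> lo b"
    using insert by (intro insert.IH) auto
  moreover have "hi b \<le> B" using insert by auto
  moreover have "b \<notin> A" using insert by auto
  moreover have "(\<Sum>k\<in>insert b A. hi k - lo k) = hi b - lo b + (\<Sum>k\<in>A. hi k - lo k)"
    using insert(1) \<open>b \<notin> A\<close> by (rule sum.insert)
  ultimately show ?case by linarith
qed

text \<open>Expanding makes the graph of the normal direction a separated set (Minty's trick).\<close>
lemma expand_normal_separated:
  fixes y y' v v' :: "'a::real_inner"
  assumes gap: "(y - y') \<bullet> (v' - v) + 3 * (norm (y - y'))\<^sup>2 \<ge> T / 16" and al: "12 \<le> al"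
  shows "(norm ((al *\<^sub>R y - v) - (al *\<^sub>R y' - v')))\<^sup>2
    \<ge> al\<^sup>2 / 2 * (norm (y - y'))\<^sup>2 + (norm (v - v'))\<^sup>2 + al * T / 8"
proof -
  define d e where "d = y - y'" and "e = v - v'"
  have eq: "(al *\<^sub>R y - v) - (al *\<^sub>R y' - v') = al *\<^sub>R d - e"
    by (simp add: d_def e_def algebra_simps)
  have "(norm (al *\<^sub>R d - e))\<^sup>2 = al\<^sup>2 * (norm d)\<^sup>2 - 2 * (al * (d \<bullet> e)) + (norm e)\<^sup>2"
    by (simp only: power2_norm_eq_inner) (simp add: inner_simps inner_commute algebra_simps power2_eq_square)
  moreover have "al * (- (d \<bullet> e)) \<ge> al * (T/16 - 3 * (norm d)\<^sup>2)"
    using gap al by (intro mult_left_mono) (auto simp: d_def e_def inner_diff_right)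
  moreover have "(al\<^sup>2 / 2) * (norm d)\<^sup>2 \<ge> 6 * al * (norm d)\<^sup>2"
    using al by (intro mult_right_mono) (auto simp: power2_eq_square)
  ultimately show ?thesis unfolding eq unfolding d_def[symmetric] e_def[symmetric]
    by (simp add: algebra_simps)
qed

text \<open>By \<open>h\<close> neither point lies far below the tangent plane at the other, so the
  displacement of the points is nearly tangential. The difference of two unit normals is orthogonal
  to their sum, hence nearly orthogonal to \<open>w\<close>. The expanded points thus follow a
  hypersurface with normal close to \<open>w\<close>, and packing them costs only the dimension
  minus one.\<close>

lemma expand_normal_flat:
  fixes y y' v v' w :: "'a::real_inner"
  assumes gap: "(y - y') \<bullet> (v' - v) + 3 * (norm (y - y'))\<^sup>2 \<ge> T / 16" and al: "12 \<le> al"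
    and h: "(y' - y) \<bullet> v \<ge> - 3 * (norm (y - y'))\<^sup>2 - 3 * T" "(y - y') \<bullet> v' \<ge> - 3 * (norm (y - y'))\<^sup>2 - 3 * T"
    and unit: "norm v = 1" "norm v' = 1" and close: "norm (v - w) \<le> 1/100" "norm (v' - w) \<le> 1/100"
      "norm (y - y') \<le> 1/100"
    and T: "0 < T" "al * T \<le> 1 / 160000"
  shows "\<bar>((al *\<^sub>R y - v) - (al *\<^sub>R y' - v')) \<bullet> w\<bar> \<le> norm ((al *\<^sub>R y - v) - (al *\<^sub>R y' - v')) / 8"
proof -
  define d e where "d = y - y'" and "e = v - v'"
  define N where "N = norm ((al *\<^sub>R y - v) - (al *\<^sub>R y' - v'))"
  have eq: "(al *\<^sub>R y - v) - (al *\<^sub>R y' - v') = al *\<^sub>R d - e"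
    by (simp add: d_def e_def algebra_simps)
  have N: "N\<^sup>2 \<ge> al\<^sup>2 / 2 * (norm d)\<^sup>2 + (norm e)\<^sup>2 + al * T / 8"
    unfolding N_def d_def e_def by (rule expand_normal_separated[OF gap al])
  have N0: "0 \<le> N" by (simp add: N_def)
  have nn: "0 \<le> al\<^sup>2 / 2 * (norm d)\<^sup>2" "0 \<le> (norm e)\<^sup>2" "0 \<le> al * T / 8" using al T by auto
  have n1: "al * norm d \<le> 3/2 * N"
  proof (rule power2_le_imp_le)
    have "al\<^sup>2 * (norm d)\<^sup>2 \<le> 2 * N\<^sup>2" using N nn by linarith
    moreover have "(al * norm d)\<^sup>2 = al\<^sup>2 * (norm d)\<^sup>2" by (rule power_mult_distrib)
    moreover have "(3/2 * N)\<^sup>2 = 9/4 * N\<^sup>2" by (simp add: power_mult_distrib power_divide)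
    ultimately show "(al * norm d)\<^sup>2 \<le> (3/2 * N)\<^sup>2" using zero_le_power2[of N] by linarith
  qed (use N0 in simp)
  have n2: "norm e \<le> N"
  proof (rule power2_le_imp_le)
    show "(norm e)\<^sup>2 \<le> N\<^sup>2" using N nn by linarith
  qed (rule N0)
  \<comment> \<open>The error of the flatness is linear in \<open>al * T\<close>, while the
    separation controls it only by \<open>N\<^sup>2\<close>. Of the two factors in the square of
    \<open>al * T\<close>, one is replaced by \<open>8 * N\<^sup>2\<close> and the other by its
    absolute bound, which leaves a small multiple of \<open>N\<close>.\<close>
  have n3: "al * T \<le> N / 100"
  proof (rule power2_le_imp_le)
    have "al * T \<le> 8 * N\<^sup>2" using N nn by linarith
    then have "(al * T) * (al * T) \<le> (8 * N\<^sup>2) * (1/160000)"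
      by (rule mult_mono[OF _ T(2)]) (use nn(3) zero_le_power2[of N] in auto)
    moreover have "(N / 100)\<^sup>2 = N\<^sup>2 / 10000" by (simp add: power_divide)
    ultimately show "(al * T)\<^sup>2 \<le> (N / 100)\<^sup>2"
      using zero_le_power2[of N] unfolding power2_eq_square[of "al * T"] by linarith
  qed (use N0 in simp)
  have sq: "3 * (norm d)\<^sup>2 \<le> 3/100 * norm d"
    using mult_right_mono[OF close(3), of "norm (y - y')"] by (simp add: d_def power2_eq_square)
  have c1: "\<bar>d \<bullet> (w - v)\<bar> \<le> norm d / 100" "\<bar>d \<bullet> (w - v')\<bar> \<le> norm d / 100"
    using order_trans[OF Cauchy_Schwarz_ineq2 mult_left_mono[OF close(1), of "norm d"]]
      order_trans[OF Cauchy_Schwarz_ineq2 mult_left_mono[OF close(2), of "norm d"]]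
      inner_minus_right[of d "v - w"] inner_minus_right[of d "v' - w"]
    by (auto simp: minus_diff_eq)
  have h': "d \<bullet> v \<le> 3 * (norm d)\<^sup>2 + 3 * T" "d \<bullet> v' \<ge> - 3 * (norm d)\<^sup>2 - 3 * T"
    using h by (auto simp: d_def inner_diff_left)
  have dw: "\<bar>d \<bullet> w\<bar> \<le> norm d / 25 + 3 * T"
    using abs_le_D1[OF c1(1)] abs_le_D2[OF c1(2)] h' sq
    unfolding inner_diff_right by (intro abs_leI) linarith+
  have "e \<bullet> (v + v') = 0" using unit
    by (simp add: e_def inner_simps inner_commute norm_eq_1)
  then have "e \<bullet> w = - (e \<bullet> ((v - w) + (v' - w))) / 2"
    by (simp add: inner_simps)
  also have "\<bar>\<dots>\<bar> \<le> norm e * (1/50) / 2"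
  proof -
    have "norm ((v - w) + (v' - w)) \<le> 1/50"
      using norm_triangle_ineq[of "v - w" "v' - w"] close by linarith
    then have "\<bar>e \<bullet> ((v - w) + (v' - w))\<bar> \<le> norm e * (1/50)"
      using order_trans[OF Cauchy_Schwarz_ineq2 mult_left_mono] by (metis norm_ge_zero)
    then show ?thesis by simp
  qed
  finally have ew: "\<bar>e \<bullet> w\<bar> \<le> norm e / 100" by simp
  have "\<bar>(al *\<^sub>R d - e) \<bullet> w\<bar> \<le> al * \<bar>d \<bullet> w\<bar> + \<bar>e \<bullet> w\<bar>"
    using al abs_triangle_ineq4[of "al * (d \<bullet> w)" "e \<bullet> w"] by (simp add: inner_simps abs_mult)
  also have "al * \<bar>d \<bullet> w\<bar> \<le> al * (norm d / 25 + 3 * T)"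
    using dw al by (intro mult_left_mono) auto
  finally have "\<bar>(al *\<^sub>R d - e) \<bullet> w\<bar> \<le> (al * norm d) / 25 + 3 * (al * T) + norm e / 100"
    using ew by (simp add: algebra_simps)
  also have "\<dots> \<le> N / 8" using n1 n2 n3 N0 by simp
  finally show ?thesis unfolding N_def eq by simp
qed

text \<open>Data of one scale: \<open>y i\<close> lies in the ball \<open>B (c i) (r i)\<close>, which has the least power at \<open>y i\<close>;
  the bound \<open>T\<close> controls the powers, and is at the same time the gap.\<close>
definition one_scale :: "'i set \<Rightarrow> ('i \<Rightarrow> 'a::real_inner) \<Rightarrow> ('i \<Rightarrow> 'a) \<Rightarrow> ('i \<Rightarrow> real) \<Rightarrow> real \<Rightarrow> bool" where
  "one_scale I y c r T \<longleftrightarrow> finite I \<and> 0 < T \<and>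
    (\<forall>i\<in>I. 1 \<le> r i \<and> r i \<le> 2 \<and> norm (y i - c i) \<le> r i \<and> (r i)\<^sup>2 - (norm (y i - c i))\<^sup>2 \<le> 4 * T) \<and>
    (\<forall>i\<in>I. \<forall>j\<in>I. (norm (y i - c i))\<^sup>2 - (r i)\<^sup>2 \<le> (norm (y i - c j))\<^sup>2 - (r j)\<^sup>2) \<and>
    (\<forall>i\<in>I. \<forall>j\<in>I. i \<noteq> j \<longrightarrow>
       T / 2 \<le> (norm (y i - c j))\<^sup>2 - (r j)\<^sup>2 - ((norm (y i - c i))\<^sup>2 - (r i)\<^sup>2) \<or>
       T / 2 \<le> (norm (y j - c i))\<^sup>2 - (r i)\<^sup>2 - ((norm (y j - c j))\<^sup>2 - (r j)\<^sup>2))"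

section \<open>Monotonicity and counting within one scale\<close>

lemma one_scale_subset:
  assumes "one_scale I y c r T" and J: "J \<subseteq> I"
  shows "one_scale J y c r T"
  using assms(1) finite_subset[OF J] subsetD[OF J] unfolding one_scale_def by meson

lemma one_scale_norm_ge:
  assumes "one_scale I y c r T" "i \<in> I" "T \<le> 1/32"
  shows "9/10 \<le> norm (y i - c i)" "norm (y i - c i) \<le> 2"
proof -
  have r: "1 \<le> r i" "r i \<le> 2" "norm (y i - c i) \<le> r i" "(r i)\<^sup>2 - (norm (y i - c i))\<^sup>2 \<le> 4 * T"
    using assms unfolding one_scale_def by auto
  show "norm (y i - c i) \<le> 2" using r by linarith
  have "1 \<le> (r i)\<^sup>2" using r by (simp add: one_le_power)
  then have "(9/10)\<^sup>2 \<le> (norm (y i - c i))\<^sup>2" using r assms(3) by (simp add: power2_eq_square)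
  then show "9/10 \<le> norm (y i - c i)" by (rule power2_le_imp_le) simp
qed

text \<open>The ball of \<open>j\<close> has the least power at \<open>y j\<close>, and this power
  is at least \<open>- 4 * T\<close>; so \<open>y j\<close> lies at most slightly inside the ball of
  \<open>i\<close>. Expanding around \<open>y i\<close> turns this into a bound for the normal
  component of the displacement, with the curvature of the sphere as the quadratic error.\<close>

lemma one_scale_support:
  assumes os: "one_scale I y c r T" and i: "i \<in> I" and j: "j \<in> I" and T: "T \<le> 1/32"
  shows "(y j - y i) \<bullet> sgn (y i - c i) \<ge> - 3 * (norm (y i - y j))\<^sup>2 - 3 * T"
proof -
  define n where "n = y i - c i"
  have nb: "9/10 \<le> norm n" using one_scale_norm_ge[OF os i T] by (simp add: n_def)
  define D where "D = (norm (y i - y j))\<^sup>2"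
  have *: "(norm (y j - c j))\<^sup>2 - (r j)\<^sup>2 \<le> (norm (y j - c i))\<^sup>2 - (r i)\<^sup>2"
    "norm (y i - c i) \<le> r i" "(r j)\<^sup>2 - (norm (y j - c j))\<^sup>2 \<le> 4 * T"
    using os i j unfolding one_scale_def by auto
  have "(norm (y j - c i))\<^sup>2 = (norm n)\<^sup>2 + 2 * ((y j - y i) \<bullet> n) + D"
    unfolding n_def D_def by (simp only: power2_norm_eq_inner) (simp add: inner_simps inner_commute)
  moreover have "(norm n)\<^sup>2 \<le> (r i)\<^sup>2" unfolding n_def using *(2) by (intro power_mono) auto
  ultimately have ge: "(y j - y i) \<bullet> n \<ge> - (4 * T + D) / 2" using * by simp
  have T0: "0 < T" using os by (simp add: one_scale_def)
  have D0: "0 \<le> D" by (simp add: D_def)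
  have "(y j - y i) \<bullet> sgn n = ((y j - y i) \<bullet> n) / norm n"
    by (simp add: sgn_div_norm divide_inverse mult.commute)
  also have "\<dots> \<ge> (- (4 * T + D) / 2) / norm n"
    using ge nb by (intro divide_right_mono) auto
  finally have "(y j - y i) \<bullet> sgn n \<ge> - ((4 * T + D) / 2 / norm n)" by (simp only: minus_divide_left)
  moreover have "(4 * T + D) / 2 / norm n \<le> (4 * T + D) / 2 / (9/10)"
    using nb T0 D0 by (intro divide_left_mono) auto
  moreover have "(4 * T + D) / 2 / (9/10) \<le> 3 * D + 3 * T" using T0 D0 by simp
  ultimately show ?thesis unfolding n_def[symmetric] D_def[symmetric] by linarith
qed

text \<open>The two minimality conditions, one of them with the surplus \<open>T / 2\<close>, add up
  to monotonicity of the vectors from the centres to the points. Passing to unit normals weights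
  them by different reciprocal lengths \<open>p\<close> and \<open>q\<close>. This leaves the term
  \<open>(p - q) * (t - s)\<close> with depths \<open>s\<close> and \<open>t\<close> up to
  \<open>4 * T\<close>, and the hypothesis \<open>close\<close> keeps it below the surplus.\<close>

lemma one_scale_gap:
  assumes os: "one_scale I y c r T" and i: "i \<in> I" and j: "j \<in> I" and ij: "i \<noteq> j" and T: "T \<le> 1/32"
    and close: "\<bar>norm (y i - c i) - norm (y j - c j)\<bar> \<le> 1/40"
  shows "(y i - y j) \<bullet> (sgn (y j - c j) - sgn (y i - c i)) + 3 * (norm (y i - y j))\<^sup>2 \<ge> T / 16"
proof -
  have main: "(y i - y j) \<bullet> (sgn (y j - c j) - sgn (y i - c i)) + 3 * (norm (y i - y j))\<^sup>2 \<ge> T / 16"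
    if i: "i \<in> I" and j: "j \<in> I" and close: "\<bar>norm (y i - c i) - norm (y j - c j)\<bar> \<le> 1/40"
      and g: "T / 2 \<le> (norm (y i - c j))\<^sup>2 - (r j)\<^sup>2 - ((norm (y i - c i))\<^sup>2 - (r i)\<^sup>2)" for i j
  proof -
    define m n where "m = y i - c i" and "n = y j - c j"
    define s t where "s = (r i)\<^sup>2 - (norm m)\<^sup>2" and "t = (r j)\<^sup>2 - (norm n)\<^sup>2"
    define d D where "d = y i - y j" and "D = (norm d)\<^sup>2"
    have mb: "9/10 \<le> norm m" "norm m \<le> 2" using one_scale_norm_ge[OF os i T] by (auto simp: m_def)
    have nb: "9/10 \<le> norm n" "norm n \<le> 2" using one_scale_norm_ge[OF os j T] by (auto simp: n_def)
    have T0: "0 < T" using os by (simp add: one_scale_def)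
    have D0: "0 \<le> D" by (simp add: D_def)
    have *: "(norm (y j - c j))\<^sup>2 - (r j)\<^sup>2 \<le> (norm (y j - c i))\<^sup>2 - (r i)\<^sup>2"
      "norm m \<le> r i" "norm n \<le> r j" "s \<le> 4 * T" "t \<le> 4 * T"
      using os i j unfolding one_scale_def m_def n_def s_def t_def by auto
    have st0: "0 \<le> s" "0 \<le> t" unfolding s_def t_def using *(2,3) by (auto intro!: power_mono)
    have e1: "(norm (y j - c i))\<^sup>2 = (norm m)\<^sup>2 - 2 * (d \<bullet> m) + D"
      unfolding m_def d_def D_def by (simp only: power2_norm_eq_inner) (simp add: inner_simps inner_commute)
    have e2: "(norm (y i - c j))\<^sup>2 = (norm n)\<^sup>2 + 2 * (d \<bullet> n) + D"
      unfolding n_def d_def D_def by (simp only: power2_norm_eq_inner) (simp add: inner_simps inner_commute)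
    have g1: "d \<bullet> n \<ge> (t - s + T/2 - D) / 2" using g e2 unfolding m_def[symmetric] s_def t_def by simp
    have g2: "- (d \<bullet> m) \<ge> (s - t - D) / 2" using *(1) e1 unfolding n_def[symmetric] s_def t_def by simp
    define p q where "p = 1 / norm n" and "q = 1 / norm m"
    have p: "1/2 \<le> p" "p \<le> 10/9" and q: "1/2 \<le> q" "q \<le> 10/9"
    proof -
      have "0 < norm m" "0 < norm n" using mb nb by linarith+
      then show "1/2 \<le> p" "p \<le> 10/9" "1/2 \<le> q" "q \<le> 10/9"
        using mb nb unfolding p_def q_def by (simp_all add: pos_le_divide_eq pos_divide_le_eq)
    qed
    have "p - q = (norm m - norm n) * (p * q)"
    proof -
      have "norm m \<noteq> 0" "norm n \<noteq> 0" using mb nb by linarith+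
      then show ?thesis unfolding p_def q_def by (simp add: divide_simps)
    qed
    then have "\<bar>p - q\<bar> = \<bar>norm m - norm n\<bar> * (p * q)" using p q by (simp add: abs_mult)
    also have "\<dots> \<le> (1/40) * (10/9 * (10/9))"
      using close p q unfolding m_def n_def by (intro mult_mono) auto
    finally have pq: "\<bar>p - q\<bar> \<le> 1/32" by simp
    have "\<bar>(p - q) * (t - s)\<bar> \<le> (1/32) * (4 * T)"
      unfolding abs_mult using pq * st0 by (intro mult_mono) auto
    then have cross: "(p - q) * (t - s) \<ge> - T / 8" by linarith
    have i1: "p * (d \<bullet> n) \<ge> p * ((t - s + T/2 - D) / 2)" using g1 p by (intro mult_left_mono) auto
    have i2: "q * (- (d \<bullet> m)) \<ge> q * ((s - t - D) / 2)" using g2 q by (intro mult_left_mono) auto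
    have "d \<bullet> (sgn n - sgn m) = p * (d \<bullet> n) + q * (- (d \<bullet> m))"
      by (simp add: sgn_div_norm p_def q_def inner_simps divide_inverse)
    then have "d \<bullet> (sgn n - sgn m) \<ge> p * ((t - s + T/2 - D) / 2) + q * ((s - t - D) / 2)" using i1 i2 by linarith
    moreover have "p * ((t - s + T/2 - D) / 2) + q * ((s - t - D) / 2)
        = p * T / 4 + (p - q) * (t - s) / 2 - (p + q) * D / 2" by (simp add: field_simps)
    ultimately have "d \<bullet> (sgn n - sgn m) \<ge> p * T / 4 + (p - q) * (t - s) / 2 - (p + q) * D / 2"
      by simp
    moreover have "p * T / 4 \<ge> (1/2) * T / 4" using p T0 by (intro divide_right_mono mult_right_mono) auto
    moreover have "(p + q) * D / 2 \<le> 6 * D / 2" using p q D0 by (intro divide_right_mono mult_right_mono) auto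
    ultimately have "d \<bullet> (sgn n - sgn m) + 3 * D \<ge> T / 16" using cross by linarith
    then show ?thesis unfolding d_def D_def m_def n_def .
  qed
  have "T / 2 \<le> (norm (y i - c j))\<^sup>2 - (r j)\<^sup>2 - ((norm (y i - c i))\<^sup>2 - (r i)\<^sup>2) \<or>
       T / 2 \<le> (norm (y j - c i))\<^sup>2 - (r i)\<^sup>2 - ((norm (y j - c j))\<^sup>2 - (r j)\<^sup>2)"
    using os i j ij unfolding one_scale_def by blast
  then show ?thesis
  proof
    assume "T / 2 \<le> (norm (y i - c j))\<^sup>2 - (r j)\<^sup>2 - ((norm (y i - c i))\<^sup>2 - (r i)\<^sup>2)"
    then show ?thesis using main i j close by blast
  next
    assume "T / 2 \<le> (norm (y j - c i))\<^sup>2 - (r i)\<^sup>2 - ((norm (y j - c j))\<^sup>2 - (r j)\<^sup>2)"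
    then have "(y j - y i) \<bullet> (sgn (y i - c i) - sgn (y j - c j)) + 3 * (norm (y j - y i))\<^sup>2 \<ge> T / 16"
      using main[of j i] i j close by (auto simp: abs_minus_commute)
    moreover have "(y j - y i) \<bullet> (sgn (y i - c i) - sgn (y j - c j)) = (y i - y j) \<bullet> (sgn (y j - c j) - sgn (y i - c i))"
      by (simp add: inner_simps)
    ultimately show ?thesis by (simp add: norm_minus_commute)
  qed
qed

lemma card_le_one_if_close:
  assumes "\<And>i j. i \<in> J \<Longrightarrow> j \<in> J \<Longrightarrow> i = j"
  shows "card J \<le> 1"
  using assms by (metis card_eq_0_iff card_le_Suc0_iff_eq le0 One_nat_def)

text \<open>The factor \<open>al\<close> balances the two spreads: \<open>al * a1\<close> is of the
  order of \<open>B\<close>, the larger of the two cell sizes. The expanded points are separated by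
  \<open>s\<close>, with \<open>s\<^sup>2\<close> of order \<open>al * T\<close>, in a set of
  diameter of order \<open>B\<close>. Flat packing gives \<open>B / s\<close> to the power
  \<open>2 * \<sigma>\<close>, which is at most a multiple of
  \<open>(a * b / T) powr \<sigma>\<close>. Keeping the spread \<open>a\<close> of the points apart
  from the spread \<open>b\<close> of the normals is what later yields decay from scale to
  scale.\<close>

lemma one_scale_count:
  fixes C3 :: real
  assumes C3: "0 < C3"
  shows "\<exists>C>0. \<forall>(I::'i set) (y::'i \<Rightarrow> 'a::euclidean_space) c r T a b.
    one_scale I y c r T \<and> T \<le> 1 / 1920000 \<and> 0 < a \<and> a \<le> 8 \<and> 0 < b \<and> b \<le> 2 \<and> a \<le> 4 * b \<and> T \<le> C3 * a * b \<and>
    (\<forall>i\<in>I. \<forall>j\<in>I. norm (y i - y j) \<le> a) \<and> (\<forall>i\<in>I. \<forall>j\<in>I. norm (sgn (y i - c i) - sgn (y j - c j)) \<le> b)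
    \<longrightarrow> real (card I) \<le> C * (a * b / T) powr ((real DIM('a) - 1) / 2)"
proof -
  define n where "n = DIM('a)"
  define \<sigma> where "\<sigma> = (real n - 1) / 2"
  have n1: "1 \<le> n" by (simp add: n_def DIM_positive Suc_leI)
  have \<sigma>0: "0 \<le> \<sigma>" using n1 by (simp add: \<sigma>_def)
  \<comment> \<open>The second bound serves \<open>alT\<close>: if the normals have the larger
    cells, \<open>al * T\<close> is a multiple of \<open>e * b * T / a\<close>, which
    \<open>T \<le> C3 * a * b\<close> turns into a multiple of
    \<open>C3 * e * b\<^sup>2\<close>.\<close>
  define e where "e = min (1/200) (1 / (160000 * 38400 * C3))"
  have e: "0 < e" "e \<le> 1/200" "38400 * C3 * e \<le> 1 / 160000"
  proof -
    show "0 < e" "e \<le> 1/200" using C3 by (auto simp: e_def)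
    have "e \<le> 1 / (160000 * 38400 * C3)" by (simp add: e_def)
    then show "38400 * C3 * e \<le> 1 / 160000" using C3 by (simp add: field_simps)
  qed
  define C where "C = 4800 ^ n * (6 / e) ^ n * 480 * (12 ^ n + C3 powr \<sigma>)"
  have C: "0 < C" using e C3 by (simp add: C_def add_pos_nonneg)
  show ?thesis
  proof (intro exI[of _ C] conjI C allI impI, elim conjE)
    fix I :: "'i set" and y :: "'i \<Rightarrow> 'a" and c r T a b
    assume os: "one_scale I y c r T" and T: "T \<le> 1 / 1920000" and a: "0 < a" "a \<le> 8" and b: "0 < b" "b \<le> 2"
      and ab: "a \<le> 4 * b" "T \<le> C3 * a * b"
      and dy: "\<forall>i\<in>I. \<forall>j\<in>I. norm (y i - y j) \<le> a" and dv: "\<forall>i\<in>I. \<forall>j\<in>I. norm (sgn (y i - c i) - sgn (y j - c j)) \<le> b"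
    have T0: "0 < T" and fin: "finite I" using os by (auto simp: one_scale_def)
    have T32: "T \<le> 1/32" using T by simp
    let ?v = "\<lambda>i. sgn (y i - c i)"
    show "real (card I) \<le> C * (a * b / T) powr ((real DIM('a) - 1) / 2)"
    proof (cases "I = {}")
      case True then show ?thesis using C by simp
    next
      case False
      then obtain i0 where i0: "i0 \<in> I" by auto
      define a1 b1 where "a1 = a / 800" and "b1 = e * b"
      define B where "B = max a1 b1"
      have a1: "0 < a1" "a1 \<le> 1/100" using a by (auto simp: a1_def)
      have "e * b \<le> (1/200) * 2" using e b by (intro mult_mono) auto
      then have b1: "0 < b1" "b1 \<le> 1/100" using e b by (auto simp: b1_def)
      have eb: "e * b \<le> 1 * b" using e b by (intro mult_right_mono) auto
      have B: "0 < B" "B \<le> 1/100" "a1 \<le> B" "b1 \<le> B" "B \<le> b"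
        using a1 b1 ab b eb by (auto simp: B_def a1_def b1_def)
      define al where "al = 12 * B / a1"
      have al: "12 \<le> al" using a1 B by (simp add: al_def field_simps)
      have alT: "al * T \<le> 1 / 160000"
      proof (cases "B = a1")
        case True then show ?thesis using a1 T by (simp add: al_def)
      next
        case False
        then have "B = e * b" by (auto simp: B_def b1_def max_def split: if_splits)
        then have "al * T = 9600 * e * b * T / a" by (simp add: al_def a1_def)
        also have "\<dots> \<le> 9600 * e * b * (C3 * a * b) / a"
          using ab e a b by (intro divide_right_mono mult_left_mono) auto
        also have "\<dots> = 9600 * C3 * e * (b * b)" using a by simp
        also have "\<dots> \<le> 9600 * C3 * e * (2 * 2)" using b e C3 by (intro mult_left_mono mult_mono) auto
        finally show ?thesis using e by simp
      qed
      have "\<exists>J\<subseteq>I. real (card I) \<le> (6 * a / a1) ^ DIM('a) * real (card J) \<and> (\<forall>i\<in>J. \<forall>j\<in>J. dist (y i) (y j) \<le> a1)"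
        using dy i0 a1 a by (intro pigeonhole_cell[OF fin, of "y i0"]) (auto simp: dist_norm a1_def)
      then obtain J1 where J1: "J1 \<subseteq> I" "real (card I) \<le> (6 * a / a1) ^ DIM('a) * real (card J1)"
        "\<forall>i\<in>J1. \<forall>j\<in>J1. dist (y i) (y j) \<le> a1" by auto
      have finJ1: "finite J1" using J1 fin finite_subset by blast
      have "\<exists>J\<subseteq>J1. real (card J1) \<le> (6 * b / b1) ^ DIM('a) * real (card J) \<and> (\<forall>i\<in>J. \<forall>j\<in>J. dist (?v i) (?v j) \<le> b1)"
        using dv i0 b1 b J1(1) B by (intro pigeonhole_cell[OF finJ1, of "?v i0"]) (auto simp: dist_norm)
      then obtain J2 where J2: "J2 \<subseteq> J1" "real (card J1) \<le> (6 * b / b1) ^ DIM('a) * real (card J2)"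
        "\<forall>i\<in>J2. \<forall>j\<in>J2. dist (?v i) (?v j) \<le> b1" by auto
      have finJ2: "finite J2" using J2 finJ1 finite_subset by blast
      have "\<exists>J\<subseteq>J2. real (card J2) \<le> (6 * 2 / (1/40)) ^ DIM(real) * real (card J) \<and>
          (\<forall>i\<in>J. \<forall>j\<in>J. dist (norm (y i - c i)) (norm (y j - c j)) \<le> 1/40)"
        using one_scale_norm_ge(2)[OF os _ T32] J1(1) J2(1) by (intro pigeonhole_cell[OF finJ2, of 0]) auto
      then obtain J where J: "J \<subseteq> J2" "real (card J2) \<le> 480 * real (card J)"
        "\<forall>i\<in>J. \<forall>j\<in>J. dist (norm (y i - c i)) (norm (y j - c j)) \<le> 1/40" by auto
      have finJ: "finite J" using J finJ2 finite_subset by blast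
      have JI: "J \<subseteq> I" using J J1 J2 by auto
      note osJ = one_scale_subset[OF os JI]
      have unit: "norm (?v i) = 1" if "i \<in> J" for i
      proof -
        have "i \<in> I" using that JI by auto
        from one_scale_norm_ge(1)[OF os this T32] have "y i - c i \<noteq> 0" by auto
        then show ?thesis by (simp add: norm_sgn)
      qed
      define f where "f i = al *\<^sub>R y i - ?v i" for i
      define s where "s = sqrt (al * T / 8)"
      have s0: "0 < s" using al T0 by (simp add: s_def)
      have dyJ: "norm (y i - y j) \<le> a1" and dvJ: "norm (?v i - ?v j) \<le> b1" if "i \<in> J" "j \<in> J" for i j
      proof -
        have m: "i \<in> J1" "j \<in> J1" "i \<in> J2" "j \<in> J2" using that J2(1) J(1) by auto
        show "norm (y i - y j) \<le> a1" using J1(3) m(1,2) by (simp add: dist_norm)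
        show "norm (?v i - ?v j) \<le> b1" using J2(3) m(3,4) by (simp add: dist_norm)
      qed
      have gap: "(y i - y j) \<bullet> (?v j - ?v i) + 3 * (norm (y i - y j))\<^sup>2 \<ge> T / 16"
        if "i \<in> J" "j \<in> J" "i \<noteq> j" for i j
        using one_scale_gap[OF osJ that T32] J(3) that by (auto simp: dist_real_def)
      have sep: "s \<le> dist (f i) (f j)" if "i \<in> J" "j \<in> J" "i \<noteq> j" for i j
      proof -
        have "al\<^sup>2 / 2 * (norm (y i - y j))\<^sup>2 + (norm (?v i - ?v j))\<^sup>2 + al * T / 8 \<le> (norm (f i - f j))\<^sup>2"
          unfolding f_def by (rule expand_normal_separated[OF gap[OF that] al])
        moreover have "0 \<le> al\<^sup>2 / 2 * (norm (y i - y j))\<^sup>2" "0 \<le> (norm (?v i - ?v j))\<^sup>2" by auto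
        ultimately have "al * T / 8 \<le> (norm (f i - f j))\<^sup>2" by linarith
        then show ?thesis unfolding s_def dist_norm by (intro real_le_lsqrt) auto
      qed
      have diam: "dist (f i) (f j) \<le> 13 * B" if "i \<in> J" "j \<in> J" for i j
      proof -
        have "dist (f i) (f j) = norm (al *\<^sub>R (y i - y j) - (?v i - ?v j))"
          by (simp add: f_def dist_norm algebra_simps)
        also have "\<dots> \<le> al * norm (y i - y j) + norm (?v i - ?v j)"
          using al norm_triangle_ineq4[of "al *\<^sub>R (y i - y j)" "?v i - ?v j"] by simp
        also have "\<dots> \<le> al * a1 + b1" using dyJ[OF that] dvJ[OF that] al by (intro add_mono mult_left_mono) auto
        also have "\<dots> \<le> 13 * B" using B a1 by (simp add: al_def)
        finally show ?thesis .
      qed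
      have cardJ: "real (card J) \<le> (12 ^ n + C3 powr \<sigma>) * (a * b / T) powr \<sigma>"
      proof (cases "s \<le> 13 * B \<and> J \<noteq> {}")
        case True
        then obtain j0 where j0: "j0 \<in> J" by auto
        have "real (card J) \<le> 12 ^ DIM('a) * (13 * B / s) ^ (DIM('a) - 1)"
        proof (rule flat_packing[OF finJ diam sep, where e = "?v j0"])
          fix i j assume ij: "i \<in> J" "j \<in> J"
          show "\<bar>(f i - f j) \<bullet> ?v j0\<bar> \<le> norm (f i - f j) / 4"
          proof (cases "i = j")
            case False
            have "\<bar>(f i - f j) \<bullet> ?v j0\<bar> \<le> norm (f i - f j) / 8" unfolding f_def
            proof (rule expand_normal_flat[OF gap[OF ij False] al _ _ unit unit _ _ _ T0 alT])
              show "(y j - y i) \<bullet> ?v i \<ge> - 3 * (norm (y i - y j))\<^sup>2 - 3 * T"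
                by (rule one_scale_support[OF osJ ij T32])
              show "(y i - y j) \<bullet> ?v j \<ge> - 3 * (norm (y i - y j))\<^sup>2 - 3 * T"
                using one_scale_support[OF osJ ij(2,1) T32] by (simp add: norm_minus_commute)
              show "norm (?v i - ?v j0) \<le> 1/100" using dvJ[OF ij(1) j0] b1 by linarith
              show "norm (?v j - ?v j0) \<le> 1/100" using dvJ[OF ij(2) j0] b1 by linarith
              show "norm (y i - y j) \<le> 1/100" using dyJ[OF ij] a1 by linarith
            qed (rule ij)+
            then show ?thesis using norm_ge_zero[of "f i - f j"] by linarith
          qed simp
        qed (use True s0 unit j0 in auto)
        also have "(13 * B / s) ^ (DIM('a) - 1) = (13 * B / s) powr (2 * \<sigma>)"
        proof -
          have "real (DIM('a) - 1) = 2 * \<sigma>" using n1 by (simp add: \<sigma>_def n_def of_nat_diff)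
          then show ?thesis using B s0 powr_realpow[of "13 * B / s" "DIM('a) - 1"] by simp
        qed
        also have "\<dots> = ((13 * B / s)\<^sup>2) powr \<sigma>"
          using B s0 by (subst powr_powr[symmetric]) (auto simp: powr_numeral)
        also have "\<dots> \<le> (a * b / T) powr \<sigma>"
        proof (rule powr_mono2[OF \<sigma>0])
          have "(13 * B / s)\<^sup>2 = 169 * B\<^sup>2 * 8 / (al * T)"
            using al T0 by (simp add: s_def power_divide power_mult_distrib)
          also have "\<dots> = (338/3) * (B * a1) / T"
            using B a1 T0 by (simp add: al_def power2_eq_square)
          also have "\<dots> \<le> 800 * (b * a1) / T"
            using B a1 T0 b by (intro divide_right_mono mult_mono) auto
          finally show "(13 * B / s)\<^sup>2 \<le> a * b / T" by (simp add: a1_def mult.commute)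
        qed simp
        finally have "real (card J) \<le> 12 ^ n * (a * b / T) powr \<sigma>" by (simp add: n_def)
        then show ?thesis by (simp add: distrib_right add_increasing2)
      next
        case False
        \<comment> \<open>If \<open>J\<close> is not empty, the separation exceeds the diameter and
          only one index is left. That the asserted bound is then at least one is the purpose of
          \<open>T \<le> C3 * a * b\<close>.\<close>
        have "card J \<le> 1"
        proof (rule card_le_one_if_close)
          fix i j assume ij: "i \<in> J" "j \<in> J"
          have "\<not> s \<le> 13 * B" using False ij(1) by auto
          then show "i = j" using sep[OF ij] diam[OF ij] by linarith
        qed
        then have "real (card J) \<le> 1 powr \<sigma>" by simp
        also have "\<dots> \<le> (C3 * (a * b / T)) powr \<sigma>"
          using \<sigma>0 T0 ab by (intro powr_mono2) (auto simp: field_simps)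
        also have "\<dots> = C3 powr \<sigma> * (a * b / T) powr \<sigma>"
          using C3 T0 a b by (intro powr_mult)
        finally show ?thesis by (simp add: distrib_right add_increasing)
      qed
      have e1: "6 * a / a1 = 4800" using a by (simp add: a1_def)
      have e2: "6 * b / b1 = 6 / e" using b by (simp add: b1_def)
      have "real (card I) \<le> 4800 ^ n * ((6 / e) ^ n * (480 * real (card J)))"
      proof -
        have "real (card I) \<le> 4800 ^ n * real (card J1)" using J1(2) unfolding e1 n_def .
        also have "\<dots> \<le> 4800 ^ n * ((6 / e) ^ n * real (card J2))"
          using J2(2) unfolding e2 n_def by (intro mult_left_mono) auto
        also have "\<dots> \<le> 4800 ^ n * ((6 / e) ^ n * (480 * real (card J)))"
          using J(2) e by (intro mult_left_mono) auto
        finally show ?thesis .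
      qed
      also have "\<dots> \<le> 4800 ^ n * ((6 / e) ^ n * (480 * ((12 ^ n + C3 powr \<sigma>) * (a * b / T) powr \<sigma>)))"
        using cardJ e by (intro mult_left_mono) auto
      finally show ?thesis by (simp add: C_def \<sigma>_def n_def algebra_simps)
    qed
  qed
qed

section \<open>Towers of balls through a point\<close>

text \<open>The data behind the overlap count at the point \<open>0\<close>: the balls \<open>B (c i) (r i)\<close> contain \<open>0\<close> and
  were selected for the sake of the points \<open>y i\<close>; \<open>m i\<close> is the scale of the radius.
  All points have comparable depth, measured by \<open>T\<close>, in their balls.\<close>
definition tower :: "real \<Rightarrow> real \<Rightarrow> 'i set \<Rightarrow> ('i \<Rightarrow> int) \<Rightarrow> ('i \<Rightarrow> 'a::real_inner) \<Rightarrow> ('i \<Rightarrow> 'a) \<Rightarrow> ('i \<Rightarrow> real) \<Rightarrow> bool" where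
  "tower d T I m y c r \<longleftrightarrow> finite I \<and> 0 < d \<and> d \<le> 1/4 \<and> d \<le> T \<and>
    (\<forall>i\<in>I. norm (c i) < r i \<and> norm (y i - c i) < r i) \<and>
    (\<forall>i\<in>I. \<forall>j\<in>I. m i < m j \<longrightarrow> 64 * r i \<le> r j \<and> (1 + d) * r j \<le> norm (y i - c j)) \<and>
    (\<forall>i\<in>I. \<forall>j\<in>I. m i = m j \<longrightarrow> r i \<le> 2 * r j \<and>
       (norm (y i - c i))\<^sup>2 - (r i)\<^sup>2 \<le> (norm (y i - c j))\<^sup>2 - (r j)\<^sup>2) \<and>
    (\<forall>i\<in>I. \<forall>j\<in>I. m i = m j \<longrightarrow> i \<noteq> j \<longrightarrow>
       (1 + d) * r j \<le> norm (y i - c j) \<or> (1 + d) * r i \<le> norm (y j - c i)) \<and>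
    (\<forall>i\<in>I. (r i)\<^sup>2 - (norm (y i - c i))\<^sup>2 \<le> T * (r i)\<^sup>2 \<and>
       (T = d \<or> T / 2 * (r i)\<^sup>2 \<le> (r i)\<^sup>2 - (norm (y i - c i))\<^sup>2))"

lemma tower_subset:
  assumes "tower d T I m y c r" and J: "J \<subseteq> I"
  shows "tower d T J m y c r"
  using assms(1) finite_subset[OF J] subsetD[OF J] unfolding tower_def by meson

lemma towerD:
  assumes tw: "tower d T I m y c r"
  shows "finite I" "0 < d" "d \<le> 1/4" "d \<le> T" "0 < T"
    and "i \<in> I \<Longrightarrow> norm (c i) < r i" "i \<in> I \<Longrightarrow> norm (y i - c i) < r i" "i \<in> I \<Longrightarrow> 0 < r i"
    and "i \<in> I \<Longrightarrow> (r i)\<^sup>2 - (norm (y i - c i))\<^sup>2 \<le> T * (r i)\<^sup>2"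
    and "i \<in> I \<Longrightarrow> T = d \<or> T / 2 * (r i)\<^sup>2 \<le> (r i)\<^sup>2 - (norm (y i - c i))\<^sup>2"
    and "i \<in> I \<Longrightarrow> j \<in> I \<Longrightarrow> m i < m j \<Longrightarrow> 64 * r i \<le> r j"
    and "i \<in> I \<Longrightarrow> j \<in> I \<Longrightarrow> m i < m j \<Longrightarrow> (1 + d) * r j \<le> norm (y i - c j)"
    and "i \<in> I \<Longrightarrow> j \<in> I \<Longrightarrow> m i = m j \<Longrightarrow> r i \<le> 2 * r j"
    and "i \<in> I \<Longrightarrow> j \<in> I \<Longrightarrow> m i = m j \<Longrightarrow> (norm (y i - c i))\<^sup>2 - (r i)\<^sup>2 \<le> (norm (y i - c j))\<^sup>2 - (r j)\<^sup>2"
    and "i \<in> I \<Longrightarrow> j \<in> I \<Longrightarrow> m i = m j \<Longrightarrow> i \<noteq> j \<Longrightarrow>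
       (1 + d) * r j \<le> norm (y i - c j) \<or> (1 + d) * r i \<le> norm (y j - c i)"
proof -
  show *: "finite I" "0 < d" "d \<le> 1/4" "d \<le> T" using tw unfolding tower_def by auto
  show "0 < T" using * by simp
  show "i \<in> I \<Longrightarrow> norm (c i) < r i" "i \<in> I \<Longrightarrow> norm (y i - c i) < r i" using tw unfolding tower_def by auto
  show "i \<in> I \<Longrightarrow> 0 < r i" using tw norm_ge_zero[of "c i"] unfolding tower_def by (meson le_less_trans)
  show "i \<in> I \<Longrightarrow> (r i)\<^sup>2 - (norm (y i - c i))\<^sup>2 \<le> T * (r i)\<^sup>2"
    "i \<in> I \<Longrightarrow> T = d \<or> T / 2 * (r i)\<^sup>2 \<le> (r i)\<^sup>2 - (norm (y i - c i))\<^sup>2"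
    using tw unfolding tower_def by meson+
  show "i \<in> I \<Longrightarrow> j \<in> I \<Longrightarrow> m i < m j \<Longrightarrow> 64 * r i \<le> r j"
    "i \<in> I \<Longrightarrow> j \<in> I \<Longrightarrow> m i < m j \<Longrightarrow> (1 + d) * r j \<le> norm (y i - c j)"
    "i \<in> I \<Longrightarrow> j \<in> I \<Longrightarrow> m i = m j \<Longrightarrow> r i \<le> 2 * r j"
    "i \<in> I \<Longrightarrow> j \<in> I \<Longrightarrow> m i = m j \<Longrightarrow> (norm (y i - c i))\<^sup>2 - (r i)\<^sup>2 \<le> (norm (y i - c j))\<^sup>2 - (r j)\<^sup>2"
    "i \<in> I \<Longrightarrow> j \<in> I \<Longrightarrow> m i = m j \<Longrightarrow> i \<noteq> j \<Longrightarrow>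
       (1 + d) * r j \<le> norm (y i - c j) \<or> (1 + d) * r i \<le> norm (y j - c i)"
    using tw unfolding tower_def by meson+
qed

lemma power_gap:
  fixes d s t :: real
  assumes "(1 + d) * s \<le> t" "0 \<le> d" "0 \<le> s"
  shows "2 * d * s\<^sup>2 \<le> t\<^sup>2 - s\<^sup>2"
proof -
  have "((1 + d) * s)\<^sup>2 \<le> t\<^sup>2" using assms by (intro power_mono) auto
  moreover have "((1 + d) * s)\<^sup>2 = s\<^sup>2 + 2 * d * s\<^sup>2 + d\<^sup>2 * s\<^sup>2"
    by (simp add: power2_eq_square algebra_simps)
  moreover have "0 \<le> d\<^sup>2 * s\<^sup>2" by simp
  ultimately show ?thesis by linarith
qed

text \<open>For \<open>T = d\<close> the surplus comes from \<open>y i\<close> lying outside the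
  dilate of the ball of \<open>j\<close>, otherwise from the depth of \<open>y i\<close> in its own
  ball. This is the reason for the alternative in the last clause of \<open>tower\<close>.\<close>

lemma tower_gap:
  assumes tw: "tower d T I m y c r" and i: "i \<in> I" and j: "j \<in> I"
    and g: "(1 + d) * r j \<le> norm (y i - c j)" and R: "0 < R" "R \<le> r i" "R \<le> r j"
  shows "T / 2 * R\<^sup>2 \<le> (norm (y i - c j))\<^sup>2 - (r j)\<^sup>2 - ((norm (y i - c i))\<^sup>2 - (r i)\<^sup>2)"
proof -
  have RR: "R\<^sup>2 \<le> (r i)\<^sup>2" "R\<^sup>2 \<le> (r j)\<^sup>2" using R by (auto intro: power_mono)
  have 1: "2 * d * (r j)\<^sup>2 \<le> (norm (y i - c j))\<^sup>2 - (r j)\<^sup>2"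
    using power_gap[OF g] towerD(2,8)[OF tw] j by (simp add: less_imp_le)
  have 2: "(norm (y i - c i))\<^sup>2 \<le> (r i)\<^sup>2" using towerD(7)[OF tw i] by (intro power_mono) auto
  have d0: "0 < d" by (rule towerD(2)[OF tw])
  have 3: "d * R\<^sup>2 \<le> d * (r j)\<^sup>2" using RR d0 by (intro mult_left_mono) auto
  have 4: "0 \<le> d * R\<^sup>2" using d0 by simp
  from towerD(10)[OF tw i] show ?thesis
  proof
    assume T: "T = d" show ?thesis unfolding T using 1 2 3 4 by linarith
  next
    assume a: "T / 2 * (r i)\<^sup>2 \<le> (r i)\<^sup>2 - (norm (y i - c i))\<^sup>2"
    have "T / 2 * R\<^sup>2 \<le> T / 2 * (r i)\<^sup>2" using RR towerD(5)[OF tw] by (intro mult_left_mono) auto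
    then show ?thesis using a 1 3 4 by linarith
  qed
qed

lemma norm_diff_scaled:
  fixes x y :: "'a::real_normed_vector"
  assumes "0 < R"
  shows "norm (x /\<^sub>R R - y /\<^sub>R R) = norm (x - y) / R"
proof -
  have "x /\<^sub>R R - y /\<^sub>R R = (x - y) /\<^sub>R R" by (rule scaleR_diff_right[symmetric])
  then show ?thesis using assms by (simp add: divide_inverse mult.commute)
qed

lemma sgn_diff_scaled:
  fixes x y :: "'a::real_normed_vector"
  assumes "0 < R"
  shows "sgn (x /\<^sub>R R - y /\<^sub>R R) = sgn (x - y)"
proof -
  have "x /\<^sub>R R - y /\<^sub>R R = (x - y) /\<^sub>R R" by (rule scaleR_diff_right[symmetric])
  then show ?thesis using assms by (simp add: sgn_scaleR)
qed

lemma tower_one_scale: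
  assumes tw: "tower d T I m y c r" and R: "0 < R"
    and m: "\<And>i j. i \<in> I \<Longrightarrow> j \<in> I \<Longrightarrow> m i = m j" and r: "\<And>i. i \<in> I \<Longrightarrow> R \<le> r i \<and> r i \<le> 2 * R"
  shows "one_scale I (\<lambda>i. y i /\<^sub>R R) (\<lambda>i. c i /\<^sub>R R) (\<lambda>i. r i / R) T"
proof -
  have n: "norm (y i /\<^sub>R R - c j /\<^sub>R R) = norm (y i - c j) / R" for i j
    by (rule norm_diff_scaled[OF R])
  have n2: "(norm (y i /\<^sub>R R - c j /\<^sub>R R))\<^sup>2 - (r j / R)\<^sup>2 = ((norm (y i - c j))\<^sup>2 - (r j)\<^sup>2) / R\<^sup>2" for i j
    unfolding n by (simp add: power_divide diff_divide_distrib)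
  have n3: "(r j / R)\<^sup>2 - (norm (y i /\<^sub>R R - c j /\<^sub>R R))\<^sup>2 = ((r j)\<^sup>2 - (norm (y i - c j))\<^sup>2) / R\<^sup>2" for i j
    unfolding n by (simp add: power_divide diff_divide_distrib)
  have R2: "0 < R\<^sup>2" using R by simp
  show ?thesis unfolding one_scale_def n2 n3
  proof (intro conjI ballI impI)
    show "finite I" "0 < T" by (rule towerD[OF tw])+
    fix i assume i: "i \<in> I"
    show "1 \<le> r i / R" "r i / R \<le> 2" using r[OF i] R by (auto simp: field_simps)
    show "norm (y i /\<^sub>R R - c i /\<^sub>R R) \<le> r i / R" unfolding n
      using towerD(7)[OF tw i] R by (simp add: divide_right_mono)
    have "(r i)\<^sup>2 - (norm (y i - c i))\<^sup>2 \<le> T * (r i)\<^sup>2" by (rule towerD(9)[OF tw i])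
    also have "\<dots> \<le> T * (2 * R)\<^sup>2" using r[OF i] R towerD(5)[OF tw] by (intro mult_left_mono power_mono) auto
    finally show "((r i)\<^sup>2 - (norm (y i - c i))\<^sup>2) / R\<^sup>2 \<le> 4 * T"
      using R2 by (simp add: pos_divide_le_eq power_mult_distrib)
    fix j assume j: "j \<in> I"
    show "((norm (y i - c i))\<^sup>2 - (r i)\<^sup>2) / R\<^sup>2 \<le> ((norm (y i - c j))\<^sup>2 - (r j)\<^sup>2) / R\<^sup>2"
      using towerD(14)[OF tw i j m[OF i j]] R2 by (intro divide_right_mono) auto
    assume ij: "i \<noteq> j"
    have *: "T / 2 \<le> ((norm (y i - c j))\<^sup>2 - (r j)\<^sup>2) / R\<^sup>2 - ((norm (y i - c i))\<^sup>2 - (r i)\<^sup>2) / R\<^sup>2"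
      if "(1 + d) * r j \<le> norm (y i - c j)" "i \<in> I" "j \<in> I" for i j
      using tower_gap[OF tw that(2,3,1) R] r that R2
      by (simp add: diff_divide_distrib[symmetric] pos_le_divide_eq)
    from towerD(15)[OF tw i j m[OF i j] ij]
    show "T / 2 \<le> ((norm (y i - c j))\<^sup>2 - (r j)\<^sup>2) / R\<^sup>2 - ((norm (y i - c i))\<^sup>2 - (r i)\<^sup>2) / R\<^sup>2 \<or>
       T / 2 \<le> ((norm (y j - c i))\<^sup>2 - (r i)\<^sup>2) / R\<^sup>2 - ((norm (y j - c j))\<^sup>2 - (r j)\<^sup>2) / R\<^sup>2"
      using *[OF _ i j] *[OF _ j i] by blast
  qed
qed

lemma tower_scale_count:
  assumes C3: "0 < C3"
  shows "\<exists>C>0. \<forall>d T (I::'i set) m (y::'i \<Rightarrow> 'a::euclidean_space) c r R a b.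
    tower d T I m y c r \<and> 0 < R \<and> (\<forall>i\<in>I. \<forall>j\<in>I. m i = m j) \<and> (\<forall>i\<in>I. R \<le> r i \<and> r i \<le> 2 * R) \<and>
    T \<le> 1 / 1920000 \<and> 0 < a \<and> a \<le> 8 \<and> 0 < b \<and> b \<le> 2 \<and> a \<le> 4 * b \<and> T \<le> C3 * a * b \<and>
    (\<forall>i\<in>I. \<forall>j\<in>I. norm (y i - y j) \<le> a * R) \<and> (\<forall>i\<in>I. \<forall>j\<in>I. norm (sgn (y i - c i) - sgn (y j - c j)) \<le> b)
    \<longrightarrow> real (card I) \<le> C * (a * b / T) powr ((real DIM('a) - 1) / 2)"
proof -
  obtain C where C: "0 < C" and count: "\<forall>(I::'i set) (y::'i \<Rightarrow> 'a) c r T a b.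
    one_scale I y c r T \<and> T \<le> 1 / 1920000 \<and> 0 < a \<and> a \<le> 8 \<and> 0 < b \<and> b \<le> 2 \<and> a \<le> 4 * b \<and> T \<le> C3 * a * b \<and>
    (\<forall>i\<in>I. \<forall>j\<in>I. norm (y i - y j) \<le> a) \<and> (\<forall>i\<in>I. \<forall>j\<in>I. norm (sgn (y i - c i) - sgn (y j - c j)) \<le> b)
    \<longrightarrow> real (card I) \<le> C * (a * b / T) powr ((real DIM('a) - 1) / 2)"
    by (rule exE[OF one_scale_count[OF C3, where 'i='i and 'a='a]], erule conjE, rule that, assumption, assumption)
  show ?thesis
  proof (rule exI[of _ C], rule conjI, rule C, (rule allI)+, rule impI, elim conjE)
    fix d T and I :: "'i set" and m and y :: "'i \<Rightarrow> 'a" and c r R a b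
    assume tw: "tower d T I m y c r" and R: "0 < R" and m: "\<forall>i\<in>I. \<forall>j\<in>I. m i = m j" and r: "\<forall>i\<in>I. R \<le> r i \<and> r i \<le> 2 * R"
      and ab: "T \<le> 1 / 1920000" "0 < a" "a \<le> 8" "0 < b" "b \<le> 2" "a \<le> 4 * b" "T \<le> C3 * a * b"
      and dy: "\<forall>i\<in>I. \<forall>j\<in>I. norm (y i - y j) \<le> a * R"
      and dv: "\<forall>i\<in>I. \<forall>j\<in>I. norm (sgn (y i - c i) - sgn (y j - c j)) \<le> b"
    have os: "one_scale I (\<lambda>i. y i /\<^sub>R R) (\<lambda>i. c i /\<^sub>R R) (\<lambda>i. r i / R) T"
      using m r by (intro tower_one_scale[OF tw R]) blast+
    have dy': "norm (y i /\<^sub>R R - y j /\<^sub>R R) \<le> a" if "i \<in> I" "j \<in> I" for i j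
    proof -
      have "norm (y i - y j) \<le> a * R" using dy that by blast
      then show ?thesis unfolding norm_diff_scaled[OF R] using R by (simp add: pos_divide_le_eq)
    qed
    have sg: "sgn (y i /\<^sub>R R - c i /\<^sub>R R) = sgn (y i - c i)" for i
      by (rule sgn_diff_scaled[OF R])
    show "real (card I) \<le> C * (a * b / T) powr ((real DIM('a) - 1) / 2)"
      by (rule count[rule_format, of I "\<lambda>i. y i /\<^sub>R R" "\<lambda>i. c i /\<^sub>R R" "\<lambda>i. r i / R" T a b], intro conjI ballI)
        (use os ab dy' dv in \<open>simp_all add: sg\<close>)
  qed
qed

lemma exists_min_radius:
  fixes r :: "'i \<Rightarrow> real"
  assumes "finite I" "I \<noteq> {}"
  shows "\<exists>k\<in>I. \<forall>i\<in>I. r k \<le> r i"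
  using ex_min_if_finite[of "r ` I"] assms by (metis arg_min_if_finite(1) arg_min_least)

lemma tower_y_bound:
  assumes tw: "tower d T I m y c r" and i: "i \<in> I"
  shows "norm (y i) < 2 * r i"
  using towerD(6,7)[OF tw i] norm_triangle_ineq[of "y i - c i" "c i"] by simp

text \<open>The spreads \<open>a = 8\<close> and \<open>b = 2\<close> hold in any single scale. The
  bound serves where the number of scales is controlled by other means.\<close>

lemma tower_top_count:
  "\<exists>C>0. \<forall>d T (I::'i set) m (y::'i \<Rightarrow> 'a::euclidean_space) c r.
    tower d T I m y c r \<and> (\<forall>i\<in>I. \<forall>j\<in>I. m i = m j) \<and> T \<le> 1 / 1920000
    \<longrightarrow> real (card I) \<le> C * T powr (- ((real DIM('a) - 1) / 2))"
proof -
  define \<sigma> where "\<sigma> = (real DIM('a) - 1) / 2"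
  obtain C where C: "0 < C" and count: "\<forall>d T (I::'i set) m (y::'i \<Rightarrow> 'a) c r R a b.
    tower d T I m y c r \<and> 0 < R \<and> (\<forall>i\<in>I. \<forall>j\<in>I. m i = m j) \<and> (\<forall>i\<in>I. R \<le> r i \<and> r i \<le> 2 * R) \<and>
    T \<le> 1 / 1920000 \<and> 0 < a \<and> a \<le> 8 \<and> 0 < b \<and> b \<le> 2 \<and> a \<le> 4 * b \<and> T \<le> 1 * a * b \<and>
    (\<forall>i\<in>I. \<forall>j\<in>I. norm (y i - y j) \<le> a * R) \<and> (\<forall>i\<in>I. \<forall>j\<in>I. norm (sgn (y i - c i) - sgn (y j - c j)) \<le> b)
    \<longrightarrow> real (card I) \<le> C * (a * b / T) powr ((real DIM('a) - 1) / 2)"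

    by (rule exE[OF tower_scale_count[OF zero_less_one, where 'i='i and 'a='a]], erule conjE, rule that, assumption, assumption)
  have C': "0 < C * 16 powr \<sigma>" using C by simp
  show ?thesis
  proof (rule exI[of _ "C * 16 powr \<sigma>"], rule conjI, rule C', (rule allI)+, rule impI, elim conjE)
    fix d T and I :: "'i set" and m and y :: "'i \<Rightarrow> 'a" and c r
    assume tw: "tower d T I m y c r" and m: "\<forall>i\<in>I. \<forall>j\<in>I. m i = m j" and T: "T \<le> 1 / 1920000"
    show "real (card I) \<le> C * 16 powr \<sigma> * T powr (- ((real DIM('a) - 1) / 2))"
    proof (cases "I = {}")
      case True then show ?thesis using C by simp
    next
      case False
      obtain k where k: "k \<in> I" "\<forall>i\<in>I. r k \<le> r i" using exists_min_radius[OF towerD(1)[OF tw] False] by blast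
      define R where "R = r k"
      have R: "0 < R" using towerD(8)[OF tw k(1)] by (simp add: R_def)
      have r: "R \<le> r i \<and> r i \<le> 2 * R" if "i \<in> I" for i

      proof -
        have "m i = m k" using m that k(1) by blast
        then show ?thesis using k(2) that towerD(13)[OF tw that k(1)] by (simp add: R_def)
      qed
      have n: "norm (y i) \<le> 4 * R" if "i \<in> I" for i using tower_y_bound[OF tw that] r[OF that] by linarith
      have dy: "norm (y i - y j) \<le> 8 * R" if "i \<in> I" "j \<in> I" for i j
        using norm_triangle_ineq4[of "y i" "y j"] n[OF that(1)] n[OF that(2)] by linarith
      have "norm (sgn v) \<le> 1" for v :: 'a by (simp add: norm_sgn)
      then have dv: "norm (sgn v - sgn w) \<le> 2" for v w :: 'a
        using norm_triangle_ineq4[of "sgn v" "sgn w"] by (smt (verit))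
      have "real (card I) \<le> C * (8 * 2 / T) powr \<sigma>"
        unfolding \<sigma>_def using tw R r T dy dv by (intro count[rule_format, of d T I m y c r R 8 2] conjI m) auto
      also have "(8 * 2 / T) powr \<sigma> = 16 powr \<sigma> * T powr (- \<sigma>)"
        using towerD(5)[OF tw] powr_divide[of 16 T \<sigma>] by (simp add: powr_minus_divide)
      finally show ?thesis by (simp add: \<sigma>_def mult.assoc)
    qed
  qed
qed

text \<open>With \<open>t\<close> a squared radius, the two brackets are the depths of the origin
  and of \<open>y\<close> in the ball around \<open>c\<close>: the position of the centre relative
  to the direction of \<open>y\<close> is read off from powers.\<close>

lemma inner_via_powers:
  fixes y c :: "'a::real_inner"
  shows "2 * (y \<bullet> c) = (norm y)\<^sup>2 - (t - (norm c)\<^sup>2) + (t - (norm (y - c))\<^sup>2)"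
  by (simp only: power2_norm_eq_inner) (simp add: inner_simps inner_commute)

section \<open>Comparison with the lowest scale\<close>

lemma tower_cross_inner:
  assumes tw: "tower d T I m y c r" and ij: "i \<in> I" "j \<in> I" "m i < m j"
  shows "2 * (y i \<bullet> c j) \<le> (norm (y i))\<^sup>2 - ((r j)\<^sup>2 - (norm (c j))\<^sup>2) - 2 * d * (r j)\<^sup>2"
proof -
  have "2 * d * (r j)\<^sup>2 \<le> (norm (y i - c j))\<^sup>2 - (r j)\<^sup>2"
    using power_gap[OF towerD(12)[OF tw ij]] towerD(2)[OF tw] towerD(8)[OF tw ij(2)] by simp
  then show ?thesis using inner_via_powers[of "y i" "c j" "(r j)\<^sup>2"] by linarith
qed

text \<open>The point \<open>y k\<close> of the lowest scale lies outside every larger ball,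
  although its norm is below \<open>2 * r k\<close>; so the origin is within \<open>2 * r k\<close>
  of the larger spheres. Balls of the lowest scale itself have comparable radii.\<close>

lemma tower_depth_bound:
  assumes tw: "tower d T I m y c r" and k: "k \<in> I" "\<And>j. j \<in> I \<Longrightarrow> m k \<le> m j" and j: "j \<in> I"
  shows "(r j)\<^sup>2 - (norm (c j))\<^sup>2 \<le> 4 * r k * r j"
proof (cases "m k = m j")
  case True
  have "r j * r j \<le> 2 * r k * r j"
    using towerD(13)[OF tw j k(1) True[symmetric]] towerD(8)[OF tw j] by (intro mult_right_mono) auto
  moreover have "0 \<le> 2 * r k * r j" using towerD(8)[OF tw j] towerD(8)[OF tw k(1)] by simp
  ultimately show ?thesis using zero_le_power2[of "norm (c j)"] unfolding power2_eq_square[of "r j"] by linarith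
next
  case False
  then have lt: "m k < m j" using k(2)[OF j] by simp
  have 1: "r j \<le> norm (y k - c j)"
  proof -
    have "1 * r j \<le> (1 + d) * r j" using towerD(2)[OF tw] towerD(8)[OF tw j] by (intro mult_right_mono) auto
    then show ?thesis using towerD(12)[OF tw k(1) j lt] by simp
  qed
  have 2: "norm (y k - c j) \<le> norm (y k) + norm (c j)" by (rule norm_triangle_ineq4)
  have 3: "r j - 2 * r k \<le> norm (c j)" using 1 2 tower_y_bound[OF tw k(1)] by linarith
  have 4: "0 \<le> r j - 2 * r k" using towerD(11)[OF tw k(1) j lt] towerD(8)[OF tw k(1)] by linarith
  have "(r j - 2 * r k)\<^sup>2 \<le> (norm (c j))\<^sup>2" using 3 4 by (rule power_mono)
  moreover have "(r j - 2 * r k)\<^sup>2 = (r j)\<^sup>2 - 4 * r k * r j + (2 * r k)\<^sup>2"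
    by (simp add: power2_eq_square algebra_simps)
  ultimately show ?thesis using zero_le_power2[of "2 * r k"] by linarith
qed

text \<open>The margin \<open>d * r j\<close> around a larger ball has to be bridged by
  \<open>y k\<close>, whose norm is below \<open>2 * r k\<close>. The radii through one point thus
  spread over a factor of order \<open>1 / d\<close> at most.\<close>

lemma tower_radius_ratio:
  assumes tw: "tower d T I m y c r" and k: "k \<in> I" "\<And>j. j \<in> I \<Longrightarrow> m k \<le> m j" and j: "j \<in> I"
  shows "d * r j \<le> 5 / 2 * r k"
proof (cases "m k = m j")
  case True
  have "d * r j \<le> (1/4) * (2 * r k)"
    using towerD(13)[OF tw j k(1) True[symmetric]] towerD(2,3,8)[OF tw] j by (intro mult_mono) (auto simp: less_imp_le)
  then show ?thesis using towerD(8)[OF tw k(1)] by linarith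
next
  case False
  then have lt: "m k < m j" using k(2)[OF j] by simp
  have pos: "0 < r j" "0 < r k" using towerD(8)[OF tw] j k by auto
  have c: "norm (c j) < r j" by (rule towerD(6)[OF tw j])
  have y: "norm (y k) < 2 * r k" by (rule tower_y_bound[OF tw k(1)])
  have "(norm (c j))\<^sup>2 \<le> (r j)\<^sup>2" using c by (intro power_mono) auto
  then have "2 * d * (r j)\<^sup>2 \<le> (norm (y k))\<^sup>2 - 2 * (y k \<bullet> c j)"
    using tower_cross_inner[OF tw k(1) j lt] by linarith
  moreover have "- (y k \<bullet> c j) \<le> norm (y k) * norm (c j)" using Cauchy_Schwarz_ineq2[of "y k" "c j"] by linarith
  moreover have "norm (y k) * norm (c j) \<le> (2 * r k) * r j" using y c pos by (intro mult_mono) auto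
  moreover have "(norm (y k))\<^sup>2 \<le> (2 * r k) * (2 * r k)"
    unfolding power2_eq_square using y pos by (intro mult_mono) auto
  moreover have "(2 * r k) * (2 * r k) \<le> r k * r j"
    using towerD(11)[OF tw k(1) j lt] pos mult_left_mono[of "4 * r k" "r j" "r k"] by (simp add: algebra_simps)
  ultimately have "2 * d * (r j)\<^sup>2 \<le> 5 * (r k * r j)" by linarith
  then have "(2 * (d * r j)) * r j \<le> (5 * r k) * r j" by (simp add: power2_eq_square algebra_simps)
  then show ?thesis using pos by simp
qed

section \<open>Summation over the scales\<close>

lemma tower_representatives:
  assumes tw: "tower d T I m y c r"
  obtains k where "\<And>\<mu>. \<mu> \<in> m ` I \<Longrightarrow> k \<mu> \<in> I \<and> m (k \<mu>) = \<mu>"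
    "\<And>i. i \<in> I \<Longrightarrow> r (k (m i)) \<le> r i \<and> r i \<le> 2 * r (k (m i))"
proof -
  have "\<exists>k. k \<in> I \<and> m k = \<mu> \<and> (\<forall>i\<in>I. m i = \<mu> \<longrightarrow> r k \<le> r i)" if "\<mu> \<in> m ` I" for \<mu>
    using exists_min_radius[of "{i\<in>I. m i = \<mu>}" r] towerD(1)[OF tw] that by auto
  then obtain k where k: "\<And>\<mu>. \<mu> \<in> m ` I \<Longrightarrow> k \<mu> \<in> I \<and> m (k \<mu>) = \<mu> \<and> (\<forall>i\<in>I. m i = \<mu> \<longrightarrow> r (k \<mu>) \<le> r i)"
    by metis
  show ?thesis
  proof (rule that[of k])
    show "k \<mu> \<in> I \<and> m (k \<mu>) = \<mu>" if "\<mu> \<in> m ` I" for \<mu> using k[OF that] by blast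
    show "r (k (m i)) \<le> r i \<and> r i \<le> 2 * r (k (m i))" if i: "i \<in> I" for i
    proof -
      have k': "k (m i) \<in> I" "m i = m (k (m i))" "r (k (m i)) \<le> r i" using k[of "m i"] i by auto
      show ?thesis using towerD(13)[OF tw i k'(1,2)] k'(3) by simp
    qed
  qed
qed

lemma card_eq_sum_fibres:
  assumes "finite I"
  shows "real (card I) = (\<Sum>\<mu>\<in>f ` I. real (card {i\<in>I. f i = \<mu>}))"
proof -
  have "card I = (\<Sum>i\<in>I. 1)" by simp
  also have "\<dots> = (\<Sum>\<mu>\<in>f ` I. (\<Sum>i\<in>{i\<in>I. f i = \<mu>}. 1))" by (rule sum.image_gen[OF assms])
  finally show ?thesis by simp
qed

text \<open>Reciprocal radii fall at least by the factor 64 from one scale to the next. The 2 in the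
  numerator allows for a representative of the lowest scale that is smaller than
  \<open>r k0\<close>.\<close>

lemma tower_radii_lacunary:
  assumes tw: "tower d T I m y c r" and k0: "k0 \<in> I" "\<And>j. j \<in> I \<Longrightarrow> m k0 \<le> m j"
    and k: "\<And>\<mu>. \<mu> \<in> m ` I \<Longrightarrow> k \<mu> \<in> I \<and> m (k \<mu>) = \<mu>" and g: "0 < g"
  shows "(\<Sum>\<mu>\<in>m ` I. (r k0 / r (k \<mu>)) powr g) \<le> 2 powr g / (1 - 2 powr (- g))"
proof (rule sum_lacunary_powr_le)
  have r0: "0 < r k0" by (rule towerD(8)[OF tw k0(1)])
  show "finite (m ` I)" using towerD(1)[OF tw] by simp
  fix \<mu> assume mu: "\<mu> \<in> m ` I"
  have K: "k \<mu> \<in> I" "m (k \<mu>) = \<mu>" using k[OF mu] by auto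
  have rk: "0 < r (k \<mu>)" by (rule towerD(8)[OF tw K(1)])
  show "0 < r k0 / r (k \<mu>)" using r0 rk by simp
  have "r k0 \<le> 2 * r (k \<mu>)"
  proof (cases "m k0 = m (k \<mu>)")
    case True then show ?thesis by (rule towerD(13)[OF tw k0(1) K(1)])
  next
    case False
    then have "m k0 < m (k \<mu>)" using k0(2)[OF K(1)] by simp
    from towerD(11)[OF tw k0(1) K(1) this] show ?thesis using rk r0 by simp
  qed
  then show "r k0 / r (k \<mu>) \<le> 2" using rk by (simp add: pos_divide_le_eq)
next
  fix \<mu> \<mu>' assume mu: "\<mu> \<in> m ` I" "\<mu>' \<in> m ` I" and ne: "\<mu> \<noteq> \<mu>'"
  have *: "2 * (r k0 / r (k b)) \<le> r k0 / r (k a)" if "a \<in> m ` I" "b \<in> m ` I" "a < b" for a b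
  proof -
    have K: "k a \<in> I" "m (k a) = a" "k b \<in> I" "m (k b) = b" using k that by auto
    then have r: "64 * r (k a) \<le> r (k b)" using towerD(11)[OF tw K(1,3)] that by simp
    have ra: "0 < r (k a)" "0 < r k0" using towerD(8)[OF tw] K(1) k0(1) by auto
    have "r k0 / r (k b) \<le> r k0 / (2 * r (k a))" using r ra by (intro divide_left_mono) auto
    then show ?thesis using ra by simp
  qed
  show "2 * (r k0 / r (k \<mu>)) \<le> r k0 / r (k \<mu>') \<or> 2 * (r k0 / r (k \<mu>')) \<le> r k0 / r (k \<mu>)"
    using *[OF mu] *[OF mu(2,1)] ne by linarith
qed (use g in auto)

lemma tower_lowest:
  assumes tw: "tower d T I m y c r" and "I \<noteq> {}"
  obtains k0 where "k0 \<in> I" "\<And>j. j \<in> I \<Longrightarrow> m k0 \<le> m j"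
proof -
  have fin: "finite (m ` I)" using towerD(1)[OF tw] by simp
  have "Min (m ` I) \<in> m ` I" using fin assms(2) by (intro Min_in) auto
  then obtain k0 where k0: "k0 \<in> I" "m k0 = Min (m ` I)" by force
  show ?thesis using that[OF k0(1)] fin k0(2) by simp
qed

text \<open>Let \<rho> be the lowest radius and \<open>R\<close> the radius of a scale. The depth of
  the origin in a ball of that scale is at most of order \<open>\<rho> * R\<close>, so a point that
  is not far has norm of order \<open>x * R\<close> with \<open>x = sqrt (\<rho> / R)\<close>. The
  points of the scale spread over the fraction \<open>x\<close> of its size, their number is of
  order \<open>(x / T) powr \<sigma>\<close>, and lacunarity of the radii sums these bounds.\<close>

lemma tower_near_count:
  assumes dim: "2 \<le> DIM('a::euclidean_space)"
  shows "\<exists>C>0. \<forall>d T (I::'i set) m (y::'i \<Rightarrow> 'a) c r.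
    tower d T I m y c r \<and> T \<le> 1 / 1920000 \<and> (\<forall>i\<in>I. (norm (y i))\<^sup>2 \<le> 4 * ((r i)\<^sup>2 - (norm (c i))\<^sup>2))
    \<longrightarrow> real (card I) \<le> C * T powr (- ((real DIM('a) - 1) / 2))"
proof -
  define \<sigma> where "\<sigma> = (real DIM('a) - 1) / 2"
  have \<sigma>: "0 < \<sigma>" using dim by (simp add: \<sigma>_def)
  obtain C where C: "0 < C" and count: "\<forall>d T (I::'i set) m (y::'i \<Rightarrow> 'a) c r R a b.
    tower d T I m y c r \<and> 0 < R \<and> (\<forall>i\<in>I. \<forall>j\<in>I. m i = m j) \<and> (\<forall>i\<in>I. R \<le> r i \<and> r i \<le> 2 * R) \<and>
    T \<le> 1 / 1920000 \<and> 0 < a \<and> a \<le> 8 \<and> 0 < b \<and> b \<le> 2 \<and> a \<le> 4 * b \<and> T \<le> 4 * a * b \<and>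
    (\<forall>i\<in>I. \<forall>j\<in>I. norm (y i - y j) \<le> a * R) \<and> (\<forall>i\<in>I. \<forall>j\<in>I. norm (sgn (y i - c i) - sgn (y j - c j)) \<le> b)
    \<longrightarrow> real (card I) \<le> C * (a * b / T) powr ((real DIM('a) - 1) / 2)"
    by (rule exE[OF tower_scale_count[OF zero_less_numeral, where 'i='i and 'a='a]], erule conjE, rule that, assumption, assumption)
  define C' where "C' = C * 24 powr \<sigma> * (2 powr (\<sigma>/2) / (1 - 2 powr (- (\<sigma>/2))))"
  have pos2: "0 < 1 - 2 powr (- (\<sigma>/2))" using \<sigma> powr_less_one[of 2 "-(\<sigma>/2)"] by simp
  have C': "0 < C'" using C pos2 by (simp add: C'_def)
  show ?thesis
  proof (rule exI[of _ C'], rule conjI, rule C', (rule allI)+, rule impI, elim conjE)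
    fix d T and I :: "'i set" and m and y :: "'i \<Rightarrow> 'a" and c r
    assume tw: "tower d T I m y c r" and T: "T \<le> 1 / 1920000"
      and near: "\<forall>i\<in>I. (norm (y i))\<^sup>2 \<le> 4 * ((r i)\<^sup>2 - (norm (c i))\<^sup>2)"
    show "real (card I) \<le> C' * T powr (- ((real DIM('a) - 1) / 2))"
    proof (cases "I = {}")
      case True then show ?thesis using C' by simp
    next
      case False
      have fin: "finite I" and T0: "0 < T" by (rule towerD[OF tw])+
      obtain k0 where k0: "k0 \<in> I" and k0min: "\<And>j. j \<in> I \<Longrightarrow> m k0 \<le> m j"
        by (rule tower_lowest[OF tw False], rule that)
      define \<rho> where "\<rho> = r k0"
      have \<rho>: "0 < \<rho>" using towerD(8)[OF tw k0] by (simp add: \<rho>_def)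
      obtain k where k: "\<And>\<mu>. \<mu> \<in> m ` I \<Longrightarrow> k \<mu> \<in> I \<and> m (k \<mu>) = \<mu>"
        "\<And>i. i \<in> I \<Longrightarrow> r (k (m i)) \<le> r i \<and> r i \<le> 2 * r (k (m i))"
        by (rule tower_representatives[OF tw], rule that)
      define f where "f \<mu> = \<rho> / r (k \<mu>)" for \<mu>
      have f_pos: "0 < f \<mu>" if "\<mu> \<in> m ` I" for \<mu>
        using towerD(8)[OF tw, of "k \<mu>"] k(1)[OF that] \<rho> by (simp add: f_def)
      have f_le: "f \<mu> \<le> 2" if "\<mu> \<in> m ` I" for \<mu>
      proof -
        have K: "k \<mu> \<in> I" "m (k \<mu>) = \<mu>" using k(1)[OF that] by auto
        have rk: "0 < r (k \<mu>)" by (rule towerD(8)[OF tw K(1)])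
        have "\<rho> \<le> 2 * r (k \<mu>)"
        proof (cases "m k0 = m (k \<mu>)")
          case True then show ?thesis unfolding \<rho>_def by (rule towerD(13)[OF tw k0 K(1)])
        next
          case False
          then have "m k0 < m (k \<mu>)" using k0min[OF K(1)] by simp
          from towerD(11)[OF tw k0 K(1) this] show ?thesis using rk \<rho> by (simp add: \<rho>_def)
        qed
        then show ?thesis using rk by (simp add: f_def pos_divide_le_eq)
      qed
      have fibre: "real (card {i\<in>I. m i = \<mu>}) \<le> C * 24 powr \<sigma> * T powr (-\<sigma>) * f \<mu> powr (\<sigma>/2)"
        if mu: "\<mu> \<in> m ` I" for \<mu>
      proof -
        define J where "J = {i\<in>I. m i = \<mu>}"
        define R where "R = r (k \<mu>)"
        define x where "x = sqrt (f \<mu>)"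
        have K: "k \<mu> \<in> I" "m (k \<mu>) = \<mu>" using k(1)[OF mu] by auto
        have R: "0 < R" unfolding R_def by (rule towerD(8)[OF tw K(1)])
        have x: "0 < x" "x\<^sup>2 = f \<mu>" using f_pos[OF mu] by (auto simp: x_def)
        have "x\<^sup>2 \<le> (3/2)\<^sup>2" using f_le[OF mu] by (simp add: x(2) power_divide)
        then have x2: "x \<le> 3/2" by (rule power2_le_imp_le) simp
        have xx: "x * x \<le> 3/2 * x" using x x2 by (intro mult_right_mono) auto
        have \<rho>R: "\<rho> = x\<^sup>2 * R" using R unfolding x(2) f_def R_def by simp
        have rJ: "R \<le> r i \<and> r i \<le> 2 * R" if "i \<in> J" for i using k(2)[of i] that by (auto simp: J_def R_def)
        have JI: "J \<subseteq> I" by (auto simp: J_def)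
        have D: "(r i)\<^sup>2 - (norm (c i))\<^sup>2 \<le> 4 * \<rho> * r i" if "i \<in> I" for i
          unfolding \<rho>_def by (rule tower_depth_bound[OF tw k0 k0min that])
        have y: "norm (y i) \<le> 6 * x * R" if i: "i \<in> J" for i
        proof (rule power2_le_imp_le)
          have "(norm (y i))\<^sup>2 \<le> 4 * (4 * \<rho> * r i)" using near D JI i by fastforce
          also have "\<dots> \<le> 4 * (4 * \<rho> * (2 * R))" using rJ[OF i] \<rho> by (intro mult_left_mono) auto
          also have "\<dots> = 32 * (x * R)\<^sup>2" unfolding \<rho>R by (simp add: power2_eq_square algebra_simps)
          also have "\<dots> \<le> 36 * (x * R)\<^sup>2" by simp
          also have "\<dots> = (6 * x * R)\<^sup>2" by (simp add: power2_eq_square algebra_simps)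
          finally show "(norm (y i))\<^sup>2 \<le> (6 * x * R)\<^sup>2" .
        qed (use x R in auto)
        have dy: "norm (y i - y j) \<le> min 8 (12 * x) * R" if "i \<in> J" "j \<in> J" for i j
        proof -
          have 1: "norm (y i - y j) \<le> norm (y i) + norm (y j)" by (rule norm_triangle_ineq4)
          have "norm (y i) \<le> 4 * R" "norm (y j) \<le> 4 * R"
            using tower_y_bound[OF tw, of i] tower_y_bound[OF tw, of j] rJ[OF that(1)] rJ[OF that(2)] that JI by force+
          then have "norm (y i - y j) \<le> 8 * R" using 1 by linarith
          moreover have "norm (y i - y j) \<le> 12 * x * R" using 1 y[OF that(1)] y[OF that(2)] by linarith
          ultimately show ?thesis by (simp add: min_def)
        qed
        \<comment> \<open>The count of one scale wants \<open>T\<close> below a multiple of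
          \<open>a * b\<close>. For \<open>T = d\<close> this is the bound on the ratio of radii.
          Otherwise the depth of a representative is at most the depth of the origin plus twice the
          product of the norms of point and centre, both of order
          \<open>x * R\<^sup>2\<close>.\<close>
        have Tx: "T \<le> 36 * x"
        proof -
          from towerD(10)[OF tw K(1)] show ?thesis
          proof
            assume "T = d"
            then have "T * R \<le> 5 / 2 * \<rho>" using tower_radius_ratio[OF tw k0 k0min K(1)] by (simp add: R_def \<rho>_def)
            also have "\<dots> = (5/2 * (x * x)) * R" unfolding \<rho>R by (simp add: power2_eq_square)
            finally have "T \<le> 5/2 * (x * x)" using R by simp
            then show ?thesis using xx x by linarith
          next
            assume a: "T / 2 * (r (k \<mu>))\<^sup>2 \<le> (r (k \<mu>))\<^sup>2 - (norm (y (k \<mu>) - c (k \<mu>)))\<^sup>2"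
            have kJ: "k \<mu> \<in> J" using K by (simp add: J_def)
            have cn: "norm (c (k \<mu>)) \<le> R" using towerD(6)[OF tw K(1)] by (simp add: R_def)
            have "y (k \<mu>) \<bullet> c (k \<mu>) \<le> norm (y (k \<mu>)) * norm (c (k \<mu>))" by (rule norm_cauchy_schwarz)
            also have "\<dots> \<le> (6 * x * R) * R" using y[OF kJ] cn x R by (intro mult_mono) auto
            finally have "T / 2 * R\<^sup>2 \<le> 4 * \<rho> * R + 2 * ((6 * x * R) * R)"
              using a D[OF K(1)] inner_via_powers[of "y (k \<mu>)" "c (k \<mu>)" "R\<^sup>2"] zero_le_power2[of "norm (y (k \<mu>))"]
              unfolding R_def[symmetric] by linarith
            also have "\<dots> = (4 * (x * x) + 12 * x) * R\<^sup>2" unfolding \<rho>R by (simp add: power2_eq_square algebra_simps)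
            finally have "T / 2 \<le> 4 * (x * x) + 12 * x" using R by simp
            then show ?thesis using xx by linarith
          qed
        qed
        have a: "5 * x \<le> min 8 (12 * x)" using x x2 by simp
        have nsgn: "norm (sgn v) \<le> 1" for v :: 'a by (simp add: norm_sgn)
        have dv: "norm (sgn v - sgn w) \<le> 2" for v w :: 'a
          using norm_triangle_ineq4[of "sgn v" "sgn w"] nsgn[of v] nsgn[of w] by linarith
        have mJ: "\<forall>i\<in>J. \<forall>j\<in>J. m i = m j" by (simp add: J_def)
        have "real (card J) \<le> C * (min 8 (12 * x) * 2 / T) powr \<sigma>"
          unfolding \<sigma>_def using tower_subset[OF tw JI] R rJ T Tx a x dy dv
          by (intro count[rule_format, of d T J m y c r R "min 8 (12 * x)" 2] conjI mJ ballI) auto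
        also have "\<dots> \<le> C * (24 * x / T) powr \<sigma>"
          using C T0 \<sigma> x by (intro mult_left_mono powr_mono2 divide_right_mono) auto
        also have "(24 * x / T) powr \<sigma> = 24 powr \<sigma> * x powr \<sigma> * T powr (-\<sigma>)"
          using x T0 by (simp add: powr_divide powr_mult powr_minus_divide)
        also have "x powr \<sigma> = f \<mu> powr (\<sigma>/2)"
        proof -
          have "f \<mu> powr (\<sigma>/2) = (x powr 2) powr (\<sigma>/2)" using x by (simp add: powr_numeral)
          also have "\<dots> = x powr \<sigma>" by (simp add: powr_powr)
          finally show ?thesis ..
        qed
        finally show ?thesis by (simp add: J_def algebra_simps)
      qed
      have lac: "(\<Sum>\<mu>\<in>m ` I. f \<mu> powr (\<sigma>/2)) \<le> 2 powr (\<sigma>/2) / (1 - 2 powr (- (\<sigma>/2)))"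
        unfolding f_def \<rho>_def by (rule tower_radii_lacunary[OF tw k0 k0min k(1)]) (use \<sigma> in simp_all)
      have "real (card I) = (\<Sum>\<mu>\<in>m ` I. real (card {i\<in>I. m i = \<mu>}))" by (rule card_eq_sum_fibres[OF fin])
      also have "\<dots> \<le> (\<Sum>\<mu>\<in>m ` I. C * 24 powr \<sigma> * T powr (-\<sigma>) * f \<mu> powr (\<sigma>/2))"
        by (rule sum_mono) (rule fibre)
      also have "\<dots> = C * 24 powr \<sigma> * T powr (-\<sigma>) * (\<Sum>\<mu>\<in>m ` I. f \<mu> powr (\<sigma>/2))"
        by (simp add: sum_distrib_left)
      also have "\<dots> \<le> C * 24 powr \<sigma> * T powr (-\<sigma>) * (2 powr (\<sigma>/2) / (1 - 2 powr (- (\<sigma>/2))))"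
        using lac C by (intro mult_left_mono) auto
      also have "\<dots> = C' * T powr (- ((real DIM('a) - 1) / 2))" by (simp add: C'_def \<sigma>_def)
      finally show ?thesis .
    qed
  qed
qed

section \<open>Far points and the protrusion of their balls\<close>

definition far :: "('i \<Rightarrow> 'a::real_inner) \<Rightarrow> ('i \<Rightarrow> 'a) \<Rightarrow> ('i \<Rightarrow> real) \<Rightarrow> 'i \<Rightarrow> bool" where
  "far y c r i \<longleftrightarrow> 4 * ((r i)\<^sup>2 - (norm (c i))\<^sup>2) < (norm (y i))\<^sup>2"

text \<open>The amount by which the ball \<open>B (c i) (r i)\<close> sticks out of the larger ones at \<open>y i\<close>, as an angle.\<close>
definition protrusion :: "real \<Rightarrow> ('i \<Rightarrow> 'a::real_inner) \<Rightarrow> ('i \<Rightarrow> real) \<Rightarrow> 'i \<Rightarrow> real" where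
  "protrusion T y r i = norm (y i) / r i + T / (norm (y i) / r i)"

lemma sgn_inner_scaled:
  fixes x z :: "'a::real_inner"
  shows "sgn x \<bullet> (z /\<^sub>R t) = (x \<bullet> z) / (norm x * t)"
  unfolding sgn_div_norm inner_scaleR_left inner_scaleR_right by (simp add: divide_inverse)

context
  fixes d T :: real and I :: "'i set" and m and y c :: "'i \<Rightarrow> 'a::real_inner" and r
  assumes tw: "tower d T I m y c r"
begin

lemma far_pos:
  assumes "i \<in> I" "far y c r i"
  shows "0 < norm (y i)"
proof -
  have "(norm (c i))\<^sup>2 < (r i)\<^sup>2" using towerD(6)[OF tw assms(1)] by (intro power_strict_mono) auto
  then have "0 < (norm (y i))\<^sup>2" using assms(2) unfolding far_def by argo
  then show ?thesis by simp
qed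

text \<open>In the identity \<open>inner_via_powers\<close> the depth of the origin takes at most a
  quarter of the squared norm, and three quarters survive: a far point lies on the side of its
  centre.\<close>

lemma far_inner_lower:
  assumes i: "i \<in> I" "far y c r i"
  shows "3/8 * (norm (y i) / r i) + ((r i)\<^sup>2 - (norm (y i - c i))\<^sup>2) / (2 * norm (y i) * r i)
    \<le> sgn (y i) \<bullet> (c i /\<^sub>R r i)"
proof -
  have N: "0 < norm (y i)" by (rule far_pos[OF i])
  have r: "0 < r i" by (rule towerD(8)[OF tw i(1)])
  have "3/4 * (norm (y i))\<^sup>2 + ((r i)\<^sup>2 - (norm (y i - c i))\<^sup>2) \<le> 2 * (y i \<bullet> c i)"
    using inner_via_powers[of "y i" "c i" "(r i)\<^sup>2"] i(2) unfolding far_def by argo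
  then have "(3/4 * (norm (y i))\<^sup>2 + ((r i)\<^sup>2 - (norm (y i - c i))\<^sup>2)) / (2 * norm (y i) * r i)
     \<le> (2 * (y i \<bullet> c i)) / (2 * norm (y i) * r i)"
    using N r by (intro divide_right_mono) auto
  moreover have "(2 * (y i \<bullet> c i)) / (2 * norm (y i) * r i) = sgn (y i) \<bullet> (c i /\<^sub>R r i)"
    unfolding sgn_inner_scaled by simp
  moreover have "(3/4 * (norm (y i))\<^sup>2) / (2 * norm (y i) * r i) = 3/8 * (norm (y i) / r i)"
    using N r by (simp add: power2_eq_square)
  ultimately show ?thesis by (simp add: add_divide_distrib)
qed

lemma far_inner_pos:
  assumes i: "i \<in> I" "far y c r i"
  shows "0 < sgn (y i) \<bullet> (c i /\<^sub>R r i)"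
proof -
  have N: "0 < norm (y i)" by (rule far_pos[OF i])
  have r: "0 < r i" by (rule towerD(8)[OF tw i(1)])
  have "(norm (y i - c i))\<^sup>2 \<le> (r i)\<^sup>2" using towerD(7)[OF tw i(1)] by (intro power_mono) auto
  then have "0 \<le> ((r i)\<^sup>2 - (norm (y i - c i))\<^sup>2) / (2 * norm (y i) * r i)" using N r by simp
  moreover have "0 < 3/8 * (norm (y i) / r i)" using N r by simp
  ultimately show ?thesis using far_inner_lower[OF i] by linarith
qed

text \<open>The direction of \<open>y i\<close> separates the centre of its own ball from those of
  the larger ones: \<open>y i\<close> lies inside the former and outside the dilates of the latter,
  while the ratio 64 of the radii makes the curvature term \<open>N / (2 * r j)\<close> small. The
  factor \<mu> is there because centres are compared later up to rescaling only, by the ratio of two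
  heights in the plane and by a free multiple in higher dimensions.\<close>

lemma far_cross:
  assumes i: "i \<in> I" "far y c r i" and j: "j \<in> I" "m i < m j" and \<mu>: "1/2 \<le> \<mu>" "\<mu> \<le> 6"
  shows "protrusion T y r i / 4 \<le> sgn (y i) \<bullet> (c i /\<^sub>R r i) - \<mu> * (sgn (y i) \<bullet> (c j /\<^sub>R r j))"
proof -
  define N where "N = norm (y i)"
  have N: "0 < N" unfolding N_def by (rule far_pos[OF i])
  have r: "0 < r i" "0 < r j" using towerD(8)[OF tw] i j by auto
  have rr: "64 * r i \<le> r j" by (rule towerD(11)[OF tw i(1) j])
  have d: "0 < d" "0 < T" by (rule towerD[OF tw])+
  have "(norm (c j))\<^sup>2 \<le> (r j)\<^sup>2" using towerD(6)[OF tw j(1)] by (intro power_mono) auto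
  then have "2 * (y i \<bullet> c j) \<le> N\<^sup>2 - 2 * d * (r j)\<^sup>2"
    using tower_cross_inner[OF tw i(1) j] unfolding N_def by linarith
  then have "(2 * (y i \<bullet> c j)) / (2 * N * r j) \<le> (N\<^sup>2 - 2 * d * (r j)\<^sup>2) / (2 * N * r j)"
    using N r by (intro divide_right_mono) auto
  moreover have "(2 * (y i \<bullet> c j)) / (2 * N * r j) = sgn (y i) \<bullet> (c j /\<^sub>R r j)"
    unfolding sgn_inner_scaled N_def by simp
  moreover have "(N\<^sup>2 - 2 * d * (r j)\<^sup>2) / (2 * N * r j) = N / (2 * r j) - d * r j / N"
    using N r by (simp add: diff_divide_distrib power2_eq_square)
  ultimately have "sgn (y i) \<bullet> (c j /\<^sub>R r j) \<le> N / (2 * r j) - d * r j / N" by simp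
  then have "\<mu> * (sgn (y i) \<bullet> (c j /\<^sub>R r j)) \<le> \<mu> * (N / (2 * r j) - d * r j / N)"
    using \<mu> by (intro mult_left_mono) auto
  also have "\<dots> = \<mu> * (N / (2 * r j)) - \<mu> * (d * r j / N)" by (simp add: right_diff_distrib)
  also have "\<dots> \<le> 6 * (N / (2 * r j)) - 1/2 * (d * r j / N)"
    using \<mu> N r d by (intro diff_mono mult_right_mono) auto
  finally have "\<mu> * (sgn (y i) \<bullet> (c j /\<^sub>R r j)) \<le> 6 * (N / (2 * r j)) - 1/2 * (d * r j / N)" .
  moreover have "N / (2 * r j) \<le> N / (128 * r i)"
    using rr r N by (intro divide_left_mono) auto
  moreover have "d * r j / N \<ge> d * (64 * r i) / N"
    using rr N d by (intro divide_right_mono mult_left_mono) auto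
  ultimately have B: "\<mu> * (sgn (y i) \<bullet> (c j /\<^sub>R r j)) \<le> 6 * (N / (128 * r i)) - 1/2 * (d * (64 * r i) / N)" by linarith
  define x where "x = N / r i"
  have x: "0 < x" using N r by (simp add: x_def)
  have B': "\<mu> * (sgn (y i) \<bullet> (c j /\<^sub>R r j)) \<le> 6/128 * x - 32 * (d / x)" using B by (simp add: x_def)
  define t where "t = (r i)\<^sup>2 - (norm (y i - c i))\<^sup>2"
  have A: "3/8 * x + t / (2 * N * r i) \<le> sgn (y i) \<bullet> (c i /\<^sub>R r i)"
    using far_inner_lower[OF i] by (simp add: x_def t_def N_def)
  have "(norm (y i - c i))\<^sup>2 \<le> (r i)\<^sup>2" using towerD(7)[OF tw i(1)] by (intro power_mono) auto
  then have t0: "0 \<le> t / (2 * N * r i)" using N r by (simp add: t_def)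
  have dx: "0 < d / x" using d x by simp
  \<comment> \<open>This accounts for the summand \<open>T / x\<close> of the protrusion: it comes
    from the margin around the larger ball if \<open>T = d\<close>, and from the depth of
    \<open>y i\<close> in its own ball otherwise.\<close>
  have "T / x / 4 \<le> t / (2 * N * r i) + 32 * (d / x)"
    using towerD(10)[OF tw i(1)]
  proof
    assume "T = d" then show ?thesis using t0 dx by simp
  next
    assume "T / 2 * (r i)\<^sup>2 \<le> (r i)\<^sup>2 - (norm (y i - c i))\<^sup>2"
    then have "(T / 2 * (r i)\<^sup>2) / (2 * N * r i) \<le> t / (2 * N * r i)"
      using N r by (intro divide_right_mono) (auto simp: t_def)
    moreover have "(T / 2 * (r i)\<^sup>2) / (2 * N * r i) = T / x / 4"
      using N r by (simp add: x_def power2_eq_square)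
    ultimately show ?thesis using dx by linarith
  qed
  then have "1/4 * (T / x) \<le> t / (2 * N * r i) + 32 * (d / x)" by simp
  moreover have "protrusion T y r i = x + T / x" by (simp add: protrusion_def x_def N_def)
  ultimately show ?thesis using A B' x by argo
qed

text \<open>Upper counterpart of \<open>far_cross\<close>: the power of \<open>y i\<close> is least
  for its own ball and not below \<open>- T * (r i)\<^sup>2\<close>, which limits how far any centre
  of the same scale can lie in the direction of \<open>y i\<close>.\<close>

lemma far_same:
  assumes i: "i \<in> I" "far y c r i" and j: "j \<in> I" "m i = m j"
  shows "sgn (y i) \<bullet> (c j /\<^sub>R r j) \<le> protrusion T y r i"
proof -
  define N where "N = norm (y i)"
  have N: "0 < N" unfolding N_def by (rule far_pos[OF i])
  have r: "0 < r i" "0 < r j" using towerD(8)[OF tw] i j by auto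
  have rr: "r i \<le> 2 * r j" by (rule towerD(13)[OF tw i(1) j])
  have T: "0 < T" by (rule towerD[OF tw])
  have "(norm (c j))\<^sup>2 \<le> (r j)\<^sup>2" using towerD(6)[OF tw j(1)] by (intro power_mono) auto
  then have "2 * (y i \<bullet> c j) \<le> N\<^sup>2 + T * (r i)\<^sup>2"
    using towerD(14)[OF tw i(1) j] towerD(9)[OF tw i(1)] inner_via_powers[of "y i" "c j" "(r j)\<^sup>2"]
    unfolding N_def by linarith
  then have "(2 * (y i \<bullet> c j)) / (2 * N * r j) \<le> (N\<^sup>2 + T * (r i)\<^sup>2) / (2 * N * r j)"
    using N r by (intro divide_right_mono) auto
  also have "\<dots> \<le> (N\<^sup>2 + T * (r i)\<^sup>2) / (N * r i)"
    using N r rr T by (intro divide_left_mono) (auto intro!: add_nonneg_nonneg mult_pos_pos)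
  also have "\<dots> = protrusion T y r i"
    using N r by (simp add: protrusion_def N_def[symmetric] add_divide_distrib power2_eq_square)
  finally show ?thesis unfolding sgn_inner_scaled N_def by simp
qed

lemma protrusion_bounds:
  assumes i: "i \<in> I" "far y c r i"
  shows "norm (y i) \<le> protrusion T y r i * r i" "T \<le> (protrusion T y r i)\<^sup>2 / 4" "0 < protrusion T y r i"
proof -
  define x where "x = norm (y i) / r i"
  have r: "0 < r i" by (rule towerD(8)[OF tw i(1)])
  have x: "0 < x" using far_pos[OF i] r by (simp add: x_def)
  have T: "0 < T" by (rule towerD[OF tw])
  have p: "protrusion T y r i = x + T / x" by (simp add: protrusion_def x_def)
  have Tx: "0 < T / x" using T x by simp
  show "0 < protrusion T y r i" unfolding p using x Tx by simp
  have "norm (y i) = x * r i" using r by (simp add: x_def)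
  also have "\<dots> \<le> (x + T / x) * r i" using r Tx by (intro mult_right_mono) auto
  finally show "norm (y i) \<le> protrusion T y r i * r i" unfolding p .
  have "4 * (x * (T / x)) \<le> (x + T / x)\<^sup>2"
    using zero_le_power2[of "x - T / x"] by (simp add: power2_eq_square algebra_simps)
  then show "T \<le> (protrusion T y r i)\<^sup>2 / 4" unfolding p using x by simp
qed

text \<open>For a far point the depth of the origin is at most a quarter of
  \<open>(norm (y i))\<^sup>2\<close>, so the origin is close to the sphere, quadratically in the
  protrusion.\<close>

lemma far_center_norm:
  assumes i: "i \<in> I" "far y c r i" and p: "protrusion T y r i \<le> 1"
  shows "1 - (protrusion T y r i)\<^sup>2 / 4 \<le> norm (c i /\<^sub>R r i)" "norm (c i /\<^sub>R r i) \<le> 1"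
proof -
  have r: "0 < r i" by (rule towerD(8)[OF tw i(1)])
  define q where "q = (protrusion T y r i)\<^sup>2 / 4"
  have "(norm (y i))\<^sup>2 \<le> (protrusion T y r i * r i)\<^sup>2"
    using protrusion_bounds(1)[OF i] by (intro power_mono) auto
  then have "(r i)\<^sup>2 - (norm (c i))\<^sup>2 \<le> q * (r i)\<^sup>2"
    using i(2) unfolding far_def q_def by (simp add: power_mult_distrib)
  then have 1: "(1 - q) * (r i)\<^sup>2 \<le> (norm (c i))\<^sup>2" by (simp add: algebra_simps)
  have n: "norm (c i /\<^sub>R r i) = norm (c i) / r i" using r by (simp add: divide_inverse mult.commute)
  then show "norm (c i /\<^sub>R r i) \<le> 1" using towerD(6)[OF tw i(1)] r by simp
  have "(1 - q) \<le> (norm (c i /\<^sub>R r i))\<^sup>2" unfolding n power_divide using 1 r by (simp add: pos_le_divide_eq)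
  moreover have q: "0 \<le> q" by (simp add: q_def)
  ultimately show "1 - q \<le> norm (c i /\<^sub>R r i)"
  proof -
    assume a: "1 - q \<le> (norm (c i /\<^sub>R r i))\<^sup>2"
    have "(norm (c i /\<^sub>R r i))\<^sup>2 \<le> norm (c i /\<^sub>R r i) * 1"
      unfolding power2_eq_square using \<open>norm (c i /\<^sub>R r i) \<le> 1\<close> by (intro mult_left_mono) auto
    then show ?thesis using a by linarith
  qed
qed

end

text \<open>By \<open>far_cross\<close> the normalised centres of different scales are at distance
  at least \<open>z0 / 4\<close> in the unit ball, so the number of scales is bounded.\<close>

lemma tower_far_big_count:
  assumes z0: "0 < z0" "z0 \<le> 4"
  shows "\<exists>C>0. \<forall>d T (I::'i set) m (y::'i \<Rightarrow> 'a::euclidean_space) c r.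
    tower d T I m y c r \<and> T \<le> 1 / 1920000 \<and> (\<forall>i\<in>I. far y c r i \<and> z0 \<le> protrusion T y r i)
    \<longrightarrow> real (card I) \<le> C * T powr (- ((real DIM('a) - 1) / 2))"
proof -
  obtain C where C: "0 < C" and count: "\<forall>d T (I::'i set) m (y::'i \<Rightarrow> 'a) c r.
    tower d T I m y c r \<and> (\<forall>i\<in>I. \<forall>j\<in>I. m i = m j) \<and> T \<le> 1 / 1920000
    \<longrightarrow> real (card I) \<le> C * T powr (- ((real DIM('a) - 1) / 2))"
    by (rule exE[OF tower_top_count[where 'i='i and 'a='a]], erule conjE, rule that, assumption, assumption)
  define K where "K = (12 / z0) ^ DIM('a)"
  have K: "0 < K" using z0 by (simp add: K_def)
  show ?thesis
  proof (rule exI[of _ "K * C"], rule conjI, simp add: K C, (rule allI)+, rule impI, elim conjE)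
    fix d T and I :: "'i set" and m and y :: "'i \<Rightarrow> 'a" and c r
    assume tw: "tower d T I m y c r" and T: "T \<le> 1 / 1920000"
      and f: "\<forall>i\<in>I. far y c r i \<and> z0 \<le> protrusion T y r i"
    obtain k where k: "\<And>\<mu>. \<mu> \<in> m ` I \<Longrightarrow> k \<mu> \<in> I \<and> m (k \<mu>) = \<mu>"
        "\<And>i. i \<in> I \<Longrightarrow> r (k (m i)) \<le> r i \<and> r i \<le> 2 * r (k (m i))"
      by (rule tower_representatives[OF tw], rule that)
    let ?u = "\<lambda>\<mu>. c (k \<mu>) /\<^sub>R r (k \<mu>)"
    have sep: "z0 / 4 \<le> dist (?u \<mu>) (?u \<mu>')" if mu: "\<mu> \<in> m ` I" "\<mu>' \<in> m ` I" "\<mu> < \<mu>'" for \<mu> \<mu>'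
    proof -
      have K: "k \<mu> \<in> I" "m (k \<mu>) = \<mu>" "k \<mu>' \<in> I" "m (k \<mu>') = \<mu>'" using k(1) mu by auto
      have fk: "far y c r (k \<mu>)" "z0 \<le> protrusion T y r (k \<mu>)" using f K by auto
      have lt: "m (k \<mu>) < m (k \<mu>')" using K mu by simp
      have "protrusion T y r (k \<mu>) / 4 \<le> sgn (y (k \<mu>)) \<bullet> ?u \<mu> - 1 * (sgn (y (k \<mu>)) \<bullet> ?u \<mu>')"
        by (rule far_cross[OF tw K(1) fk(1) K(3) lt]) auto
      also have "\<dots> = sgn (y (k \<mu>)) \<bullet> (?u \<mu> - ?u \<mu>')" by (simp add: inner_diff_right)
      also have "\<dots> \<le> norm (sgn (y (k \<mu>))) * norm (?u \<mu> - ?u \<mu>')" by (rule norm_cauchy_schwarz)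
      also have "\<dots> \<le> 1 * norm (?u \<mu> - ?u \<mu>')" by (intro mult_right_mono) (auto simp: norm_sgn)
      finally show ?thesis using fk(2) by (simp add: dist_norm)
    qed
    have fin: "finite I" by (rule towerD[OF tw])
    have "real (card (m ` I)) \<le> (3 * 1 / (z0/4)) ^ DIM('a)"
    proof (rule packing_card[where z = 0 and f = ?u])
      show "dist 0 (?u \<mu>) \<le> 1" if "\<mu> \<in> m ` I" for \<mu>
        using towerD(6,8)[OF tw, of "k \<mu>"] k(1)[OF that] by (simp add: field_simps)
      show "z0 / 4 \<le> dist (?u \<mu>) (?u \<mu>')" if "\<mu> \<in> m ` I" "\<mu>' \<in> m ` I" "\<mu> \<noteq> \<mu>'" for \<mu> \<mu>'
        using sep[OF that(1,2)] sep[OF that(2,1)] that(3) by (cases "\<mu> < \<mu>'") (auto simp: dist_commute)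
    qed (use fin z0 in auto)
    then have cm: "real (card (m ` I)) \<le> K" by (simp add: K_def)
    have "real (card I) = (\<Sum>\<mu>\<in>m ` I. real (card {i\<in>I. m i = \<mu>}))" by (rule card_eq_sum_fibres[OF fin])
    also have "\<dots> \<le> (\<Sum>\<mu>\<in>m ` I. C * T powr (- ((real DIM('a) - 1) / 2)))"
    proof (rule sum_mono)
      fix \<mu>
      have "tower d T {i\<in>I. m i = \<mu>} m y c r" by (rule tower_subset[OF tw]) auto
      moreover have "\<forall>i\<in>{i\<in>I. m i = \<mu>}. \<forall>j\<in>{i\<in>I. m i = \<mu>}. m i = m j" by simp
      ultimately show "real (card {i\<in>I. m i = \<mu>}) \<le> C * T powr (- ((real DIM('a) - 1) / 2))"
        using count[rule_format, of d T "{i\<in>I. m i = \<mu>}" m y c r] T by blast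
    qed
    also have "\<dots> = real (card (m ` I)) * (C * T powr (- ((real DIM('a) - 1) / 2)))" by simp
    also have "\<dots> \<le> K * (C * T powr (- ((real DIM('a) - 1) / 2)))"
      using cm C by (intro mult_right_mono) auto
    finally show "real (card I) \<le> K * C * T powr (- ((real DIM('a) - 1) / 2))" by simp
  qed
qed

section \<open>Slopes of the centres in the plane\<close>

lemma norm_sgn_diff_le:
  fixes a b :: "'a::real_normed_vector"
  assumes "a \<noteq> 0"
  shows "norm (sgn a - sgn b) \<le> 2 * norm (a - b) / norm a"
proof (cases "b = 0")
  case True then show ?thesis using assms by (simp add: norm_sgn)
next
  case False
  have "sgn a - sgn b = (a - b) /\<^sub>R norm a + (inverse (norm a) - inverse (norm b)) *\<^sub>R b"
    by (simp add: sgn_div_norm algebra_simps)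
  then have "norm (sgn a - sgn b) \<le> norm ((a - b) /\<^sub>R norm a) + norm ((inverse (norm a) - inverse (norm b)) *\<^sub>R b)"
    by (metis norm_triangle_ineq)
  also have "norm ((a - b) /\<^sub>R norm a) = norm (a - b) / norm a" by (simp add: divide_inverse mult.commute)
  also have "norm ((inverse (norm a) - inverse (norm b)) *\<^sub>R b) = \<bar>norm b - norm a\<bar> / norm a"
  proof -
    have "inverse (norm a) - inverse (norm b) = (norm b - norm a) / (norm a * norm b)"
      using assms False by (simp add: field_simps)
    then show ?thesis using assms False by (simp add: abs_mult)
  qed
  also have "\<dots> \<le> norm (a - b) / norm a"
    using norm_triangle_ineq3[of b a] by (intro divide_right_mono) (auto simp: norm_minus_commute)
  finally show ?thesis by simp
qed

lemma unit_orthogonal_dim2: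
  fixes e v :: "'a::euclidean_space"
  assumes "DIM('a) = 2" "norm e = 1"
  shows "\<exists>f. norm f = 1 \<and> e \<bullet> f = 0 \<and> 0 \<le> v \<bullet> f \<and> (\<forall>w. w \<bullet> e = 0 \<longrightarrow> w = (w \<bullet> f) *\<^sub>R f)"
proof -
  let ?S = "{x. e \<bullet> x = 0}"
  have e0: "e \<noteq> 0" using assms by auto
  have "dim ?S = 1" using dim_hyperplane[OF e0] assms by simp
  moreover obtain B where B: "B \<subseteq> ?S" "pairwise orthogonal B" "\<And>x. x \<in> B \<Longrightarrow> norm x = 1"
     "independent B" "card B = dim ?S" "span B = ?S"
    using orthonormal_basis_subspace[OF subspace_hyperplane] by metis
  ultimately obtain g where g: "B = {g}" by (metis card_1_singletonE)
  have *: "norm g = 1" "e \<bullet> g = 0" using B g by auto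
  have **: "w = (w \<bullet> g) *\<^sub>R g" if "w \<bullet> e = 0" for w
  proof -
    have "w \<in> span {g}" using B(6) g that by (simp add: inner_commute)
    then obtain k where "w = k *\<^sub>R g" by (auto simp: span_singleton)
    then show ?thesis using * by (simp add: norm_eq_1)
  qed
  show ?thesis
  proof (cases "0 \<le> v \<bullet> g")
    case True then show ?thesis using * ** by blast
  next
    case False
    show ?thesis
    proof (intro exI[of _ "- g"] conjI allI impI)
      show "w = (w \<bullet> - g) *\<^sub>R - g" if "w \<bullet> e = 0" for w
      proof -
        have "(w \<bullet> - g) *\<^sub>R - g = (w \<bullet> g) *\<^sub>R g" by simp
        then show ?thesis by (simp only: **[OF that, symmetric])
      qed
    qed (use * False in auto)
  qed
qed


text \<open>Projecting the normalised centres from the origin to the line through \<open>e\<close>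
  with direction \<open>g\<close> gives each ball a slope \<open>q\<close>. By
  \<open>far_cross\<close> the slope drops from a scale to any larger one by at least a quarter of
  the protrusion, so the largest protrusions of all scales have a bounded sum. Within a scale
  \<open>far_same\<close> confines the slopes, and with them the normals, to the size
  \<open>Z\<close> of the largest protrusion. With both spreads of order \<open>Z\<close> the count
  is of order \<open>sqrt (Z\<^sup>2 / T)\<close>, linear in \<open>Z\<close>.\<close>

lemma tower_far_small_count_dim2:
  assumes dim: "DIM('a::euclidean_space) = 2"
  shows "\<exists>C>0. \<forall>d T (I::'i set) m (y::'i \<Rightarrow> 'a) c r.
    tower d T I m y c r \<and> T \<le> 1 / 1920000 \<and> (\<forall>i\<in>I. far y c r i \<and> protrusion T y r i \<le> 1/100)
    \<longrightarrow> real (card I) \<le> C * T powr (- ((real DIM('a) - 1) / 2))"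
proof -
  obtain C where C: "0 < C" and count: "\<forall>d T (I::'i set) m (y::'i \<Rightarrow> 'a) c r R a b.
    tower d T I m y c r \<and> 0 < R \<and> (\<forall>i\<in>I. \<forall>j\<in>I. m i = m j) \<and> (\<forall>i\<in>I. R \<le> r i \<and> r i \<le> 2 * R) \<and>
    T \<le> 1 / 1920000 \<and> 0 < a \<and> a \<le> 8 \<and> 0 < b \<and> b \<le> 2 \<and> a \<le> 4 * b \<and> T \<le> 1 * a * b \<and>
    (\<forall>i\<in>I. \<forall>j\<in>I. norm (y i - y j) \<le> a * R) \<and> (\<forall>i\<in>I. \<forall>j\<in>I. norm (sgn (y i - c i) - sgn (y j - c j)) \<le> b)
    \<longrightarrow> real (card I) \<le> C * (a * b / T) powr ((real DIM('a) - 1) / 2)"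
    by (rule exE[OF tower_scale_count[OF zero_less_one, where 'i='i and 'a='a]], erule conjE, rule that, assumption, assumption)
  define C' where "C' = 1200 ^ 4 * (140 * C)"
  have C': "0 < C'" using C by (simp add: C'_def)
  show ?thesis
  proof (rule exI[of _ C'], rule conjI, rule C', (rule allI)+, rule impI, elim conjE)
    fix d T and I :: "'i set" and m and y :: "'i \<Rightarrow> 'a" and c r
    assume tw: "tower d T I m y c r" and T: "T \<le> 1 / 1920000"
      and f: "\<forall>i\<in>I. far y c r i \<and> protrusion T y r i \<le> 1/100"
    have fin: "finite I" and T0: "0 < T" by (rule towerD[OF tw])+
    define p where "p = protrusion T y r"
    define u where "u i = c i /\<^sub>R r i" for i
    define \<theta> where "\<theta> i = sgn (y i)" for i
    have uI: "norm (u i) \<le> 1" "99/100 \<le> norm (u i)" if "i \<in> I" for i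
    proof -
      have fi: "far y c r i" "protrusion T y r i \<le> 1/100" using f that by auto
      then have p1: "protrusion T y r i \<le> 1" by simp
      show "norm (u i) \<le> 1" unfolding u_def by (rule far_center_norm(2)[OF tw that fi(1) p1])
      have "(protrusion T y r i)\<^sup>2 \<le> (1/100)\<^sup>2"
        using fi(2) protrusion_bounds(3)[OF tw that fi(1)] by (intro power_mono) auto
      then show "99/100 \<le> norm (u i)"
        using far_center_norm(1)[OF tw that fi(1) p1] unfolding u_def by (simp add: power2_eq_square)
    qed
    have "\<exists>J\<subseteq>I. real (card I) \<le> (6 * 2 / (1/100)) ^ DIM('a) * real (card J) \<and> (\<forall>i\<in>J. \<forall>j\<in>J. dist (u i) (u j) \<le> 1/100)"
    proof (rule pigeonhole_cell[OF fin, of 0])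
      show "dist 0 (u i) \<le> 2" if "i \<in> I" for i using uI(1)[OF that] by simp
    qed auto
    then obtain J1 where J1: "J1 \<subseteq> I" "real (card I) \<le> (6 * 2 / (1/100)) ^ DIM('a) * real (card J1)"
      "\<forall>i\<in>J1. \<forall>j\<in>J1. dist (u i) (u j) \<le> 1/100" by auto
    have finJ1: "finite J1" using J1(1) fin finite_subset by blast
    have "\<exists>J\<subseteq>J1. real (card J1) \<le> (6 * 2 / (1/100)) ^ DIM('a) * real (card J) \<and> (\<forall>i\<in>J. \<forall>j\<in>J. dist (\<theta> i) (\<theta> j) \<le> 1/100)"
      by (rule pigeonhole_cell[OF finJ1, of 0]) (auto simp: \<theta>_def norm_sgn)
    then obtain J where J: "J \<subseteq> J1" "real (card J1) \<le> (6 * 2 / (1/100)) ^ DIM('a) * real (card J)"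
      "\<forall>i\<in>J. \<forall>j\<in>J. dist (\<theta> i) (\<theta> j) \<le> 1/100" by auto
    have JI: "J \<subseteq> I" using J J1 by auto
    have finJ: "finite J" using JI fin finite_subset by blast
    have du: "norm (u i - u j) \<le> 1/100" and d\<theta>: "norm (\<theta> i - \<theta> j) \<le> 1/100" if "i \<in> J" "j \<in> J" for i j
      using that J1(3) J(1,3) by (auto simp: dist_norm subset_iff)
    have twJ: "tower d T J m y c r" by (rule tower_subset[OF tw JI])
    have fJ: "far y c r i" "p i \<le> 1/100" if "i \<in> J" for i using f JI that by (auto simp: p_def)
    have p0: "0 < p i" if "i \<in> J" for i unfolding p_def by (rule protrusion_bounds(3)[OF twJ that fJ(1)[OF that]])
    have cardJ: "real (card J) \<le> (140 * C) * T powr (- (1/2))"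
    proof (cases "J = {}")
      case True then show ?thesis using C by simp
    next
      case False
      then obtain i0 where i0: "i0 \<in> J" by auto
      define e where "e = sgn (u i0)"
      have e: "norm e = 1" using uI(2)[of i0] i0 JI by (auto simp: e_def norm_sgn)
      have e0: "norm (u i0 - e) \<le> 1/100"
      proof -
        have ui: "99/100 \<le> norm (u i0)" "norm (u i0) \<le> 1" using uI i0 JI by auto
        moreover have "norm (u i0) \<noteq> 0" using ui(1) by linarith
        ultimately have "u i0 = norm (u i0) *\<^sub>R e" by (auto simp: e_def sgn_div_norm)
        then have "u i0 - e = (norm (u i0) - 1) *\<^sub>R e" by (simp add: scaleR_diff_left)
        then have "norm (u i0 - e) = \<bar>norm (u i0) - 1\<bar>" using e by simp
        then show ?thesis using ui by linarith
      qed
      have ue: "norm (u i - e) \<le> 1/50" if "i \<in> J" for i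
        using norm_triangle_ineq[of "u i - u i0" "u i0 - e"] du[OF that i0] e0 by simp
      define h where "h i = u i \<bullet> e" for i
      have h: "98/100 \<le> h i" "h i \<le> 1" if "i \<in> J" for i
      proof -
        have "h i = 1 + (u i - e) \<bullet> e" using e by (simp add: h_def inner_diff_left norm_eq_1)
        moreover have "\<bar>(u i - e) \<bullet> e\<bar> \<le> 1/50" using Cauchy_Schwarz_ineq2[of "u i - e" e] ue[OF that] e by simp
        ultimately show "98/100 \<le> h i" by linarith
        have "h i \<le> norm (u i) * norm e" unfolding h_def by (rule norm_cauchy_schwarz)
        then show "h i \<le> 1" using uI(1)[of i] that JI e by auto
      qed
      obtain g where g: "norm g = 1" "e \<bullet> g = 0" "0 \<le> \<theta> i0 \<bullet> g" "\<And>w. w \<bullet> e = 0 \<Longrightarrow> w = (w \<bullet> g) *\<^sub>R g"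
        using unit_orthogonal_dim2[OF dim e, of "\<theta> i0"] by auto
      define q where "q i = (u i /\<^sub>R h i) \<bullet> g" for i
      have uh: "u i /\<^sub>R h i = e + q i *\<^sub>R g" if "i \<in> J" for i
      proof -
        have "(u i /\<^sub>R h i - e) \<bullet> e = 0" using h[OF that] e by (simp add: inner_diff_left h_def[symmetric] norm_eq_1)
        from g(4)[OF this] have "u i /\<^sub>R h i - e = ((u i /\<^sub>R h i) \<bullet> g) *\<^sub>R g" using g(2) by (simp add: inner_diff_left)
        then show ?thesis unfolding q_def diff_eq_eq by (simp only: add.commute)
      qed
      have uhn: "norm (u i /\<^sub>R h i) \<le> 2" if "i \<in> J" for i
        using uI(1)[of i] that JI h[OF that] by (auto simp: field_simps)
      have q2: "\<bar>q i\<bar> \<le> 2" if "i \<in> J" for i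
        using Cauchy_Schwarz_ineq2[of "u i /\<^sub>R h i" g] g(1) uhn[OF that] unfolding q_def by simp
      have \<theta>1: "norm (\<theta> i) = 1" if "i \<in> J" for i
        using far_pos[OF twJ that fJ(1)[OF that]] by (auto simp: \<theta>_def norm_sgn)
      \<comment> \<open>The vector \<open>u i0\<close> is close to \<open>e\<close> and nearly
        orthogonal to the direction of \<open>y i0\<close>; in the plane this direction is therefore
        close to \<open>g\<close>, whose sign was chosen accordingly.\<close>
      have g0: "9/10 \<le> \<theta> i0 \<bullet> g"
      proof -
        have A: "0 < \<theta> i0 \<bullet> u i0" "\<theta> i0 \<bullet> u i0 \<le> 1/100"
          using far_inner_pos[OF twJ i0 fJ(1)[OF i0]] far_same[OF twJ i0 fJ(1)[OF i0] i0 refl] fJ(2)[OF i0]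
          by (auto simp: \<theta>_def u_def p_def)
        have "\<theta> i0 \<bullet> e = \<theta> i0 \<bullet> u i0 - \<theta> i0 \<bullet> (u i0 - e)" by (simp add: inner_diff_right)
        moreover have "\<bar>\<theta> i0 \<bullet> (u i0 - e)\<bar> \<le> 1/100"
          using Cauchy_Schwarz_ineq2[of "\<theta> i0" "u i0 - e"] \<theta>1[OF i0] e0 by simp
        ultimately have te: "\<bar>\<theta> i0 \<bullet> e\<bar> \<le> 1/50" using A by linarith
        have "(\<theta> i0 - (\<theta> i0 \<bullet> e) *\<^sub>R e) \<bullet> e = 0" using e by (simp add: inner_diff_left norm_eq_1)
        from g(4)[OF this] have "\<theta> i0 - (\<theta> i0 \<bullet> e) *\<^sub>R e = (\<theta> i0 \<bullet> g) *\<^sub>R g" using g(2) by (simp add: inner_diff_left)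
        then have eq: "\<theta> i0 = (\<theta> i0 \<bullet> g) *\<^sub>R g + (\<theta> i0 \<bullet> e) *\<^sub>R e" by (simp add: algebra_simps)
        have "1 = norm (\<theta> i0)" using \<theta>1[OF i0] by simp
        also have "\<dots> \<le> norm ((\<theta> i0 \<bullet> g) *\<^sub>R g) + norm ((\<theta> i0 \<bullet> e) *\<^sub>R e)" by (subst eq) (rule norm_triangle_ineq)
        also have "\<dots> = \<theta> i0 \<bullet> g + \<bar>\<theta> i0 \<bullet> e\<bar>" using g e by simp
        finally show ?thesis using te by linarith
      qed
      have gi: "88/100 \<le> \<theta> i \<bullet> g" "\<theta> i \<bullet> g \<le> 1" if "i \<in> J" for i
      proof -
        have "\<bar>(\<theta> i - \<theta> i0) \<bullet> g\<bar> \<le> 1/100" using Cauchy_Schwarz_ineq2[of "\<theta> i - \<theta> i0" g] d\<theta>[OF that i0] g(1) by simp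
        from abs_le_D2[OF this] show "88/100 \<le> \<theta> i \<bullet> g" using g0 unfolding inner_diff_left by linarith
        show "\<theta> i \<bullet> g \<le> 1" using norm_cauchy_schwarz[of "\<theta> i" g] \<theta>1[OF that] g(1) by simp
      qed
      have \<theta>q: "\<theta> i \<bullet> (u j /\<^sub>R h j) - \<theta> i \<bullet> (u k /\<^sub>R h k) = (q j - q k) * (\<theta> i \<bullet> g)" if "j \<in> J" "k \<in> J" for i j k
        unfolding uh[OF that(1)] uh[OF that(2)] by (simp add: inner_simps algebra_simps)
      \<comment> \<open>Division by the heights puts all centres on one line, so that only their
        slopes differ; the ratio of the heights is the factor \<mu> of
        \<open>far_cross\<close>.\<close>
      have cross: "p i / 4 \<le> q i - q j" if ij: "i \<in> J" "j \<in> J" "m i < m j" for i j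
      proof -
        have \<mu>: "1/2 \<le> h i / h j" "h i / h j \<le> 6"
        proof -
          have "0 < h j" using h[OF ij(2)] by linarith
          then show "1/2 \<le> h i / h j" "h i / h j \<le> 6"
            using h[OF ij(1)] h[OF ij(2)] by (simp_all add: pos_le_divide_eq pos_divide_le_eq)
        qed
        have "p i / 4 \<le> \<theta> i \<bullet> u i - h i / h j * (\<theta> i \<bullet> u j)"
          unfolding p_def \<theta>_def u_def by (rule far_cross[OF twJ ij(1) fJ(1)[OF ij(1)] ij(2,3) \<mu>])
        also have "\<dots> = h i * (\<theta> i \<bullet> (u i /\<^sub>R h i) - \<theta> i \<bullet> (u j /\<^sub>R h j))"
        proof -
          have "h i \<noteq> 0" using h[OF ij(1)] by auto
          then have "s - h i / h j * t = h i * (inverse (h i) * s - inverse (h j) * t)" for s t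
            by (simp add: right_diff_distrib divide_inverse)
          then show ?thesis by (simp only: inner_scaleR_right)
        qed
        also have "\<dots> = (h i * (\<theta> i \<bullet> g)) * (q i - q j)" unfolding \<theta>q[OF ij(1,2)] by simp
        finally have *: "p i / 4 \<le> (h i * (\<theta> i \<bullet> g)) * (q i - q j)" .
        have hg: "0 < h i * (\<theta> i \<bullet> g)" "h i * (\<theta> i \<bullet> g) \<le> 1"
        proof -
          have *: "0 < h i" "h i \<le> 1" "0 < \<theta> i \<bullet> g" "\<theta> i \<bullet> g \<le> 1"
            using h[OF ij(1)] gi[OF ij(1)] by linarith+
          show "0 < h i * (\<theta> i \<bullet> g)" using * by simp
          show "h i * (\<theta> i \<bullet> g) \<le> 1" using * by (intro mult_le_one) auto
        qed
        have "0 < (h i * (\<theta> i \<bullet> g)) * (q i - q j)" using * p0[OF ij(1)] by linarith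
        then have "0 < q i - q j" using hg by (simp add: zero_less_mult_iff)
        then have "(h i * (\<theta> i \<bullet> g)) * (q i - q j) \<le> 1 * (q i - q j)" using hg by (intro mult_right_mono) auto
        from order_trans[OF * this] show ?thesis by simp
      qed
      have same: "q j - q i \<le> 3/2 * p i" if ij: "i \<in> J" "j \<in> J" "m i = m j" for i j
      proof (cases "q j - q i \<le> 0")
        case True then show ?thesis using p0[OF ij(1)] by linarith
      next
        case False
        have A: "0 \<le> \<theta> i \<bullet> (u i /\<^sub>R h i)"
        proof -
          have "0 < \<theta> i \<bullet> u i"
            using far_inner_pos[OF twJ ij(1) fJ(1)[OF ij(1)]] by (simp add: \<theta>_def u_def)
          moreover have "0 < h i" using h[OF ij(1)] by linarith
          ultimately show ?thesis by simp
        qed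
        have B: "\<theta> i \<bullet> u j \<le> p i"
          using far_same[OF twJ ij(1) fJ(1)[OF ij(1)] ij(2,3)] by (simp add: \<theta>_def u_def p_def)
        have "\<theta> i \<bullet> (u j /\<^sub>R h j) = (\<theta> i \<bullet> u j) / h j" by (simp add: divide_inverse)
        also have "\<dots> \<le> p i / h j" using B h[OF ij(2)] by (intro divide_right_mono) auto
        also have "\<dots> \<le> p i / (98/100)" using h[OF ij(2)] p0[OF ij(1)] by (intro divide_left_mono) auto
        finally have **: "(q j - q i) * (\<theta> i \<bullet> g) \<le> p i / (98/100)" using \<theta>q[OF ij(2,1), of i] A by linarith
        have "(q j - q i) * (88/100) \<le> (q j - q i) * (\<theta> i \<bullet> g)"
          using False gi[OF ij(1)] by (intro mult_left_mono) auto
        from order_trans[OF this **] have "(q j - q i) * (88/100) \<le> p i * (50/49)" by simp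
        then show ?thesis using p0[OF ij(1)] by argo
      qed
      \<comment> \<open>Each scale is represented by an index of largest protrusion, which bounds
        the spread in the scale and at the same time gives the largest guaranteed drop of the
        slope.\<close>
      have "\<exists>k. k \<in> J \<and> m k = \<mu> \<and> (\<forall>i\<in>J. m i = \<mu> \<longrightarrow> p i \<le> p k)" if "\<mu> \<in> m ` J" for \<mu>
        using exists_min_radius[of "{i\<in>J. m i = \<mu>}" "\<lambda>i. - p i"] finJ that by auto
      then obtain k where k: "\<And>\<mu>. \<mu> \<in> m ` J \<Longrightarrow> k \<mu> \<in> J \<and> m (k \<mu>) = \<mu> \<and> (\<forall>i\<in>J. m i = \<mu> \<longrightarrow> p i \<le> p (k \<mu>))"
        by metis
      have sumZ: "(\<Sum>\<mu>\<in>m ` J. p (k \<mu>)) \<le> 20"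
      proof -
        \<comment> \<open>\<open>2 - q\<close> is nonnegative and grows with the scale, and the
          segment of length \<open>p / 4\<close> above it contains no value of a larger scale in its
          interior. All segments lie below 5.\<close>
        have "(\<Sum>\<mu>\<in>m ` J. (2 - q (k \<mu>) + p (k \<mu>) / 4) - (2 - q (k \<mu>))) \<le> 5"
        proof (rule sum_telescoping_le)
          show "finite (m ` J)" using finJ by simp
          show "0 \<le> 2 - q (k \<mu>)" if "\<mu> \<in> m ` J" for \<mu> using q2[of "k \<mu>"] k[OF that] by force
          show "2 - q (k \<mu>) + p (k \<mu>) / 4 \<le> 5" if "\<mu> \<in> m ` J" for \<mu>
            using q2[of "k \<mu>"] fJ(2)[of "k \<mu>"] k[OF that] by force
          show "2 - q (k \<mu>) + p (k \<mu>) / 4 \<le> 2 - q (k \<nu>)" if "\<mu> \<in> m ` J" "\<nu> \<in> m ` J" "\<mu> < \<nu>" for \<mu> \<nu>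
            using cross[of "k \<mu>" "k \<nu>"] k[OF that(1)] k[OF that(2)] that(3) by force
        qed simp
        then have "(\<Sum>\<mu>\<in>m ` J. p (k \<mu>) / 4) \<le> 5" by simp
        then show ?thesis by (simp add: sum_divide_distrib[symmetric])
      qed
      obtain kr where kr: "\<And>\<mu>. \<mu> \<in> m ` J \<Longrightarrow> kr \<mu> \<in> J \<and> m (kr \<mu>) = \<mu>"
        "\<And>i. i \<in> J \<Longrightarrow> r (kr (m i)) \<le> r i \<and> r i \<le> 2 * r (kr (m i))"
        by (rule tower_representatives[OF twJ], rule that)
      have fibre: "real (card {i\<in>J. m i = \<mu>}) \<le> 7 * C * T powr (- (1/2)) * p (k \<mu>)" if mu: "\<mu> \<in> m ` J" for \<mu>
      proof -
        define L where "L = {i\<in>J. m i = \<mu>}"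
        define R where "R = r (kr \<mu>)"
        define Z where "Z = p (k \<mu>)"
        have K: "k \<mu> \<in> J" "m (k \<mu>) = \<mu>" "kr \<mu> \<in> J" "m (kr \<mu>) = \<mu>" using k[OF mu] kr(1)[OF mu] by auto
        have R: "0 < R" unfolding R_def by (rule towerD(8)[OF twJ K(3)])
        have Z: "0 < Z" "Z \<le> 1/100" unfolding Z_def using p0[OF K(1)] fJ(2)[OF K(1)] by auto
        have LJ: "L \<subseteq> J" by (auto simp: L_def)
        have L: "i \<in> J" "p i \<le> Z" "R \<le> r i" "r i \<le> 2 * R" "0 < r i" if "i \<in> L" for i
          using that k[OF mu] kr(2)[of i] R by (auto simp: L_def Z_def R_def)
        have y: "norm (y i) \<le> Z * r i" if "i \<in> L" for i
        proof -
          have "norm (y i) \<le> p i * r i" unfolding p_def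
            by (rule protrusion_bounds(1)[OF twJ L(1)[OF that] fJ(1)[OF L(1)[OF that]]])
          also have "\<dots> \<le> Z * r i" using L(2,5)[OF that] by (intro mult_right_mono) auto
          finally show ?thesis .
        qed
        have dy: "norm (y i - y j) \<le> 4 * Z * R" if "i \<in> L" "j \<in> L" for i j
        proof -
          have "Z * r i \<le> Z * (2 * R)" "Z * r j \<le> Z * (2 * R)" using L that Z by (auto intro!: mult_left_mono)
          then show ?thesis using norm_triangle_ineq4[of "y i" "y j"] y[OF that(1)] y[OF that(2)] by linarith
        qed
        \<comment> \<open>Division by \<open>r i * h i\<close> keeps the direction of
          \<open>y i - c i\<close> and turns the contribution of the centre into
          \<open>- (e + q i *\<^sub>R g)\<close>. The normals then differ only through the slopes
          and through \<open>norm (y i) / r i\<close>, both of order \<open>Z\<close>.\<close>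
        define v where "v i = (y i - c i) /\<^sub>R (r i * h i)" for i
        have v: "v i = y i /\<^sub>R (r i * h i) - (e + q i *\<^sub>R g)" "sgn (v i) = sgn (y i - c i)"
          "norm (y i /\<^sub>R (r i * h i)) \<le> 11/10 * Z" if "i \<in> L" for i
        proof -
          have hi: "98/100 \<le> h i" "0 < r i" using h[OF L(1)[OF that]] L(5)[OF that] by auto
          have "v i = y i /\<^sub>R (r i * h i) - u i /\<^sub>R h i" by (simp add: v_def u_def scaleR_diff_right mult.commute)
          then show "v i = y i /\<^sub>R (r i * h i) - (e + q i *\<^sub>R g)" using uh[OF L(1)[OF that]] by simp
          have h0: "0 < h i" using hi(1) by linarith
          have rh: "0 < r i * h i" by (rule mult_pos_pos[OF hi(2) h0])
          then have ip: "0 < inverse (r i * h i)" by (rule positive_imp_inverse_positive)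
          show "sgn (v i) = sgn (y i - c i)" unfolding v_def sgn_scaleR sgn_pos[OF ip] by (rule scaleR_one)
          have "norm (y i /\<^sub>R (r i * h i)) = norm (y i) / (r i * h i)"
            unfolding norm_scaleR abs_of_pos[OF ip] by (simp only: divide_inverse mult.commute)
          also have "\<dots> \<le> (Z * r i) / (r i * h i)" by (rule divide_right_mono[OF y[OF that] less_imp_le[OF rh]])
          also have "\<dots> = Z / h i" using hi(2) by simp
          also have "\<dots> \<le> Z / (98/100)" using hi(1) h0 Z by (intro divide_left_mono) auto
          also have "\<dots> \<le> 11/10 * Z" using Z by simp
          finally show "norm (y i /\<^sub>R (r i * h i)) \<le> 11/10 * Z" .
        qed
        have dv: "norm (sgn (y i - c i) - sgn (y j - c j)) \<le> 12 * Z" if ij: "i \<in> L" "j \<in> L" for i j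
        proof -
          have "\<bar>q i - q j\<bar> \<le> 3/2 * Z"
          proof (rule abs_leI)
            have mm: "m i = m j" "m j = m i" using ij by (auto simp: L_def)
            have s1: "q j - q i \<le> 3/2 * p i" by (rule same[OF L(1)[OF ij(1)] L(1)[OF ij(2)] mm(1)])
            have s2: "q i - q j \<le> 3/2 * p j" by (rule same[OF L(1)[OF ij(2)] L(1)[OF ij(1)] mm(2)])
            show "q i - q j \<le> 3/2 * Z" using s2 L(2)[OF ij(2)] by linarith
            show "- (q i - q j) \<le> 3/2 * Z" using s1 L(2)[OF ij(1)] by linarith
          qed
          then have qq: "norm ((q i - q j) *\<^sub>R g) \<le> 3/2 * Z" using g(1) by simp
          have "v i - v j = (y i /\<^sub>R (r i * h i) - y j /\<^sub>R (r j * h j)) - (q i - q j) *\<^sub>R g"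
            unfolding v(1)[OF ij(1)] v(1)[OF ij(2)] by (simp add: algebra_simps)
          then have "norm (v i - v j) \<le> norm (y i /\<^sub>R (r i * h i) - y j /\<^sub>R (r j * h j)) + norm ((q i - q j) *\<^sub>R g)"
            by (metis norm_triangle_ineq4)
          also have "\<dots> \<le> (11/10 * Z + 11/10 * Z) + 3/2 * Z"
            using norm_triangle_ineq4[of "y i /\<^sub>R (r i * h i)" "y j /\<^sub>R (r j * h j)"] v(3)[OF ij(1)] v(3)[OF ij(2)] qq by linarith
          finally have 1: "norm (v i - v j) \<le> 4 * Z" using Z by linarith
          have "norm e - norm (y i /\<^sub>R (r i * h i)) \<le> norm (v i)"
          proof -
            have "v i \<bullet> e = (y i /\<^sub>R (r i * h i)) \<bullet> e - 1"
              unfolding v(1)[OF ij(1)] using e g(2) by (simp add: inner_simps norm_eq_1 inner_commute)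
            moreover have "\<bar>v i \<bullet> e\<bar> \<le> norm (v i)" "\<bar>(y i /\<^sub>R (r i * h i)) \<bullet> e\<bar> \<le> norm (y i /\<^sub>R (r i * h i))"
              using Cauchy_Schwarz_ineq2[of "v i" e] Cauchy_Schwarz_ineq2[of "y i /\<^sub>R (r i * h i)" e] e by auto
            ultimately show ?thesis using e by linarith
          qed
          then have 2: "9/10 \<le> norm (v i)" using v(3)[OF ij(1)] e Z by linarith
          then have "v i \<noteq> 0" by auto
          from norm_sgn_diff_le[OF this, of "v j"]
          have "norm (sgn (v i) - sgn (v j)) \<le> 2 * norm (v i - v j) / norm (v i)" .
          also have "\<dots> \<le> (2 * (4 * Z)) / norm (v i)" using 1 by (intro divide_right_mono) auto
          also have "\<dots> \<le> (2 * (4 * Z)) / (9/10)" using 2 Z by (intro divide_left_mono) auto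
          also have "\<dots> \<le> 12 * Z" using Z by simp
          finally show ?thesis using v(2)[OF ij(1)] v(2)[OF ij(2)] by simp
        qed
        have TZ: "T \<le> Z * Z"
        proof -
          have "T \<le> Z\<^sup>2 / 4" unfolding Z_def p_def by (rule protrusion_bounds(2)[OF twJ K(1) fJ(1)[OF K(1)]])
          then have "T \<le> Z * Z / 4" by (simp only: power2_eq_square)
          then show ?thesis using mult_pos_pos[OF Z(1) Z(1)] by linarith
        qed
        have mL: "\<forall>i\<in>L. \<forall>j\<in>L. m i = m j" by (simp add: L_def)
        have "1 * (4 * Z) * (12 * Z) = 48 * (Z * Z)" by simp
        then have TZ': "T \<le> 1 * (4 * Z) * (12 * Z)" using TZ mult_pos_pos[OF Z(1) Z(1)] by linarith
        have "real (card L) \<le> C * ((4 * Z) * (12 * Z) / T) powr ((real DIM('a) - 1) / 2)"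
        proof (rule count[rule_format, of d T L m y c r R "4 * Z" "12 * Z"], intro conjI mL ballI)
          show "tower d T L m y c r" by (rule tower_subset[OF twJ LJ])
        qed (use R L T T0 Z TZ' dy dv in auto)
        also have "(real DIM('a) - 1) / 2 = 1/2" using dim by simp
        also have "((4 * Z) * (12 * Z) / T) powr (1/2) \<le> ((7 * Z)\<^sup>2 / T) powr (1/2)"
          using T0 Z mult_pos_pos[OF Z(1) Z(1)] by (intro powr_mono2 divide_right_mono) (auto simp: power2_eq_square)
        also have "\<dots> = 7 * Z * T powr (- (1/2))"
        proof -
          have "((7 * Z)\<^sup>2 / T) powr (1/2) = sqrt ((7 * Z)\<^sup>2 / T)" using T0 by (intro powr_half_sqrt) auto
          also have "\<dots> = \<bar>7 * Z\<bar> / sqrt T" by (simp only: real_sqrt_divide real_sqrt_abs)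
          also have "\<dots> = 7 * Z / T powr (1/2)" using Z T0 by (simp add: powr_half_sqrt)
          finally show ?thesis by (simp add: powr_minus_divide)
        qed
        finally show ?thesis using C by (simp add: L_def Z_def mult_ac)
      qed
      have "real (card J) = (\<Sum>\<mu>\<in>m ` J. real (card {i\<in>J. m i = \<mu>}))" by (rule card_eq_sum_fibres[OF finJ])
      also have "\<dots> \<le> (\<Sum>\<mu>\<in>m ` J. 7 * C * T powr (- (1/2)) * p (k \<mu>))" by (rule sum_mono) (rule fibre)
      also have "\<dots> = 7 * C * T powr (- (1/2)) * (\<Sum>\<mu>\<in>m ` J. p (k \<mu>))" by (simp add: sum_distrib_left)
      also have "\<dots> \<le> 7 * C * T powr (- (1/2)) * 20" using sumZ C by (intro mult_left_mono) auto
      finally show ?thesis by (simp add: mult_ac)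
    qed
    have "real (card I) \<le> 1200\<^sup>2 * real (card J1)" using J1(2) dim by simp
    also have "\<dots> \<le> 1200\<^sup>2 * (1200\<^sup>2 * real (card J))" using J(2) dim by (intro mult_left_mono) auto
    also have "\<dots> \<le> 1200\<^sup>2 * (1200\<^sup>2 * ((140 * C) * T powr (- (1/2))))" using cardJ by (intro mult_left_mono) auto
    finally show "real (card I) \<le> C' * T powr (- ((real DIM('a) - 1) / 2))" using dim by (simp add: C'_def)
  qed
qed

text \<open>The missing dimension is filled by multiplying the expanded points with about
  \<open>1 / \<rho>\<close> numbers \<open>l\<close> between 1 and 2 rather than by translating
  them, since a multiple of the centre can absorb \<open>l\<close> later. The volume of the balls of
  radius \<open>\<rho> / 4\<close> around \<open>W\<close> then measures the number of indices. The
  choice of \<open>al\<close> brings the positions to norm at most 1/16, so the expanded points stay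
  near the unit sphere; the bound 1/5000 on the protrusion yields
  \<open>al * T \<le> 1 / 160000\<close>.\<close>

lemma class_centres:
  "\<exists>M>0. \<forall>d T (I::'i set) m (y::'i \<Rightarrow> 'a::euclidean_space) c r R X al \<rho>.
    tower d T I m y c r \<and> (\<forall>i\<in>I. \<forall>j\<in>I. m i = m j) \<and> T \<le> 1 / 1920000 \<and> 0 < R \<and>
    (\<forall>i\<in>I. R \<le> r i \<and> r i \<le> 2 * R \<and> protrusion T y r i \<le> 1/5000 \<and> X * r i \<le> norm (y i) \<and> norm (y i) < 2 * X * r i) \<and>
    I \<noteq> {} \<and> 0 < X \<and> al = 1 / (64 * X) \<and> \<rho> = sqrt (al * T / 8) \<longrightarrow>
    (\<exists>W. finite W \<and> real (card I) \<le> M * \<rho> * real (card W) \<and>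
      (\<forall>w\<in>W. norm w \<le> 5/2 \<and> (\<exists>i\<in>I. \<exists>l. 1 \<le> l \<and> l \<le> 2 \<and> w = l *\<^sub>R (al *\<^sub>R (y i /\<^sub>R R) - sgn (y i - c i)))) \<and>
      (\<forall>w\<in>W. \<forall>w'\<in>W. w \<noteq> w' \<longrightarrow> \<rho> / 2 \<le> dist w w'))"
proof -
  define M where "M = 1200 ^ DIM('a) * (480::real)"
  have M: "0 < M" by (simp add: M_def)
  show ?thesis
  proof (rule exI[of _ M], rule conjI, rule M, (rule allI)+, rule impI, elim conjE)
    fix d T and I :: "'i set" and m and y :: "'i \<Rightarrow> 'a" and c r R X al \<rho>
    assume tw: "tower d T I m y c r" and m: "\<forall>i\<in>I. \<forall>j\<in>I. m i = m j" and T: "T \<le> 1 / 1920000" and R: "0 < R"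
      and r: "\<forall>i\<in>I. R \<le> r i \<and> r i \<le> 2 * R \<and> protrusion T y r i \<le> 1/5000 \<and> X * r i \<le> norm (y i) \<and> norm (y i) < 2 * X * r i"
      and ne: "I \<noteq> {}" and X: "0 < X" and al_def: "al = 1 / (64 * X)" and \<rho>_def: "\<rho> = sqrt (al * T / 8)"
    have fin: "finite I" and T0: "0 < T" by (rule towerD[OF tw])+
    have T32: "T \<le> 1/32" using T by simp
    define y' c' where "y' i = y i /\<^sub>R R" and "c' i = c i /\<^sub>R R" for i
    define v where "v i = sgn (y i - c i)" for i
    have os: "one_scale I y' c' (\<lambda>i. r i / R) T"
      unfolding y'_def c'_def by (rule tower_one_scale[OF tw R]) (use m r in blast)+
    have sg: "sgn (y' i - c' i) = v i" for i unfolding y'_def c'_def v_def by (rule sgn_diff_scaled[OF R])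
    have xi: "X \<le> 1/5000" "T / X \<le> 2/5000" "norm (y' i) \<le> 4 * X" if i: "i \<in> I" for i
    proof -
      have ri: "R \<le> r i" "r i \<le> 2 * R" "X * r i \<le> norm (y i)" "norm (y i) < 2 * X * r i" "protrusion T y r i \<le> 1/5000" using r i by auto
      have r0: "0 < r i" using ri R by linarith
      define x where "x = norm (y i) / r i"
      have x: "X \<le> x" "x < 2 * X" using ri r0 by (auto simp: x_def pos_le_divide_eq pos_divide_less_eq)
      have p: "x + T / x \<le> 1/5000" using ri(5) by (simp add: protrusion_def x_def)
      have "0 < T / x" using T0 x X by simp
      then show "X \<le> 1/5000" using x p by linarith
      have "T / (2 * X) \<le> T / x" using x X T0 by (intro divide_left_mono) auto
      then have "T / (2 * X) \<le> 1/5000" using p x X by linarith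
      moreover have "T / X = 2 * (T / (2 * X))" by simp
      ultimately show "T / X \<le> 2/5000" by linarith
      have "norm (y' i) = norm (y i) / R" using R by (simp add: y'_def divide_inverse mult.commute)
      also have "\<dots> \<le> (2 * X * r i) / R" using ri R by (intro divide_right_mono) auto
      also have "\<dots> \<le> (2 * X * (2 * R)) / R" using ri R X by (intro divide_right_mono mult_left_mono) auto
      finally show "norm (y' i) \<le> 4 * X" using R by simp
    qed
    obtain i1 where i1: "i1 \<in> I" using ne by auto
    have al: "12 \<le> al" using xi(1)[OF i1] X by (simp add: al_def pos_le_divide_eq)
    have alT: "al * T \<le> 1 / 160000"
    proof -
      have "al * T = (T / X) / 64" by (simp add: al_def)
      then show ?thesis using xi(2)[OF i1] by argo
    qed
    have aly: "norm (al *\<^sub>R y' i) \<le> 1/16" if "i \<in> I" for i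
    proof -
      have "norm (al *\<^sub>R y' i) = al * norm (y' i)" using al by simp
      also have "\<dots> \<le> al * (4 * X)" using xi(3)[OF that] al by (intro mult_left_mono) auto
      also have "\<dots> = 1/16" using X by (simp add: al_def)
      finally show ?thesis .
    qed
    have "\<exists>J\<subseteq>I. real (card I) \<le> (6 * 2 / (1/100)) ^ DIM('a) * real (card J) \<and> (\<forall>i\<in>J. \<forall>j\<in>J. dist (v i) (v j) \<le> 1/100)"
      by (rule pigeonhole_cell[OF fin, of 0]) (auto simp: v_def norm_sgn)
    then obtain J1 where J1: "J1 \<subseteq> I" "real (card I) \<le> (6 * 2 / (1/100)) ^ DIM('a) * real (card J1)"
      "\<forall>i\<in>J1. \<forall>j\<in>J1. dist (v i) (v j) \<le> 1/100" by auto
    have finJ1: "finite J1" using J1 fin finite_subset by blast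
    have "\<exists>J\<subseteq>J1. real (card J1) \<le> (6 * 2 / (1/40)) ^ DIM(real) * real (card J) \<and>
          (\<forall>i\<in>J. \<forall>j\<in>J. dist (norm (y' i - c' i)) (norm (y' j - c' j)) \<le> 1/40)"
    proof (rule pigeonhole_cell[OF finJ1, of 0])
      show "dist 0 (norm (y' i - c' i)) \<le> 2" if "i \<in> J1" for i
        using one_scale_norm_ge(2)[OF os _ T32, of i] J1(1) that by auto
    qed auto
    then obtain J where J: "J \<subseteq> J1" "real (card J1) \<le> 480 * real (card J)"
        "\<forall>i\<in>J. \<forall>j\<in>J. dist (norm (y' i - c' i)) (norm (y' j - c' j)) \<le> 1/40" by auto
    have JI: "J \<subseteq> I" using J J1 by auto
    have finJ: "finite J" using JI fin finite_subset by blast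
    have "0 < card I" using ne fin by (simp add: card_gt_0_iff)
    then have "J \<noteq> {}" using J1(2) J(2) by (auto simp: zero_less_mult_iff)
    then obtain i0 where i0: "i0 \<in> J" by auto
    define w where "w = v i0"
    have unit: "norm (v i) = 1" if "i \<in> I" for i
    proof -
      from one_scale_norm_ge(1)[OF os that T32] have "y' i - c' i \<noteq> 0" by auto
      then show ?thesis by (simp add: sg[symmetric] norm_sgn)
    qed
    have vw: "norm (v i - w) \<le> 1/100" if "i \<in> J" for i using J1(3) J(1) that i0 by (auto simp: w_def dist_norm)
    define f where "f i = al *\<^sub>R y' i - v i" for i
    have \<rho>0: "0 < \<rho>" using al T0 by (simp add: \<rho>_def)
    have \<rho>2: "\<rho>\<^sup>2 = al * T / 8" using al T0 by (simp add: \<rho>_def)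
    have \<rho>1: "\<rho> \<le> 1"
    proof (rule power2_le_imp_le)
      show "\<rho>\<^sup>2 \<le> 1\<^sup>2" unfolding \<rho>2 using alT by simp
    qed simp
    have gap: "(y' i - y' j) \<bullet> (v j - v i) + 3 * (norm (y' i - y' j))\<^sup>2 \<ge> T / 16"
      if "i \<in> J" "j \<in> J" "i \<noteq> j" for i j
    proof -
      have ij: "i \<in> I" "j \<in> I" using that JI by auto
      have "\<bar>norm (y' i - c' i) - norm (y' j - c' j)\<bar> \<le> 1/40" using J(3) that by (auto simp: dist_real_def)
      from one_scale_gap[OF os ij that(3) T32 this] show ?thesis unfolding sg .
    qed
    have sep: "\<rho>\<^sup>2 \<le> (norm (f i - f j))\<^sup>2" if "i \<in> J" "j \<in> J" "i \<noteq> j" for i j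
    proof -
      have "al\<^sup>2 / 2 * (norm (y' i - y' j))\<^sup>2 + (norm (v i - v j))\<^sup>2 + al * T / 8 \<le> (norm (f i - f j))\<^sup>2"
        unfolding f_def by (rule expand_normal_separated[OF gap[OF that] al])
      moreover have "0 \<le> al\<^sup>2 / 2 * (norm (y' i - y' j))\<^sup>2" "0 \<le> (norm (v i - v j))\<^sup>2" by auto
      ultimately show ?thesis unfolding \<rho>2 by linarith
    qed
    have flat: "\<bar>(f i - f j) \<bullet> w\<bar> \<le> norm (f i - f j) / 8" if ij: "i \<in> J" "j \<in> J" for i j
    proof (cases "i = j")
      case True then show ?thesis by simp
    next
      case False
      have ijI: "i \<in> I" "j \<in> I" using ij JI by auto
      show ?thesis unfolding f_def
      proof (rule expand_normal_flat[OF gap[OF ij False] al _ _ unit[OF ijI(1)] unit[OF ijI(2)] vw[OF ij(1)] vw[OF ij(2)] _ T0 alT])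
        show "(y' j - y' i) \<bullet> v i \<ge> - 3 * (norm (y' i - y' j))\<^sup>2 - 3 * T"
          using one_scale_support[OF os ijI T32] unfolding sg .
        show "(y' i - y' j) \<bullet> v j \<ge> - 3 * (norm (y' i - y' j))\<^sup>2 - 3 * T"
          using one_scale_support[OF os ijI(2,1) T32] unfolding sg norm_minus_commute[of "y' j"] .
        show "norm (y' i - y' j) \<le> 1/100"
          using norm_triangle_ineq4[of "y' i" "y' j"] xi(3)[OF ijI(1)] xi(3)[OF ijI(2)] xi(1)[OF i1] by linarith
      qed
    qed
    have fw: "norm (f i + w) \<le> 3/40" "9/10 \<le> norm (f i)" "norm (f i) \<le> 17/16" if i: "i \<in> J" for i
    proof -
      have iI: "i \<in> I" using i JI by auto
      have eq: "f i + w = al *\<^sub>R y' i - (v i - w)" by (simp add: f_def)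
      show "norm (f i + w) \<le> 3/40" unfolding eq
        using norm_triangle_ineq4[of "al *\<^sub>R y' i" "v i - w"] aly[OF iI] vw[OF i] by linarith
      show "norm (f i) \<le> 17/16" unfolding f_def
        using norm_triangle_ineq4[of "al *\<^sub>R y' i" "v i"] aly[OF iI] unit[OF iI] by linarith
      show "9/10 \<le> norm (f i)" unfolding f_def
        using norm_triangle_ineq2[of "v i" "al *\<^sub>R y' i"] aly[OF iI] unit[OF iI]
        unfolding norm_minus_commute[of "v i"] by linarith
    qed
    define Q where "Q = nat \<lfloor>1 / \<rho>\<rfloor>"
    have Q: "real Q \<le> 1 / \<rho>" "1 / \<rho> \<le> real Q + 1" using \<rho>0 by (auto simp: Q_def)
    define l where "l k = 1 + real k * \<rho>" for k :: nat
    have l: "1 \<le> l k" "k \<le> Q \<Longrightarrow> l k \<le> 2" for k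
    proof -
      show "1 \<le> l k" using \<rho>0 by (simp add: l_def)
      assume "k \<le> Q"
      then have "real k \<le> 1 / \<rho>" using Q(1) by linarith
      then show "l k \<le> 2" using \<rho>0 by (simp add: l_def pos_le_divide_eq)
    qed
    let ?g = "\<lambda>(i,k). l k *\<^sub>R f i"
    let ?P = "J \<times> {..Q}"
    have sepP: "\<rho> / 2 \<le> dist (?g a) (?g b)" if ab: "a \<in> ?P" "b \<in> ?P" "a \<noteq> b" for a b
    proof -
      obtain i k j k' where ik: "a = (i,k)" "b = (j,k')" "i \<in> J" "j \<in> J" "k \<le> Q" "k' \<le> Q" using ab by auto
      define D where "D = f i - f j"
      define g where "g = l k - l k'"
      have eq: "l k *\<^sub>R f i - l k' *\<^sub>R f j = l k *\<^sub>R D + g *\<^sub>R f j" by (simp add: D_def g_def algebra_simps)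
      \<comment> \<open>\<open>f j\<close> is close to \<open>- w\<close> and \<open>D\<close> is
        nearly orthogonal to \<open>w\<close>, so radial copies are as good as translates.\<close>
      have "D \<bullet> f j = D \<bullet> (f j + w) - D \<bullet> w" by (simp add: inner_add_right)
      moreover have "\<bar>D \<bullet> w\<bar> \<le> norm D / 8" unfolding D_def by (rule flat[OF ik(3,4)])
      moreover have "\<bar>D \<bullet> (f j + w)\<bar> \<le> norm D * (3/40)"
        using order_trans[OF Cauchy_Schwarz_ineq2 mult_left_mono[OF fw(1)[OF ik(4)]]] by simp
      ultimately have Df: "\<bar>D \<bullet> f j\<bar> \<le> norm D / 5" by linarith
      have "\<bar>(l k * g) * (D \<bullet> f j)\<bar> \<le> (l k * \<bar>g\<bar>) * (norm D / 5)"
        unfolding abs_mult using Df l(1)[of k] by (intro mult_mono) auto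
      then have 1: "2 * ((l k * g) * (D \<bullet> f j)) \<ge> - (2/5) * ((l k * norm D) * \<bar>g\<bar>)" by (simp add: mult_ac)
      have 2: "(l k * norm D) * \<bar>g\<bar> \<le> ((l k * norm D)\<^sup>2 + \<bar>g\<bar>\<^sup>2) / 2"
        using sum_squares_bound[of "l k * norm D" "\<bar>g\<bar>"] by simp
      have 3: "(norm (l k *\<^sub>R D + g *\<^sub>R f j))\<^sup>2 = (l k * norm D)\<^sup>2 + 2 * ((l k * g) * (D \<bullet> f j)) + g\<^sup>2 * (norm (f j))\<^sup>2"
        unfolding power_mult_distrib
        by (simp only: power2_norm_eq_inner) (simp add: inner_simps inner_commute power2_eq_square algebra_simps)
      have "(9/10)\<^sup>2 \<le> (norm (f j))\<^sup>2" using fw(2)[OF ik(4)] by (intro power_mono) auto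
      then have 4: "g\<^sup>2 * (81/100) \<le> g\<^sup>2 * (norm (f j))\<^sup>2" by (intro mult_left_mono) (auto simp: power2_eq_square)
      have "(1 * norm D)\<^sup>2 \<le> (l k * norm D)\<^sup>2" using l(1)[of k] by (intro power_mono mult_right_mono) auto
      then have 5: "(norm D)\<^sup>2 \<le> (l k * norm D)\<^sup>2" by simp
      have 6: "0 \<le> (norm D)\<^sup>2" "0 \<le> g\<^sup>2" "\<bar>g\<bar>\<^sup>2 = g\<^sup>2" by auto
      have 7: "((norm D)\<^sup>2 + g\<^sup>2) / 2 \<le> (norm (l k *\<^sub>R D + g *\<^sub>R f j))\<^sup>2"
        using 1 2 3 4 5 6 by argo
      have "\<rho>\<^sup>2 \<le> (norm D)\<^sup>2 + g\<^sup>2"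
      proof (cases "i = j")
        case True
        then have "k \<noteq> k'" using ab ik by auto
        then have "1 \<le> \<bar>real k - real k'\<bar>" by linarith
        then have "1 * \<rho> \<le> \<bar>real k - real k'\<bar> * \<rho>" using \<rho>0 by (intro mult_right_mono) auto
        also have "\<dots> = \<bar>g\<bar>" using \<rho>0 by (simp add: g_def l_def left_diff_distrib[symmetric] abs_mult)
        finally have "\<rho>\<^sup>2 \<le> \<bar>g\<bar>\<^sup>2" using \<rho>0 by (intro power_mono) auto
        then show ?thesis using 6 by argo
      next
        case False
        then show ?thesis using sep[OF ik(3,4)] 6 unfolding D_def by argo
      qed
      then have "(\<rho> / 2)\<^sup>2 \<le> (norm (l k *\<^sub>R D + g *\<^sub>R f j))\<^sup>2"
      proof -
        have "(\<rho> / 2)\<^sup>2 = \<rho>\<^sup>2 / 4" by (simp add: power_divide)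
        then show ?thesis using \<open>\<rho>\<^sup>2 \<le> (norm D)\<^sup>2 + g\<^sup>2\<close> 7 zero_le_power2[of \<rho>] by argo
      qed
      then have "\<rho> / 2 \<le> norm (l k *\<^sub>R D + g *\<^sub>R f j)" by (rule power2_le_imp_le) simp
      then show ?thesis by (simp add: ik dist_norm eq)
    qed
    have inj: "inj_on ?g ?P"
    proof (rule inj_onI, rule ccontr)
      fix a b assume "a \<in> ?P" "b \<in> ?P" "?g a = ?g b" "a \<noteq> b"
      then show False using sepP[of a b] \<rho>0 by simp
    qed
    have cW: "card (?g ` ?P) = card J * (Q + 1)" by (simp add: card_image[OF inj] card_cartesian_product)
    show "\<exists>W. finite W \<and> real (card I) \<le> M * \<rho> * real (card W) \<and>
      (\<forall>w\<in>W. norm w \<le> 5/2 \<and> (\<exists>i\<in>I. \<exists>l. 1 \<le> l \<and> l \<le> 2 \<and> w = l *\<^sub>R (al *\<^sub>R (y i /\<^sub>R R) - sgn (y i - c i)))) \<and>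
      (\<forall>w\<in>W. \<forall>w'\<in>W. w \<noteq> w' \<longrightarrow> \<rho> / 2 \<le> dist w w')"
    proof (intro exI[of _ "?g ` ?P"] conjI)
      show "finite (?g ` ?P)" using finJ by simp
      have "1 \<le> \<rho> * (real Q + 1)" using Q(2) \<rho>0 by (simp add: pos_divide_le_eq mult.commute)
      then have "real (card J) * 1 \<le> real (card J) * (\<rho> * (real Q + 1))" by (intro mult_left_mono) auto
      then have cJ: "real (card J) \<le> \<rho> * real (card (?g ` ?P))" unfolding cW by (simp add: mult_ac algebra_simps)
      have "real (card I) \<le> 1200 ^ DIM('a) * real (card J1)" using J1(2) by simp
      also have "\<dots> \<le> 1200 ^ DIM('a) * (480 * real (card J))" using J(2) by (intro mult_left_mono) auto
      also have "\<dots> \<le> 1200 ^ DIM('a) * (480 * (\<rho> * real (card (?g ` ?P))))" using cJ by (intro mult_left_mono) auto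
      finally show "real (card I) \<le> M * \<rho> * real (card (?g ` ?P))" by (simp add: M_def mult.assoc)
      show "\<forall>w\<in>?g ` ?P. norm w \<le> 5/2 \<and> (\<exists>i\<in>I. \<exists>l. 1 \<le> l \<and> l \<le> 2 \<and> w = l *\<^sub>R (al *\<^sub>R (y i /\<^sub>R R) - sgn (y i - c i)))"
      proof
        fix w assume "w \<in> ?g ` ?P"
        then obtain i k where ik: "i \<in> J" "k \<le> Q" "w = l k *\<^sub>R f i" by auto
        have "norm w = l k * norm (f i)" using ik l(1)[of k] by simp
        also have "\<dots> \<le> 2 * (17/16)" using l[of k] ik fw(3)[OF ik(1)] by (intro mult_mono) auto
        finally have "norm w \<le> 5/2" by simp
        moreover have "w = l k *\<^sub>R (al *\<^sub>R (y i /\<^sub>R R) - sgn (y i - c i))" by (simp add: ik f_def y'_def v_def)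
        ultimately show "norm w \<le> 5/2 \<and> (\<exists>i\<in>I. \<exists>l. 1 \<le> l \<and> l \<le> 2 \<and> w = l *\<^sub>R (al *\<^sub>R (y i /\<^sub>R R) - sgn (y i - c i)))"
          using l[of k] ik JI by blast
      qed
      show "\<forall>w\<in>?g ` ?P. \<forall>w'\<in>?g ` ?P. w \<noteq> w' \<longrightarrow> \<rho> / 2 \<le> dist w w'" using sepP by blast
    qed
  qed
qed

text \<open>Near \<open>z\<close>, adding the ball \<open>i\<close> thus lowers the squared distance to the points \<open>s *\<^sub>R (c j /\<^sub>R r j)\<close> of
  the larger balls by at least \<open>X / 512\<close>; the drops at different scales telescope.\<close>
lemma larger_balls_further:
  fixes y c :: "'i \<Rightarrow> 'a::euclidean_space"
  assumes tw: "tower d T I m y c r" and T: "T \<le> 1 / 1920000" and i: "i \<in> I" "far y c r i"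
    and R: "0 < R" "R \<le> r i" "r i \<le> 2 * R" and p: "protrusion T y r i \<le> 1/5000"
    and X: "0 < X" "X * r i \<le> norm (y i)" "norm (y i) < 2 * X * r i" and al: "al = 1 / (64 * X)"
    and \<rho>: "\<rho> = sqrt (al * T / 8)" and l: "1 \<le> l" "l \<le> 2"
    and z: "norm (z - l *\<^sub>R (al *\<^sub>R (y i /\<^sub>R R) - sgn (y i - c i))) \<le> \<rho> / 4"
  shows "\<exists>t. 1/2 \<le> t \<and> t \<le> 6 \<and> (\<forall>j s. j \<in> I \<longrightarrow> m i < m j \<longrightarrow> 1/2 \<le> s \<longrightarrow> s \<le> 6 \<longrightarrow>
     (norm (z - t *\<^sub>R (c i /\<^sub>R r i)))\<^sup>2 + X / 512 \<le> (norm (z - s *\<^sub>R (c j /\<^sub>R r j)))\<^sup>2)"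
proof -
  define N where "N = norm (y i - c i)"
  define x where "x = norm (y i) / r i"
  define P where "P = protrusion T y r i"
  have r0: "0 < r i" using R by linarith
  have T0: "0 < T" by (rule towerD[OF tw])
  have x: "X \<le> x" "x < 2 * X" using X r0 by (auto simp: x_def pos_le_divide_eq pos_divide_less_eq)
  have P: "P = x + T / x" by (simp add: P_def protrusion_def x_def)
  have Tx: "0 < T / x" using T0 x X by simp
  have XP: "X \<le> P" using x Tx unfolding P by linarith
  have "T / (2 * X) \<le> T / x" using x X T0 by (intro divide_left_mono) auto
  then have TX: "T / X \<le> 2 * P" using x X unfolding P by simp
  have al12: "12 \<le> al" using XP p X unfolding P_def by (simp add: al pos_le_divide_eq)
  have N1: "N \<le> r i" unfolding N_def using towerD(7)[OF tw i(1)] by simp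
  have N2: "9/10 * R \<le> N"
  proof (rule power2_le_imp_le)
    have "(r i)\<^sup>2 - N\<^sup>2 \<le> T * (r i)\<^sup>2" unfolding N_def by (rule towerD(9)[OF tw i(1)])
    also have "\<dots> \<le> (1/1920000) * (r i)\<^sup>2" using T by (intro mult_right_mono) auto
    finally have "(81/100) * (r i)\<^sup>2 \<le> N\<^sup>2" using zero_le_power2[of "r i"] by argo
    moreover have "R\<^sup>2 \<le> (r i)\<^sup>2" using R by (intro power_mono) auto
    ultimately show "(9/10 * R)\<^sup>2 \<le> N\<^sup>2" unfolding power_mult_distrib power_divide by simp
  qed (simp add: N_def)
  have N0: "0 < N" using N2 R by linarith
  \<comment> \<open>As \<open>- sgn (y i - c i)\<close> is \<open>c i - y i\<close> divided by
    \<open>N\<close>, the expanded point is the multiple \<open>t\<close> of the normalised centre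
    plus a positive multiple \<open>b\<close> of \<open>y i\<close>. By \<open>far_cross\<close>,
    moving along \<open>y i\<close> leads away from the multiples of the larger centres.\<close>
  define t where "t = l * (r i / N)"
  have q: "1 \<le> r i / N" using N1 N0 by (simp add: pos_le_divide_eq)
  have q2: "r i / N \<le> 20/9"
  proof -
    have "r i / N \<le> (2 * R) / (9/10 * R)" using R N2 r0 by (intro frac_le) auto
    then show ?thesis using R by simp
  qed
  have t1: "1 \<le> t" using mult_mono[OF l(1) q] l by (simp add: t_def)
  have "t \<le> 2 * (20/9)" unfolding t_def using l q q2 by (intro mult_mono) auto
  then have t6: "t \<le> 6" by simp
  define v where "v = z - l *\<^sub>R (al *\<^sub>R (y i /\<^sub>R R) - sgn (y i - c i))"
  define b where "b = l * (al / R - 1 / N)"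
  have zp: "z = t *\<^sub>R (c i /\<^sub>R r i) + b *\<^sub>R y i + v"
  proof -
    have s: "sgn (y i - c i) = (y i) /\<^sub>R N - (c i) /\<^sub>R N" by (simp add: sgn_div_norm N_def scaleR_diff_right)
    have tc: "t *\<^sub>R (c i /\<^sub>R r i) = (l / N) *\<^sub>R c i" using r0 by (simp add: t_def)
    show ?thesis unfolding v_def b_def s tc by (simp add: algebra_simps divide_inverse)
  qed
  have "1 / N \<le> 1 / (9/10 * R)" using N2 N0 R by (intro divide_left_mono) auto
  also have "\<dots> \<le> (al / 2) / R" using al12 R by (simp add: field_simps)
  finally have "1 / N \<le> al / R / 2" by simp
  then have "al / R / 2 \<le> al / R - 1 / N" by linarith
  moreover have alR: "0 \<le> al / R / 2" using al12 R by simp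
  ultimately have "1 * (al / R / 2) \<le> b" unfolding b_def using l by (intro mult_mono) auto
  then have b: "al / R / 2 \<le> b" by simp
  have v: "(norm v)\<^sup>2 \<le> P / 4096"
  proof -
    have "(norm v)\<^sup>2 \<le> (\<rho> / 4)\<^sup>2" using z by (intro power_mono) (auto simp: v_def)
    also have "\<dots> = al * T / 128" using al12 T0 by (simp add: \<rho> power_divide)
    also have "\<dots> = (T / X) / 8192" by (simp add: al)
    finally show ?thesis using TX by simp
  qed
  have main: "(norm (z - t *\<^sub>R (c i /\<^sub>R r i)))\<^sup>2 + X / 512 \<le> (norm (z - s *\<^sub>R (c j /\<^sub>R r j)))\<^sup>2"
    if j: "j \<in> I" "m i < m j" and s: "1/2 \<le> s" "s \<le> 6" for j s
  proof -
    define D where "D = t *\<^sub>R (c i /\<^sub>R r i) - s *\<^sub>R (c j /\<^sub>R r j)"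
    define E where "E = b *\<^sub>R y i + v"
    have e1: "z - t *\<^sub>R (c i /\<^sub>R r i) = E" unfolding E_def by (subst zp) simp
    have e2: "z - s *\<^sub>R (c j /\<^sub>R r j) = D + E" unfolding E_def D_def by (subst zp) simp
    have e3: "(norm (D + E))\<^sup>2 = (norm E)\<^sup>2 + (norm D)\<^sup>2 + 2 * (D \<bullet> E)"
      by (simp only: power2_norm_eq_inner) (simp add: inner_simps inner_commute)
    have e4: "D \<bullet> E = b * (D \<bullet> y i) + D \<bullet> v" by (simp add: E_def inner_simps)
    \<comment> \<open>The square of \<open>D\<close> pays for its product with the error
      \<open>v\<close>, up to \<open>(norm v)\<^sup>2\<close>, which is small against the gain from
      \<open>D \<bullet> y i\<close>.\<close>
    have e5: "0 \<le> (norm D)\<^sup>2 + 2 * (D \<bullet> v) + (norm v)\<^sup>2"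
    proof -
      have "(norm D)\<^sup>2 + 2 * (D \<bullet> v) + (norm v)\<^sup>2 = (norm (D + v))\<^sup>2"
        by (simp only: power2_norm_eq_inner) (simp add: inner_simps inner_commute)
      then show ?thesis by simp
    qed
    define \<theta> where "\<theta> = sgn (y i)"
    have "P / 4 \<le> \<theta> \<bullet> (c i /\<^sub>R r i) - s * (\<theta> \<bullet> (c j /\<^sub>R r j))"
      unfolding P_def \<theta>_def by (rule far_cross[OF tw i j s])
    also have "\<dots> \<le> t * (\<theta> \<bullet> (c i /\<^sub>R r i)) - s * (\<theta> \<bullet> (c j /\<^sub>R r j))"
      using mult_right_mono[OF t1, of "\<theta> \<bullet> (c i /\<^sub>R r i)"] far_inner_pos[OF tw i] by (simp add: \<theta>_def)
    also have "\<dots> = \<theta> \<bullet> D" by (simp add: D_def inner_diff_right)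
    finally have \<theta>D: "P / 4 \<le> \<theta> \<bullet> D" .
    have "y i = norm (y i) *\<^sub>R \<theta>" using far_pos[OF tw i] by (simp add: \<theta>_def sgn_div_norm)
    then have Dy: "D \<bullet> y i = norm (y i) * (\<theta> \<bullet> D)" by (metis inner_commute inner_scaleR_left)
    have yR: "X * R \<le> norm (y i)" using X R mult_left_mono[OF R(2), of X] by linarith
    have P0: "0 \<le> P / 4" using XP X by simp
    have "(al / R / 2) * ((X * R) * (P / 4)) \<le> b * (norm (y i) * (\<theta> \<bullet> D))"
      using b alR yR \<theta>D P0 X R by (intro mult_mono mult_nonneg_nonneg) auto
    moreover have "(al / R / 2) * ((X * R) * (P / 4)) = P / 512" using R X by (simp add: al)
    ultimately have "P / 256 \<le> 2 * (b * (D \<bullet> y i))" unfolding Dy by simp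
    then have "(norm E)\<^sup>2 + P / 512 \<le> (norm (D + E))\<^sup>2" unfolding e3 e4 using e5 v P0 by argo
    moreover have "X / 512 \<le> P / 512" using XP by simp
    ultimately show ?thesis unfolding e1 e2 by argo
  qed
  show ?thesis using t1 t6 main by (intro exI[of _ t]) auto
qed


text \<open>\<open>lo z \<mu>\<close> and \<open>hi z \<mu>\<close> are squared distances from
  \<open>z\<close> to the multiples of the normalised centres, of the scales from \<mu> on and of
  those above \<mu>. At every \<open>z\<close> the differences telescope, and on the set
  \<open>U\<close> of a class they are at least \<open>X / 512\<close>; integration bounds the sum
  of \<open>X\<close> times the volume of \<open>U\<close>. The number of indices in a class is at
  most of order \<open>(X / T) powr \<sigma>\<close> times that volume. Dimension three enters
  through \<sigma> \<ge> 1: as \<open>X\<close> is at most 1, so is \<open>X powr \<sigma>\<close>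
  at most \<open>X\<close>.\<close>

lemma tower_far_small_count_dim3:
  assumes dim: "3 \<le> DIM('a::euclidean_space)"
  shows "\<exists>C>0. \<forall>d T (I::'i set) m (y::'i \<Rightarrow> 'a) c r.
    tower d T I m y c r \<and> T \<le> 1 / 1920000 \<and> (\<forall>i\<in>I. far y c r i \<and> protrusion T y r i \<le> 1/5000)
    \<longrightarrow> real (card I) \<le> C * T powr (- ((real DIM('a) - 1) / 2))"
proof -
  define \<sigma> where "\<sigma> = (real DIM('a) - 1) / 2"
  have \<sigma>1: "1 \<le> \<sigma>" using dim by (simp add: \<sigma>_def)
  define n where "n = DIM('a)"
  define \<omega> where "\<omega> = unit_ball_vol (real n)"
  have \<omega>: "0 < \<omega>" by (simp add: \<omega>_def)
  obtain C0 where C0: "0 < C0" and top: "\<forall>d T (I::'i set) m (y::'i \<Rightarrow> 'a) c r.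
    tower d T I m y c r \<and> (\<forall>i\<in>I. \<forall>j\<in>I. m i = m j) \<and> T \<le> 1 / 1920000
    \<longrightarrow> real (card I) \<le> C0 * T powr (- ((real DIM('a) - 1) / 2))"
    by (rule exE[OF tower_top_count[where 'i='i and 'a='a]], erule conjE, rule that, assumption, assumption)
  obtain M where M: "0 < M" and centres: "\<forall>d T (I::'i set) m (y::'i \<Rightarrow> 'a::euclidean_space) c r R X al \<rho>.
    tower d T I m y c r \<and> (\<forall>i\<in>I. \<forall>j\<in>I. m i = m j) \<and> T \<le> 1 / 1920000 \<and> 0 < R \<and>
    (\<forall>i\<in>I. R \<le> r i \<and> r i \<le> 2 * R \<and> protrusion T y r i \<le> 1/5000 \<and> X * r i \<le> norm (y i) \<and> norm (y i) < 2 * X * r i) \<and>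
    I \<noteq> {} \<and> 0 < X \<and> al = 1 / (64 * X) \<and> \<rho> = sqrt (al * T / 8) \<longrightarrow>
    (\<exists>W. finite W \<and> real (card I) \<le> M * \<rho> * real (card W) \<and>
      (\<forall>w\<in>W. norm w \<le> 5/2 \<and> (\<exists>i\<in>I. \<exists>l. 1 \<le> l \<and> l \<le> 2 \<and> w = l *\<^sub>R (al *\<^sub>R (y i /\<^sub>R R) - sgn (y i - c i)))) \<and>
      (\<forall>w\<in>W. \<forall>w'\<in>W. w \<noteq> w' \<longrightarrow> \<rho> / 2 \<le> dist w w'))"
    by (rule exE[OF class_centres[where 'i='i and 'a='a]], erule conjE, rule that, assumption, assumption)
  define M1 where "M1 = M * 4 ^ n / \<omega> * 512 powr \<sigma>"
  have M1: "0 < M1" using M \<omega> by (simp add: M1_def)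
  define C where "C = C0 + M1 * (102400 * (\<omega> * 3 ^ n))"
  have C: "0 < C" using C0 M1 \<omega> by (simp add: C_def add_pos_nonneg)
  show ?thesis
  proof (rule exI[of _ C], rule conjI, rule C, (rule allI)+, rule impI, elim conjE)
    fix d T and I :: "'i set" and m and y :: "'i \<Rightarrow> 'a" and c r
    assume tw: "tower d T I m y c r" and T: "T \<le> 1 / 1920000"
      and f: "\<forall>i\<in>I. far y c r i \<and> protrusion T y r i \<le> 1/5000"
    have fin: "finite I" and T0: "0 < T" by (rule towerD[OF tw])+
    show "real (card I) \<le> C * T powr (- ((real DIM('a) - 1) / 2))"
    proof (cases "I = {}")
      case True then show ?thesis using C by simp
    next
      case False
      define mm where "mm = Max (m ` I)"
      have mm: "m i \<le> mm" if "i \<in> I" for i using that fin by (simp add: mm_def)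
      have "mm \<in> m ` I" unfolding mm_def using fin False by (intro Max_in) auto
      then obtain jt where jt: "jt \<in> I" "m jt = mm" by auto
      \<comment> \<open>The top scale has no larger balls to compare with, and
        \<open>infdist\<close> to the empty set is 0, which would spoil \<open>hi\<close>. It is
        counted separately at the end.\<close>
      define J where "J = {i\<in>I. m i < mm}"
      have JI: "J \<subseteq> I" by (auto simp: J_def)
      have finJ: "finite J" using JI fin finite_subset by blast
      have twJ: "tower d T J m y c r" by (rule tower_subset[OF tw JI])
      define u where "u i = c i /\<^sub>R r i" for i
      have u1: "norm (u i) \<le> 1" if "i \<in> I" for i
        using towerD(6)[OF tw that] towerD(8)[OF tw that] by (simp add: u_def field_simps)
      \<comment> \<open>The range of the multiples is that of \<open>larger_balls_further\<close>,
        where the multiple consists of the factor \<open>l\<close> and the ratio of the radius to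
        the distance between point and centre.\<close>
      define A where "A \<mu> = {s *\<^sub>R u j | s j. 1/2 \<le> s \<and> s \<le> 6 \<and> j \<in> I \<and> \<mu> \<le> m j}" for \<mu>
      define A' where "A' \<mu> = {s *\<^sub>R u j | s j. 1/2 \<le> s \<and> s \<le> 6 \<and> j \<in> I \<and> \<mu> < m j}" for \<mu>
      define lo where "lo z \<mu> = (infdist z (A \<mu>))\<^sup>2" for z \<mu>
      define hi where "hi z \<mu> = (infdist z (A' \<mu>))\<^sup>2" for z \<mu>
      have A'jt: "1 *\<^sub>R u jt \<in> A' \<mu>" if "\<mu> < mm" for \<mu>
      proof -
        have "(1::real)/2 \<le> 1 \<and> (1::real) \<le> 6 \<and> jt \<in> I \<and> \<mu> < m jt" using jt that by auto
        then show ?thesis unfolding A'_def by blast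
      qed
      have tele: "(\<Sum>\<mu>\<in>m ` J. hi z \<mu> - lo z \<mu>) \<le> 100" if z: "norm z \<le> 3" for z
      proof (rule sum_telescoping_le)
        show "finite (m ` J)" using finJ by simp
        show "0 \<le> lo z \<mu>" for \<mu> by (simp add: lo_def)
        show "hi z \<mu> \<le> 100" if "\<mu> \<in> m ` J" for \<mu>
        proof -
          have "\<mu> < mm" using that by (auto simp: J_def)
          from infdist_le[OF A'jt[OF this], of z] have "infdist z (A' \<mu>) \<le> dist z (u jt)" by simp
          also have "\<dots> \<le> 4" using z u1[OF jt(1)] norm_triangle_ineq4[of z "u jt"] by (simp add: dist_norm)
          finally have "infdist z (A' \<mu>) \<le> 10" by simp
          then have "(infdist z (A' \<mu>))\<^sup>2 \<le> 10\<^sup>2" using infdist_nonneg by (intro power_mono) auto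
          then show ?thesis by (simp add: hi_def)
        qed
        show "hi z \<mu> \<le> lo z \<nu>" if "\<mu> \<in> m ` J" "\<nu> \<in> m ` J" "\<mu> < \<nu>" for \<mu> \<nu>
        proof -
          have sub: "A \<nu> \<subseteq> A' \<mu>" unfolding A_def A'_def using that(3) by fastforce
          have "\<nu> < mm" using that by (auto simp: J_def)
          then have "(1::real)/2 \<le> 1 \<and> (1::real) \<le> 6 \<and> jt \<in> I \<and> \<nu> \<le> m jt" using jt by auto
          then have "1 *\<^sub>R u jt \<in> A \<nu>" unfolding A_def by blast
          then have "infdist z (A' \<mu>) \<le> infdist z (A \<nu>)" using sub by (intro infdist_mono) auto
          then show ?thesis unfolding hi_def lo_def using infdist_nonneg by (intro power_mono) auto
        qed
      qed simp
      define x where "x i = norm (y i) / r i" for i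
      have x0: "0 < x i" if "i \<in> I" for i
        using far_pos[OF tw that] f that towerD(8)[OF tw that] by (simp add: x_def)
      \<comment> \<open>A class fixes the scale and the dyadic size of
        \<open>norm (y i) / r i\<close>, because the expansion factor in
        \<open>class_centres\<close> has to match this size up to the factor 2.\<close>
      define g where "g i = (m i, \<lfloor>log 2 (x i)\<rfloor>)" for i
      define X where "X \<kappa> = 2 powr real_of_int (snd \<kappa>)" for \<kappa> :: "int \<times> int"
      define \<rho> where "\<rho> \<kappa> = sqrt ((1 / (64 * X \<kappa>)) * T / 8)" for \<kappa>
      have X0: "0 < X \<kappa>" for \<kappa> by (simp add: X_def)
      have \<rho>0: "0 < \<rho> \<kappa>" for \<kappa> using X0[of \<kappa>] T0 by (simp add: \<rho>_def)
      have Xx: "X (g i) \<le> x i" "x i < 2 * X (g i)" if "i \<in> I" for i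
      proof -
        have iff: "(v \<le> log 2 (x i)) = (2 powr v \<le> x i)" "(log 2 (x i) < v) = (x i < 2 powr v)" for v
          using le_log_iff[of 2 "x i" v] log_less_iff[of 2 "x i" v] x0[OF that] by simp_all
        have "real_of_int \<lfloor>log 2 (x i)\<rfloor> \<le> log 2 (x i)" by simp
        then have "2 powr real_of_int \<lfloor>log 2 (x i)\<rfloor> \<le> x i" by (simp only: iff(1))
        then show "X (g i) \<le> x i" unfolding X_def g_def by simp
        have "log 2 (x i) < real_of_int \<lfloor>log 2 (x i)\<rfloor> + 1" by linarith
        then have "x i < 2 powr (real_of_int \<lfloor>log 2 (x i)\<rfloor> + 1)" by (simp only: iff(2))
        then show "x i < 2 * X (g i)" unfolding X_def g_def by (simp add: powr_add mult.commute)
      qed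
      have Xr: "X (g i) * r i \<le> norm (y i)" "norm (y i) < 2 * X (g i) * r i" if "i \<in> I" for i
        using Xx[OF that] towerD(8)[OF tw that] by (auto simp: x_def pos_le_divide_eq pos_divide_less_eq)
      have X1: "X (g i) \<le> 1" if "i \<in> I" for i
      proof -
        have "x i \<le> protrusion T y r i" using x0[OF that] T0 by (simp add: protrusion_def x_def[symmetric])
        then show ?thesis using Xx[OF that] f that by force
      qed
      obtain k where k: "\<And>\<mu>. \<mu> \<in> m ` J \<Longrightarrow> k \<mu> \<in> J \<and> m (k \<mu>) = \<mu>"
        "\<And>i. i \<in> J \<Longrightarrow> r (k (m i)) \<le> r i \<and> r i \<le> 2 * r (k (m i))"
        by (rule tower_representatives[OF twJ], rule that)
      define R where "R \<mu> = r (k \<mu>)" for \<mu>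
      have R0: "0 < R \<mu>" if "\<mu> \<in> m ` J" for \<mu> unfolding R_def using towerD(8)[OF twJ] k(1)[OF that] by blast
      define Kc where "Kc \<kappa> = {i\<in>J. g i = \<kappa>}" for \<kappa>
      define good where "good \<kappa> W \<longleftrightarrow> finite W \<and> real (card (Kc \<kappa>)) \<le> M * \<rho> \<kappa> * real (card W) \<and>
        (\<forall>w\<in>W. norm w \<le> 5/2 \<and> (\<exists>i\<in>Kc \<kappa>. \<exists>l. 1 \<le> l \<and> l \<le> 2 \<and> w = l *\<^sub>R ((1 / (64 * X \<kappa>)) *\<^sub>R (y i /\<^sub>R R (fst \<kappa>)) - sgn (y i - c i)))) \<and>
        (\<forall>w\<in>W. \<forall>w'\<in>W. w \<noteq> w' \<longrightarrow> \<rho> \<kappa> / 2 \<le> dist w w')" for \<kappa> W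
      have ex: "\<exists>W. good \<kappa> W" if kap: "\<kappa> \<in> g ` J" for \<kappa>
        unfolding good_def
      proof (rule centres[rule_format, of d T "Kc \<kappa>" m y c r "R (fst \<kappa>)" "X \<kappa>"], intro conjI ballI)
        have KJ: "Kc \<kappa> \<subseteq> J" by (auto simp: Kc_def)
        show "tower d T (Kc \<kappa>) m y c r" by (rule tower_subset[OF twJ KJ])
        show "m i = m j" if "i \<in> Kc \<kappa>" "j \<in> Kc \<kappa>" for i j using that by (auto simp: Kc_def g_def)
        show "0 < R (fst \<kappa>)" using R0 kap by (auto simp: g_def)
        fix i assume i: "i \<in> Kc \<kappa>"
        then have iJ: "i \<in> J" "i \<in> I" and gi: "\<kappa> = g i" using JI by (auto simp: Kc_def)
        have fk: "fst \<kappa> = m i" by (simp add: gi g_def)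
        show "R (fst \<kappa>) \<le> r i" "r i \<le> 2 * R (fst \<kappa>)" using k(2)[OF iJ(1)] unfolding fk R_def by auto
        show "protrusion T y r i \<le> 1/5000" using f iJ by auto
        show "X \<kappa> * r i \<le> norm (y i)" "norm (y i) < 2 * X \<kappa> * r i" unfolding gi using Xr[OF iJ(2)] by auto
      next
        show "Kc \<kappa> \<noteq> {}" using kap by (auto simp: Kc_def)
      qed (use T X0 in \<open>auto simp: \<rho>_def\<close>)
      define W where "W \<kappa> = (SOME W. good \<kappa> W)" for \<kappa>
      have goodW: "good \<kappa> (W \<kappa>)" if "\<kappa> \<in> g ` J" for \<kappa> unfolding W_def by (rule someI_ex) (rule ex[OF that])
      have W: "\<And>\<kappa>. \<kappa> \<in> g ` J \<Longrightarrow> finite (W \<kappa>)"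
        "\<And>\<kappa>. \<kappa> \<in> g ` J \<Longrightarrow> real (card (Kc \<kappa>)) \<le> M * \<rho> \<kappa> * real (card (W \<kappa>))"
        "\<And>\<kappa> w. \<kappa> \<in> g ` J \<Longrightarrow> w \<in> W \<kappa> \<Longrightarrow> norm w \<le> 5/2"
        "\<And>\<kappa> w. \<kappa> \<in> g ` J \<Longrightarrow> w \<in> W \<kappa> \<Longrightarrow> \<exists>i\<in>Kc \<kappa>. \<exists>l. 1 \<le> l \<and> l \<le> 2 \<and> w = l *\<^sub>R ((1 / (64 * X \<kappa>)) *\<^sub>R (y i /\<^sub>R R (fst \<kappa>)) - sgn (y i - c i))"
        "\<And>\<kappa> w w'. \<kappa> \<in> g ` J \<Longrightarrow> w \<in> W \<kappa> \<Longrightarrow> w' \<in> W \<kappa> \<Longrightarrow> w \<noteq> w' \<Longrightarrow> \<rho> \<kappa> / 2 \<le> dist w w'"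
        using goodW unfolding good_def by meson+
      define U where "U \<kappa> = (\<Union>w\<in>W \<kappa>. ball w (\<rho> \<kappa> / 4))" for \<kappa>
      have drop: "X \<kappa> \<le> 512 * (hi z (fst \<kappa>) - lo z (fst \<kappa>))" if kap: "\<kappa> \<in> g ` J" and z: "z \<in> U \<kappa>" for \<kappa> z
      proof -
        from z obtain w where w: "w \<in> W \<kappa>" "dist w z < \<rho> \<kappa> / 4" by (auto simp: U_def)
        from W(4)[OF kap w(1)] obtain i l where il: "i \<in> Kc \<kappa>" "1 \<le> l" "l \<le> 2"
          "w = l *\<^sub>R ((1 / (64 * X \<kappa>)) *\<^sub>R (y i /\<^sub>R R (fst \<kappa>)) - sgn (y i - c i))" by auto
        have iJ: "i \<in> J" "i \<in> I" and gi: "\<kappa> = g i" using il JI by (auto simp: Kc_def)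
        have fk: "fst \<kappa> = m i" by (simp add: gi g_def)
        have Rk: "0 < R (fst \<kappa>)" "R (fst \<kappa>) \<le> r i" "r i \<le> 2 * R (fst \<kappa>)"
          using k(2)[OF iJ(1)] R0[of "m i"] iJ(1) unfolding fk R_def by auto
        have fi: "far y c r i" "protrusion T y r i \<le> 1/5000" using f iJ by auto
        have zz: "norm (z - l *\<^sub>R ((1 / (64 * X \<kappa>)) *\<^sub>R (y i /\<^sub>R R (fst \<kappa>)) - sgn (y i - c i))) \<le> \<rho> \<kappa> / 4"
          using w(2) unfolding il(4)[symmetric] by (simp add: dist_norm norm_minus_commute)
        have Xg: "X \<kappa> * r i \<le> norm (y i)" "norm (y i) < 2 * X \<kappa> * r i" unfolding gi using Xr[OF iJ(2)] by auto
        obtain t where t: "1/2 \<le> t" "t \<le> 6" and cmp: "\<And>j s. j \<in> I \<Longrightarrow> m i < m j \<Longrightarrow> 1/2 \<le> s \<Longrightarrow> s \<le> 6 \<Longrightarrow>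
          (norm (z - t *\<^sub>R (c i /\<^sub>R r i)))\<^sup>2 + X \<kappa> / 512 \<le> (norm (z - s *\<^sub>R (c j /\<^sub>R r j)))\<^sup>2"
          using larger_balls_further[OF tw T iJ(2) fi(1) Rk fi(2) X0 Xg refl \<rho>_def il(2,3) zz] by blast
        have "t *\<^sub>R u i \<in> A (fst \<kappa>)" unfolding A_def fk using t iJ(2) by blast
        from infdist_le[OF this, of z] have "infdist z (A (fst \<kappa>)) \<le> norm (z - t *\<^sub>R u i)" by (simp add: dist_norm)
        then have lo: "lo z (fst \<kappa>) \<le> (norm (z - t *\<^sub>R u i))\<^sup>2" unfolding lo_def by (intro power_mono infdist_nonneg)
        have mi: "fst \<kappa> < mm" using iJ(1) by (simp add: fk J_def)
        have ne: "A' (fst \<kappa>) \<noteq> {}" using A'jt[OF mi] by auto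
        have nn: "0 \<le> lo z (fst \<kappa>) + X \<kappa> / 512" using X0[of \<kappa>] by (simp add: lo_def)
        have "sqrt (lo z (fst \<kappa>) + X \<kappa> / 512) \<le> infdist z (A' (fst \<kappa>))"
          unfolding infdist_notempty[OF ne]
        proof (rule cINF_greatest[OF ne])
          fix a assume "a \<in> A' (fst \<kappa>)"
          then obtain s j where a: "a = s *\<^sub>R u j" "1/2 \<le> s" "s \<le> 6" "j \<in> I" "m i < m j" unfolding A'_def fk by auto
          have "lo z (fst \<kappa>) + X \<kappa> / 512 \<le> (dist z a)\<^sup>2"
            using lo cmp[OF a(4,5,2,3)] by (simp add: a(1) u_def dist_norm)
          then show "sqrt (lo z (fst \<kappa>) + X \<kappa> / 512) \<le> dist z a" by (intro real_le_lsqrt) auto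
        qed
        then have "(sqrt (lo z (fst \<kappa>) + X \<kappa> / 512))\<^sup>2 \<le> hi z (fst \<kappa>)" unfolding hi_def using nn by (intro power_mono) auto
        then show ?thesis using nn by simp
      qed
      have Usub: "U \<kappa> \<subseteq> ball 0 3" if kap: "\<kappa> \<in> g ` J" for \<kappa>
      proof
        fix z assume "z \<in> U \<kappa>"
        then obtain w where w: "w \<in> W \<kappa>" "dist w z < \<rho> \<kappa> / 4" by (auto simp: U_def)
        obtain i where i: "i \<in> I" "\<kappa> = g i" using kap JI by auto
        have "T / (2 * X \<kappa>) \<le> T / x i" using Xx[OF i(1)] x0[OF i(1)] T0 X0[of \<kappa>] i(2) by (intro divide_left_mono) auto
        also have "\<dots> \<le> 1/5000"
        proof -
          have "x i + T / x i \<le> 1/5000" using f i(1) unfolding protrusion_def x_def[symmetric] by blast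
          then show ?thesis using x0[OF i(1)] by linarith
        qed
        finally have "(\<rho> \<kappa>)\<^sup>2 \<le> 1\<^sup>2" using X0[of \<kappa>] T0 by (simp add: \<rho>_def)
        then have "\<rho> \<kappa> \<le> 1" by (rule power2_le_imp_le) simp
        then have "dist w z \<le> 1/4" using w(2) by simp
        then show "z \<in> ball 0 3" using W(3)[OF kap w(1)] norm_triangle_ineq4[of w "w - z"] by (simp add: dist_norm)
      qed
      have Uopen: "open (U \<kappa>)" for \<kappa> unfolding U_def by auto
      have keys: "g ` J \<subseteq> m ` J \<times> UNIV" by (auto simp: g_def)
      have fing: "finite (g ` J)" using finJ by simp
      have pointwise: "(\<Sum>\<kappa>\<in>g ` J. X \<kappa> * indicator (U \<kappa>) z) \<le> 102400 * indicator (ball 0 3) z" for z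
      proof (cases "z \<in> ball 0 3")
        case False
        then have "X \<kappa> * indicator (U \<kappa>) z = 0" if "\<kappa> \<in> g ` J" for \<kappa>
          using subsetD[OF Usub[OF that], of z] by (auto simp: indicator_def)
        then have "(\<Sum>\<kappa>\<in>g ` J. X \<kappa> * indicator (U \<kappa>) z) = 0" by (intro sum.neutral ballI)
        then show ?thesis by simp
      next
        case True
        have "(\<Sum>\<kappa>\<in>g ` J. X \<kappa> * indicator (U \<kappa>) z)
          = (\<Sum>\<mu>\<in>m ` J. \<Sum>\<kappa>\<in>{\<kappa>\<in>g ` J. fst \<kappa> = \<mu>}. X \<kappa> * indicator (U \<kappa>) z)"
          by (rule sum.group[symmetric]) (use fing finJ in \<open>auto simp: g_def\<close>)
        also have "\<dots> \<le> (\<Sum>\<mu>\<in>m ` J. 1024 * (hi z \<mu> - lo z \<mu>))"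
        proof (rule sum_mono)
          fix \<mu> assume mu: "\<mu> \<in> m ` J"
          define S where "S = {\<kappa>\<in>g ` J. fst \<kappa> = \<mu> \<and> z \<in> U \<kappa>}"
          define B where "B = 512 * (hi z \<mu> - lo z \<mu>)"
          have finS: "finite S" using fing by (simp add: S_def)
          have "(\<Sum>\<kappa>\<in>{\<kappa>\<in>g ` J. fst \<kappa> = \<mu>}. X \<kappa> * indicator (U \<kappa>) z) = (\<Sum>\<kappa>\<in>S. X \<kappa>)"
            using fing by (intro sum.mono_neutral_cong_right) (auto simp: S_def)
          also have "\<dots> \<le> 2 * B"
          proof (cases "S = {}")
            case True
            have "0 \<le> B"
            proof -
              obtain i where i: "i \<in> J" "\<mu> = m i" using mu by auto
              have "A' \<mu> \<subseteq> A \<mu>" unfolding A_def A'_def by fastforce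
              moreover have "\<mu> < mm" using i by (simp add: J_def)
              ultimately have "infdist z (A \<mu>) \<le> infdist z (A' \<mu>)" using A'jt by (intro infdist_mono) auto
              then have "lo z \<mu> \<le> hi z \<mu>" unfolding lo_def hi_def by (intro power_mono infdist_nonneg)
              then show ?thesis by (simp add: B_def)
            qed
            then show ?thesis using True by simp
          next
            case False
            \<comment> \<open>Several dyadic classes of one scale may contain the same
              \<open>z\<close>. Each of their \<open>X\<close> is at most \<open>B\<close> and they
              are distinct powers of 2, so their sum is at most \<open>2 * B\<close>.\<close>
            have XB: "X \<kappa> \<le> B" if "\<kappa> \<in> S" for \<kappa> using drop[of \<kappa> z] that by (auto simp: S_def B_def)
            have "(\<Sum>\<kappa>\<in>S. X \<kappa> powr 1) \<le> B powr 1 / (1 - 2 powr (- 1))"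
            proof (rule sum_lacunary_powr_le[OF finS X0 XB])
              show "2 * X \<kappa> \<le> X \<kappa>' \<or> 2 * X \<kappa>' \<le> X \<kappa>" if "\<kappa> \<in> S" "\<kappa>' \<in> S" "\<kappa> \<noteq> \<kappa>'" for \<kappa> \<kappa>'
              proof -
                have *: "2 * X a \<le> X b" if "snd a < snd b" for a b :: "int \<times> int"
                proof -
                  have "2 * X a = 2 powr (1 + real_of_int (snd a))" by (simp add: X_def powr_add)
                  also have "\<dots> \<le> X b" unfolding X_def using that by (intro powr_mono) auto
                  finally show ?thesis .
                qed
                have "snd \<kappa> \<noteq> snd \<kappa>'" using that by (auto simp: S_def prod_eq_iff)
                then show ?thesis using *[of \<kappa> \<kappa>'] *[of \<kappa>' \<kappa>] by linarith
              qed
              show "0 \<le> B" using False XB X0 by (meson equals0I less_le_trans less_imp_le)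
            qed auto
            moreover have "B powr 1 / (1 - 2 powr (- 1)) = 2 * B"
            proof -
              have "0 \<le> B" using False XB X0 by (meson equals0I less_le_trans less_imp_le)
              then show ?thesis by (simp add: powr_minus_divide)
            qed
            ultimately show ?thesis using X0 by (simp add: less_imp_le)
          qed
          finally show "(\<Sum>\<kappa>\<in>{\<kappa>\<in>g ` J. fst \<kappa> = \<mu>}. X \<kappa> * indicator (U \<kappa>) z) \<le> 1024 * (hi z \<mu> - lo z \<mu>)"
            by (simp add: B_def)
        qed
        also have "\<dots> = 1024 * (\<Sum>\<mu>\<in>m ` J. hi z \<mu> - lo z \<mu>)" by (rule sum_distrib_left[symmetric])
        also have "\<dots> \<le> 1024 * 100" using tele[of z] True by (intro mult_left_mono) auto
        finally show ?thesis using True by simp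
      qed
      have fm: "U \<kappa> \<in> fmeasurable lborel" if "\<kappa> \<in> g ` J" for \<kappa>
      proof (rule fmeasurableI2)
        show "ball 0 3 \<in> fmeasurable (lborel :: 'a measure)" using emeasure_lborel_ball_finite[of "0::'a" 3] by (simp add: fmeasurable_def)
        show "U \<kappa> \<in> sets lborel" using Uopen[of \<kappa>] by simp
      qed (rule Usub[OF that])
      have total: "(\<Sum>\<kappa>\<in>g ` J. X \<kappa> * measure lborel (U \<kappa>)) \<le> 102400 * (\<omega> * 3 ^ n)"
      proof -
        have int: "integrable lborel (\<lambda>z. X \<kappa> * indicator (U \<kappa>) z :: real)" if "\<kappa> \<in> g ` J" for \<kappa>
          using fm[OF that] by (auto simp: fmeasurable_def)
        have "(\<Sum>\<kappa>\<in>g ` J. X \<kappa> * measure lborel (U \<kappa>)) = (\<Sum>\<kappa>\<in>g ` J. \<integral>z. X \<kappa> * indicator (U \<kappa>) z \<partial>lborel)"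
          using Uopen by (intro sum.cong refl) simp
        also have "\<dots> = (\<integral>z. (\<Sum>\<kappa>\<in>g ` J. X \<kappa> * indicator (U \<kappa>) z) \<partial>lborel)"
          using int by (intro Bochner_Integration.integral_sum[symmetric])
        also have "\<dots> \<le> (\<integral>z. 102400 * indicator (ball (0::'a) 3) z \<partial>lborel)"
        proof (rule integral_mono)
          show "integrable lborel (\<lambda>z. \<Sum>\<kappa>\<in>g ` J. X \<kappa> * indicator (U \<kappa>) z :: real)" using int by auto
          show "integrable lborel (\<lambda>z. 102400 * indicator (ball (0::'a) 3) z :: real)"
            using emeasure_lborel_ball_finite[of "0::'a" 3] by simp
        qed (rule pointwise)
        also have "\<dots> = 102400 * (\<omega> * 3 ^ n)" by (simp add: content_ball \<omega>_def n_def)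
        finally show ?thesis .
      qed
      have fibre: "real (card (Kc \<kappa>)) \<le> M1 * T powr (-\<sigma>) * (X \<kappa> * measure lborel (U \<kappa>))" if kap: "\<kappa> \<in> g ` J" for \<kappa>
      proof -
        have XX: "X \<kappa> \<le> 1" using X1 kap JI by auto
        have disj: "disjoint_family_on (\<lambda>w. ball w (\<rho> \<kappa> / 4)) (W \<kappa>)"
          unfolding disjoint_family_on_def
        proof (intro ballI impI)
          fix a b assume "a \<in> W \<kappa>" "b \<in> W \<kappa>" "a \<noteq> b"
          from W(5)[OF kap this] show "ball a (\<rho> \<kappa> / 4) \<inter> ball b (\<rho> \<kappa> / 4) = {}"
            by (intro disjoint_ballI) simp
        qed
        have "measure lborel (U \<kappa>) = (\<Sum>w\<in>W \<kappa>. measure lborel (ball w (\<rho> \<kappa> / 4)))"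
          unfolding U_def using disj W(1)[OF kap] emeasure_lborel_ball_finite
          by (intro measure_finite_Union) (auto simp: less_le)
        also have "\<dots> = real (card (W \<kappa>)) * (\<omega> * (\<rho> \<kappa> / 4) ^ n)" using \<rho>0[of \<kappa>] by (simp add: content_ball \<omega>_def n_def)
        finally have vol: "measure lborel (U \<kappa>) = real (card (W \<kappa>)) * (\<omega> * (\<rho> \<kappa> / 4) ^ n)" .
        have n1: "n = Suc (n - 1)" using dim by (simp add: n_def)
        have \<rho>n: "(\<rho> \<kappa>) ^ n = \<rho> \<kappa> * (\<rho> \<kappa>) ^ (n - 1)" by (subst n1) simp
        have cW: "\<rho> \<kappa> * real (card (W \<kappa>)) = (4 ^ n / \<omega>) * measure lborel (U \<kappa>) * (1 / (\<rho> \<kappa>) ^ (n - 1))"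
          unfolding vol power_divide \<rho>n using \<rho>0[of \<kappa>] \<omega> by (simp add: field_simps)
        have "(\<rho> \<kappa>) ^ (n - 1) = \<rho> \<kappa> powr (2 * \<sigma>)"
        proof -
          have "real (n - 1) = 2 * \<sigma>" using dim by (simp add: \<sigma>_def n_def of_nat_diff)
          then show ?thesis using \<rho>0[of \<kappa>] powr_realpow[of "\<rho> \<kappa>" "n - 1"] by simp
        qed
        also have "\<dots> = ((\<rho> \<kappa>)\<^sup>2) powr \<sigma>" using \<rho>0[of \<kappa>] by (simp add: powr_powr[symmetric])
        also have "(\<rho> \<kappa>)\<^sup>2 = T / (512 * X \<kappa>)" using X0[of \<kappa>] T0 by (simp add: \<rho>_def)
        finally have "1 / (\<rho> \<kappa>) ^ (n - 1) = 512 powr \<sigma> * X \<kappa> powr \<sigma> * T powr (-\<sigma>)"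
          using X0[of \<kappa>] T0 by (simp add: powr_divide powr_mult powr_minus_divide)
        also have "\<dots> \<le> 512 powr \<sigma> * X \<kappa> * T powr (-\<sigma>)"
        proof -
          have "X \<kappa> powr \<sigma> \<le> X \<kappa> powr 1" using XX X0[of \<kappa>] \<sigma>1 by (intro powr_mono') auto
          then show ?thesis using X0[of \<kappa>] by (intro mult_right_mono mult_left_mono) auto
        qed
        finally have inv: "1 / (\<rho> \<kappa>) ^ (n - 1) \<le> 512 powr \<sigma> * X \<kappa> * T powr (-\<sigma>)" .
        have "real (card (Kc \<kappa>)) \<le> M * (\<rho> \<kappa> * real (card (W \<kappa>)))" using W(2)[OF kap] by (simp add: mult.assoc)
        also have "\<dots> \<le> M * ((4 ^ n / \<omega>) * measure lborel (U \<kappa>) * (512 powr \<sigma> * X \<kappa> * T powr (-\<sigma>)))"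
          unfolding cW using inv M \<omega> by (intro mult_left_mono) auto
        finally show ?thesis by (simp add: M1_def mult_ac)
      qed
      have cardJ: "real (card J) \<le> M1 * (102400 * (\<omega> * 3 ^ n)) * T powr (-\<sigma>)"
      proof -
        have "real (card J) = (\<Sum>\<kappa>\<in>g ` J. real (card (Kc \<kappa>)))" unfolding Kc_def by (rule card_eq_sum_fibres[OF finJ])
        also have "\<dots> \<le> (\<Sum>\<kappa>\<in>g ` J. M1 * T powr (-\<sigma>) * (X \<kappa> * measure lborel (U \<kappa>)))" by (rule sum_mono) (rule fibre)
        also have "\<dots> = M1 * T powr (-\<sigma>) * (\<Sum>\<kappa>\<in>g ` J. X \<kappa> * measure lborel (U \<kappa>))" by (rule sum_distrib_left[symmetric])
        also have "\<dots> \<le> M1 * T powr (-\<sigma>) * (102400 * (\<omega> * 3 ^ n))" using total M1 by (intro mult_left_mono) auto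
        finally show ?thesis by (simp add: mult_ac)
      qed
      define L where "L = {i\<in>I. m i = mm}"
      have "tower d T L m y c r" by (rule tower_subset[OF tw]) (auto simp: L_def)
      moreover have "\<forall>i\<in>L. \<forall>j\<in>L. m i = m j" by (simp add: L_def)
      ultimately have cardL: "real (card L) \<le> C0 * T powr (- \<sigma>)"
        unfolding \<sigma>_def using top[rule_format, of d T L m y c r] T by blast
      have "I = J \<union> L" using mm by (force simp: J_def L_def)
      then have "card I \<le> card J + card L" by (metis card_Un_le)
      then have "real (card I) \<le> real (card J) + real (card L)" by linarith
      also have "\<dots> \<le> C * T powr (- \<sigma>)" using cardJ cardL by (simp add: C_def algebra_simps)
      finally show ?thesis by (simp add: \<sigma>_def)
    qed
  qed
qed

section \<open>The covering lemma\<close>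

lemma tower_count:
  assumes dim: "2 \<le> DIM('a::euclidean_space)"
  shows "\<exists>C>0. \<forall>d T (I::'i set) m (y::'i \<Rightarrow> 'a) c r.
    tower d T I m y c r \<and> T \<le> 1 / 1920000
    \<longrightarrow> real (card I) \<le> C * T powr (- ((real DIM('a) - 1) / 2))"
proof -
  define \<sigma> where "\<sigma> = (real DIM('a) - 1) / 2"
  obtain C1 where C1: "0 < C1" and near: "\<forall>d T (I::'i set) m (y::'i \<Rightarrow> 'a) c r.
    tower d T I m y c r \<and> T \<le> 1 / 1920000 \<and> (\<forall>i\<in>I. (norm (y i))\<^sup>2 \<le> 4 * ((r i)\<^sup>2 - (norm (c i))\<^sup>2))
    \<longrightarrow> real (card I) \<le> C1 * T powr (- ((real DIM('a) - 1) / 2))"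
    by (rule exE[OF tower_near_count[OF dim, where 'i='i]], erule conjE, rule that, assumption, assumption)
  \<comment> \<open>The threshold 1/5000 is dictated by \<open>class_centres\<close>; larger
    protrusions belong to boundedly many scales.\<close>
  have z: "0 < (1/5000::real)" "(1/5000::real) \<le> 4" by auto
  obtain C2 where C2: "0 < C2" and big: "\<forall>d T (I::'i set) m (y::'i \<Rightarrow> 'a) c r.
    tower d T I m y c r \<and> T \<le> 1 / 1920000 \<and> (\<forall>i\<in>I. far y c r i \<and> 1/5000 \<le> protrusion T y r i)
    \<longrightarrow> real (card I) \<le> C2 * T powr (- ((real DIM('a) - 1) / 2))"
    by (rule exE[OF tower_far_big_count[OF z, where 'i='i and 'a='a]], erule conjE, rule that, assumption, assumption)
  have small_ex: "\<exists>C>0. \<forall>d T (I::'i set) m (y::'i \<Rightarrow> 'a) c r.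
    tower d T I m y c r \<and> T \<le> 1 / 1920000 \<and> (\<forall>i\<in>I. far y c r i \<and> protrusion T y r i \<le> 1/5000)
    \<longrightarrow> real (card I) \<le> C * T powr (- ((real DIM('a) - 1) / 2))"
  proof (cases "DIM('a) = 2")
    case True
    obtain C where C: "0 < C" and small: "\<forall>d T (I::'i set) m (y::'i \<Rightarrow> 'a) c r.
      tower d T I m y c r \<and> T \<le> 1 / 1920000 \<and> (\<forall>i\<in>I. far y c r i \<and> protrusion T y r i \<le> 1/100)
      \<longrightarrow> real (card I) \<le> C * T powr (- ((real DIM('a) - 1) / 2))"
      by (rule exE[OF tower_far_small_count_dim2[OF True, where 'i='i]], erule conjE, rule that, assumption, assumption)
    show ?thesis
    proof (rule exI[of _ C], rule conjI, rule C, (rule allI)+, rule impI, elim conjE)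
      fix d T and I :: "'i set" and m and y :: "'i \<Rightarrow> 'a" and c r
      assume "tower d T I m y c r" "T \<le> 1 / 1920000" and f: "\<forall>i\<in>I. far y c r i \<and> protrusion T y r i \<le> 1/5000"
      moreover have "\<forall>i\<in>I. far y c r i \<and> protrusion T y r i \<le> 1/100" using f by fastforce
      ultimately show "real (card I) \<le> C * T powr (- ((real DIM('a) - 1) / 2))"
        using small[rule_format, of d T I m y c r] by blast
    qed
  next
    case False
    then have "3 \<le> DIM('a)" using dim by simp
    from tower_far_small_count_dim3[OF this, where 'i='i] show ?thesis .
  qed
  obtain C3 where C3: "0 < C3" and small: "\<forall>d T (I::'i set) m (y::'i \<Rightarrow> 'a) c r.
    tower d T I m y c r \<and> T \<le> 1 / 1920000 \<and> (\<forall>i\<in>I. far y c r i \<and> protrusion T y r i \<le> 1/5000)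
    \<longrightarrow> real (card I) \<le> C3 * T powr (- ((real DIM('a) - 1) / 2))"
    by (rule exE[OF small_ex], erule conjE, rule that, assumption, assumption)
  have C: "0 < C1 + C2 + C3" using C1 C2 C3 by simp
  show ?thesis
  proof (rule exI[of _ "C1 + C2 + C3"], rule conjI, rule C, (rule allI)+, rule impI, elim conjE)
    fix d T and I :: "'i set" and m and y :: "'i \<Rightarrow> 'a" and c r
    assume tw: "tower d T I m y c r" and T: "T \<le> 1 / 1920000"
    define I1 where "I1 = {i\<in>I. \<not> far y c r i}"
    define I2 where "I2 = {i\<in>I. far y c r i \<and> 1/5000 \<le> protrusion T y r i}"
    define I3 where "I3 = {i\<in>I. far y c r i \<and> protrusion T y r i \<le> 1/5000}"
    have sub: "I1 \<subseteq> I" "I2 \<subseteq> I" "I3 \<subseteq> I" by (auto simp: I1_def I2_def I3_def)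
    note tws = tower_subset[OF tw sub(1)] tower_subset[OF tw sub(2)] tower_subset[OF tw sub(3)]
    have "\<forall>i\<in>I1. (norm (y i))\<^sup>2 \<le> 4 * ((r i)\<^sup>2 - (norm (c i))\<^sup>2)" by (auto simp: I1_def far_def)
    then have 1: "real (card I1) \<le> C1 * T powr (- \<sigma>)"
      unfolding \<sigma>_def using near[rule_format, of d T I1 m y c r] tws(1) T by blast
    have "\<forall>i\<in>I2. far y c r i \<and> 1/5000 \<le> protrusion T y r i" by (simp add: I2_def)
    then have 2: "real (card I2) \<le> C2 * T powr (- \<sigma>)"
      unfolding \<sigma>_def using big[rule_format, of d T I2 m y c r] tws(2) T by blast
    have "\<forall>i\<in>I3. far y c r i \<and> protrusion T y r i \<le> 1/5000" by (simp add: I3_def)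
    then have 3: "real (card I3) \<le> C3 * T powr (- \<sigma>)"
      unfolding \<sigma>_def using small[rule_format, of d T I3 m y c r] tws(3) T by blast
    have "I = I1 \<union> (I2 \<union> I3)" by (auto simp: I1_def I2_def I3_def)
    then have "card I \<le> card I1 + card (I2 \<union> I3)" by (metis card_Un_le)
    also have "\<dots> \<le> card I1 + (card I2 + card I3)" using card_Un_le[of I2 I3] by simp
    finally have "real (card I) \<le> real (card I1) + real (card I2) + real (card I3)" by linarith
    also have "\<dots> \<le> (C1 + C2 + C3) * T powr (- \<sigma>)" using 1 2 3 by (simp add: algebra_simps)
    finally show "real (card I) \<le> (C1 + C2 + C3) * T powr (- ((real DIM('a) - 1) / 2))" by (simp add: \<sigma>_def)
  qed
qed

text \<open>For \<open>T\<close> bounded below the points themselves are separated: the two power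
  differences add up to \<open>2 * ((c i - c j) \<bullet> (y i - y j))\<close>, and the centres are
  bounded.\<close>

lemma one_scale_crude_count:
  fixes y :: "'i \<Rightarrow> 'a::euclidean_space"
  assumes os: "one_scale I y c r T" and T: "0 < T0" "T0 \<le> T" "T0 \<le> 1" and b: "\<And>i. i \<in> I \<Longrightarrow> norm (c i) \<le> 2"
  shows "real (card I) \<le> (192 / T0) ^ DIM('a)"
proof -
  have fin: "finite I" using os by (simp add: one_scale_def)
  have "real (card I) \<le> (3 * 4 / (T0/16)) ^ DIM('a)"
  proof (rule packing_card[OF fin, of 0 y])
    show "dist 0 (y i) \<le> 4" if "i \<in> I" for i
    proof -
      have "norm (y i - c i) \<le> 2" using os that unfolding one_scale_def by force
      then show ?thesis using b[OF that] norm_triangle_ineq[of "y i - c i" "c i"] by simp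
    qed
    fix i j assume ij: "i \<in> I" "j \<in> I" "i \<noteq> j"
    define p where "p i j = (norm (y i - c j))\<^sup>2 - (r j)\<^sup>2" for i j
    have 1: "p i i \<le> p i j" "p j j \<le> p j i" using os ij unfolding one_scale_def p_def by blast+
    have 2: "T / 2 \<le> p i j - p i i \<or> T / 2 \<le> p j i - p j j" using os ij unfolding one_scale_def p_def by blast
    have 3: "p i j - p i i + (p j i - p j j) = 2 * ((c i - c j) \<bullet> (y i - y j))"
      unfolding p_def power2_norm_eq_inner by (simp add: inner_simps inner_commute)
    have "T0 / 4 \<le> (c i - c j) \<bullet> (y i - y j)" using 1 2 3 T by argo
    also have "\<dots> \<le> norm (c i - c j) * norm (y i - y j)" by (rule norm_cauchy_schwarz)
    also have "\<dots> \<le> 4 * norm (y i - y j)"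
      using b[OF ij(1)] b[OF ij(2)] norm_triangle_ineq4[of "c i" "c j"] by (intro mult_right_mono) auto
    finally show "T0 / 16 \<le> dist (y i) (y j)" by (simp add: dist_norm)
  qed (use T in auto)
  then show ?thesis by simp
qed

text \<open>Each scale holds boundedly many balls, but there may be about log (1 / d) scales. No
  logarithm is lost: by \<open>tower_radius_ratio\<close> the quotient \<open>r k0 / (d * R)\<close>
  is bounded below, so the bound of a scale may be multiplied by its power \<sigma>, and these
  powers form a geometric sum.\<close>

lemma tower_crude_count:
  fixes T0 :: real
  assumes dim: "2 \<le> DIM('a::euclidean_space)" and T0: "0 < T0" "T0 \<le> 1"
  shows "\<exists>C>0. \<forall>d T (I::'i set) m (y::'i \<Rightarrow> 'a) c r.
    tower d T I m y c r \<and> T0 \<le> T \<longrightarrow> real (card I) \<le> C * d powr (- ((real DIM('a) - 1) / 2))"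
proof -
  define \<sigma> where "\<sigma> = (real DIM('a) - 1) / 2"
  have \<sigma>: "0 < \<sigma>" using dim by (simp add: \<sigma>_def)
  define K where "K = (192 / T0) ^ DIM('a)"
  have K: "0 < K" using T0 by (simp add: K_def)
  have q: "0 < 1 - 2 powr (- \<sigma>)" using \<sigma> powr_less_one[of 2 "-\<sigma>"] by simp
  define C where "C = K * ((5/2) powr \<sigma> * (2 powr \<sigma> / (1 - 2 powr (- \<sigma>))))"
  have C: "0 < C" using K q by (simp add: C_def)
  show ?thesis
  proof (rule exI[of _ C], rule conjI, rule C, (rule allI)+, rule impI, elim conjE)
    fix d T and I :: "'i set" and m and y :: "'i \<Rightarrow> 'a" and c r
    assume tw: "tower d T I m y c r" and T: "T0 \<le> T"
    show "real (card I) \<le> C * d powr (- ((real DIM('a) - 1) / 2))"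
    proof (cases "I = {}")
      case True then show ?thesis using C by simp
    next
      case False
      have fin: "finite I" and d0: "0 < d" by (rule towerD[OF tw])+
      obtain k0 where k0: "k0 \<in> I" "\<And>j. j \<in> I \<Longrightarrow> m k0 \<le> m j" by (rule tower_lowest[OF tw False], rule that)
      obtain k where k: "\<And>\<mu>. \<mu> \<in> m ` I \<Longrightarrow> k \<mu> \<in> I \<and> m (k \<mu>) = \<mu>"
        "\<And>i. i \<in> I \<Longrightarrow> r (k (m i)) \<le> r i \<and> r i \<le> 2 * r (k (m i))"
        by (rule tower_representatives[OF tw], rule that)
      have fibre: "real (card {i\<in>I. m i = \<mu>}) \<le> K * ((5/2) powr \<sigma> * d powr (-\<sigma>)) * (r k0 / r (k \<mu>)) powr \<sigma>"
        if mu: "\<mu> \<in> m ` I" for \<mu>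
      proof -
        define L where "L = {i\<in>I. m i = \<mu>}"
        define R where "R = r (k \<mu>)"
        have Kk: "k \<mu> \<in> I" using k(1)[OF mu] by auto
        have R: "0 < R" unfolding R_def by (rule towerD(8)[OF tw Kk])
        have r0: "0 < r k0" by (rule towerD(8)[OF tw k0(1)])
        have twL: "tower d T L m y c r" by (rule tower_subset[OF tw]) (auto simp: L_def)
        have rL: "R \<le> r i \<and> r i \<le> 2 * R" if "i \<in> L" for i using k(2)[of i] that by (auto simp: L_def R_def)
        have "one_scale L (\<lambda>i. y i /\<^sub>R R) (\<lambda>i. c i /\<^sub>R R) (\<lambda>i. r i / R) T"
          by (rule tower_one_scale[OF twL R]) (use rL in \<open>auto simp: L_def\<close>)
        then have "real (card L) \<le> K" unfolding K_def
        proof (rule one_scale_crude_count)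
          fix i assume i: "i \<in> L"
          have "norm (c i) \<le> 2 * R" using towerD(6)[OF twL i] rL[OF i] by linarith
          then show "norm (c i /\<^sub>R R) \<le> 2" using R by (simp add: field_simps)
        qed (use T0 T in auto)
        also have "K = K * 1 powr \<sigma>" by simp
        also have "\<dots> \<le> K * (5/2 * (r k0 / R) / d) powr \<sigma>"
        proof -
          have "d * R \<le> 5/2 * r k0" unfolding R_def by (rule tower_radius_ratio[OF tw k0 Kk])
          then have "1 \<le> 5/2 * (r k0 / R) / d" using R d0 by (simp add: field_simps)
          then show ?thesis using K \<sigma> by (intro mult_left_mono powr_mono2) auto
        qed
        also have "(5/2 * (r k0 / R) / d) powr \<sigma> = (5/2) powr \<sigma> * (r k0 / R) powr \<sigma> * d powr (-\<sigma>)"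
        proof -
          have "(5/2 * (r k0 / R) / d) powr \<sigma> = (5/2 * (r k0 / R)) powr \<sigma> / d powr \<sigma>"
            using R r0 d0 by (intro powr_divide)
          also have "(5/2 * (r k0 / R)) powr \<sigma> = (5/2) powr \<sigma> * (r k0 / R) powr \<sigma>"
            using R r0 by (intro powr_mult)
          finally show ?thesis by (simp add: powr_minus_divide)
        qed
        finally show ?thesis by (simp add: L_def R_def mult_ac)
      qed
      have "real (card I) = (\<Sum>\<mu>\<in>m ` I. real (card {i\<in>I. m i = \<mu>}))" by (rule card_eq_sum_fibres[OF fin])
      also have "\<dots> \<le> (\<Sum>\<mu>\<in>m ` I. K * ((5/2) powr \<sigma> * d powr (-\<sigma>)) * (r k0 / r (k \<mu>)) powr \<sigma>)"
        by (rule sum_mono) (rule fibre)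
      also have "\<dots> = K * ((5/2) powr \<sigma> * d powr (-\<sigma>)) * (\<Sum>\<mu>\<in>m ` I. (r k0 / r (k \<mu>)) powr \<sigma>)"
        by (rule sum_distrib_left[symmetric])
      also have "\<dots> \<le> K * ((5/2) powr \<sigma> * d powr (-\<sigma>)) * (2 powr \<sigma> / (1 - 2 powr (- \<sigma>)))"
        using tower_radii_lacunary[OF tw k0 k(1) \<sigma>] K by (intro mult_left_mono) auto
      also have "\<dots> = C * d powr (-\<sigma>)" by (simp add: C_def)
      finally show ?thesis by (simp add: \<sigma>_def)
    qed
  qed
qed

text \<open>Sorting the indices by relative depth into levels \<open>2 ^ l * d\<close> makes a tower
  of each level. For small \<open>T\<close> the bounds \<open>T powr (- \<sigma>)\<close> sum to a
  multiple of the one for \<open>T = d\<close>; above the fixed threshold \<open>T0\<close> only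
  boundedly many levels occur, since relative depths are at most 1.\<close>

lemma overlap_count:
  assumes dim: "2 \<le> DIM('a::euclidean_space)"
  shows "\<exists>C>0. \<forall>d (I::'i set) (m::'i \<Rightarrow> int) (y::'i \<Rightarrow> 'a) c r.
    finite I \<and> 0 < d \<and> d \<le> 1/4 \<and>
    (\<forall>i\<in>I. norm (c i) < r i \<and> norm (y i - c i) < r i) \<and>
    (\<forall>i\<in>I. \<forall>j\<in>I. m i < m j \<longrightarrow> 64 * r i \<le> r j \<and> (1 + d) * r j \<le> norm (y i - c j)) \<and>
    (\<forall>i\<in>I. \<forall>j\<in>I. m i = m j \<longrightarrow> r i \<le> 2 * r j \<and>
       (norm (y i - c i))\<^sup>2 - (r i)\<^sup>2 \<le> (norm (y i - c j))\<^sup>2 - (r j)\<^sup>2) \<and>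
    (\<forall>i\<in>I. \<forall>j\<in>I. m i = m j \<longrightarrow> i \<noteq> j \<longrightarrow>
       (1 + d) * r j \<le> norm (y i - c j) \<or> (1 + d) * r i \<le> norm (y j - c i))
    \<longrightarrow> real (card I) \<le> C * d powr (- ((real DIM('a) - 1) / 2))"
proof -
  define \<sigma> where "\<sigma> = (real DIM('a) - 1) / 2"
  have \<sigma>: "0 < \<sigma>" using dim by (simp add: \<sigma>_def)
  have q: "0 < 1 - 2 powr (- \<sigma>)" using \<sigma> powr_less_one[of 2 "-\<sigma>"] by simp
  define T0 :: real where "T0 = 1/1920000"
  have T0: "0 < T0" "T0 \<le> 1" by (auto simp: T0_def)
  obtain C1 where C1: "0 < C1" and small: "\<forall>d T (I::'i set) (m::'i \<Rightarrow> int) (y::'i \<Rightarrow> 'a) c r.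
    tower d T I m y c r \<and> T \<le> 1/1920000 \<longrightarrow> real (card I) \<le> C1 * T powr (- ((real DIM('a) - 1) / 2))"
    by (rule exE[OF tower_count[OF dim, where 'i='i]], erule conjE, rule that, assumption, assumption)
  obtain C2 where C2: "0 < C2" and large: "\<forall>d T (I::'i set) (m::'i \<Rightarrow> int) (y::'i \<Rightarrow> 'a) c r.
    tower d T I m y c r \<and> T0 \<le> T \<longrightarrow> real (card I) \<le> C2 * d powr (- ((real DIM('a) - 1) / 2))"
    by (rule exE[OF tower_crude_count[OF dim T0, where 'i='i]], erule conjE, rule that, assumption, assumption)
  define C where "C = C1 / (1 - 2 powr (- \<sigma>)) + C2 * (4 / T0)"
  have C: "0 < C" using C1 C2 q T0 by (simp add: C_def add_pos_pos)
  show ?thesis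
  proof (rule exI[of _ C], rule conjI, rule C, (rule allI)+, rule impI, elim conjE)
    fix d and I :: "'i set" and m :: "'i \<Rightarrow> int" and y :: "'i \<Rightarrow> 'a" and c r
    assume fin: "finite I" and d: "0 < d" "d \<le> 1/4"
      and h1: "\<forall>i\<in>I. norm (c i) < r i \<and> norm (y i - c i) < r i"
      and h2: "\<forall>i\<in>I. \<forall>j\<in>I. m i < m j \<longrightarrow> 64 * r i \<le> r j \<and> (1 + d) * r j \<le> norm (y i - c j)"
      and h3: "\<forall>i\<in>I. \<forall>j\<in>I. m i = m j \<longrightarrow> r i \<le> 2 * r j \<and>
       (norm (y i - c i))\<^sup>2 - (r i)\<^sup>2 \<le> (norm (y i - c j))\<^sup>2 - (r j)\<^sup>2"
      and h4: "\<forall>i\<in>I. \<forall>j\<in>I. m i = m j \<longrightarrow> i \<noteq> j \<longrightarrow>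
       (1 + d) * r j \<le> norm (y i - c j) \<or> (1 + d) * r i \<le> norm (y j - c i)"
    define t where "t i = ((r i)\<^sup>2 - (norm (y i - c i))\<^sup>2) / (r i)\<^sup>2" for i
    have r0: "0 < r i" if "i \<in> I" for i using h1 that norm_ge_zero[of "c i"] by (meson le_less_trans)
    have t1: "t i \<le> 1" if "i \<in> I" for i using r0[OF that] by (simp add: t_def)
    \<comment> \<open>Level 0 takes all depths up to \<open>d\<close> without a lower bound, which
      is the case \<open>T = d\<close> in \<open>tower\<close>.\<close>
    define l where "l i = (LEAST l::nat. t i \<le> 2 ^ l * d)" for i
    define T where "T l = 2 ^ l * d" for l :: nat
    have l: "t i \<le> T (l i)" "l i = 0 \<or> T (l i) / 2 < t i" if "i \<in> I" for i
    proof -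
      obtain n :: nat where "1 / d < 2 ^ n" using real_arch_pow[of 2 "1/d"] by auto
      then have "t i \<le> 2 ^ n * d" using t1[OF that] d by (simp add: field_simps)
      then show "t i \<le> T (l i)" unfolding l_def T_def by (rule LeastI)
      show "l i = 0 \<or> T (l i) / 2 < t i"
      proof (cases "l i")
        case (Suc k)
        then have "k < l i" by simp
        then have "\<not> t i \<le> 2 ^ k * d" unfolding l_def by (rule not_less_Least)
        then show ?thesis by (simp add: T_def Suc)
      qed simp
    qed
    have T_pos: "0 < T l" for l using d by (simp add: T_def)
    have T_le: "T (l i) \<le> 2" if "i \<in> I" for i
      using l(2)[OF that]
    proof
      assume "l i = 0" then show ?thesis using d by (simp add: T_def)
    next
      assume "T (l i) / 2 < t i" then show ?thesis using t1[OF that] by linarith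
    qed
    have tw: "tower d (T k) {i\<in>I. l i = k} m y c r" for k
    proof -
      have "1 * d \<le> 2 ^ k * d" using d by (intro mult_right_mono) auto
      moreover have "(r i)\<^sup>2 - (norm (y i - c i))\<^sup>2 \<le> T k * (r i)\<^sup>2 \<and>
         (T k = d \<or> T k / 2 * (r i)\<^sup>2 \<le> (r i)\<^sup>2 - (norm (y i - c i))\<^sup>2)" if i: "i \<in> I" "l i = k" for i
      proof -
        have r2: "0 < (r i)\<^sup>2" using r0[OF i(1)] by simp
        have eq: "(r i)\<^sup>2 - (norm (y i - c i))\<^sup>2 = t i * (r i)\<^sup>2" using r2 by (simp add: t_def)
        have "t i \<le> T k" "k = 0 \<or> T k / 2 < t i" using l[OF i(1)] i(2) by auto
        then show ?thesis unfolding eq using r2 by (auto simp: T_def)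
      qed
      ultimately show ?thesis unfolding tower_def T_def[of k]
        using fin d h1 h2 h3 h4 by (simp add: T_def)
    qed
    have lac: "2 * T a \<le> T b" if "a < b" for a b :: nat
    proof -
      have "(2::real) ^ Suc a \<le> 2 ^ b" using that by (intro power_increasing) auto
      then show ?thesis using d by (simp add: T_def)
    qed
    have lac1: "2 * T a \<le> T b \<or> 2 * T b \<le> T a" if "a \<noteq> b" for a b :: nat
      using lac[of a b] lac[of b a] that by linarith
    \<comment> \<open>Above the threshold the factor \<open>T k / T0\<close> is at least 1; it is
      inserted to make the bound summable over all levels.\<close>
    have fibre: "real (card {i\<in>I. l i = k}) \<le> C1 * (1 / T k) powr \<sigma> + C2 * d powr (-\<sigma>) / T0 * T k powr 1" for k
    proof (cases "T k \<le> T0")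
      case True
      then have "real (card {i\<in>I. l i = k}) \<le> C1 * T k powr (- \<sigma>)"
        using small[rule_format, of d "T k" "{i\<in>I. l i = k}" m y c r] tw unfolding \<sigma>_def T0_def by blast
      also have "T k powr (- \<sigma>) = (1 / T k) powr \<sigma>" using T_pos[of k] by (simp add: powr_divide powr_minus_divide)
      finally show ?thesis using C2 T0 T_pos[of k] by (simp add: add_increasing2)
    next
      case False
      then have "T0 \<le> T k" by simp
      then have "real (card {i\<in>I. l i = k}) \<le> C2 * d powr (- \<sigma>)"
        using large[rule_format, of d "T k" "{i\<in>I. l i = k}" m y c r] tw unfolding \<sigma>_def by blast
      also have "\<dots> = (C2 * d powr (-\<sigma>) / T0) * T0" using T0 by simp
      also have "\<dots> \<le> (C2 * d powr (-\<sigma>) / T0) * T k" using \<open>T0 \<le> T k\<close> C2 T0 by (intro mult_left_mono) auto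
      finally show ?thesis using C1 T_pos[of k] by (simp add: add_increasing)
    qed
    have s1: "(\<Sum>k\<in>l ` I. (1 / T k) powr \<sigma>) \<le> (1 / d) powr \<sigma> / (1 - 2 powr (- \<sigma>))"
    proof (rule sum_lacunary_powr_le)
      show "1 / T k \<le> 1 / d" for k
      proof -
        have "1 * d \<le> T k" unfolding T_def using d by (intro mult_right_mono) auto
        then show ?thesis using d by (intro divide_left_mono) auto
      qed
      show "2 * (1 / T a) \<le> 1 / T b \<or> 2 * (1 / T b) \<le> 1 / T a" if "a \<in> l ` I" "b \<in> l ` I" "a \<noteq> b" for a b
        using lac1[OF that(3)] T_pos[of a] T_pos[of b] by (auto simp: field_simps)
    qed (use fin \<sigma> d T_pos in auto)
    have s2: "(\<Sum>k\<in>l ` I. T k powr 1) \<le> 2 powr 1 / (1 - 2 powr (- 1))"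
      by (rule sum_lacunary_powr_le) (use fin T_pos T_le lac1 in auto)
    have "real (card I) = (\<Sum>k\<in>l ` I. real (card {i\<in>I. l i = k}))" by (rule card_eq_sum_fibres[OF fin])
    also have "\<dots> \<le> (\<Sum>k\<in>l ` I. C1 * (1 / T k) powr \<sigma> + C2 * d powr (-\<sigma>) / T0 * T k powr 1)"
      by (rule sum_mono) (rule fibre)
    also have "\<dots> = C1 * (\<Sum>k\<in>l ` I. (1 / T k) powr \<sigma>) + C2 * d powr (-\<sigma>) / T0 * (\<Sum>k\<in>l ` I. T k powr 1)"
      by (simp only: sum.distrib sum_distrib_left)
    also have "\<dots> \<le> C1 * ((1 / d) powr \<sigma> / (1 - 2 powr (- \<sigma>))) + C2 * d powr (-\<sigma>) / T0 * (2 powr 1 / (1 - 2 powr (- 1)))"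
      using s1 s2 C1 C2 T0 by (intro add_mono mult_left_mono) auto
    also have "\<dots> = C * d powr (-\<sigma>)"
      using d by (simp add: C_def powr_divide powr_minus_divide algebra_simps)
    finally show "real (card I) \<le> C * d powr (- ((real DIM('a) - 1) / 2))" by (simp add: \<sigma>_def)
  qed
qed

text \<open>The ball \<open>B y\<close> is attached to each point beforehand, not in the course of
  the selection, and the induction runs over the number of attached balls: every point with the ball
  of the selected \<open>e\<close> lies in \<open>N (B e)\<close>, so this ball disappears. Since
  \<open>e\<close> has the largest rank, all later points avoid the dilates of the larger
  balls.\<close>

lemma greedy_selection:
  fixes B :: "'y \<Rightarrow> 'b" and rk :: "'b \<Rightarrow> int"
  assumes "finite (B ` E)" and "\<And>y. y \<in> E \<Longrightarrow> y \<in> N (B y)"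
  shows "\<exists>S\<subseteq>E. finite S \<and> inj_on B S \<and> E \<subseteq> (\<Union>s\<in>S. N (B s)) \<and>
    (\<forall>s\<in>S. \<forall>t\<in>S. rk (B s) < rk (B t) \<longrightarrow> s \<notin> N (B t)) \<and>
    (\<forall>s\<in>S. \<forall>t\<in>S. s \<noteq> t \<longrightarrow> s \<notin> N (B t) \<or> t \<notin> N (B s))"
  using assms
proof (induction "card (B ` E)" arbitrary: E rule: less_induct)
  case less
  show ?case
  proof (cases "E = {}")
    case True then show ?thesis by auto
  next
    case False
    have "Max (rk ` B ` E) \<in> rk ` B ` E" using less(2) False by (intro Max_in) auto
    then obtain e where e: "e \<in> E" "rk (B e) = Max (rk ` B ` E)" by auto
    have emax: "rk (B x) \<le> rk (B e)" if "x \<in> E" for x using that less(2) e(2) by simp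
    define E' where "E' = {x\<in>E. x \<notin> N (B e)}"
    have "B x \<noteq> B e" if "x \<in> E'" for x using less(3)[of x] that by (auto simp: E'_def)
    then have sub: "B ` E' \<subseteq> B ` E - {B e}" by (auto simp: E'_def)
    have "card (B ` E') < card (B ` E)"
      by (rule psubset_card_mono[OF less(2)]) (use sub e(1) in blast)
    moreover have "finite (B ` E')" using sub less(2) finite_subset by blast
    moreover have "\<And>y. y \<in> E' \<Longrightarrow> y \<in> N (B y)" using less(3) by (simp add: E'_def)
    ultimately have "\<exists>S\<subseteq>E'. finite S \<and> inj_on B S \<and> E' \<subseteq> (\<Union>s\<in>S. N (B s)) \<and>
      (\<forall>s\<in>S. \<forall>t\<in>S. rk (B s) < rk (B t) \<longrightarrow> s \<notin> N (B t)) \<and>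
      (\<forall>s\<in>S. \<forall>t\<in>S. s \<noteq> t \<longrightarrow> s \<notin> N (B t) \<or> t \<notin> N (B s))"
      by (rule less(1))
    then obtain S where S: "S \<subseteq> E'" "finite S" "inj_on B S" "E' \<subseteq> (\<Union>s\<in>S. N (B s))"
      "\<And>s t. s \<in> S \<Longrightarrow> t \<in> S \<Longrightarrow> rk (B s) < rk (B t) \<Longrightarrow> s \<notin> N (B t)"
      "\<And>s t. s \<in> S \<Longrightarrow> t \<in> S \<Longrightarrow> s \<noteq> t \<Longrightarrow> s \<notin> N (B t) \<or> t \<notin> N (B s)" by auto
    have SE: "x \<in> E" "x \<notin> N (B e)" if "x \<in> S" for x using S(1) that by (auto simp: E'_def)
    have Bne: "B x \<noteq> B e" if "x \<in> S" for x using SE[OF that] less(3) by metis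
    show ?thesis
    proof (intro exI[of _ "insert e S"] conjI ballI impI)
      show "insert e S \<subseteq> E" using SE e by auto
      show "finite (insert e S)" using S(2) by simp
      have "B e \<notin> B ` S"
      proof
        assume "B e \<in> B ` S"
        then obtain x where x: "B e = B x" "x \<in> S" by (rule imageE)
        with Bne[OF x(2)] show False by simp
      qed
      then show "inj_on B (insert e S)" using S(3) by (auto simp: inj_on_insert)
      show "E \<subseteq> (\<Union>s\<in>insert e S. N (B s))" using S(4) by (auto simp: E'_def)
      show "s \<notin> N (B t)" if "s \<in> insert e S" "t \<in> insert e S" "rk (B s) < rk (B t)" for s t
        using that S(5) SE emax by (metis insert_iff less_le_not_le)
      show "s \<notin> N (B t) \<or> t \<notin> N (B s)" if "s \<in> insert e S" "t \<in> insert e S" "s \<noteq> t" for s t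
        using that S(6) SE by blast
    qed
  qed
qed

theorem covering_bounded_overlap:
  assumes dim: "2 \<le> DIM('a::euclidean_space)"
  shows "\<exists>C>0. \<forall>d (F :: ('a \<times> real) set) K. 0 < d \<and> d \<le> 1/4 \<and> finite F \<and> (\<forall>b\<in>F. 0 < snd b) \<and>
     K \<subseteq> (\<Union>b\<in>F. ball (fst b) (snd b)) \<longrightarrow>
     (\<exists>G\<subseteq>F. K \<subseteq> (\<Union>b\<in>G. ball (fst b) ((1 + d) * snd b)) \<and>
       (\<forall>p. real (card {b\<in>G. p \<in> ball (fst b) (snd b)}) \<le> C * d powr (- ((real DIM('a) - 1) / 2))))"
proof -
  obtain C where C: "0 < C" and count: "\<forall>d (I::'a set) (m::'a \<Rightarrow> int) (y::'a \<Rightarrow> 'a) c r.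
    finite I \<and> 0 < d \<and> d \<le> 1/4 \<and>
    (\<forall>i\<in>I. norm (c i) < r i \<and> norm (y i - c i) < r i) \<and>
    (\<forall>i\<in>I. \<forall>j\<in>I. m i < m j \<longrightarrow> 64 * r i \<le> r j \<and> (1 + d) * r j \<le> norm (y i - c j)) \<and>
    (\<forall>i\<in>I. \<forall>j\<in>I. m i = m j \<longrightarrow> r i \<le> 2 * r j \<and>
       (norm (y i - c i))\<^sup>2 - (r i)\<^sup>2 \<le> (norm (y i - c j))\<^sup>2 - (r j)\<^sup>2) \<and>
    (\<forall>i\<in>I. \<forall>j\<in>I. m i = m j \<longrightarrow> i \<noteq> j \<longrightarrow>
       (1 + d) * r j \<le> norm (y i - c j) \<or> (1 + d) * r i \<le> norm (y j - c i))
    \<longrightarrow> real (card I) \<le> C * d powr (- ((real DIM('a) - 1) / 2))"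
    by (rule exE[OF overlap_count[OF dim, where 'i='a]], erule conjE, rule that, assumption, assumption)
  have C7: "0 < 7 * C" using C by simp
  show ?thesis
  proof (rule exI[of _ "7 * C"], rule conjI, rule C7, (rule allI)+, rule impI, elim conjE)
    fix d :: real and F :: "('a \<times> real) set" and K
    assume d: "0 < d" "d \<le> 1/4" and fin: "finite F" and pos: "\<forall>b\<in>F. 0 < snd b"
      and K: "K \<subseteq> (\<Union>b\<in>F. ball (fst b) (snd b))"
    define sc where "sc b = \<lfloor>log 2 (snd b)\<rfloor>" for b :: "'a \<times> real"
    have sc: "2 powr real_of_int (sc b) \<le> snd b" "snd b < 2 * 2 powr real_of_int (sc b)" if "b \<in> F" for b
    proof -
      have p: "0 < snd b" using pos that by auto
      have iff: "(v \<le> log 2 (snd b)) = (2 powr v \<le> snd b)" "(log 2 (snd b) < v) = (snd b < 2 powr v)" for v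
        using le_log_iff[of 2 "snd b" v] log_less_iff[of 2 "snd b" v] p by simp_all
      have "real_of_int (sc b) \<le> log 2 (snd b)" by (simp add: sc_def)
      then show "2 powr real_of_int (sc b) \<le> snd b" by (simp only: iff)
      have "log 2 (snd b) < real_of_int (sc b) + 1" unfolding sc_def by linarith
      then have "snd b < 2 powr (real_of_int (sc b) + 1)" by (simp only: iff)
      then show "snd b < 2 * 2 powr real_of_int (sc b)" by (simp add: powr_add mult.commute)
    qed
    define P where "P b y = (norm (y - fst b))\<^sup>2 - (snd b)\<^sup>2" for b :: "'a \<times> real" and y
    \<comment> \<open>The largest scale with a ball containing \<open>y\<close> is the one that
      counts. The least power is taken over all balls of this scale, including those that miss
      \<open>y\<close>, so that minimality holds against every competitor; as some ball of the scale
      contains \<open>y\<close>, the least power is negative and the chosen ball contains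
      \<open>y\<close> too.\<close>
    define mu where "mu y = Max (sc ` {b\<in>F. y \<in> ball (fst b) (snd b)})" for y
    have "\<exists>b. b \<in> F \<and> sc b = mu y \<and> y \<in> ball (fst b) (snd b) \<and> (\<forall>b'\<in>F. sc b' = mu y \<longrightarrow> P b y \<le> P b' y)"
      if y: "y \<in> K" for y
    proof -
      obtain b1 where "b1 \<in> F" "y \<in> ball (fst b1) (snd b1)" using subsetD[OF K y] by (rule UN_E)
      have "mu y \<in> sc ` {b\<in>F. y \<in> ball (fst b) (snd b)}" unfolding mu_def
      proof (rule Max_in)
        show "finite (sc ` {b\<in>F. y \<in> ball (fst b) (snd b)})" using fin by simp
        show "sc ` {b\<in>F. y \<in> ball (fst b) (snd b)} \<noteq> {}" using \<open>b1 \<in> F\<close> \<open>y \<in> ball (fst b1) (snd b1)\<close> by blast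
      qed
      then obtain b0 where b0: "b0 \<in> F" "y \<in> ball (fst b0) (snd b0)" "sc b0 = mu y" by auto
      have "b0 \<in> {b\<in>F. sc b = mu y}" "finite {b\<in>F. sc b = mu y}" using b0(1,3) fin by simp_all
      then have "\<exists>b\<in>{b\<in>F. sc b = mu y}. \<forall>i\<in>{b\<in>F. sc b = mu y}. P b y \<le> P i y"
        by (intro exists_min_radius) fast+
      then obtain b where b': "b \<in> {b\<in>F. sc b = mu y}" "\<forall>i\<in>{b\<in>F. sc b = mu y}. P b y \<le> P i y" by (rule bexE)
      have b: "b \<in> F" "sc b = mu y" using b'(1) by simp_all
      have bmin: "P b y \<le> P b1 y" if "b1 \<in> F" "sc b1 = mu y" for b1 by (rule bspec[OF b'(2)]) (use that in simp)
      have "norm (y - fst b0) < snd b0" using b0(2) by (simp add: dist_norm norm_minus_commute)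
      then have "(norm (y - fst b0))\<^sup>2 < (snd b0)\<^sup>2" by (intro power_strict_mono) auto
      then have "P b y < 0" using bmin[OF b0(1,3)] by (simp add: P_def)
      then have "(norm (y - fst b))\<^sup>2 < (snd b)\<^sup>2" by (simp add: P_def)
      then have "norm (y - fst b) < snd b"
        using less_imp_le[OF bspec[OF pos b(1)]] by (rule power_less_imp_less_base)
      then have "y \<in> ball (fst b) (snd b)" by (simp add: dist_norm norm_minus_commute)
      then show ?thesis using b bmin by (intro exI[of _ b] conjI ballI impI)
    qed
    then have "\<forall>y\<in>K. \<exists>b. b \<in> F \<and> sc b = mu y \<and> y \<in> ball (fst b) (snd b) \<and> (\<forall>b'\<in>F. sc b' = mu y \<longrightarrow> P b y \<le> P b' y)"
      by (rule ballI)
    from bchoice[OF this] obtain B where B: "\<forall>y\<in>K. B y \<in> F \<and> sc (B y) = mu y \<and> y \<in> ball (fst (B y)) (snd (B y)) \<and>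
      (\<forall>b'\<in>F. sc b' = mu y \<longrightarrow> P (B y) y \<le> P b' y)" by (rule exE)
    have BF: "B y \<in> F" and Bsc: "sc (B y) = mu y" and Bball: "y \<in> ball (fst (B y)) (snd (B y))"
      and Bmin: "\<And>b'. b' \<in> F \<Longrightarrow> sc b' = mu y \<Longrightarrow> P (B y) y \<le> P b' y" if "y \<in> K" for y
    proof -
      note h = bspec[OF B that] and h1 = conjunct2[OF bspec[OF B that]]
      show "B y \<in> F" "sc (B y) = mu y" "y \<in> ball (fst (B y)) (snd (B y))"
        by (rule conjunct1[OF h] conjunct1[OF h1] conjunct1[OF conjunct2[OF h1]])+
      show "P (B y) y \<le> P b' y" if "b' \<in> F" "sc b' = mu y" for b'
        by (rule mp[OF bspec[OF conjunct2[OF conjunct2[OF h1]] that(1)] that(2)])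
    qed
    define N where "N b = ball (fst b) ((1 + d) * snd b)" for b :: "'a \<times> real"
    have NB: "y \<in> N (B y)" if "y \<in> K" for y
    proof -
      have "0 < snd (B y)" by (rule bspec[OF pos BF[OF that]])
      then have "1 * snd (B y) \<le> (1 + d) * snd (B y)" using d by (intro mult_right_mono) auto
      then show ?thesis using Bball[OF that] by (simp add: N_def)
    qed
    have "finite (B ` K)" by (rule finite_subset[OF _ fin]) (use BF in blast)
    from greedy_selection[OF this NB, where rk = sc]
    obtain S where S: "S \<subseteq> K" "finite S" "inj_on B S" "K \<subseteq> (\<Union>s\<in>S. N (B s))"
      "\<And>s t. s \<in> S \<Longrightarrow> t \<in> S \<Longrightarrow> sc (B s) < sc (B t) \<Longrightarrow> s \<notin> N (B t)"
      "\<And>s t. s \<in> S \<Longrightarrow> t \<in> S \<Longrightarrow> s \<noteq> t \<Longrightarrow> s \<notin> N (B t) \<or> t \<notin> N (B s)" by blast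
    show "\<exists>G\<subseteq>F. K \<subseteq> (\<Union>b\<in>G. ball (fst b) ((1 + d) * snd b)) \<and>
       (\<forall>p. real (card {b\<in>G. p \<in> ball (fst b) (snd b)}) \<le> 7 * C * d powr (- ((real DIM('a) - 1) / 2)))"
    proof (intro exI[of _ "B ` S"] conjI allI)
      show "B ` S \<subseteq> F" using BF S(1) by blast
      show "K \<subseteq> (\<Union>b\<in>B ` S. ball (fst b) ((1 + d) * snd b))" using S(4) by (simp add: N_def)
      fix p
      define I where "I = {s\<in>S. p \<in> ball (fst (B s)) (snd (B s))}"
      define m where "m s = sc (B s)" for s
      have finI: "finite I" using S(2) by (simp add: I_def)
      \<comment> \<open>Radii of neighbouring dyadic scales may nearly coincide. Different scales in
        one residue class modulo 7 have radii with ratio at least \<open>2 ^ 7 / 2 = 64\<close>, as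
        the overlap count demands. Translation moves \<open>p\<close> to the origin.\<close>
      have fibre: "real (card {s\<in>I. m s mod 7 = k}) \<le> C * d powr (- ((real DIM('a) - 1) / 2))" for k
      proof (rule count[rule_format, of "{s\<in>I. m s mod 7 = k}" d "\<lambda>s. fst (B s) - p" "\<lambda>s. snd (B s)" "\<lambda>s. s - p" m],
          intro conjI ballI impI)
        fix s assume s: "s \<in> {s\<in>I. m s mod 7 = k}"
        then have sI: "s \<in> S" "s \<in> K" "p \<in> ball (fst (B s)) (snd (B s))" "m s mod 7 = k" using S(1) by (auto simp: I_def)
        show "norm (fst (B s) - p) < snd (B s)" using sI(3) by (simp add: dist_norm)
        show "norm ((s - p) - (fst (B s) - p)) < snd (B s)" using Bball[OF sI(2)] by (simp add: dist_norm norm_minus_commute)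
        fix t assume t: "t \<in> {s\<in>I. m s mod 7 = k}"
        then have tI: "t \<in> S" "t \<in> K" "m t mod 7 = k" using S(1) by (auto simp: I_def)
        have F: "B s \<in> F" "B t \<in> F" using BF sI tI by blast+
        have out: "(1 + d) * snd (B b) \<le> norm ((a - p) - (fst (B b) - p))" if "a \<notin> N (B b)" for a b
          using that by (simp add: N_def dist_norm norm_minus_commute)
        {
          assume lt: "m s < m t"
          then show "(1 + d) * snd (B t) \<le> norm ((s - p) - (fst (B t) - p))"
            using S(5)[OF sI(1) tI(1)] by (intro out) (simp add: m_def)
          have "m s + 7 \<le> m t" using lt sI(4) tI(3) by presburger
          then have "2 powr (real_of_int (m s) + 7) \<le> 2 powr real_of_int (m t)" by (intro powr_mono) auto
          then have "128 * 2 powr real_of_int (m s) \<le> 2 powr real_of_int (m t)" by (simp add: powr_add)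
          then show "64 * snd (B s) \<le> snd (B t)" using sc[OF F(1)] sc[OF F(2)] by (simp add: m_def)
        next
          assume eq: "m s = m t"
          show "snd (B s) \<le> 2 * snd (B t)" using sc[OF F(1)] sc[OF F(2)] eq by (simp add: m_def)
          have "P (B s) s \<le> P (B t) s" using Bsc[OF sI(2)] eq by (intro Bmin[OF sI(2) F(2)]) (simp add: m_def)
          then show "(norm ((s - p) - (fst (B s) - p)))\<^sup>2 - (snd (B s))\<^sup>2 \<le> (norm ((s - p) - (fst (B t) - p)))\<^sup>2 - (snd (B t))\<^sup>2"
            by (simp add: P_def)
          assume "s \<noteq> t"
          then show "(1 + d) * snd (B t) \<le> norm ((s - p) - (fst (B t) - p)) \<or> (1 + d) * snd (B s) \<le> norm ((t - p) - (fst (B s) - p))"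
            using S(6)[OF sI(1) tI(1)] out by blast
        }
      qed (use finI d in auto)
      have "{b\<in>B ` S. p \<in> ball (fst b) (snd b)} = B ` I" by (auto simp: I_def)
      then have "real (card {b\<in>B ` S. p \<in> ball (fst b) (snd b)}) \<le> real (card I)" using card_image_le[OF finI] by simp
      also have "\<dots> = (\<Sum>k\<in>(\<lambda>s. m s mod 7) ` I. real (card {s\<in>I. m s mod 7 = k}))" by (rule card_eq_sum_fibres[OF finI])
      also have "\<dots> \<le> (\<Sum>k\<in>{0..6::int}. real (card {s\<in>I. m s mod 7 = k}))"
        by (rule sum_mono2) auto
      also have "\<dots> \<le> (\<Sum>k\<in>{0..6::int}. C * d powr (- ((real DIM('a) - 1) / 2)))" by (rule sum_mono) (rule fibre)
      also have "\<dots> = 7 * C * d powr (- ((real DIM('a) - 1) / 2))" by simp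
      finally show "real (card {b\<in>B ` S. p \<in> ball (fst b) (snd b)}) \<le> 7 * C * d powr (- ((real DIM('a) - 1) / 2))" .
    qed
  qed
qed

section \<open>Weak and strong type with two weights\<close>

lemma radon_measureD:
  assumes "radon_measure \<mu>"
  shows "sets \<mu> = sets borel" and "bounded A \<Longrightarrow> A \<in> sets borel \<Longrightarrow> emeasure \<mu> A < \<infinity>"
proof -
  show s: "sets \<mu> = sets borel" using assms by (simp add: radon_measure_def)
  assume "bounded A" "A \<in> sets borel"
  then have "compact (closure A)" by (simp add: compact_closure)
  then have "emeasure \<mu> (closure A) < \<infinity>" using assms unfolding radon_measure_def by blast
  moreover have "emeasure \<mu> A \<le> emeasure \<mu> (closure A)"
    by (rule emeasure_mono[OF closure_subset]) (simp add: s)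
  ultimately show "emeasure \<mu> A < \<infinity>" by (rule le_less_trans[rotated])
qed

lemma average_le_maximal_op:
  assumes "0 < r" "x \<in> ball c r"
  shows "(\<integral>\<^sup>+y\<in>ball c r. ennreal \<bar>f y\<bar> \<partial>\<mu>) / emeasure \<mu> (ball c (k * r)) \<le> maximal_op k \<mu> f x"
  unfolding maximal_op_def by (rule SUP_upper2[of "(c, r)"]) (use assms in auto)

lemma maximal_op_le:
  assumes "\<And>c r. 0 < r \<Longrightarrow> x \<in> ball c r \<Longrightarrow>
    (\<integral>\<^sup>+y\<in>ball c r. ennreal \<bar>f y\<bar> \<partial>\<mu>) / emeasure \<mu> (ball c (k * r)) \<le> a"
  shows "maximal_op k \<mu> f x \<le> a"
  unfolding maximal_op_def by (rule SUP_least) (use assms in auto)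

lemma less_maximal_op_iff:
  "a < maximal_op k \<mu> f x \<longleftrightarrow> (\<exists>c r. 0 < r \<and> x \<in> ball c r \<and>
    a < (\<integral>\<^sup>+y\<in>ball c r. ennreal \<bar>f y\<bar> \<partial>\<mu>) / emeasure \<mu> (ball c (k * r)))"
  unfolding maximal_op_def less_SUP_iff by auto

text \<open>A ball that witnesses the value at one of its points does so at all of them: superlevel
  sets of the uncentred operator are unions of open balls.\<close>

lemma open_maximal_op_superlevel: "open {x. a < maximal_op k \<mu> f x}"
proof -
  have "{x. a < maximal_op k \<mu> f x} = (\<Union>(c, r)\<in>{(c, r). 0 < r \<and>
    a < (\<integral>\<^sup>+y\<in>ball c r. ennreal \<bar>f y\<bar> \<partial>\<mu>) / emeasure \<mu> (ball c (k * r))}. ball c r)"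
    unfolding less_maximal_op_iff by blast
  then show ?thesis by (simp only:) (intro open_UN ballI, clarsimp)
qed

lemma borel_measurable_maximal_op [measurable]: "maximal_op k \<mu> f \<in> borel_measurable borel"
  by (rule borel_measurableI_greater) (simp add: open_maximal_op_superlevel borel_open)

lemma ennreal_divide_mult_swap: "a / m * b = a * (b / (m::ennreal))"
  by (simp add: divide_ennreal_def mult_ac)

lemma ennreal_divide_le:
  fixes a m :: ennreal
  assumes "m = 0 \<Longrightarrow> a = 0" "a \<le> b * m"
  shows "a / m \<le> b"
proof (cases "m = 0")
  case False
  then show ?thesis using assms by (intro divide_le_posI_ennreal) (auto simp: mult.commute zero_less_iff_neq_zero)
qed (use assms in auto)

text \<open>The two integrals change places: the quotient of \<open>f\<close> over the large ball,
  times the mass of \<open>g\<close>, is the mass of \<open>f\<close> times a quotient of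
  \<open>g\<close>. The latter is admissible in the maximal function of \<open>g\<close> at every
  point of \<open>ball c r\<close>, so it may be put under the integral of \<open>f\<close>.\<close>

lemma dilated_ball_integral_le:
  assumes \<mu>: "radon_measure (\<mu> :: (real^'n) measure)" and k: "1 < k"
    and [measurable]: "f \<in> borel_measurable borel" "g \<in> borel_measurable borel"
    and l: "0 < l" and r: "0 < r" and big: "ennreal l < (\<integral>\<^sup>+y\<in>ball c r. ennreal \<bar>f y\<bar> \<partial>\<mu>) / emeasure \<mu> (ball c (k * r))"
  shows "ennreal l * (\<integral>\<^sup>+y\<in>ball c (sqrt k * r). ennreal \<bar>g y\<bar> \<partial>\<mu>)
    \<le> (\<integral>\<^sup>+y\<in>ball c r. ennreal \<bar>f y\<bar> * maximal_op (sqrt k) \<mu> g y \<partial>\<mu>)"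
proof -
  have s [measurable_cong]: "sets \<mu> = sets borel" by (rule radon_measureD(1)[OF \<mu>])
  have [measurable]: "ball c r \<in> sets borel" for c :: "real^'n" and r by simp
  define W where "W = (\<integral>\<^sup>+y\<in>ball c (sqrt k * r). ennreal \<bar>g y\<bar> \<partial>\<mu>)"
  define m where "m = emeasure \<mu> (ball c (k * r))"
  have sk: "1 \<le> sqrt k" "sqrt k * (sqrt k * r) = k * r" using k by auto
  have "ennreal l * W \<le> (\<integral>\<^sup>+y\<in>ball c r. ennreal \<bar>f y\<bar> \<partial>\<mu>) / m * W"
    using big by (intro mult_right_mono) (auto simp: m_def)
  also have "\<dots> = (\<integral>\<^sup>+y\<in>ball c r. ennreal \<bar>f y\<bar> \<partial>\<mu>) * (W / m)" by (rule ennreal_divide_mult_swap)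
  also have "\<dots> = (\<integral>\<^sup>+y. ennreal \<bar>f y\<bar> * indicator (ball c r) y * (W / m) \<partial>\<mu>)"
    by (rule nn_integral_multc[symmetric]) measurable
  also have "\<dots> \<le> (\<integral>\<^sup>+y\<in>ball c r. ennreal \<bar>f y\<bar> * maximal_op (sqrt k) \<mu> g y \<partial>\<mu>)"
  proof (rule nn_integral_mono)
    fix y
    have "W / m \<le> maximal_op (sqrt k) \<mu> g y" if y: "y \<in> ball c r"
    proof -
      have rr: "1 * r \<le> sqrt k * r" using sk r by (intro mult_right_mono) auto
      have "0 < sqrt k * r" "y \<in> ball c (sqrt k * r)" using rr r y unfolding mem_ball by linarith+
      from average_le_maximal_op[OF this, of \<mu> g "sqrt k"] show ?thesis by (simp add: W_def m_def sk)
    qed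
    then show "ennreal \<bar>f y\<bar> * indicator (ball c r) y * (W / m)
      \<le> ennreal \<bar>f y\<bar> * maximal_op (sqrt k) \<mu> g y * indicator (ball c r) y"
      by (auto simp: indicator_def intro!: mult_left_mono)
  qed
  finally show ?thesis by (simp add: W_def)
qed

lemma weak_type_two_weights:
  assumes dim: "2 \<le> CARD('n)"
  shows "\<exists>C>0. \<forall>k (\<mu> :: (real^'n) measure) f g l. 1 < k \<and> k \<le> 3/2 \<and> radon_measure \<mu> \<and>
    f \<in> borel_measurable borel \<and> g \<in> borel_measurable borel \<and> 0 < l \<longrightarrow>
    (\<integral>\<^sup>+x\<in>{x. ennreal l < maximal_op k \<mu> f x}. ennreal \<bar>g x\<bar> \<partial>\<mu>)
      \<le> ennreal (C * (k - 1) powr (- ((real CARD('n) - 1) / 2)) / l) *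
         (\<integral>\<^sup>+x. ennreal \<bar>f x\<bar> * maximal_op (sqrt k) \<mu> g x \<partial>\<mu>)"
proof -
  have D: "DIM(real^'n) = CARD('n)" by simp
  have dim': "2 \<le> DIM(real^'n)" using dim D by simp
  obtain C where C: "0 < C" and cover: "\<forall>d (F :: ((real^'n) \<times> real) set) K. 0 < d \<and> d \<le> 1/4 \<and> finite F \<and> (\<forall>b\<in>F. 0 < snd b) \<and>
     K \<subseteq> (\<Union>b\<in>F. ball (fst b) (snd b)) \<longrightarrow>
     (\<exists>G\<subseteq>F. K \<subseteq> (\<Union>b\<in>G. ball (fst b) ((1 + d) * snd b)) \<and>
       (\<forall>p. real (card {b\<in>G. p \<in> ball (fst b) (snd b)}) \<le> C * d powr (- ((real DIM(real^'n) - 1) / 2))))"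
    by (rule exE[OF covering_bounded_overlap[OF dim']], erule conjE, rule that, assumption, assumption)
  define \<sigma> where "\<sigma> = (real CARD('n) - 1) / 2"
  have \<sigma>: "0 < \<sigma>" using dim by (simp add: \<sigma>_def)
  define C' where "C' = C * 3 powr \<sigma>"
  have C': "0 < C'" using C by (simp add: C'_def)
  show ?thesis
  proof (rule exI[of _ C'], rule conjI, rule C', (rule allI)+, rule impI, elim conjE)
    fix k l :: real and \<mu> :: "(real^'n) measure" and f g :: "real^'n \<Rightarrow> real"
    assume k: "1 < k" "k \<le> 3/2" and \<mu>: "radon_measure \<mu>" and l: "0 < l"
      and fm [measurable]: "f \<in> borel_measurable borel" and gm [measurable]: "g \<in> borel_measurable borel"
    have s [measurable_cong]: "sets \<mu> = sets borel" by (rule radon_measureD(1)[OF \<mu>])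
  have [measurable]: "ball c r \<in> sets borel" for c :: "real^'n" and r by simp
    define d where "d = sqrt k - 1"
    \<comment> \<open>With \<open>1 + d = sqrt k\<close>, the bound
      \<open>3/2 \<le> (5/4)\<^sup>2\<close> yields the \<open>d \<le> 1/4\<close> of the covering
      lemma, and \<open>k - 1 = d * (sqrt k + 1)\<close> makes \<open>d\<close> and
      \<open>k - 1\<close> comparable.\<close>
    have "sqrt k \<le> sqrt ((5/4)\<^sup>2)" using k by (intro real_sqrt_le_mono) (simp add: power2_eq_square)
    then have d: "0 < d" "d \<le> 1/4" using k by (auto simp: d_def)
    have "k - 1 = d * (sqrt k + 1)" using k by (simp add: d_def algebra_simps)
    also have "\<dots> \<le> d * 3" using d by (intro mult_left_mono) (auto simp: d_def)
    finally have "(k - 1) / 3 \<le> d" by simp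
    then have "C * d powr (- \<sigma>) \<le> C * ((k - 1) / 3) powr (- \<sigma>)"
      using k \<sigma> C by (intro mult_left_mono powr_mono2') auto
    also have "\<dots> = C' * (k - 1) powr (- \<sigma>)"
      using k by (simp add: C'_def powr_divide powr_minus_divide field_simps)
    finally have dk: "C * d powr (- \<sigma>) \<le> C' * (k - 1) powr (- \<sigma>)" .
    define A where "A = C' * (k - 1) powr (- \<sigma>)"
    have A: "0 \<le> A" using C' by (simp add: A_def)
    define E where "E = {x. ennreal l < maximal_op k \<mu> f x}"
    define v where "v x = ennreal \<bar>f x\<bar> * maximal_op (sqrt k) \<mu> g x" for x
    have vm [measurable]: "v \<in> borel_measurable borel" unfolding v_def by measurable
    have oE: "open E" unfolding E_def by (rule open_maximal_op_superlevel)
    \<comment> \<open>The covering lemma takes finite families, so the estimate is made on compact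
      subsets of the open superlevel set. Continuity from below of the measure with density
      \<open>\<bar>g\<bar>\<close> extends it to the whole set, even where this measure is
      infinite.\<close>
    have cpt: "(\<integral>\<^sup>+x\<in>K. ennreal \<bar>g x\<bar> \<partial>\<mu>) \<le> ennreal (A / l) * (\<integral>\<^sup>+x. v x \<partial>\<mu>)"
      if K: "compact K" "K \<subseteq> E" for K
    proof -
      define Q where "Q = {b. 0 < snd b \<and> ennreal l <
        (\<integral>\<^sup>+y\<in>ball (fst b) (snd b). ennreal \<bar>f y\<bar> \<partial>\<mu>) / emeasure \<mu> (ball (fst b) (k * snd b))}"
      have "E \<subseteq> (\<Union>b\<in>Q. ball (fst b) (snd b))"
      proof
        fix x assume "x \<in> E"
        then obtain c r where "0 < r" "x \<in> ball c r"
          "ennreal l < (\<integral>\<^sup>+y\<in>ball c r. ennreal \<bar>f y\<bar> \<partial>\<mu>) / emeasure \<mu> (ball c (k * r))"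
          unfolding E_def mem_Collect_eq less_maximal_op_iff by blast
        then show "x \<in> (\<Union>b\<in>Q. ball (fst b) (snd b))" by (intro UN_I[of "(c, r)"]) (simp_all add: Q_def)
      qed
      then have "K \<subseteq> (\<Union>b\<in>Q. ball (fst b) (snd b))" using K(2) by (rule order_trans[rotated])
      from compactE_image[OF K(1) open_ball this]
      obtain F where F: "F \<subseteq> Q" "finite F" "K \<subseteq> (\<Union>b\<in>F. ball (fst b) (snd b))" .
      have "\<forall>b\<in>F. 0 < snd b" using F(1) unfolding Q_def by blast
      with d F have "\<exists>G\<subseteq>F. K \<subseteq> (\<Union>b\<in>G. ball (fst b) ((1 + d) * snd b)) \<and>
        (\<forall>p. real (card {b\<in>G. p \<in> ball (fst b) (snd b)}) \<le> C * d powr (- ((real DIM(real^'n) - 1) / 2)))"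
        by (intro mp[OF spec[OF spec[OF spec[OF cover]]]] conjI)
      then obtain G where G: "G \<subseteq> F" "K \<subseteq> (\<Union>b\<in>G. ball (fst b) ((1 + d) * snd b))"
        "\<forall>p. real (card {b\<in>G. p \<in> ball (fst b) (snd b)}) \<le> C * d powr (- ((real DIM(real^'n) - 1) / 2))"
        by (elim exE conjE)
      have finG: "finite G" using G(1) F(2) by (rule finite_subset)
      have ov: "real (card {b\<in>G. p \<in> ball (fst b) (snd b)}) \<le> A" for p
        using G(3)[rule_format, of p] dk unfolding D A_def \<sigma>_def by linarith
      have "ennreal l * (\<integral>\<^sup>+x\<in>K. ennreal \<bar>g x\<bar> \<partial>\<mu>)
        \<le> ennreal l * (\<integral>\<^sup>+x. (\<Sum>b\<in>G. ennreal \<bar>g x\<bar> * indicator (ball (fst b) (sqrt k * snd b)) x) \<partial>\<mu>)"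
      proof (intro mult_left_mono nn_integral_mono)
        fix x
        show "ennreal \<bar>g x\<bar> * indicator K x \<le> (\<Sum>b\<in>G. ennreal \<bar>g x\<bar> * indicator (ball (fst b) (sqrt k * snd b)) x)"
        proof (cases "x \<in> K")
          case True
          then obtain b where b: "b \<in> G" "x \<in> ball (fst b) (sqrt k * snd b)" using G(2) by (auto simp: d_def)
          have "ennreal \<bar>g x\<bar> * indicator (ball (fst b) (sqrt k * snd b)) x
            \<le> (\<Sum>b\<in>G. ennreal \<bar>g x\<bar> * indicator (ball (fst b) (sqrt k * snd b)) x)"
            by (rule member_le_sum[OF b(1) _ finG]) simp
          then show ?thesis using b(2) True by simp
        qed simp
      qed simp
      also have "\<dots> = (\<Sum>b\<in>G. ennreal l * (\<integral>\<^sup>+x\<in>ball (fst b) (sqrt k * snd b). ennreal \<bar>g x\<bar> \<partial>\<mu>))"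
        by (simp add: nn_integral_sum sum_distrib_left)
      also have "\<dots> \<le> (\<Sum>b\<in>G. (\<integral>\<^sup>+x\<in>ball (fst b) (snd b). v x \<partial>\<mu>))"
      proof (rule sum_mono)
        fix b assume "b \<in> G"
        then have "b \<in> Q" using G(1) F(1) by blast
        then have b: "0 < snd b" "ennreal l <
          (\<integral>\<^sup>+y\<in>ball (fst b) (snd b). ennreal \<bar>f y\<bar> \<partial>\<mu>) / emeasure \<mu> (ball (fst b) (k * snd b))"
          unfolding Q_def by blast+
        show "ennreal l * (\<integral>\<^sup>+x\<in>ball (fst b) (sqrt k * snd b). ennreal \<bar>g x\<bar> \<partial>\<mu>) \<le> (\<integral>\<^sup>+x\<in>ball (fst b) (snd b). v x \<partial>\<mu>)"
          unfolding v_def by (rule dilated_ball_integral_le[OF \<mu> k(1) fm gm l b])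
      qed
      also have "\<dots> = (\<integral>\<^sup>+x. (\<Sum>b\<in>G. v x * indicator (ball (fst b) (snd b)) x) \<partial>\<mu>)"
        by (rule nn_integral_sum[symmetric]) measurable
      also have "\<dots> \<le> (\<integral>\<^sup>+x. ennreal A * v x \<partial>\<mu>)"
      proof (rule nn_integral_mono)
        fix x
        have "(\<Sum>b\<in>G. v x * indicator (ball (fst b) (snd b)) x) = (\<Sum>b\<in>{b\<in>G. x \<in> ball (fst b) (snd b)}. v x)"
          by (rule sum.mono_neutral_cong_right) (use finG in \<open>auto simp: indicator_def\<close>)
        also have "\<dots> = ennreal (real (card {b\<in>G. x \<in> ball (fst b) (snd b)})) * v x" by (simp add: ennreal_of_nat_eq_real_of_nat)
        also have "\<dots> \<le> ennreal A * v x" by (intro mult_right_mono ennreal_leI ov) simp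
        finally show "(\<Sum>b\<in>G. v x * indicator (ball (fst b) (snd b)) x) \<le> ennreal A * v x" .
      qed
      also have "\<dots> = ennreal A * (\<integral>\<^sup>+x. v x \<partial>\<mu>)" by (rule nn_integral_cmult) measurable
      finally have "ennreal (1 / l) * (ennreal l * (\<integral>\<^sup>+x\<in>K. ennreal \<bar>g x\<bar> \<partial>\<mu>)) \<le> ennreal (1 / l) * (ennreal A * (\<integral>\<^sup>+x. v x \<partial>\<mu>))"
        by (rule mult_left_mono) simp
      then show ?thesis using l A by (simp add: mult.assoc[symmetric] ennreal_mult'[symmetric])
    qed
    obtain Kn where Kn: "\<And>n. compact (Kn n)" "\<And>n. Kn n \<subseteq> E" "\<And>n. Kn n \<subseteq> interior (Kn (Suc n))"
        "\<Union> (range Kn) = E"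
      using open_Union_compact_subsets[OF oE] by metis
    have inc: "incseq Kn" using Kn(3) interior_subset by (intro incseq_SucI) blast
    have meas: "Kn n \<in> sets \<mu>" for n using Kn(1)[of n] by (simp add: s borel_compact)
    define \<nu> where "\<nu> = density \<mu> (\<lambda>x. ennreal \<bar>g x\<bar>)"
    have em: "emeasure \<nu> B = (\<integral>\<^sup>+x\<in>B. ennreal \<bar>g x\<bar> \<partial>\<mu>)" if "B \<in> sets \<mu>" for B
      unfolding \<nu>_def by (rule emeasure_density[OF _ that]) measurable
    have "(\<integral>\<^sup>+x\<in>E. ennreal \<bar>g x\<bar> \<partial>\<mu>) = emeasure \<nu> E" using oE by (intro em[symmetric]) (simp add: s)
    also have "\<dots> = (SUP n. emeasure \<nu> (Kn n))"
      unfolding Kn(4)[symmetric] by (rule SUP_emeasure_incseq[symmetric]) (use inc meas in \<open>auto simp: \<nu>_def\<close>)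
    also have "\<dots> \<le> ennreal (A / l) * (\<integral>\<^sup>+x. v x \<partial>\<mu>)"
      by (rule SUP_least) (use em[OF meas] cpt[OF Kn(1,2)] in simp)
    finally show "(\<integral>\<^sup>+x\<in>{x. ennreal l < maximal_op k \<mu> f x}. ennreal \<bar>g x\<bar> \<partial>\<mu>)
      \<le> ennreal (C' * (k - 1) powr (- ((real CARD('n) - 1) / 2)) / l) *
         (\<integral>\<^sup>+x. ennreal \<bar>f x\<bar> * maximal_op (sqrt k) \<mu> g x \<partial>\<mu>)"
      by (simp add: E_def v_def A_def \<sigma>_def)
  qed
qed

lemma maximal_op_one_le:
  fixes \<mu> :: "(real^'n) measure"
  assumes \<mu>: "radon_measure \<mu>" and k: "1 \<le> k"
  shows "maximal_op k \<mu> (\<lambda>_. 1) x \<le> 1"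
proof (rule maximal_op_le)
  fix c r :: "_" assume r: "0 < r" "x \<in> ball c r"
  have s: "sets \<mu> = sets borel" by (rule radon_measureD(1)[OF \<mu>])
  have "1 * r \<le> k * r" using k r by (intro mult_right_mono) auto
  then have le: "emeasure \<mu> (ball c r) \<le> emeasure \<mu> (ball c (k * r))"
    by (intro emeasure_mono subset_ball) (auto simp: s)
  have eq: "(\<integral>\<^sup>+y\<in>ball c r. ennreal \<bar>1\<bar> \<partial>\<mu>) = emeasure \<mu> (ball c r)" by (simp add: s)
  show "(\<integral>\<^sup>+y\<in>ball c r. ennreal \<bar>1\<bar> \<partial>\<mu>) / emeasure \<mu> (ball c (k * r)) \<le> 1"
    unfolding eq
    by (rule ennreal_divide_le) (use le in auto)
qed

text \<open>The part of \<open>f\<close> that stays below \<open>l\<close> has maximal function at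
  most \<open>l\<close>, since that of the constant 1 is at most 1. This is the endpoint at infinity
  of the interpolation.\<close>

lemma maximal_op_truncation:
  fixes \<mu> :: "(real^'n) measure"
  assumes \<mu>: "radon_measure \<mu>" and k: "1 \<le> k" and [measurable]: "f \<in> borel_measurable borel" and l: "0 < l"
  shows "maximal_op k \<mu> f x \<le> maximal_op k \<mu> (\<lambda>y. f y * indicator {y. l < \<bar>f y\<bar>} y) x + ennreal l"
proof (rule maximal_op_le)
  fix c and r :: real assume r: "0 < r" "x \<in> ball c r"
  have s [measurable_cong]: "sets \<mu> = sets borel" by (rule radon_measureD(1)[OF \<mu>])
  have [measurable]: "ball c r \<in> sets borel" for c :: "real^'n" and r by simp
  let ?h = "\<lambda>y. f y * indicator {y. l < \<bar>f y\<bar>} y"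
  have "(\<integral>\<^sup>+y\<in>ball c r. ennreal \<bar>f y\<bar> \<partial>\<mu>) \<le> (\<integral>\<^sup>+y. ennreal \<bar>?h y\<bar> * indicator (ball c r) y + ennreal l * (ennreal \<bar>1\<bar> * indicator (ball c r) y) \<partial>\<mu>)"
  proof (rule nn_integral_mono)
    fix y
    have "ennreal \<bar>f y\<bar> \<le> ennreal (\<bar>?h y\<bar> + l)" using l by (intro ennreal_leI) (auto simp: indicator_def)
    also have "\<dots> = ennreal \<bar>?h y\<bar> + ennreal l" using l by (intro ennreal_plus) auto
    finally show "ennreal \<bar>f y\<bar> * indicator (ball c r) y
      \<le> ennreal \<bar>?h y\<bar> * indicator (ball c r) y + ennreal l * (ennreal \<bar>1\<bar> * indicator (ball c r) y)"
      by (cases "y \<in> ball c r") simp_all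
  qed
  also have "\<dots> = (\<integral>\<^sup>+y\<in>ball c r. ennreal \<bar>?h y\<bar> \<partial>\<mu>) + ennreal l * (\<integral>\<^sup>+y\<in>ball c r. ennreal \<bar>1\<bar> \<partial>\<mu>)"
    by (subst nn_integral_add) (simp_all add: nn_integral_cmult)
  finally have "(\<integral>\<^sup>+y\<in>ball c r. ennreal \<bar>f y\<bar> \<partial>\<mu>) / emeasure \<mu> (ball c (k * r))
    \<le> ((\<integral>\<^sup>+y\<in>ball c r. ennreal \<bar>?h y\<bar> \<partial>\<mu>) + ennreal l * (\<integral>\<^sup>+y\<in>ball c r. ennreal \<bar>1\<bar> \<partial>\<mu>)) / emeasure \<mu> (ball c (k * r))"
    by (rule divide_right_mono_ennreal)
  also have "\<dots> = (\<integral>\<^sup>+y\<in>ball c r. ennreal \<bar>?h y\<bar> \<partial>\<mu>) / emeasure \<mu> (ball c (k * r)) +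
     ennreal l * ((\<integral>\<^sup>+y\<in>ball c r. ennreal \<bar>1\<bar> \<partial>\<mu>) / emeasure \<mu> (ball c (k * r)))"
    by (simp add: divide_ennreal_def distrib_right mult.assoc)
  also have "\<dots> \<le> maximal_op k \<mu> ?h x + ennreal l * 1"
  proof (intro add_mono mult_left_mono)
    show "(\<integral>\<^sup>+y\<in>ball c r. ennreal \<bar>1\<bar> \<partial>\<mu>) / emeasure \<mu> (ball c (k * r)) \<le> 1"
      using average_le_maximal_op[OF r, of \<mu> "\<lambda>_. 1" k] maximal_op_one_le[OF \<mu> k, of x] by (rule order_trans)
  qed (simp_all add: average_le_maximal_op[OF r])
  finally show "(\<integral>\<^sup>+y\<in>ball c r. ennreal \<bar>f y\<bar> \<partial>\<mu>) / emeasure \<mu> (ball c (k * r)) \<le> maximal_op k \<mu> ?h x + ennreal l" by simp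
qed

text \<open>A sum over all integers, written as an integral over \<open>count_space\<close> so that
  it can be exchanged with the integral over the measure. The largest exponent is at most
  \<open>\<lceil>log 2 a\<rceil>\<close>; rounding up costs the factor 2 in
  \<open>2 * a\<close>.\<close>

lemma nn_integral_dyadic_geometric_le:
  assumes a: "0 \<le> a" and q: "0 < q"
  shows "(\<integral>\<^sup>+j. ennreal (2 powr (real_of_int j * q)) * indicator {j. 2 powr (real_of_int j - 1) < a} j \<partial>count_space UNIV)
    \<le> ennreal ((2 * a) powr q / (1 - 2 powr (- q)))"
proof (cases "a = 0")
  case True
  have "\<not> 2 powr (real_of_int j - 1) < a" for j using True by simp
  then show ?thesis by (simp add: indicator_def True)
next
  case False
  then have a: "0 < a" using a by simp
  define J where "J = \<lceil>log 2 a\<rceil>"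
  define x where "x = 2 powr (- q)"
  have x: "0 \<le> x" "x < 1" using q powr_less_one[of 2 "-q"] by (auto simp: x_def)
  have J: "j \<le> J" if "2 powr (real_of_int j - 1) < a" for j
  proof -
    have "real_of_int j - 1 < log 2 a" using that a by (simp add: less_log_iff)
    also have "\<dots> \<le> real_of_int J" unfolding J_def by linarith
    finally show ?thesis by linarith
  qed
  have "2 powr (real_of_int J - 1) \<le> a"
  proof -
    have "real_of_int J - 1 \<le> log 2 a" unfolding J_def by linarith
    then show ?thesis using a by (simp add: le_log_iff)
  qed
  then have "2 powr real_of_int J \<le> 2 * a" by (simp add: powr_diff)
  then have Jq: "2 powr (real_of_int J * q) \<le> (2 * a) powr q"
    using powr_mono2[of q "2 powr real_of_int J" "2 * a"] q by (simp add: powr_powr)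
  have "(\<integral>\<^sup>+j. ennreal (2 powr (real_of_int j * q)) * indicator {j. 2 powr (real_of_int j - 1) < a} j \<partial>count_space UNIV)
    \<le> (\<integral>\<^sup>+j. ennreal (2 powr (real_of_int j * q)) * indicator {..J} j \<partial>count_space UNIV)"
    by (rule nn_integral_mono) (use J in \<open>auto simp: indicator_def\<close>)
  also have "\<dots> = (\<integral>\<^sup>+j. ennreal (2 powr (real_of_int j * q)) \<partial>count_space {..J})"
    by (rule nn_integral_count_space_indicator[symmetric]) (simp add: NO_MATCH_def)
  also have "\<dots> = (\<integral>\<^sup>+n. ennreal (2 powr (real_of_int (J - int n) * q)) \<partial>count_space UNIV)"
  proof (rule nn_integral_bij_count_space[symmetric])
    show "bij_betw (\<lambda>n. J - int n) UNIV {..J}"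
      by (rule bij_betw_byWitness[where f' = "\<lambda>j. nat (J - j)"]) auto
  qed
  also have "\<dots> = (\<integral>\<^sup>+n. ennreal (2 powr (real_of_int J * q) * x ^ n) \<partial>count_space UNIV)"
    by (intro nn_integral_cong arg_cong[of _ _ ennreal])
      (simp add: x_def powr_realpow[symmetric] powr_powr powr_add[symmetric] algebra_simps)
  also have "\<dots> = ennreal (2 powr (real_of_int J * q) * (1 / (1 - x)))"
    unfolding nn_integral_count_space_nat
  proof (rule suminf_ennreal_eq)
    show "(\<lambda>n. 2 powr (real_of_int J * q) * x ^ n) sums (2 powr (real_of_int J * q) * (1 / (1 - x)))"
      by (intro sums_mult geometric_sums) (use x in auto)
  qed (use x in auto)
  also have "\<dots> \<le> ennreal ((2 * a) powr q * (1 / (1 - x)))"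
    by (intro ennreal_leI mult_right_mono Jq) (use x in auto)
  finally show ?thesis by (simp add: x_def)
qed

text \<open>For finite positive \<open>h\<close> one term suffices, the one whose level is the last
  power of 2 strictly below \<open>h\<close>. For infinite \<open>h\<close> all terms are present
  and unbounded.\<close>

lemma ennreal_powr_le_dyadic:
  assumes p: "0 < p"
  shows "ennreal_powr h p \<le>
    (\<integral>\<^sup>+j. ennreal (2 powr (real_of_int (j + 1) * p)) * indicator {j. ennreal (2 powr real_of_int j) < h} j \<partial>count_space UNIV)"
    (is "_ \<le> ?S")
proof -
  have ge: "ennreal (2 powr (real_of_int (j + 1) * p)) \<le> ?S" if "ennreal (2 powr real_of_int j) < h" for j
    using nn_integral_ge_point[of j UNIV "\<lambda>j. ennreal (2 powr (real_of_int (j + 1) * p)) * indicator {j. ennreal (2 powr real_of_int j) < h} j"] that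
    by simp
  show ?thesis
  proof (cases h)
    case (real a)
    show ?thesis
    proof (cases "a = 0")
      case False
      with real have a: "0 < a" by simp
      define j where "j = \<lceil>log 2 a\<rceil> - 1"
      have "real_of_int j < log 2 a" unfolding j_def by linarith
      then have "2 powr real_of_int j < a" using a by (simp add: less_log_iff)
      then have "ennreal (2 powr real_of_int j) < h" using real a by (simp add: ennreal_lessI)
      note ge[OF this]
      moreover have "a powr p \<le> 2 powr (real_of_int (j + 1) * p)"
      proof -
        have "log 2 a \<le> real_of_int (j + 1)" unfolding j_def by linarith
        then have "a \<le> 2 powr real_of_int (j + 1)" using a by (simp add: log_le_iff)
        then show ?thesis using powr_mono2[of p a "2 powr real_of_int (j + 1)"] a p by (simp add: powr_powr)
      qed
      ultimately show ?thesis using real by (simp add: ennreal_powr_def) (meson ennreal_leI order_trans)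
    qed (use real p in \<open>simp add: ennreal_powr_def\<close>)
  next
    case top
    have "of_nat n \<le> ?S" for n
    proof -
      define j where "j = \<lceil>log 2 (real n + 1) / p\<rceil>"
      have "log 2 (real n + 1) / p \<le> real_of_int (j + 1)" unfolding j_def by linarith
      then have "log 2 (real n + 1) \<le> real_of_int (j + 1) * p" using p by (simp add: divide_le_eq)
      then have "real n + 1 \<le> 2 powr (real_of_int (j + 1) * p)" by (subst (asm) log_le_iff) simp_all
      then have "ennreal (real n) \<le> ennreal (2 powr (real_of_int (j + 1) * p))" by (intro ennreal_leI) simp
      also have "\<dots> \<le> ?S" by (rule ge) (simp add: top)
      finally show ?thesis by (simp add: ennreal_of_nat_eq_real_of_nat)
    qed
    then have "?S = top" using ennreal_Ex_less_of_nat[of ?S] by (meson less_top not_less)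
    then show ?thesis by simp
  qed
qed

lemma borel_measurable_ennreal_powr [measurable]: "(\<lambda>h. ennreal_powr h p) \<in> borel_measurable borel"
  unfolding ennreal_powr_def by measurable

text \<open>Interpolation between the weak type and the trivial bound at infinity. The weight on the
  right is the same maximal function of \<open>g\<close> at every level, so the levels are summed
  pointwise under the integral.\<close>

lemma strong_type_two_weights:
  assumes dim: "2 \<le> CARD('n)" and p: "1 < p"
  shows "\<exists>C>0. \<forall>k (\<mu> :: (real^'n) measure) f g. 1 < k \<and> k \<le> 3/2 \<and> radon_measure \<mu> \<and>
    f \<in> borel_measurable borel \<and> g \<in> borel_measurable borel \<longrightarrow>
    (\<integral>\<^sup>+x. ennreal_powr (maximal_op k \<mu> f x) p * ennreal \<bar>g x\<bar> \<partial>\<mu>)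
      \<le> ennreal (C * (k - 1) powr (- ((real CARD('n) - 1) / 2))) *
         (\<integral>\<^sup>+x. ennreal (\<bar>f x\<bar> powr p) * maximal_op (sqrt k) \<mu> g x \<partial>\<mu>)"
proof -
  obtain C where C: "0 < C" and weak: "\<forall>k (\<mu> :: (real^'n) measure) f g l. 1 < k \<and> k \<le> 3/2 \<and> radon_measure \<mu> \<and>
    f \<in> borel_measurable borel \<and> g \<in> borel_measurable borel \<and> 0 < l \<longrightarrow>
    (\<integral>\<^sup>+x\<in>{x. ennreal l < maximal_op k \<mu> f x}. ennreal \<bar>g x\<bar> \<partial>\<mu>)
      \<le> ennreal (C * (k - 1) powr (- ((real CARD('n) - 1) / 2)) / l) *
         (\<integral>\<^sup>+x. ennreal \<bar>f x\<bar> * maximal_op (sqrt k) \<mu> g x \<partial>\<mu>)"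
    by (rule exE[OF weak_type_two_weights[OF dim]], erule conjE, rule that, assumption, assumption)
  define q where "q = p - 1"
  have q: "0 < q" using p by (simp add: q_def)
  have q1: "0 < 1 - 2 powr (- q)" using q powr_less_one[of 2 "-q"] by simp
  define C' where "C' = C * (2 * 2 powr p * (2 powr q / (1 - 2 powr (- q))))"
  have C': "0 < C'" using C q1 by (simp add: C'_def)
  show ?thesis
  proof (rule exI[of _ C'], rule conjI, rule C', (rule allI)+, rule impI, elim conjE)
    fix k :: real and \<mu> :: "(real^'n) measure" and f g :: "real^'n \<Rightarrow> real"
    assume k: "1 < k" "k \<le> 3/2" and \<mu>: "radon_measure \<mu>"
      and fm [measurable]: "f \<in> borel_measurable borel" and gm [measurable]: "g \<in> borel_measurable borel"
    have s [measurable_cong]: "sets \<mu> = sets borel" by (rule radon_measureD(1)[OF \<mu>])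
    define A where "A = C * (k - 1) powr (- ((real CARD('n) - 1) / 2))"
    have A: "0 \<le> A" using C by (simp add: A_def)
    define h where "h = maximal_op k \<mu> f"
    define v where "v = maximal_op (sqrt k) \<mu> g"
    have hm [measurable]: "h \<in> borel_measurable borel" and vm [measurable]: "v \<in> borel_measurable borel"
      unfolding h_def v_def by measurable
    define P where "P j = 2 powr (real_of_int (j + 1) * p)" for j
    \<comment> \<open>Truncation at half of the level: the discarded part of \<open>f\<close>
      contributes at most \<open>2 powr (j - 1)\<close> to the maximal function, so the kept part
      has to exceed the other half.\<close>
    define fj where "fj j = (\<lambda>y. f y * indicator {y. 2 powr (real_of_int j - 1) < \<bar>f y\<bar>} y)" for j
    have fjm [measurable]: "fj j \<in> borel_measurable borel" for j unfolding fj_def by measurable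
    have "(\<integral>\<^sup>+x. ennreal_powr (h x) p * ennreal \<bar>g x\<bar> \<partial>\<mu>)
      \<le> (\<integral>\<^sup>+x. (\<integral>\<^sup>+j. ennreal (P j) * indicator {j. ennreal (2 powr real_of_int j) < h x} j \<partial>count_space UNIV) * ennreal \<bar>g x\<bar> \<partial>\<mu>)"
      unfolding P_def using p by (intro nn_integral_mono mult_right_mono ennreal_powr_le_dyadic) auto
    also have "\<dots> = (\<integral>\<^sup>+x. (\<integral>\<^sup>+j. ennreal (P j) * (ennreal \<bar>g x\<bar> * indicator {x. ennreal (2 powr real_of_int j) < h x} x) \<partial>count_space UNIV) \<partial>\<mu>)"
    proof (rule nn_integral_cong)
      fix x
      have "(\<integral>\<^sup>+j. ennreal (P j) * indicator {j. ennreal (2 powr real_of_int j) < h x} j \<partial>count_space UNIV) * ennreal \<bar>g x\<bar>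
        = (\<integral>\<^sup>+j. ennreal (P j) * indicator {j. ennreal (2 powr real_of_int j) < h x} j * ennreal \<bar>g x\<bar> \<partial>count_space UNIV)"
        by (rule nn_integral_multc[symmetric]) simp
      also have "\<dots> = (\<integral>\<^sup>+j. ennreal (P j) * (ennreal \<bar>g x\<bar> * indicator {x. ennreal (2 powr real_of_int j) < h x} x) \<partial>count_space UNIV)"
        by (rule nn_integral_cong) (simp add: indicator_def)
      finally show "(\<integral>\<^sup>+j. ennreal (P j) * indicator {j. ennreal (2 powr real_of_int j) < h x} j \<partial>count_space UNIV) * ennreal \<bar>g x\<bar> = \<dots>" .
    qed
    also have "\<dots> = (\<integral>\<^sup>+j. (\<integral>\<^sup>+x. ennreal (P j) * (ennreal \<bar>g x\<bar> * indicator {x. ennreal (2 powr real_of_int j) < h x} x) \<partial>\<mu>) \<partial>count_space UNIV)"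
      by (rule nn_integral_count_space_nn_integral) (simp, measurable)
    also have "\<dots> \<le> (\<integral>\<^sup>+j. (\<integral>\<^sup>+x. ennreal (2 powr (real_of_int j * q)) * indicator {j. 2 powr (real_of_int j - 1) < \<bar>f x\<bar>} j *
        (ennreal (A * (2 * 2 powr p)) * (ennreal \<bar>f x\<bar> * v x)) \<partial>\<mu>) \<partial>count_space UNIV)"
    proof (rule nn_integral_mono)
      fix j :: int
      define l where "l = 2 powr (real_of_int j - 1)"
      have l: "0 < l" "2 powr real_of_int j = l + l" by (simp_all add: l_def powr_diff)
      \<comment> \<open>The factor \<open>2 powr ((j + 1) * p)\<close> of the layer, divided by the
        level of the weak type, leaves the exponent \<open>j * (p - 1)\<close>. Summation over the
        levels that keep \<open>f x\<close> gives a multiple of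
        \<open>\<bar>f x\<bar> powr (p - 1)\<close>, and the integrand of the weak type supplies the
        missing factor.\<close>
      have PA: "P j * (A / l) = 2 powr (real_of_int j * q) * (A * (2 * 2 powr p))"
        by (simp add: P_def l_def q_def powr_diff powr_add algebra_simps)
      have sub: "ennreal l < maximal_op k \<mu> (fj j) x" if "ennreal (2 powr real_of_int j) < h x" for x
      proof (rule ccontr)
        assume "\<not> ?thesis"
        then have "maximal_op k \<mu> (fj j) x + ennreal l \<le> ennreal l + ennreal l" by (intro add_right_mono) simp
        moreover have "h x \<le> maximal_op k \<mu> (fj j) x + ennreal l"
          unfolding h_def fj_def l_def[symmetric] using maximal_op_truncation[OF \<mu> _ fm l(1)] k by simp
        moreover have "ennreal (2 powr real_of_int j) = ennreal l + ennreal l"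
          unfolding l(2) using l(1) by (intro ennreal_plus) auto
        ultimately have "h x \<le> ennreal (2 powr real_of_int j)" by (metis order_trans)
        then show False using that by simp
      qed
      have "(\<integral>\<^sup>+x. ennreal (P j) * (ennreal \<bar>g x\<bar> * indicator {x. ennreal (2 powr real_of_int j) < h x} x) \<partial>\<mu>)
        \<le> (\<integral>\<^sup>+x. ennreal (P j) * (ennreal \<bar>g x\<bar> * indicator {x. ennreal l < maximal_op k \<mu> (fj j) x} x) \<partial>\<mu>)"
        by (intro nn_integral_mono mult_left_mono) (use sub in \<open>auto simp: indicator_def\<close>)
      also have "\<dots> = ennreal (P j) * (\<integral>\<^sup>+x\<in>{x. ennreal l < maximal_op k \<mu> (fj j) x}. ennreal \<bar>g x\<bar> \<partial>\<mu>)"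
        by (rule nn_integral_cmult) measurable
      also have "\<dots> \<le> ennreal (P j) * (ennreal (A / l) * (\<integral>\<^sup>+x. ennreal \<bar>fj j x\<bar> * v x \<partial>\<mu>))"
        unfolding A_def v_def using k \<mu> gm fjm l
        by (intro mult_left_mono mp[OF spec[OF spec[OF spec[OF spec[OF spec[OF weak]]]]]] conjI) simp_all
      also have "\<dots> = ennreal (P j * (A / l)) * (\<integral>\<^sup>+x. ennreal \<bar>fj j x\<bar> * v x \<partial>\<mu>)"
        by (subst ennreal_mult') (simp_all only: mult.assoc, simp add: P_def)
      also have "\<dots> = ennreal (2 powr (real_of_int j * q)) * ennreal (A * (2 * 2 powr p)) * (\<integral>\<^sup>+x. ennreal \<bar>fj j x\<bar> * v x \<partial>\<mu>)"
        unfolding PA by (simp add: ennreal_mult')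
      also have "\<dots> = (\<integral>\<^sup>+x. ennreal (2 powr (real_of_int j * q)) * ennreal (A * (2 * 2 powr p)) * (ennreal \<bar>fj j x\<bar> * v x) \<partial>\<mu>)"
        by (rule nn_integral_cmult[symmetric]) measurable
      also have "\<dots> = (\<integral>\<^sup>+x. ennreal (2 powr (real_of_int j * q)) * indicator {j. 2 powr (real_of_int j - 1) < \<bar>f x\<bar>} j *
        (ennreal (A * (2 * 2 powr p)) * (ennreal \<bar>f x\<bar> * v x)) \<partial>\<mu>)"
        by (rule nn_integral_cong) (auto simp: fj_def indicator_def mult_ac)
      finally show "(\<integral>\<^sup>+x. ennreal (P j) * (ennreal \<bar>g x\<bar> * indicator {x. ennreal (2 powr real_of_int j) < h x} x) \<partial>\<mu>) \<le> \<dots>" .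
    qed
    also have "\<dots> = (\<integral>\<^sup>+x. (\<integral>\<^sup>+j. ennreal (2 powr (real_of_int j * q)) * indicator {j. 2 powr (real_of_int j - 1) < \<bar>f x\<bar>} j *
        (ennreal (A * (2 * 2 powr p)) * (ennreal \<bar>f x\<bar> * v x)) \<partial>count_space UNIV) \<partial>\<mu>)"
    proof (rule nn_integral_count_space_nn_integral[symmetric])
      fix j :: int
      have "(\<lambda>x. ennreal (2 powr (real_of_int j * q)) * indicator {x. 2 powr (real_of_int j - 1) < \<bar>f x\<bar>} x *
        (ennreal (A * (2 * 2 powr p)) * (ennreal \<bar>f x\<bar> * v x))) \<in> borel_measurable \<mu>" by measurable
      then show "(\<lambda>x. ennreal (2 powr (real_of_int j * q)) * indicator {j. 2 powr (real_of_int j - 1) < \<bar>f x\<bar>} j *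
        (ennreal (A * (2 * 2 powr p)) * (ennreal \<bar>f x\<bar> * v x))) \<in> borel_measurable \<mu>" by (simp add: indicator_def)
    qed simp
    also have "\<dots> \<le> (\<integral>\<^sup>+x. ennreal (C' / C * A) * (ennreal (\<bar>f x\<bar> powr p) * v x) \<partial>\<mu>)"
    proof (rule nn_integral_mono)
      fix x
      have "(\<integral>\<^sup>+j. ennreal (2 powr (real_of_int j * q)) * indicator {j. 2 powr (real_of_int j - 1) < \<bar>f x\<bar>} j *
          (ennreal (A * (2 * 2 powr p)) * (ennreal \<bar>f x\<bar> * v x)) \<partial>count_space UNIV)
        = (\<integral>\<^sup>+j. ennreal (2 powr (real_of_int j * q)) * indicator {j. 2 powr (real_of_int j - 1) < \<bar>f x\<bar>} j \<partial>count_space UNIV) *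
          (ennreal (A * (2 * 2 powr p)) * (ennreal \<bar>f x\<bar> * v x))"
        by (rule nn_integral_multc) simp
      also have "\<dots> \<le> ennreal ((2 * \<bar>f x\<bar>) powr q / (1 - 2 powr (- q))) * (ennreal (A * (2 * 2 powr p)) * (ennreal \<bar>f x\<bar> * v x))"
        by (intro mult_right_mono nn_integral_dyadic_geometric_le q) auto
      also have "\<dots> = ennreal ((2 * \<bar>f x\<bar>) powr q / (1 - 2 powr (- q)) * (A * (2 * 2 powr p)) * \<bar>f x\<bar>) * v x"
      proof -
        have "0 \<le> (2 * \<bar>f x\<bar>) powr q / (1 - 2 powr (- q))" "0 \<le> A * (2 * 2 powr p)" using A q1 by simp_all
        then have "ennreal ((2 * \<bar>f x\<bar>) powr q / (1 - 2 powr (- q)) * (A * (2 * 2 powr p)) * \<bar>f x\<bar>)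
          = ennreal ((2 * \<bar>f x\<bar>) powr q / (1 - 2 powr (- q))) * ennreal (A * (2 * 2 powr p)) * ennreal \<bar>f x\<bar>"
          by (simp only: ennreal_mult' mult_nonneg_nonneg)
        then show ?thesis by (simp only: ac_simps)
      qed
      also have "(2 * \<bar>f x\<bar>) powr q / (1 - 2 powr (- q)) * (A * (2 * 2 powr p)) * \<bar>f x\<bar> = C' / C * A * \<bar>f x\<bar> powr p"
      proof (cases "f x = 0")
        case False
        then have "\<bar>f x\<bar> powr p = \<bar>f x\<bar> powr q * \<bar>f x\<bar>" by (simp add: q_def powr_diff)
        then show ?thesis using C by (simp add: C'_def powr_mult)
      qed (use p in simp)
      also have "ennreal (C' / C * A * \<bar>f x\<bar> powr p) * v x = ennreal (C' / C * A) * (ennreal (\<bar>f x\<bar> powr p) * v x)"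
      proof -
        have "0 \<le> C' / C * A" using A C C' by simp
        then have "ennreal (C' / C * A * \<bar>f x\<bar> powr p) = ennreal (C' / C * A) * ennreal (\<bar>f x\<bar> powr p)" by (rule ennreal_mult')
        then show ?thesis by (simp only: mult.assoc)
      qed
      finally show "(\<integral>\<^sup>+j. ennreal (2 powr (real_of_int j * q)) * indicator {j. 2 powr (real_of_int j - 1) < \<bar>f x\<bar>} j *
          (ennreal (A * (2 * 2 powr p)) * (ennreal \<bar>f x\<bar> * v x)) \<partial>count_space UNIV)
        \<le> ennreal (C' / C * A) * (ennreal (\<bar>f x\<bar> powr p) * v x)" .
    qed
    also have "\<dots> = ennreal (C' / C * A) * (\<integral>\<^sup>+x. ennreal (\<bar>f x\<bar> powr p) * v x \<partial>\<mu>)"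
      by (rule nn_integral_cmult) measurable
    also have "C' / C * A = C' * (k - 1) powr (- ((real CARD('n) - 1) / 2))" using C by (simp add: A_def)
    finally show "(\<integral>\<^sup>+x. ennreal_powr (maximal_op k \<mu> f x) p * ennreal \<bar>g x\<bar> \<partial>\<mu>)
      \<le> ennreal (C' * (k - 1) powr (- ((real CARD('n) - 1) / 2))) *
         (\<integral>\<^sup>+x. ennreal (\<bar>f x\<bar> powr p) * maximal_op (sqrt k) \<mu> g x \<partial>\<mu>)" by (simp add: h_def v_def)
  qed
qed

lemma ennreal_powr_mono: "a \<le> b \<Longrightarrow> 0 \<le> p \<Longrightarrow> ennreal_powr a p \<le> ennreal_powr b p"
  by (auto simp: ennreal_powr_def top_unique less_top[symmetric] intro!: ennreal_leI powr_mono2 enn2real_mono)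

lemma ennreal_powr_ennreal: "0 \<le> x \<Longrightarrow> ennreal_powr (ennreal x) p = ennreal (x powr p)"
  by (simp add: ennreal_powr_def)

lemma ennreal_powr_mult:
  assumes "0 < x" shows "ennreal_powr (ennreal x * a) p = ennreal (x powr p) * ennreal_powr a p"
proof (cases a)
  case (real r)
  then show ?thesis using assms by (simp add: ennreal_mult'[symmetric] ennreal_powr_ennreal powr_mult)
qed (use assms in \<open>simp add: ennreal_powr_def ennreal_mult_top\<close>)

lemma weak_type_upper:
  assumes dim: "2 \<le> CARD('n)"
  shows "\<exists>C>0. \<forall>k (\<mu> :: (real ^ 'n) measure) f l.
        1 < k \<and> k \<le> 3 / 2 \<and> radon_measure \<mu> \<and> integrable \<mu> f \<and> 0 < l \<longrightarrow>
        emeasure \<mu> {x. ennreal l < maximal_op k \<mu> f x}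
          \<le> ennreal (C * (k - 1) powr (- ((real CARD('n) - 1) / 2)) / l) * (\<integral>\<^sup>+x. ennreal \<bar>f x\<bar> \<partial>\<mu>)"
proof -
  obtain C where C: "0 < C" and weak: "\<forall>k (\<mu> :: (real^'n) measure) f g l. 1 < k \<and> k \<le> 3/2 \<and> radon_measure \<mu> \<and>
    f \<in> borel_measurable borel \<and> g \<in> borel_measurable borel \<and> 0 < l \<longrightarrow>
    (\<integral>\<^sup>+x\<in>{x. ennreal l < maximal_op k \<mu> f x}. ennreal \<bar>g x\<bar> \<partial>\<mu>)
      \<le> ennreal (C * (k - 1) powr (- ((real CARD('n) - 1) / 2)) / l) *
         (\<integral>\<^sup>+x. ennreal \<bar>f x\<bar> * maximal_op (sqrt k) \<mu> g x \<partial>\<mu>)"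
    by (rule exE[OF weak_type_two_weights[OF dim]], erule conjE, rule that, assumption, assumption)
  show ?thesis
  proof (rule exI[of _ C], rule conjI, rule C, (rule allI)+, rule impI, elim conjE)
    fix k l :: real and \<mu> :: "(real^'n) measure" and f :: "real^'n \<Rightarrow> real"
    assume k: "1 < k" "k \<le> 3/2" and \<mu>: "radon_measure \<mu>" and f: "integrable \<mu> f" and l: "0 < l"
    have s [measurable_cong]: "sets \<mu> = sets borel" by (rule radon_measureD(1)[OF \<mu>])
    have fm: "f \<in> borel_measurable borel"
      using borel_measurable_integrable[OF f] by (simp add: measurable_cong_sets[OF s refl])
    have "emeasure \<mu> {x. ennreal l < maximal_op k \<mu> f x} = (\<integral>\<^sup>+x\<in>{x. ennreal l < maximal_op k \<mu> f x}. ennreal \<bar>1\<bar> \<partial>\<mu>)"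
      by (simp add: s open_maximal_op_superlevel borel_open)
    also have "\<dots> \<le> ennreal (C * (k - 1) powr (- ((real CARD('n) - 1) / 2)) / l) *
         (\<integral>\<^sup>+x. ennreal \<bar>f x\<bar> * maximal_op (sqrt k) \<mu> (\<lambda>_. 1) x \<partial>\<mu>)"
      using k \<mu> fm l by (intro mp[OF spec[OF spec[OF spec[OF spec[OF spec[OF weak]]]]]] conjI) simp_all
    also have "\<dots> \<le> ennreal (C * (k - 1) powr (- ((real CARD('n) - 1) / 2)) / l) * (\<integral>\<^sup>+x. ennreal \<bar>f x\<bar> * 1 \<partial>\<mu>)"
      using k by (intro mult_left_mono nn_integral_mono maximal_op_one_le[OF \<mu>]) simp_all
    finally show "emeasure \<mu> {x. ennreal l < maximal_op k \<mu> f x}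
          \<le> ennreal (C * (k - 1) powr (- ((real CARD('n) - 1) / 2)) / l) * (\<integral>\<^sup>+x. ennreal \<bar>f x\<bar> \<partial>\<mu>)" by simp
  qed
qed

text \<open>For \<open>g = 1\<close> the maximal function on the right is at most 1, and the
  \<open>p\<close>-th root gives the norm bound; this is how \<sigma> becomes
  \<open>\<sigma> / p\<close>.\<close>

lemma fefferman_stein_upper:
  assumes dim: "2 \<le> CARD('n)" and p: "1 < p"
  shows "\<exists>C>0. \<forall>k (\<mu> :: (real ^ 'n) measure). 1 < k \<and> k \<le> 3 / 2 \<and> radon_measure \<mu> \<longrightarrow>
      fefferman_stein_ineq k \<mu> p (C * (k - 1) powr (- ((real CARD('n) - 1) / 2))) \<and>
      maximal_op_norm k \<mu> p \<le> ennreal (C powr (1 / p) * (k - 1) powr (- ((real CARD('n) - 1) / 2) / p))"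
proof -
  obtain C where C: "0 < C" and strong: "\<forall>k (\<mu> :: (real^'n) measure) f g. 1 < k \<and> k \<le> 3/2 \<and> radon_measure \<mu> \<and>
    f \<in> borel_measurable borel \<and> g \<in> borel_measurable borel \<longrightarrow>
    (\<integral>\<^sup>+x. ennreal_powr (maximal_op k \<mu> f x) p * ennreal \<bar>g x\<bar> \<partial>\<mu>)
      \<le> ennreal (C * (k - 1) powr (- ((real CARD('n) - 1) / 2))) *
         (\<integral>\<^sup>+x. ennreal (\<bar>f x\<bar> powr p) * maximal_op (sqrt k) \<mu> g x \<partial>\<mu>)"
    by (rule exE[OF strong_type_two_weights[OF dim p]], erule conjE, rule that, assumption, assumption)
  show ?thesis
  proof (rule exI[of _ C], rule conjI, rule C, (rule allI)+, rule impI, elim conjE)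
    fix k :: real and \<mu> :: "(real^'n) measure"
    assume k: "1 < k" "k \<le> 3/2" and \<mu>: "radon_measure \<mu>"
    have s [measurable_cong]: "sets \<mu> = sets borel" by (rule radon_measureD(1)[OF \<mu>])
    define A where "A = C * (k - 1) powr (- ((real CARD('n) - 1) / 2))"
    have A: "0 < A" using C k by (simp add: A_def)
    have str: "(\<integral>\<^sup>+x. ennreal_powr (maximal_op k \<mu> f x) p * ennreal \<bar>g x\<bar> \<partial>\<mu>)
      \<le> ennreal A * (\<integral>\<^sup>+x. ennreal (\<bar>f x\<bar> powr p) * maximal_op (sqrt k) \<mu> g x \<partial>\<mu>)"
      if "f \<in> borel_measurable \<mu>" "g \<in> borel_measurable \<mu>" for f g
      unfolding A_def using k \<mu> that
      by (intro mp[OF spec[OF spec[OF spec[OF spec[OF strong]]]]] conjI) (simp_all add: measurable_cong_sets[OF s refl])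
    have "fefferman_stein_ineq k \<mu> p A"
      unfolding fefferman_stein_ineq_def in_L1_loc_def
    proof (intro allI impI, elim conjE)
      fix f g :: "real^'n \<Rightarrow> real"
      assume "f \<in> borel_measurable \<mu>" "g \<in> borel_measurable \<mu>" "\<forall>x. 0 \<le> g x"
      with str[of f g] show "(\<integral>\<^sup>+x. ennreal_powr (maximal_op k \<mu> f x) p * ennreal (g x) \<partial>\<mu>)
        \<le> ennreal A * (\<integral>\<^sup>+x. ennreal (\<bar>f x\<bar> powr p) * maximal_op (sqrt k) \<mu> g x \<partial>\<mu>)" by simp
    qed
    moreover have "maximal_op_norm k \<mu> p \<le> ennreal (A powr (1 / p))"
      unfolding maximal_op_norm_def
    proof (rule Inf_lower, rule CollectI, intro allI impI)
      fix f :: "real^'n \<Rightarrow> real" assume "in_Lp \<mu> p f"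
      then have f: "f \<in> borel_measurable \<mu>" by (simp add: in_Lp_def)
      have "(\<integral>\<^sup>+x. ennreal_powr (maximal_op k \<mu> f x) p \<partial>\<mu>) \<le>
         ennreal A * (\<integral>\<^sup>+x. ennreal (\<bar>f x\<bar> powr p) * maximal_op (sqrt k) \<mu> (\<lambda>_. 1) x \<partial>\<mu>)"
        using str[OF f, of "\<lambda>_. 1"] by simp
      also have "\<dots> \<le> ennreal A * (\<integral>\<^sup>+x. ennreal (\<bar>f x\<bar> powr p) * 1 \<partial>\<mu>)"
        using k by (intro mult_left_mono nn_integral_mono maximal_op_one_le[OF \<mu>]) simp_all
      also have "\<dots> = ennreal A * (\<integral>\<^sup>+x. ennreal_powr (ennreal \<bar>f x\<bar>) p \<partial>\<mu>)" by (simp add: ennreal_powr_ennreal)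
      finally have "ennreal_powr (\<integral>\<^sup>+x. ennreal_powr (maximal_op k \<mu> f x) p \<partial>\<mu>) (1 / p)
        \<le> ennreal_powr (ennreal A * (\<integral>\<^sup>+x. ennreal_powr (ennreal \<bar>f x\<bar>) p \<partial>\<mu>)) (1 / p)"
        using p by (intro ennreal_powr_mono) auto
      then show "Lp_norm \<mu> p (maximal_op k \<mu> f) \<le> ennreal (A powr (1 / p)) * Lp_norm \<mu> p (\<lambda>x. ennreal \<bar>f x\<bar>)"
        unfolding Lp_norm_def ennreal_powr_mult[OF A] .
    qed
    moreover have "A powr (1 / p) = C powr (1 / p) * (k - 1) powr (- ((real CARD('n) - 1) / 2) / p)"
      using C k by (simp add: A_def powr_mult powr_powr)
    ultimately show "fefferman_stein_ineq k \<mu> p (C * (k - 1) powr (- ((real CARD('n) - 1) / 2))) \<and>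
      maximal_op_norm k \<mu> p \<le> ennreal (C powr (1 / p) * (k - 1) powr (- ((real CARD('n) - 1) / 2) / p))"
      by (simp add: A_def)
  qed
qed

section \<open>Smooth functions\<close>

lemma C_times_Suc_D: "C_times (Suc m) f \<Longrightarrow> C_times m f"
proof (induction m arbitrary: f)
  case 0
  then show ?case by (auto intro!: differentiable_imp_continuous_on simp: differentiable_on_def intro: differentiable_at_withinI)
next
  case (Suc m)
  have "C_times m (\<lambda>x. frechet_derivative f (at x) v)" for v using Suc.prems by (intro Suc.IH) simp
  then show ?case using Suc.prems by simp
qed

lemma C_times_SucI:
  assumes "\<And>x. (f has_derivative f' x) (at x)" "\<And>v. C_times m (\<lambda>x. f' x v)"
  shows "C_times (Suc m) f"
proof -
  have "frechet_derivative f (at x) = f' x" for x using frechet_derivative_at[OF assms(1)] by simp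
  then show ?thesis using assms by (auto simp: differentiable_def)
qed

lemma C_times_has_derivative:
  assumes "C_times (Suc m) f"
  shows "(f has_derivative frechet_derivative f (at x)) (at x)"
  using assms by (simp add: frechet_derivative_works[symmetric])

lemma C_times_const: "C_times m (\<lambda>x. c)"
proof (induction m arbitrary: c)
  case (Suc m) show ?case by (rule C_times_SucI[where f' = "\<lambda>x v. 0"]) (auto intro: Suc)
qed simp

lemma C_times_add: "C_times m f \<Longrightarrow> C_times m g \<Longrightarrow> C_times m (\<lambda>x. f x + g x)"
proof (induction m arbitrary: f g)
  case 0 then show ?case by (simp add: continuous_on_add)
next
  case (Suc m)
  show ?case
    by (rule C_times_SucI[OF has_derivative_add[OF C_times_has_derivative[OF Suc.prems(1)] C_times_has_derivative[OF Suc.prems(2)]]])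
      (intro Suc.IH, use Suc.prems in simp_all)
qed

lemma C_times_mult: "C_times m f \<Longrightarrow> C_times m g \<Longrightarrow> C_times m (\<lambda>x. f x * g x)"
proof (induction m arbitrary: f g)
  case 0 then show ?case by (simp add: continuous_on_mult)
next
  case (Suc m)
  show ?case
    by (rule C_times_SucI[OF has_derivative_mult[OF C_times_has_derivative[OF Suc.prems(1)] C_times_has_derivative[OF Suc.prems(2)]]])
      (intro C_times_add Suc.IH C_times_Suc_D[OF Suc.prems(1)] C_times_Suc_D[OF Suc.prems(2)], use Suc.prems in simp_all)
qed

text \<open>The derivative contains \<open>inverse (f x)\<close> itself; it is needed there one
  order lower only, which is what the induction provides.\<close>

lemma C_times_inverse:
  assumes "\<And>x. f x \<noteq> 0"
  shows "C_times m f \<Longrightarrow> C_times m (\<lambda>x. inverse (f x))"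
proof (induction m)
  case 0 then show ?case using assms by (simp add: continuous_on_inverse)
next
  case (Suc m)
  note inv = Suc.IH[OF C_times_Suc_D[OF Suc.prems]]
  have der: "((\<lambda>x. inverse (f x)) has_derivative
    (\<lambda>v. (-1) * (inverse (f x) * frechet_derivative f (at x) v * inverse (f x)))) (at x)" for x
    using Deriv.has_derivative_inverse[OF assms C_times_has_derivative[OF Suc.prems], of x] by simp
  show ?case
    by (rule C_times_SucI[OF der]) (intro C_times_mult C_times_const inv, use Suc.prems in simp)
qed

lemma C_times_inner: "C_times m (\<lambda>x. x \<bullet> b)"
proof (cases m)
  case (Suc k)
  show ?thesis unfolding Suc
    by (rule C_times_SucI[where f' = "\<lambda>x v. v \<bullet> b"]) (auto intro: C_times_const intro!: derivative_eq_intros)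
qed (simp add: continuous_on_inner)

lemma C_times_power: "C_times m f \<Longrightarrow> C_times m (\<lambda>x. f x ^ j)"
  by (induction j) (simp_all add: C_times_const C_times_mult)

lemma C_times_prod: "finite I \<Longrightarrow> (\<And>i. i \<in> I \<Longrightarrow> C_times m (f i)) \<Longrightarrow> C_times m (\<lambda>x. \<Prod>i\<in>I. f i x)"
  by (induction I rule: finite_induct) (simp_all add: C_times_const C_times_mult)

lemma radon_measure_finite:
  fixes \<mu> :: "(real^'n) measure"
  assumes "sets \<mu> = sets borel" "finite_measure \<mu>"
  shows "radon_measure \<mu>"
proof -
  interpret finite_measure \<mu> by fact
  have fin: "emeasure \<mu> (space \<mu>) \<noteq> \<infinity>" by simp
  show ?thesis unfolding radon_measure_def
  proof (intro conjI allI impI ballI)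
    fix K :: "(real^'n) set"
    show "emeasure \<mu> K < \<infinity>" by (simp add: emeasure_eq_measure)
  next
    fix B :: "(real^'n) set" assume "B \<in> sets borel"
    then show "emeasure \<mu> B = (INF U\<in>{U. open U \<and> B \<subseteq> U}. emeasure \<mu> U)"
      using outer_regular[OF assms(1) fin, of B] by (simp add: conj_commute)
  next
    fix U :: "(real^'n) set" assume "open U"
    then show "emeasure \<mu> U = (SUP K\<in>{K. compact K \<and> K \<subseteq> U}. emeasure \<mu> K)"
      using inner_regular[OF assms(1) fin, of U] by (simp add: conj_commute)
  qed fact
qed

text \<open>\<open>D\<close> carries the test function; the last conjunct says that the weak-type quotient at the level \<open>L\<close> is large,
  and \<open>B \<le> L\<close> is what transfers this to the exponents \<open>p > 1\<close>.\<close>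
definition maximal_test_sets :: "real \<Rightarrow> (real^'n) measure \<Rightarrow> real \<Rightarrow> real \<Rightarrow> bool" where
  "maximal_test_sets k \<mu> B \<kappa> \<longleftrightarrow> (\<exists>D E L. D \<in> sets borel \<and> E \<in> sets borel \<and> 0 < measure \<mu> D \<and> 0 < L \<and> B \<le> L \<and>
     (\<forall>x\<in>E. ennreal L \<le> maximal_op k \<mu> (indicator D) x) \<and> B * \<kappa> * measure \<mu> D \<le> L * measure \<mu> E)"

section \<open>Lower bounds from test sets\<close>

lemma ennreal_cancel_right_le:
  assumes "0 < y" "ennreal (x * y) \<le> K * ennreal y"
  shows "ennreal x \<le> K"
proof (cases K)
  case (real r)
  then have "ennreal (x * y) \<le> ennreal (r * y)" using assms by (simp add: ennreal_mult)
  then have "x * y \<le> r * y" by (rule ennreal_le_iff[THEN iffD1, rotated]) (use real assms(1) in simp)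
  then have "x \<le> r" using assms(1) by simp
  then show ?thesis using real by (simp add: ennreal_leI)
qed simp

lemma weak_const_ge_test:
  fixes \<mu> :: "(real^'n) measure"
  assumes s: "sets \<mu> = sets borel" and fin: "finite_measure \<mu>" and test: "maximal_test_sets k \<mu> B \<kappa>"
  shows "ennreal (B / 2 * \<kappa>) \<le> maximal_weak_const k \<mu>"
  unfolding maximal_weak_const_def
proof (rule Inf_greatest)
  interpret finite_measure \<mu> by fact
  obtain D E L where D [measurable]: "D \<in> sets borel" and E [measurable]: "E \<in> sets borel" and d: "0 < measure \<mu> D"
    and L: "0 < L" "\<forall>x\<in>E. ennreal L \<le> maximal_op k \<mu> (indicator D) x" "B * \<kappa> * measure \<mu> D \<le> L * measure \<mu> E"
    using test unfolding maximal_test_sets_def by blast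
  have pos: "0 < 2 / L * measure \<mu> D" using L d by simp
  fix K assume "K \<in> {K. \<forall>f l. integrable \<mu> f \<longrightarrow> 0 < l \<longrightarrow>
    emeasure \<mu> {x. ennreal l < maximal_op k \<mu> f x} \<le> K * ennreal (1 / l) * (\<integral>\<^sup>+x. ennreal \<bar>f x\<bar> \<partial>\<mu>)}"
  then have K: "\<And>f l. integrable \<mu> f \<Longrightarrow> 0 < l \<Longrightarrow>
    emeasure \<mu> {x. ennreal l < maximal_op k \<mu> f x} \<le> K * ennreal (1 / l) * (\<integral>\<^sup>+x. ennreal \<bar>f x\<bar> \<partial>\<mu>)" by blast
  \<comment> \<open>Superlevel sets are strict, while \<open>E\<close> guarantees only the value
    \<open>L\<close>. The level \<open>L / 2\<close> costs the factor 2 in the conclusion.\<close>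
  have "E \<subseteq> {x. ennreal (L / 2) < maximal_op k \<mu> (indicator D) x}"
  proof
    fix x assume "x \<in> E"
    have "ennreal (L / 2) < ennreal L" using L(1) by (simp add: ennreal_lessI)
    also have "\<dots> \<le> maximal_op k \<mu> (indicator D) x" using L(2) \<open>x \<in> E\<close> by blast
    finally show "x \<in> {x. ennreal (L / 2) < maximal_op k \<mu> (indicator D) x}" by simp
  qed
  then have "emeasure \<mu> E \<le> emeasure \<mu> {x. ennreal (L / 2) < maximal_op k \<mu> (indicator D) x}"
    by (rule emeasure_mono) (simp add: s open_maximal_op_superlevel borel_open)
  also have "\<dots> \<le> K * ennreal (1 / (L / 2)) * (\<integral>\<^sup>+x. ennreal \<bar>indicator D x\<bar> \<partial>\<mu>)"
    by (rule K) (use L(1) D in \<open>simp_all add: s less_top[symmetric]\<close>)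
  also have "(\<integral>\<^sup>+x. ennreal \<bar>indicator D x\<bar> \<partial>\<mu>) = ennreal (measure \<mu> D)"
  proof -
    have "(\<integral>\<^sup>+x. ennreal \<bar>indicator D x\<bar> \<partial>\<mu>) = (\<integral>\<^sup>+x. indicator D x \<partial>\<mu>)"
      by (rule nn_integral_cong) (simp add: indicator_def)
    then show ?thesis using D by (simp add: s emeasure_eq_measure)
  qed
  finally have *: "ennreal (measure \<mu> E) \<le> K * ennreal (2 / L * measure \<mu> D)"
    using L(1) ennreal_mult'[of "2 / L" "measure \<mu> D"] by (simp only: emeasure_eq_measure mult.assoc) simp
  have "B / 2 * \<kappa> * (2 / L * measure \<mu> D) \<le> measure \<mu> E" using L by (simp add: field_simps)
  then have "ennreal (B / 2 * \<kappa> * (2 / L * measure \<mu> D)) \<le> ennreal (measure \<mu> E)" by (rule ennreal_leI)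
  from ennreal_cancel_right_le[OF pos order_trans[OF this *]] show "ennreal (B / 2 * \<kappa>) \<le> K" .
qed

lemma maximal_power_integral_ge_test:
  fixes \<mu> :: "(real^'n) measure"
  assumes s: "sets \<mu> = sets borel" and fin: "finite_measure \<mu>" and test: "maximal_test_sets k \<mu> B \<kappa>"
    and B: "0 < B" "0 \<le> \<kappa>" and p: "1 < p"
  obtains D where "D \<in> sets borel" "0 < measure \<mu> D"
    "ennreal (B powr p * \<kappa> * measure \<mu> D) \<le> (\<integral>\<^sup>+x. ennreal_powr (maximal_op k \<mu> (indicator D) x) p \<partial>\<mu>)"
proof -
  interpret finite_measure \<mu> by fact
  obtain D E L where D [measurable]: "D \<in> sets borel" and E [measurable]: "E \<in> sets borel" and d: "0 < measure \<mu> D"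
    and L: "0 < L" "\<forall>x\<in>E. ennreal L \<le> maximal_op k \<mu> (indicator D) x" "B * \<kappa> * measure \<mu> D \<le> L * measure \<mu> E" "B \<le> L"
    using test unfolding maximal_test_sets_def by blast
  have "B powr p * \<kappa> * measure \<mu> D = B powr (p - 1) * (B * \<kappa> * measure \<mu> D)" using B by (simp add: powr_diff)
  also have "\<dots> \<le> L powr (p - 1) * (L * measure \<mu> E)"
  proof (rule mult_mono)
    show "B powr (p - 1) \<le> L powr (p - 1)" using L B p by (intro powr_mono2) auto
  qed (use L B d in auto)
  also have "\<dots> = L powr p * measure \<mu> E" using L by (simp add: powr_diff)
  finally have "ennreal (B powr p * \<kappa> * measure \<mu> D) \<le> ennreal (L powr p * measure \<mu> E)" by (rule ennreal_leI)
  also have "\<dots> = (\<integral>\<^sup>+x. ennreal (L powr p) * indicator E x \<partial>\<mu>)"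
    using E by (simp add: s nn_integral_cmult_indicator emeasure_eq_measure ennreal_mult)
  also have "\<dots> \<le> (\<integral>\<^sup>+x. ennreal_powr (maximal_op k \<mu> (indicator D) x) p \<partial>\<mu>)"
  proof (rule nn_integral_mono)
    fix x
    show "ennreal (L powr p) * indicator E x \<le> ennreal_powr (maximal_op k \<mu> (indicator D) x) p"
    proof (cases "x \<in> E")
      case True
      then have "ennreal_powr (ennreal L) p \<le> ennreal_powr (maximal_op k \<mu> (indicator D) x) p"
        using L(2) p by (intro ennreal_powr_mono) auto
      then show ?thesis using True L(1) by (simp add: ennreal_powr_ennreal)
    qed simp
  qed
  finally show ?thesis using that D d by blast
qed

lemma nn_integral_indicator_powr:
  assumes "D \<in> sets \<mu>" "finite_measure \<mu>" "0 < p"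
  shows "(\<integral>\<^sup>+x. ennreal (\<bar>indicator D x\<bar> powr p) \<partial>\<mu>) = ennreal (measure \<mu> D)"
proof -
  have "(\<integral>\<^sup>+x. ennreal (\<bar>indicator D x\<bar> powr p) \<partial>\<mu>) = (\<integral>\<^sup>+x. indicator D x \<partial>\<mu>)"
    by (rule nn_integral_cong) (use assms(3) in \<open>simp add: indicator_def\<close>)
  then show ?thesis using assms by (simp add: finite_measure.emeasure_eq_measure)
qed

lemma op_norm_ge_test:
  fixes \<mu> :: "(real^'n) measure"
  assumes s: "sets \<mu> = sets borel" and fin: "finite_measure \<mu>" and test: "maximal_test_sets k \<mu> B \<kappa>"
    and B: "0 < B" "0 \<le> \<kappa>" and p: "1 < p"
  shows "ennreal (B * \<kappa> powr (1 / p)) \<le> maximal_op_norm k \<mu> p"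
  unfolding maximal_op_norm_def
proof (rule Inf_greatest)
  obtain D where D: "D \<in> sets borel" and d: "0 < measure \<mu> D"
    and ge: "ennreal (B powr p * \<kappa> * measure \<mu> D) \<le> (\<integral>\<^sup>+x. ennreal_powr (maximal_op k \<mu> (indicator D) x) p \<partial>\<mu>)"
    by (rule maximal_power_integral_ge_test[OF assms])
  have pos: "0 < measure \<mu> D powr (1 / p)" using d by simp
  fix K assume "K \<in> {K. \<forall>f. in_Lp \<mu> p f \<longrightarrow>
            Lp_norm \<mu> p (maximal_op k \<mu> f) \<le> K * Lp_norm \<mu> p (\<lambda>x. ennreal \<bar>f x\<bar>)}"
  then have K: "\<And>f. in_Lp \<mu> p f \<Longrightarrow> Lp_norm \<mu> p (maximal_op k \<mu> f) \<le> K * Lp_norm \<mu> p (\<lambda>x. ennreal \<bar>f x\<bar>)" by blast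
  have nD: "Lp_norm \<mu> p (\<lambda>x. ennreal \<bar>indicator D x\<bar>) = ennreal (measure \<mu> D powr (1 / p))"
    using nn_integral_indicator_powr[of D \<mu> p] D s fin p by (simp add: Lp_norm_def ennreal_powr_ennreal)
  have "ennreal (B * \<kappa> powr (1 / p) * measure \<mu> D powr (1 / p)) = ennreal_powr (ennreal (B powr p * \<kappa> * measure \<mu> D)) (1 / p)"
    using B p by (simp add: ennreal_powr_ennreal powr_mult powr_powr)
  also have "\<dots> \<le> Lp_norm \<mu> p (maximal_op k \<mu> (indicator D))"
    unfolding Lp_norm_def using p by (intro ennreal_powr_mono ge) simp
  also have "\<dots> \<le> K * Lp_norm \<mu> p (\<lambda>x. ennreal \<bar>indicator D x\<bar>)"
    by (rule K) (use D nD in \<open>simp add: in_Lp_def measurable_cong_sets[OF s refl]\<close>)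
  finally show "ennreal (B * \<kappa> powr (1 / p)) \<le> K" unfolding nD by (rule ennreal_cancel_right_le[OF pos])
qed

text \<open>With the weight 1, whose maximal function is at most 1, the inequality becomes the
  strong type estimate for an indicator.\<close>

lemma fefferman_stein_test:
  fixes \<mu> :: "(real^'n) measure"
  assumes s: "sets \<mu> = sets borel" and fin: "finite_measure \<mu>" and test: "maximal_test_sets k \<mu> B \<kappa>"
    and B: "0 < B" "0 < \<kappa>" and p: "1 < p" and k: "1 < k" and fs: "fefferman_stein_ineq k \<mu> p K"
  shows "B powr p * \<kappa> \<le> K"
proof -
  interpret finite_measure \<mu> by fact
  have \<mu>: "radon_measure \<mu>" by (rule radon_measure_finite[OF s fin])
  have "0 \<le> \<kappa>" using B by simp
  from maximal_power_integral_ge_test[OF s fin test B(1) this p]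
  obtain D where D: "D \<in> sets borel" and d: "0 < measure \<mu> D"
    and ge: "ennreal (B powr p * \<kappa> * measure \<mu> D) \<le> (\<integral>\<^sup>+x. ennreal_powr (maximal_op k \<mu> (indicator D) x) p \<partial>\<mu>)" .
  have "in_L1_loc \<mu> (indicator D)" "in_L1_loc \<mu> (\<lambda>_. 1)"
    unfolding in_L1_loc_def set_integrable_def using D
    by (auto simp: s measurable_cong_sets[OF s refl] indicator_inter_arith[symmetric] borel_compact emeasure_eq_measure
        intro!: integrable_real_indicator)
  then have "(\<integral>\<^sup>+x. ennreal_powr (maximal_op k \<mu> (indicator D) x) p * ennreal 1 \<partial>\<mu>)
     \<le> ennreal K * (\<integral>\<^sup>+x. ennreal (\<bar>indicator D x\<bar> powr p) * maximal_op (sqrt k) \<mu> (\<lambda>_. 1) x \<partial>\<mu>)"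
    using fs[unfolded fefferman_stein_ineq_def, rule_format, of "indicator D" "\<lambda>_. 1"] by simp
  also have "\<dots> \<le> ennreal K * (\<integral>\<^sup>+x. ennreal (\<bar>indicator D x\<bar> powr p) * 1 \<partial>\<mu>)"
    using k by (intro mult_left_mono nn_integral_mono maximal_op_one_le[OF \<mu>]) simp_all
  also have "\<dots> = ennreal K * ennreal (measure \<mu> D)"
    using nn_integral_indicator_powr[of D \<mu> p] D s fin p by simp
  finally have "ennreal (B powr p * \<kappa> * measure \<mu> D) \<le> ennreal K * ennreal (measure \<mu> D)" using ge by simp
  then have "ennreal (B powr p * \<kappa>) \<le> ennreal K" by (rule ennreal_cancel_right_le[OF d])
  \<comment> \<open>\<open>ennreal\<close> sends negative reals to 0, so a positive left-hand side
    is what excludes a negative \<open>K\<close>.\<close>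
  moreover have "0 < B powr p * \<kappa>" using B by simp
  ultimately show ?thesis by (auto simp: ennreal_le_iff2)
qed

lemma fefferman_stein_power_sharp:
  fixes \<mu> :: "(real^'n) measure"
  assumes s: "sets \<mu> = sets borel" and fin: "finite_measure \<mu>" and B: "0 < B" and p: "1 < p" and \<tau>: "\<tau> < \<sigma>"
    and test: "\<And>k. 1 < k \<Longrightarrow> k \<le> 3/2 \<Longrightarrow> maximal_test_sets k \<mu> B ((k - 1) powr (- \<sigma>))"
  shows "\<not> (\<forall>k. 1 < k \<and> k \<le> 3/2 \<longrightarrow> fefferman_stein_ineq k \<mu> p (C * (k - 1) powr (- \<tau>)))"
proof
  assume fs: "\<forall>k. 1 < k \<and> k \<le> 3/2 \<longrightarrow> fefferman_stein_ineq k \<mu> p (C * (k - 1) powr (- \<tau>))"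
  define q where "q = \<sigma> - \<tau>"
  have q: "0 < q" using \<tau> by (simp add: q_def)
  \<comment> \<open>Chosen so that \<open>(\<bar>C\<bar> + 1) * b\<close> is half of
    \<open>B powr p\<close>, with \<open>u powr q\<close> at most \<open>b\<close>. The absolute
    value covers a constant \<open>C\<close> of either sign.\<close>
  define b where "b = B powr p / (2 * (\<bar>C\<bar> + 1))"
  have b: "0 < b" using B by (simp add: b_def add_nonneg_pos)
  define u where "u = min (1/2) (b powr (1 / q))"
  have u: "0 < u" "u \<le> 1/2" "u \<le> b powr (1/q)" using b by (auto simp: u_def)
  have "B powr p * u powr (- \<sigma>) \<le> C * u powr (- \<tau>)"
    using fefferman_stein_test[OF s fin test[of "1 + u"] B _ p _ fs[rule_format, of "1 + u"]] u by simp
  then have "B powr p * u powr (- \<sigma>) * u powr \<sigma> \<le> C * u powr (- \<tau>) * u powr \<sigma>" by (rule mult_right_mono) simp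
  then have "B powr p \<le> C * u powr q" using u by (simp add: q_def powr_add[symmetric] mult.assoc)
  also have "\<dots> \<le> \<bar>C\<bar> * u powr q" by (intro mult_right_mono) auto
  also have "u powr q \<le> (b powr (1/q)) powr q" using u q by (intro powr_mono2) auto
  also have "\<dots> = b" using b q by (simp add: powr_powr)
  also have "\<bar>C\<bar> * b \<le> (\<bar>C\<bar> + 1) * b" using b by (intro mult_right_mono) auto
  also have "\<dots> = B powr p / 2" by (simp add: b_def field_simps)
  finally show False using B by (simp add: mult_left_mono)
qed

section \<open>The extremal measure\<close>

text \<open>The product makes the weight integrable. In the first summand
  \<open>(1 + (x \<bullet> e')\<^sup>2) ^ 4\<close> is the squared reciprocal of the width of the
  slab; the decay is algebraic, which keeps the weight comparable to itself when
  \<open>x \<bullet> e'\<close> changes by 1, and the power \<open>DIM('a)\<close> leaves one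
  decaying factor for each coordinate. In the second summand the exponent, together with the factor
  of the coordinate \<open>e'\<close> in the product, produces \<open>1 / T ^ (DIM('a) + 2)\<close>.
  This is the mass of a cap: width \<open>1 / T\<^sup>2\<close>, radius \<open>1 / T\<close> in
  \<open>DIM('a) - 1\<close> directions, density \<open>1 / T\<close>.\<close>

definition slab_weight :: "'a::euclidean_space \<Rightarrow> 'a \<Rightarrow> 'a \<Rightarrow> real" where
  "slab_weight e e' x = (\<Prod>b\<in>Basis. inverse (1 + (x \<bullet> b)\<^sup>2)) *
     (inverse ((1 + (1 + (x \<bullet> e')\<^sup>2) ^ 4 * (x \<bullet> e)\<^sup>2) ^ DIM('a)) + inverse ((1 + (x \<bullet> e')\<^sup>2) ^ (DIM('a) + 1)))"

lemma one_plus_square_pos: "0 < 1 + (x::real)\<^sup>2" "1 + (x::real)\<^sup>2 \<noteq> 0" "1 \<le> 1 + (x::real)\<^sup>2"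
  by (simp_all add: add_pos_nonneg add_nonneg_eq_0_iff)

lemma slab_weight_le:
  "0 < slab_weight e e' x" "slab_weight e e' x \<le> 2 * (\<Prod>b\<in>Basis. inverse (1 + (x \<bullet> b)\<^sup>2))" "slab_weight e e' x \<le> 2"
proof -
  have P0: "0 < (\<Prod>b\<in>Basis. inverse (1 + (x \<bullet> b)\<^sup>2))" by (intro prod_pos) (simp add: one_plus_square_pos)
  have P1: "(\<Prod>b\<in>Basis. inverse (1 + (x \<bullet> b)\<^sup>2)) \<le> 1" by (intro prod_le_1) (simp add: inverse_le_1_iff)
  have t: "1 \<le> 1 + (x \<bullet> e')\<^sup>2" by simp
  have a: "1 \<le> 1 + (1 + (x \<bullet> e')\<^sup>2) ^ 4 * (x \<bullet> e)\<^sup>2" by simp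
  let ?Q = "inverse ((1 + (1 + (x \<bullet> e')\<^sup>2) ^ 4 * (x \<bullet> e)\<^sup>2) ^ DIM('a)) + inverse ((1 + (x \<bullet> e')\<^sup>2) ^ (DIM('a) + 1))"
  have "1 \<le> (1 + (1 + (x \<bullet> e')\<^sup>2) ^ 4 * (x \<bullet> e)\<^sup>2) ^ DIM('a)" "1 \<le> (1 + (x \<bullet> e')\<^sup>2) ^ (DIM('a) + 1)"
    using one_le_power[OF a] one_le_power[OF t] by blast+
  then have Q: "0 < ?Q" "?Q \<le> 2"
    by (smt (verit) inverse_positive_iff_positive, smt (verit) inverse_le_1_iff)
  show "0 < slab_weight e e' x" unfolding slab_weight_def using P0 Q(1) by (rule mult_pos_pos)
  have "slab_weight e e' x \<le> (\<Prod>b\<in>Basis. inverse (1 + (x \<bullet> b)\<^sup>2)) * 2"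
    unfolding slab_weight_def using P0 Q(2) by (intro mult_left_mono) auto
  then show le: "slab_weight e e' x \<le> 2 * (\<Prod>b\<in>Basis. inverse (1 + (x \<bullet> b)\<^sup>2))" by simp
  show "slab_weight e e' x \<le> 2" using le P1 by linarith
qed

lemma C_times_slab_weight: "C_times m (slab_weight e e' :: 'a::euclidean_space \<Rightarrow> real)"
proof -
  have sq: "C_times m (\<lambda>x::'a. 1 + (x \<bullet> b)\<^sup>2)" for b
    by (intro C_times_add C_times_const C_times_power C_times_inner)
  have pos: "0 < 1 + (1 + (x \<bullet> e')\<^sup>2) ^ 4 * (x \<bullet> e)\<^sup>2" for x :: 'a by (intro add_pos_nonneg) auto
  show ?thesis unfolding slab_weight_def[abs_def]
  proof (intro C_times_mult C_times_add C_times_prod C_times_inverse C_times_power sq C_times_const C_times_inner)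
    show "(1 + (1 + (x \<bullet> e')\<^sup>2) ^ 4 * (x \<bullet> e)\<^sup>2) ^ DIM('a) \<noteq> 0" for x :: 'a using pos[of x] by simp
    show "(1 + (x \<bullet> e')\<^sup>2) ^ (DIM('a) + 1) \<noteq> 0" "1 + (x \<bullet> b)\<^sup>2 \<noteq> 0" for x b :: 'a using one_plus_square_pos by simp_all
  qed simp
qed

lemma borel_measurable_slab_weight [measurable]: "slab_weight e e' \<in> borel_measurable borel"
  using C_times_slab_weight[of 0 e e'] by (simp add: borel_measurable_continuous_onI)

section \<open>Mass estimates for the slab weight\<close>

lemma nn_integral_cauchy_density:
  obtains J where "0 \<le> J" "(\<integral>\<^sup>+u. ennreal (inverse (1 + u\<^sup>2)) \<partial>lborel) = ennreal J"
    "\<And>a c. 0 < c \<Longrightarrow> (\<integral>\<^sup>+u. ennreal (inverse (1 + ((u - a) * c)\<^sup>2)) \<partial>lborel) = ennreal (J / c)"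
proof -
  have "integrable lborel (\<lambda>u::real. inverse (1 + u\<^sup>2))"
    using integrable_inverse_1_plus_square by (simp add: set_integrable_def)
  then have J0: "(\<integral>\<^sup>+(u::real). ennreal (inverse (1 + u\<^sup>2)) \<partial>lborel) = ennreal (\<integral>u. inverse (1 + u\<^sup>2) \<partial>lborel)"
    by (intro nn_integral_eq_integral) (auto simp: one_plus_square_pos(1) less_imp_le)
  define J where "J = (\<integral>(u::real). inverse (1 + u\<^sup>2) \<partial>lborel)"
  have J: "0 \<le> J" unfolding J_def by (intro integral_nonneg_AE) (auto simp: one_plus_square_pos(1) less_imp_le)
  show ?thesis
  proof (rule that[OF J])
    fix a c :: real assume c: "0 < c"
    have "(\<integral>\<^sup>+u. ennreal (inverse (1 + ((u - a) * c)\<^sup>2)) \<partial>lborel)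
      = \<bar>1 / c\<bar> * (\<integral>\<^sup>+u. ennreal (inverse (1 + ((a + 1 / c * u - a) * c)\<^sup>2)) \<partial>lborel)"
      by (rule nn_integral_real_affine) (use c in auto)
    also have "\<dots> = ennreal (1 / c) * ennreal J" using c J0 by (simp add: J_def)
    finally show "(\<integral>\<^sup>+u. ennreal (inverse (1 + ((u - a) * c)\<^sup>2)) \<partial>lborel) = ennreal (J / c)"
      using c J by (simp add: ennreal_mult[symmetric])
  qed (simp add: J0 J_def)
qed

lemma nn_integral_slab_weight_finite: "(\<integral>\<^sup>+x. ennreal (slab_weight e e' x) \<partial>lborel) < \<infinity>"
proof -
  obtain J where J: "(\<integral>\<^sup>+u. ennreal (inverse (1 + u\<^sup>2)) \<partial>lborel) = ennreal J" by (rule nn_integral_cauchy_density)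
  have "(\<integral>\<^sup>+x. ennreal (slab_weight e e' x) \<partial>lborel) \<le> (\<integral>\<^sup>+(x::'a). ennreal 2 * (\<Prod>b\<in>Basis. ennreal (inverse (1 + (x \<bullet> b)\<^sup>2))) \<partial>lborel)"
  proof (rule nn_integral_mono)
    fix x :: 'a
    have "ennreal (slab_weight e e' x) \<le> ennreal (2 * (\<Prod>b\<in>Basis. inverse (1 + (x \<bullet> b)\<^sup>2)))" by (intro ennreal_leI slab_weight_le)
    also have "\<dots> = ennreal 2 * (\<Prod>b\<in>Basis. ennreal (inverse (1 + (x \<bullet> b)\<^sup>2)))"
      by (subst prod_ennreal) (simp_all add: ennreal_mult' one_plus_square_pos(1) less_imp_le)
    finally show "ennreal (slab_weight e e' x) \<le> \<dots>" .
  qed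
  also have "\<dots> = ennreal 2 * (\<integral>\<^sup>+(x::'a). (\<Prod>b\<in>Basis. ennreal (inverse (1 + (x \<bullet> b)\<^sup>2))) \<partial>lborel)"
    by (rule nn_integral_cmult) measurable
  also have "(\<integral>\<^sup>+(x::'a). (\<Prod>b\<in>Basis. ennreal (inverse (1 + (x \<bullet> b)\<^sup>2))) \<partial>lborel) = (\<Prod>b\<in>(Basis::'a set). ennreal J)"
    by (subst nn_integral_lborel_prod) (simp_all add: J)
  also have "ennreal 2 * \<dots> < \<infinity>" by (simp add: ennreal_power ennreal_mult_less_top power_less_top_ennreal)
  finally show ?thesis .
qed

text \<open>\<open>m\<close> marks the place on the axis \<open>e'\<close> where
  \<open>1 + m\<^sup>2 = T\<close>. Within distance 1 of it
  \<open>1 + (y \<bullet> e')\<^sup>2\<close> agrees with \<open>T\<close> up to the factor 3, so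
  \<open>T\<close> may replace it throughout. The constant 81 is \<open>3 ^ 4\<close>, and 1/5 is
  the least value of the factors of the other coordinates.\<close>

lemma slab_weight_zone:
  fixes y e e' :: "'a::euclidean_space"
  assumes e': "e' \<in> Basis" and T: "1 \<le> T" and m: "m\<^sup>2 = T - 1"
    and z: "\<bar>y \<bullet> e' - m\<bar> \<le> 1" "\<And>b. b \<in> Basis \<Longrightarrow> b \<noteq> e' \<Longrightarrow> \<bar>y \<bullet> b\<bar> \<le> 2"
  shows "slab_weight e e' y \<le> 3 / T * (81 ^ DIM('a) * inverse (1 + (y \<bullet> e * T\<^sup>2)\<^sup>2) ^ DIM('a) + 3 ^ (DIM('a) + 1) / T ^ (DIM('a) + 1))"
    and "(1/5) ^ DIM('a) / (3 * T) * (inverse (1 + 81 * (y \<bullet> e * T\<^sup>2)\<^sup>2) ^ DIM('a) + 1 / (3 * T) ^ (DIM('a) + 1)) \<le> slab_weight e e' y"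
proof -
  define t where "t = 1 + (y \<bullet> e')\<^sup>2"
  define s where "s = y \<bullet> e"
  define v where "v = y \<bullet> e' - m"
  have v: "v\<^sup>2 \<le> 1" using z(1) by (simp add: v_def abs_square_le_1)
  have t1: "1 \<le> t" by (simp add: t_def)
  have y': "y \<bullet> e' = m + v" by (simp add: v_def)
  have sq: "0 \<le> (m - v)\<^sup>2" "0 \<le> (m + 2 * v)\<^sup>2" by simp_all
  have "t = 1 + (m\<^sup>2 + 2 * (m * v) + v\<^sup>2)" by (simp add: t_def y' power2_sum)
  moreover have "(m - v)\<^sup>2 = m\<^sup>2 - 2 * (m * v) + v\<^sup>2" "(m + 2 * v)\<^sup>2 = m\<^sup>2 + 4 * (m * v) + 4 * v\<^sup>2"
    by (simp_all add: power2_eq_square algebra_simps)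
  ultimately have tT: "t \<le> 3 * T" "T \<le> 3 * t" using sq v m T t1 by argo+
  define P where "P = (\<Prod>b\<in>Basis - {e'}. inverse (1 + (y \<bullet> b)\<^sup>2))"
  have P: "(\<Prod>b\<in>Basis. inverse (1 + (y \<bullet> b)\<^sup>2)) = inverse t * P"
    unfolding P_def t_def using e' by (subst prod.remove[of _ e']) auto
  have P1: "P \<le> 1" unfolding P_def by (intro prod_le_1) (simp add: inverse_le_1_iff)
  have P0: "(1/5) ^ DIM('a) \<le> P"
  proof -
    have "(1/5::real) ^ DIM('a) \<le> (1/5) ^ card (Basis - {e'})" by (intro power_decreasing card_mono) auto
    also have "\<dots> = (\<Prod>b\<in>Basis - {e'}. 1/5)" by simp
    also have "\<dots> \<le> P" unfolding P_def
    proof (rule prod_mono)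
      fix b assume b: "b \<in> Basis - {e'}"
      have "(y \<bullet> b)\<^sup>2 \<le> 2\<^sup>2" using z(2)[of b] b by (subst abs_le_square_iff[symmetric]) auto
      then have "inverse 5 \<le> inverse (1 + (y \<bullet> b)\<^sup>2)" by (intro le_imp_inverse_le) (auto simp: one_plus_square_pos)
      then show "0 \<le> (1/5::real) \<and> 1/5 \<le> inverse (1 + (y \<bullet> b)\<^sup>2)" by simp
    qed
    finally show ?thesis .
  qed
  define a where "a = inverse ((1 + t ^ 4 * s\<^sup>2) ^ DIM('a))"
  define c where "c = inverse (t ^ (DIM('a) + 1))"
  have w: "slab_weight e e' y = inverse t * P * (a + c)"
    unfolding slab_weight_def P a_def c_def by (simp add: t_def s_def)
  have ac: "0 \<le> a" "0 \<le> c" using t1 by (simp_all add: a_def c_def)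
  have T4: "(s * T\<^sup>2)\<^sup>2 = T ^ 4 * s\<^sup>2" by (simp add: power_mult_distrib power_mult[symmetric] mult.commute)
  have s0: "0 \<le> s\<^sup>2" by simp
  have "T ^ 4 \<le> (3 * t) ^ 4" using tT T by (intro power_mono) auto
  then have "T ^ 4 * s\<^sup>2 \<le> (3 * t) ^ 4 * s\<^sup>2" using s0 by (rule mult_right_mono)
  then have "T ^ 4 * s\<^sup>2 \<le> 81 * (t ^ 4 * s\<^sup>2)" by (simp add: power_mult_distrib)
  then have "(1 + T ^ 4 * s\<^sup>2) / 81 \<le> 1 + t ^ 4 * s\<^sup>2" by simp
  moreover have pT: "0 < 1 + T ^ 4 * s\<^sup>2" by (intro add_pos_nonneg) auto
  ultimately have "inverse (1 + t ^ 4 * s\<^sup>2) \<le> inverse ((1 + T ^ 4 * s\<^sup>2) / 81)" by (intro le_imp_inverse_le) auto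
  then have "inverse (1 + t ^ 4 * s\<^sup>2) \<le> 81 * inverse (1 + T ^ 4 * s\<^sup>2)" by (simp add: inverse_eq_divide)
  then have "inverse (1 + t ^ 4 * s\<^sup>2) ^ DIM('a) \<le> (81 * inverse (1 + T ^ 4 * s\<^sup>2)) ^ DIM('a)" using t1 by (intro power_mono) auto
  then have a_le: "a \<le> 81 ^ DIM('a) * inverse (1 + T ^ 4 * s\<^sup>2) ^ DIM('a)" unfolding a_def by (simp only: power_inverse power_mult_distrib)
  have "t ^ 4 \<le> (3 * T) ^ 4" using tT t1 by (intro power_mono) auto
  then have "t ^ 4 * s\<^sup>2 \<le> (3 * T) ^ 4 * s\<^sup>2" using s0 by (rule mult_right_mono)
  then have "t ^ 4 * s\<^sup>2 \<le> 81 * (T ^ 4 * s\<^sup>2)" by (simp add: power_mult_distrib)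
  then have "inverse (1 + 81 * (T ^ 4 * s\<^sup>2)) \<le> inverse (1 + t ^ 4 * s\<^sup>2)" using t1 by (intro le_imp_inverse_le add_pos_nonneg) auto
  then have a_ge: "inverse (1 + 81 * (T ^ 4 * s\<^sup>2)) ^ DIM('a) \<le> a"
    unfolding a_def power_inverse[symmetric] using T by (intro power_mono) auto
  have "T / 3 \<le> t" using tT by simp
  then have "inverse t \<le> inverse (T / 3)" using T by (intro le_imp_inverse_le) auto
  then have it: "inverse t \<le> 3 / T" by (simp add: inverse_eq_divide)
  have "inverse t ^ (DIM('a) + 1) \<le> (3 / T) ^ (DIM('a) + 1)" using it t1 by (intro power_mono) auto
  then have c_le: "c \<le> 3 ^ (DIM('a) + 1) / T ^ (DIM('a) + 1)" unfolding c_def by (simp only: power_inverse power_divide)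
  have "inverse (3 * T) \<le> inverse t" using tT t1 by (intro le_imp_inverse_le) auto
  then have it': "1 / (3 * T) \<le> inverse t" by (simp add: inverse_eq_divide)
  have "(1 / (3 * T)) ^ (DIM('a) + 1) \<le> inverse t ^ (DIM('a) + 1)" using it' T by (intro power_mono) auto
  then have c_ge: "1 / (3 * T) ^ (DIM('a) + 1) \<le> c" unfolding c_def by (simp only: power_inverse power_divide power_one)
  have P0': "0 \<le> P" using P0 by (rule order_trans[rotated]) simp
  have "inverse t * P * (a + c) \<le> 3 / T * 1 * (81 ^ DIM('a) * inverse (1 + T ^ 4 * s\<^sup>2) ^ DIM('a) + 3 ^ (DIM('a) + 1) / T ^ (DIM('a) + 1))"
    using it P1 P0' a_le c_le ac T t1 by (intro mult_mono add_mono) auto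
  then show "slab_weight e e' y \<le> 3 / T * (81 ^ DIM('a) * inverse (1 + (y \<bullet> e * T\<^sup>2)\<^sup>2) ^ DIM('a) + 3 ^ (DIM('a) + 1) / T ^ (DIM('a) + 1))"
    unfolding w s_def[symmetric] T4 by simp
  have "1 / (3 * T) * (1/5) ^ DIM('a) * (inverse (1 + 81 * (T ^ 4 * s\<^sup>2)) ^ DIM('a) + 1 / (3 * T) ^ (DIM('a) + 1)) \<le> inverse t * P * (a + c)"
    using it' P0 P0' a_ge c_ge T t1 by (intro mult_mono add_mono) (auto intro!: add_nonneg_nonneg)
  then show "(1/5) ^ DIM('a) / (3 * T) * (inverse (1 + 81 * (y \<bullet> e * T\<^sup>2)\<^sup>2) ^ DIM('a) + 1 / (3 * T) ^ (DIM('a) + 1)) \<le> slab_weight e e' y"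
    unfolding w s_def[symmetric] T4 by simp
qed

text \<open>The ball \<open>ball (x - (x \<bullet> e + 1/2) *\<^sub>R e) (1/2)\<close> is tangent at the foot of \<open>x\<close> to the hyperplane \<open>y \<bullet> e = 0\<close>.
  Near that point the weight lives in a slab of width \<open>1 / T\<^sup>2\<close>, which the dilated ball meets in
  a cap of radius of order \<open>1 / T\<close>.\<close>
lemma dilated_tangent_ball:
  fixes x y e :: "'a::euclidean_space"
  assumes e: "e \<in> Basis" and T: "0 < T" and k: "k = 1 + 1 / T\<^sup>2" "k \<le> 3/2"
    and y: "y \<in> ball (x - (x \<bullet> e + 1/2) *\<^sub>R e) (k / 2)"
  shows "\<bar>y \<bullet> e + 1/2\<bar> < k / 2"
    and "b \<in> Basis \<Longrightarrow> b \<noteq> e \<Longrightarrow> \<bar>(y - x) \<bullet> b\<bar> < k / 2 \<and> 1 + ((y - x) \<bullet> b * T)\<^sup>2 \<le> 3 * (1 + (y \<bullet> e * T\<^sup>2)\<^sup>2)"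
proof -
  define z where "z = y - (x - (x \<bullet> e + 1/2) *\<^sub>R e)"
  have ee: "e \<bullet> e = 1" using e by (simp add: inner_Basis)
  have nz: "norm z < k / 2" using y by (simp add: z_def dist_norm norm_minus_commute)
  have ze: "z \<bullet> e = y \<bullet> e + 1/2" by (simp add: z_def inner_simps ee)
  have "\<bar>z \<bullet> e\<bar> \<le> norm z" using e by (rule Basis_le_norm)
  then show "\<bar>y \<bullet> e + 1/2\<bar> < k / 2" using nz ze by simp
  assume b: "b \<in> Basis" "b \<noteq> e"
  have zb: "z \<bullet> b = (y - x) \<bullet> b" using b e by (simp add: z_def inner_simps inner_Basis)
  have 1: "\<bar>(y - x) \<bullet> b\<bar> < k / 2" using Basis_le_norm[OF b(1), of z] nz zb by simp
  have "(z \<bullet> e)\<^sup>2 + (z \<bullet> b)\<^sup>2 = (\<Sum>i\<in>{e, b}. (z \<bullet> i)\<^sup>2)" using b by simp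
  also have "\<dots> \<le> (\<Sum>i\<in>Basis. (z \<bullet> i)\<^sup>2)" by (rule sum_mono2) (use e b in auto)
  also have "\<dots> = (norm z)\<^sup>2"
  proof -
    have "z \<bullet> z = (\<Sum>i\<in>Basis. (z \<bullet> i)\<^sup>2)" by (subst euclidean_inner) (simp add: power2_eq_square)
    then show ?thesis by (simp add: power2_norm_eq_inner)
  qed
  also have "\<dots> \<le> (k / 2)\<^sup>2" using nz by (intro power_mono) auto
  finally have "(y \<bullet> e + 1/2)\<^sup>2 + ((y - x) \<bullet> b)\<^sup>2 \<le> (k / 2)\<^sup>2" unfolding ze zb .
  moreover have "(y \<bullet> e + 1/2)\<^sup>2 = (y \<bullet> e)\<^sup>2 + y \<bullet> e + 1/4" by (simp add: power2_eq_square algebra_simps)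
  moreover have "(k / 2)\<^sup>2 \<le> 1/4 + 1 / T\<^sup>2"
  proof -
    define u where "u = 1 / T\<^sup>2"
    have u: "0 \<le> u" "u \<le> 1/2" using k by (auto simp: u_def)
    have "(k / 2)\<^sup>2 = 1/4 + u / 2 + u * u / 4" unfolding k u_def[symmetric] by (simp add: power2_eq_square algebra_simps)
    moreover have "u * u \<le> u * (1/2)" using u by (intro mult_left_mono) auto
    ultimately show ?thesis unfolding u_def[symmetric] using u by linarith
  qed
  moreover have "0 \<le> (y \<bullet> e)\<^sup>2" by simp
  \<comment> \<open>A point of the dilated ball at height \<open>y \<bullet> e\<close> is off the
    axis by at most the root of \<open>1 / T\<^sup>2 + \<bar>y \<bullet> e\<bar>\<close>. Measured
    in units of the slab, horizontal displacement is thus controlled by height.\<close>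
  ultimately have "((y - x) \<bullet> b)\<^sup>2 \<le> 1 / T\<^sup>2 + \<bar>y \<bullet> e\<bar>" by argo
  then have "((y - x) \<bullet> b)\<^sup>2 * T\<^sup>2 \<le> (1 / T\<^sup>2 + \<bar>y \<bullet> e\<bar>) * T\<^sup>2" by (rule mult_right_mono) simp
  then have "((y - x) \<bullet> b * T)\<^sup>2 \<le> 1 + \<bar>y \<bullet> e * T\<^sup>2\<bar>" using T by (simp add: power_mult_distrib distrib_right abs_mult)
  moreover have "2 * \<bar>y \<bullet> e * T\<^sup>2\<bar> \<le> 1 + (y \<bullet> e * T\<^sup>2)\<^sup>2"
  proof -
    have "0 \<le> (\<bar>y \<bullet> e * T\<^sup>2\<bar> - 1)\<^sup>2" by simp
    also have "\<dots> = \<bar>y \<bullet> e * T\<^sup>2\<bar>\<^sup>2 - 2 * \<bar>y \<bullet> e * T\<^sup>2\<bar> + 1" by (simp only: power2_diff) simp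
    also have "\<bar>y \<bullet> e * T\<^sup>2\<bar>\<^sup>2 = (y \<bullet> e * T\<^sup>2)\<^sup>2" by (rule power2_abs)
    finally show ?thesis by linarith
  qed
  moreover have "0 \<le> (y \<bullet> e * T\<^sup>2)\<^sup>2" by simp
  ultimately have "1 + ((y - x) \<bullet> b * T)\<^sup>2 \<le> 3 * (1 + (y \<bullet> e * T\<^sup>2)\<^sup>2)" by argo
  with 1 show "\<bar>(y - x) \<bullet> b\<bar> < k / 2 \<and> 1 + ((y - x) \<bullet> b * T)\<^sup>2 \<le> 3 * (1 + (y \<bullet> e * T\<^sup>2)\<^sup>2)" by blast
qed

text \<open>By \<open>dilated_tangent_ball\<close> the vertical decay factor \<open>h\<close> is at
  most three times a Cauchy density in every coordinate, on the scale \<open>1 / T\<^sup>2\<close>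
  along \<open>e\<close> and \<open>1 / T\<close> along the others. So \<open>h ^ n\<close> is
  bounded by a product with integral of order \<open>1 / T ^ (n + 1)\<close>, and the density at
  this place of the axis contributes one more \<open>1 / T\<close>.\<close>

lemma slab_weight_dilated_ball:
  assumes e: "e \<in> Basis" "e' \<in> Basis" "e \<noteq> (e' :: 'a::euclidean_space)"
  shows "\<exists>A>0. \<forall>T k m x. 1 \<le> T \<and> k = 1 + 1 / T\<^sup>2 \<and> k \<le> 3/2 \<and> m\<^sup>2 = T - 1 \<and> \<bar>x \<bullet> e' - m\<bar> \<le> 1/4 \<and>
     (\<forall>b\<in>Basis. b \<noteq> e \<longrightarrow> b \<noteq> e' \<longrightarrow> \<bar>x \<bullet> b\<bar> \<le> 1) \<longrightarrow>
     (\<integral>\<^sup>+y\<in>ball (x - (x \<bullet> e + 1/2) *\<^sub>R e) (k / 2). ennreal (slab_weight e e' y) \<partial>lborel) \<le> ennreal (A / T ^ (DIM('a) + 2))"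
proof -
  obtain J where J: "0 \<le> J" and "(\<integral>\<^sup>+u. ennreal (inverse (1 + u\<^sup>2)) \<partial>lborel) = ennreal J"
    and J': "\<And>a c. 0 < c \<Longrightarrow> (\<integral>\<^sup>+u. ennreal (inverse (1 + ((u - a) * c)\<^sup>2)) \<partial>lborel) = ennreal (J / c)"
    by (rule nn_integral_cauchy_density) (rule that)
  define n where "n = DIM('a)"
  define V where "V = unit_ball_vol (real n)"
  have V: "0 < V" by (simp add: V_def)
  define A where "A = 3 * (81 ^ n * (3 ^ n * J ^ n) + 3 ^ (n + 1) * V)"
  have A: "0 < A" using V J by (simp add: A_def add_nonneg_pos)
  show ?thesis
  proof (rule exI[of _ A], rule conjI, rule A, (rule allI)+, rule impI, elim conjE)
    fix T k m :: real and x :: 'a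
    assume T: "1 \<le> T" and k: "k = 1 + 1 / T\<^sup>2" "k \<le> 3/2" and m: "m\<^sup>2 = T - 1" and x': "\<bar>x \<bullet> e' - m\<bar> \<le> 1/4"
      and xb: "\<forall>b\<in>Basis. b \<noteq> e \<longrightarrow> b \<noteq> e' \<longrightarrow> \<bar>x \<bullet> b\<bar> \<le> 1"
    define B where "B = ball (x - (x \<bullet> e + 1/2) *\<^sub>R e) (k / 2)"
    have [measurable]: "B \<in> sets borel" by (simp add: B_def)
    define a where "a b = (if b = e then 0 else x \<bullet> b)" for b
    define q where "q b = (if b = e then T\<^sup>2 else T)" for b
    have q: "0 < q b" for b using T by (simp add: q_def)
    define G where "G y = (\<Prod>b\<in>Basis. ennreal 3 * ennreal (inverse (1 + ((y \<bullet> b - a b) * q b)\<^sup>2)))" for y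
    have T0: "0 < T" using T by simp
    have bound: "ennreal (slab_weight e e' y) \<le> ennreal (3 / T * 81 ^ n) * G y + ennreal (3 / T * (3 ^ (n + 1) / T ^ (n + 1)))"
      if y: "y \<in> B" for y
    proof -
      note d = dilated_tangent_ball[OF e(1) T0 k y[unfolded B_def]]
      have yx: "\<bar>y \<bullet> b - x \<bullet> b\<bar> < k / 2" if "b \<in> Basis" "b \<noteq> e" for b
        using d(2)[OF that] by (simp only: inner_diff_left)
      have z': "\<bar>y \<bullet> e' - m\<bar> \<le> 1" using yx[OF e(2) e(3)[symmetric]] x' k(2) by linarith
      have zb: "\<bar>y \<bullet> b\<bar> \<le> 2" if b: "b \<in> Basis" "b \<noteq> e'" for b
      proof (cases "b = e")
        case True show ?thesis unfolding True using d(1) k(2) by linarith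
      next
        case False
        then have "\<bar>x \<bullet> b\<bar> \<le> 1" using xb b by blast
        then show ?thesis using yx[OF b(1) False] k(2) by linarith
      qed
      define h where "h = inverse (1 + (y \<bullet> e * T\<^sup>2)\<^sup>2)"
      have h0: "0 \<le> h" by (simp add: h_def)
      have "h ^ n = (\<Prod>b\<in>(Basis::'a set). h)" by (simp add: n_def)
      also have "\<dots> \<le> (\<Prod>b\<in>Basis. 3 * inverse (1 + ((y \<bullet> b - a b) * q b)\<^sup>2))"
      proof (rule prod_mono, rule conjI[OF h0])
        fix b :: 'a assume b: "b \<in> Basis"
        have le: "1 + ((y \<bullet> b - a b) * q b)\<^sup>2 \<le> 3 * (1 + (y \<bullet> e * T\<^sup>2)\<^sup>2)"
        proof (cases "b = e")
          case True
          have "0 \<le> (y \<bullet> e * T\<^sup>2)\<^sup>2" by simp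
          then have "1 + (y \<bullet> e * T\<^sup>2)\<^sup>2 \<le> 3 * (1 + (y \<bullet> e * T\<^sup>2)\<^sup>2)" by argo
          then show ?thesis using True by (simp add: a_def q_def)
        next
          case False
          then show ?thesis using d(2)[OF b False] by (simp add: a_def q_def inner_diff_left)
        qed
        have "inverse (3 * (1 + (y \<bullet> e * T\<^sup>2)\<^sup>2)) \<le> inverse (1 + ((y \<bullet> b - a b) * q b)\<^sup>2)"
          by (rule le_imp_inverse_le[OF le]) (rule one_plus_square_pos(1))
        then have "inverse 3 * h \<le> inverse (1 + ((y \<bullet> b - a b) * q b)\<^sup>2)" by (simp only: h_def inverse_mult_distrib)
        then have "3 * (inverse 3 * h) \<le> 3 * inverse (1 + ((y \<bullet> b - a b) * q b)\<^sup>2)" by (rule mult_left_mono) simp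
        then show "h \<le> 3 * inverse (1 + ((y \<bullet> b - a b) * q b)\<^sup>2)" by simp
      qed
      finally have hG: "h ^ n \<le> (\<Prod>b\<in>Basis. 3 * inverse (1 + ((y \<bullet> b - a b) * q b)\<^sup>2))" .
      have G: "G y = ennreal (\<Prod>b\<in>Basis. 3 * inverse (1 + ((y \<bullet> b - a b) * q b)\<^sup>2))"
        unfolding G_def by (subst prod_ennreal[symmetric]) (simp_all add: ennreal_mult' one_plus_square_pos(1) less_imp_le)
      have "slab_weight e e' y \<le> 3 / T * (81 ^ n * h ^ n + 3 ^ (n + 1) / T ^ (n + 1))"
        unfolding h_def n_def by (rule slab_weight_zone(1)[OF e(2) T m z' zb])
      also have "\<dots> = 3 / T * 81 ^ n * h ^ n + 3 / T * (3 ^ (n + 1) / T ^ (n + 1))" by (simp only: distrib_left mult.assoc)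
      also have "\<dots> \<le> 3 / T * 81 ^ n * (\<Prod>b\<in>Basis. 3 * inverse (1 + ((y \<bullet> b - a b) * q b)\<^sup>2)) + 3 / T * (3 ^ (n + 1) / T ^ (n + 1))"
        using T by (intro add_right_mono mult_left_mono hG) auto
      finally have "ennreal (slab_weight e e' y) \<le> ennreal \<dots>" by (rule ennreal_leI)
      also have "\<dots> = ennreal (3 / T * 81 ^ n) * G y + ennreal (3 / T * (3 ^ (n + 1) / T ^ (n + 1)))"
      proof (subst ennreal_plus)
        show "0 \<le> 3 / T * 81 ^ n * (\<Prod>b\<in>Basis. 3 * inverse (1 + ((y \<bullet> b - a b) * q b)\<^sup>2))"
          using T by (intro mult_nonneg_nonneg prod_nonneg) (auto simp: one_plus_square_pos(1) less_imp_le)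
        show "0 \<le> 3 / T * (3 ^ (n + 1) / T ^ (n + 1))" using T by simp
        have "0 \<le> 3 / T * 81 ^ n" using T by simp
        then show "ennreal (3 / T * 81 ^ n * (\<Prod>b\<in>Basis. 3 * inverse (1 + ((y \<bullet> b - a b) * q b)\<^sup>2)))
            + ennreal (3 / T * (3 ^ (n + 1) / T ^ (n + 1)))
          = ennreal (3 / T * 81 ^ n) * G y + ennreal (3 / T * (3 ^ (n + 1) / T ^ (n + 1)))"
          by (simp only: G ennreal_mult')
      qed
      finally show ?thesis .
    qed
    have "(\<integral>\<^sup>+y. G y \<partial>lborel) = (\<Prod>b\<in>Basis. \<integral>\<^sup>+u. ennreal 3 * ennreal (inverse (1 + ((u - a b) * q b)\<^sup>2)) \<partial>lborel)"
      unfolding G_def by (rule nn_integral_lborel_prod) simp_all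
    also have "\<dots> = (\<Prod>b\<in>Basis. ennreal (3 * (J / q b)))"
    proof (rule prod.cong[OF refl])
      fix b :: 'a
      have "(\<integral>\<^sup>+u. ennreal 3 * ennreal (inverse (1 + ((u - a b) * q b)\<^sup>2)) \<partial>lborel) = ennreal 3 * ennreal (J / q b)"
        unfolding J'[OF q[of b], of "a b", symmetric] by (rule nn_integral_cmult) measurable
      then show "(\<integral>\<^sup>+u. ennreal 3 * ennreal (inverse (1 + ((u - a b) * q b)\<^sup>2)) \<partial>lborel) = ennreal (3 * (J / q b))"
        by (simp only: ennreal_mult'[of 3] zero_le_numeral)
    qed
    also have "\<dots> = ennreal (\<Prod>b\<in>Basis. 3 * (J / q b))"
      using J q by (intro prod_ennreal) (simp add: less_imp_le)
    also have "(\<Prod>b\<in>Basis. 3 * (J / q b)) = 3 ^ n * J ^ n / (\<Prod>b\<in>Basis. q b)"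
      by (simp add: prod.distrib prod_dividef n_def)
    also have "(\<Prod>b\<in>Basis. q b) = T ^ (n + 1)"
    proof -
      have "(\<Prod>b\<in>Basis. q b) = T\<^sup>2 * (\<Prod>b\<in>Basis - {e}. T)"
        using e(1) by (subst prod.remove[of _ e]) (auto simp: q_def intro!: prod.cong)
      also have "\<dots> = T ^ (2 + (n - 1))" unfolding power_add n_def using e(1) by (simp add: card_Diff_singleton)
      also have "2 + (n - 1) = n + 1" using DIM_positive[where 'a='a] by (simp add: n_def)
      finally show ?thesis .
    qed
    finally have IG: "(\<integral>\<^sup>+y. G y \<partial>lborel) = ennreal (3 ^ n * J ^ n / T ^ (n + 1))" .
    have vol: "emeasure lborel B \<le> ennreal V"
    proof -
      have "emeasure lborel B \<le> emeasure lborel (ball (x - (x \<bullet> e + 1/2) *\<^sub>R e) 1)"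
        unfolding B_def using k by (intro emeasure_mono subset_ball) auto
      then show ?thesis by (simp add: emeasure_ball V_def n_def)
    qed
    have [measurable]: "G \<in> borel_measurable borel" unfolding G_def by measurable
    have "(\<integral>\<^sup>+y\<in>B. ennreal (slab_weight e e' y) \<partial>lborel)
      \<le> (\<integral>\<^sup>+y. ennreal (3 / T * 81 ^ n) * G y + ennreal (3 / T * (3 ^ (n + 1) / T ^ (n + 1))) * indicator B y \<partial>lborel)"
    proof (rule nn_integral_mono)
      fix y
      show "ennreal (slab_weight e e' y) * indicator B y \<le> ennreal (3 / T * 81 ^ n) * G y + ennreal (3 / T * (3 ^ (n + 1) / T ^ (n + 1))) * indicator B y"
        using bound[of y] by (cases "y \<in> B") simp_all
    qed
    also have "\<dots> = ennreal (3 / T * 81 ^ n) * (\<integral>\<^sup>+y. G y \<partial>lborel) + ennreal (3 / T * (3 ^ (n + 1) / T ^ (n + 1))) * emeasure lborel B"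
      by (subst nn_integral_add) (simp_all add: nn_integral_cmult)
    also have "\<dots> \<le> ennreal (3 / T * 81 ^ n) * ennreal (3 ^ n * J ^ n / T ^ (n + 1)) + ennreal (3 / T * (3 ^ (n + 1) / T ^ (n + 1))) * ennreal V"
      unfolding IG by (intro add_mono mult_left_mono vol) auto
    also have "\<dots> = ennreal (3 / T * 81 ^ n * (3 ^ n * J ^ n / T ^ (n + 1)) + 3 / T * (3 ^ (n + 1) / T ^ (n + 1)) * V)"
    proof -
      have "0 \<le> 3 / T * 81 ^ n" "0 \<le> 3 ^ n * J ^ n / T ^ (n + 1)" "0 \<le> 3 / T * (3 ^ (n + 1) / T ^ (n + 1))" "0 \<le> V"
        using T J V by auto
      then show ?thesis by (simp only: ennreal_mult ennreal_plus mult_nonneg_nonneg)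
    qed
    also have "3 / T * 81 ^ n * (3 ^ n * J ^ n / T ^ (n + 1)) + 3 / T * (3 ^ (n + 1) / T ^ (n + 1)) * V = A / T ^ (n + 2)"
      using T by (simp add: A_def field_simps)
    finally show "(\<integral>\<^sup>+y\<in>ball (x - (x \<bullet> e + 1/2) *\<^sub>R e) (k / 2). ennreal (slab_weight e e' y) \<partial>lborel) \<le> ennreal (A / T ^ (DIM('a) + 2))"
      by (simp add: B_def n_def)
  qed
qed

lemma set_nn_integral_ge:
  assumes "S \<in> sets M" "\<And>y. y \<in> S \<Longrightarrow> c \<le> f y"
  shows "ennreal c * emeasure M S \<le> (\<integral>\<^sup>+y\<in>S. ennreal (f y) \<partial>M)"
proof -
  have "ennreal c * emeasure M S = (\<integral>\<^sup>+y. ennreal c * indicator S y \<partial>M)"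
    by (rule nn_integral_cmult_indicator[OF assms(1), symmetric])
  also have "\<dots> \<le> (\<integral>\<^sup>+y\<in>S. ennreal (f y) \<partial>M)"
    by (rule nn_integral_mono) (use assms(2) in \<open>auto simp: indicator_def intro!: ennreal_leI\<close>)
  finally show ?thesis .
qed

lemma slab_weight_lower:
  assumes e: "e \<in> Basis" "e' \<in> Basis" "e \<noteq> (e' :: 'a::euclidean_space)"
  shows "\<exists>a>0. \<forall>T m. 1 \<le> T \<and> m\<^sup>2 = T - 1 \<longrightarrow>
     (\<exists>E. E \<in> sets borel \<and>
       (\<forall>x\<in>E. -1 / T\<^sup>2 < x \<bullet> e \<and> x \<bullet> e < 0 \<and> (\<forall>b\<in>Basis. b \<noteq> e \<longrightarrow> \<bar>(x - m *\<^sub>R e') \<bullet> b\<bar> \<le> 1 / (4 * DIM('a)))) \<and>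
       ennreal (a / T ^ 3) \<le> (\<integral>\<^sup>+y\<in>E. ennreal (slab_weight e e' y) \<partial>lborel)) \<and>
     ennreal (a / T ^ (DIM('a) + 2)) \<le> (\<integral>\<^sup>+y\<in>ball (m *\<^sub>R e' - (1/2) *\<^sub>R e) (1/4). ennreal (slab_weight e e' y) \<partial>lborel)"
proof -
  define n where "n = DIM('a)"
  have n: "0 < n" by (simp add: n_def)
  \<comment> \<open>So small that displacements by \<open>h\<close> in all coordinates add up to at
    most 1/4. The centres of all tangent balls over \<open>E\<close> then lie within 1/4 of the
    centre of the common smaller ball.\<close>
  define h where "h = 1 / (4 * real n)"
  have h: "0 < h" "h \<le> 1/4" using n by (auto simp: h_def field_simps)
  define V where "V = unit_ball_vol (real n) * (1/4) ^ n"
  have V: "0 < V" by (simp add: V_def)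
  define a1 where "a1 = (1/5) ^ n / 3 * inverse 82 ^ n * (2 * h) ^ (n - 1)"
  define a2 where "a2 = (1/5) ^ n / 3 * (1 / 3 ^ (n + 1)) * V"
  have a12: "0 < a1" "0 < a2" using h V by (simp_all add: a1_def a2_def)
  define a where "a = min a1 a2"
  have a: "0 < a" using a12 by (simp add: a_def)
  have ie: "e \<bullet> e = 1" "e' \<bullet> e' = 1" "e \<bullet> e' = 0" "e' \<bullet> e = 0" using e by (auto simp: inner_Basis)
  show ?thesis
  proof (rule exI[of _ a], rule conjI, rule a, (rule allI)+, rule impI, elim conjE, rule conjI)
    fix T m :: real assume T: "1 \<le> T" and m: "m\<^sup>2 = T - 1"
    define \<delta> where "\<delta> = 1 / T\<^sup>2"
    have \<delta>: "0 < \<delta>" "\<delta> \<le> 1" using T by (auto simp: \<delta>_def)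
    define p where "p = m *\<^sub>R e'"
    have pe: "p \<bullet> e = 0" "p \<bullet> e' = m" by (simp_all add: p_def ie)
    have pb: "p \<bullet> b = 0" if "b \<in> Basis" "b \<noteq> e'" for b using that e by (simp add: p_def inner_Basis)
    define lo where "lo = (\<Sum>b\<in>Basis. (if b = e then - \<delta> else p \<bullet> b - h) *\<^sub>R b)"
    define hi where "hi = (\<Sum>b\<in>Basis. (if b = e then 0 else p \<bullet> b + h) *\<^sub>R b)"
    have lo: "lo \<bullet> b = (if b = e then - \<delta> else p \<bullet> b - h)" if "b \<in> Basis" for b
      unfolding lo_def using that by (rule inner_sum_left_Basis)
    have hi: "hi \<bullet> b = (if b = e then 0 else p \<bullet> b + h)" if "b \<in> Basis" for b
      unfolding hi_def using that by (rule inner_sum_left_Basis)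
    define E where "E = box lo hi"
    have Ee: "- \<delta> < x \<bullet> e \<and> x \<bullet> e < 0" if "x \<in> E" for x
    proof -
      have "lo \<bullet> e < x \<bullet> e \<and> x \<bullet> e < hi \<bullet> e" using that e(1) unfolding E_def mem_box by blast
      then show ?thesis using lo[OF e(1)] hi[OF e(1)] by simp
    qed
    have Eb: "\<bar>(x - p) \<bullet> b\<bar> \<le> h" if "x \<in> E" "b \<in> Basis" "b \<noteq> e" for x b
    proof -
      have "lo \<bullet> b < x \<bullet> b" "x \<bullet> b < hi \<bullet> b" using that(1,2) by (auto simp: E_def mem_box)
      then show ?thesis using lo[OF that(2)] hi[OF that(2)] that(3) by (simp add: inner_diff_left)
    qed
    have low: "(1/5) ^ n / (3 * T) * inverse 82 ^ n \<le> slab_weight e e' x" if x: "x \<in> E" for x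
    proof -
      have z': "\<bar>x \<bullet> e' - m\<bar> \<le> 1" using Eb[OF x e(2)] e(3) h pe by (simp add: inner_diff_left)
      have zb: "\<bar>x \<bullet> b\<bar> \<le> 2" if b: "b \<in> Basis" "b \<noteq> e'" for b
      proof (cases "b = e")
        case True show ?thesis unfolding True using Ee[OF x] \<delta> by linarith
      next
        case False then show ?thesis using Eb[OF x b(1) False] pb[OF b] h by (simp add: inner_diff_left)
      qed
      have "\<bar>x \<bullet> e\<bar> * T\<^sup>2 \<le> \<delta> * T\<^sup>2" using Ee[OF x] by (intro mult_right_mono) auto
      then have "\<bar>x \<bullet> e * T\<^sup>2\<bar> \<le> 1" using T by (simp add: \<delta>_def abs_mult)
      then have "(x \<bullet> e * T\<^sup>2)\<^sup>2 \<le> 1" by (simp only: abs_square_le_1)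
      then have "inverse 82 \<le> inverse (1 + 81 * (x \<bullet> e * T\<^sup>2)\<^sup>2)" by (intro le_imp_inverse_le add_pos_nonneg) auto
      then have "inverse 82 ^ n \<le> inverse (1 + 81 * (x \<bullet> e * T\<^sup>2)\<^sup>2) ^ n" by (intro power_mono) auto
      then have "inverse 82 ^ n \<le> inverse (1 + 81 * (x \<bullet> e * T\<^sup>2)\<^sup>2) ^ n + 1 / (3 * T) ^ (n + 1)" using T by (intro add_increasing2) auto
      then have "(1/5) ^ n / (3 * T) * inverse 82 ^ n \<le> (1/5) ^ n / (3 * T) * (inverse (1 + 81 * (x \<bullet> e * T\<^sup>2)\<^sup>2) ^ n + 1 / (3 * T) ^ (n + 1))"
        using T by (intro mult_left_mono) auto
      also have "\<dots> \<le> slab_weight e e' x" unfolding n_def by (rule slab_weight_zone(2)[OF e(2) T m z' zb])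
      finally show ?thesis .
    qed
    have volE: "emeasure lborel E = ennreal (\<delta> * (2 * h) ^ (n - 1))"
    proof -
      have "emeasure lborel E = ennreal (\<Prod>b\<in>Basis. (hi - lo) \<bullet> b)"
        unfolding E_def using lo hi h \<delta> by (intro emeasure_lborel_box) auto
      also have "(\<Prod>b\<in>Basis. (hi - lo) \<bullet> b) = \<delta> * (\<Prod>b\<in>Basis - {e}. 2 * h)"
        using e(1) lo hi by (subst prod.remove[of _ e]) (auto simp: inner_diff_left intro!: prod.cong)
      also have "\<dots> = \<delta> * (2 * h) ^ (n - 1)" using e(1) by (simp add: n_def card_Diff_singleton)
      finally show ?thesis .
    qed
    show "\<exists>E. E \<in> sets borel \<and>
       (\<forall>x\<in>E. -1 / T\<^sup>2 < x \<bullet> e \<and> x \<bullet> e < 0 \<and> (\<forall>b\<in>Basis. b \<noteq> e \<longrightarrow> \<bar>(x - m *\<^sub>R e') \<bullet> b\<bar> \<le> 1 / (4 * DIM('a)))) \<and>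
       ennreal (a / T ^ 3) \<le> (\<integral>\<^sup>+y\<in>E. ennreal (slab_weight e e' y) \<partial>lborel)"
    proof (intro exI[of _ E] conjI ballI impI)
      show "E \<in> sets borel" by (simp add: E_def)
      show "-1 / T\<^sup>2 < x \<bullet> e" "x \<bullet> e < 0" if "x \<in> E" for x using Ee[OF that] by (auto simp: \<delta>_def)
      show "\<bar>(x - m *\<^sub>R e') \<bullet> b\<bar> \<le> 1 / (4 * DIM('a))" if "x \<in> E" "b \<in> Basis" "b \<noteq> e" for x b
        using Eb[OF that] by (simp add: p_def h_def n_def)
      have "ennreal (a / T ^ 3) \<le> ennreal (a1 / T ^ 3)" using T by (intro ennreal_leI divide_right_mono) (auto simp: a_def)
      also have "a1 / T ^ 3 = (1/5) ^ n / (3 * T) * inverse 82 ^ n * (\<delta> * (2 * h) ^ (n - 1))"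
        using T by (simp add: a1_def \<delta>_def field_simps power3_eq_cube power2_eq_square)
      also have "ennreal \<dots> = ennreal ((1/5) ^ n / (3 * T) * inverse 82 ^ n) * emeasure lborel E"
        unfolding volE using T by (intro ennreal_mult') auto
      also have "\<dots> \<le> (\<integral>\<^sup>+y\<in>E. ennreal (slab_weight e e' y) \<partial>lborel)"
        by (rule set_nn_integral_ge[OF _ low]) (simp add: E_def)
      finally show "ennreal (a / T ^ 3) \<le> (\<integral>\<^sup>+y\<in>E. ennreal (slab_weight e e' y) \<partial>lborel)" .
    qed
    have low2: "(1/5) ^ n / (3 * T) * (1 / (3 * T) ^ (n + 1)) \<le> slab_weight e e' y"
      if y: "y \<in> ball (p - (1/2) *\<^sub>R e) (1/4)" for y
    proof -
      have yb: "\<bar>(y - (p - (1/2) *\<^sub>R e)) \<bullet> b\<bar> \<le> 1/4" if "b \<in> Basis" for b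
        using Basis_le_norm[OF that, of "y - (p - (1/2) *\<^sub>R e)"] y by (simp add: dist_norm norm_minus_commute)
      have z': "\<bar>y \<bullet> e' - m\<bar> \<le> 1" using yb[OF e(2)] pe ie by (simp add: inner_diff_left)
      have zb: "\<bar>y \<bullet> b\<bar> \<le> 2" if b: "b \<in> Basis" "b \<noteq> e'" for b
      proof -
        have "\<bar>e \<bullet> b\<bar> \<le> 1" using e b by (simp add: inner_Basis)
        then show ?thesis using yb[OF b(1)] pb[OF b] by (simp add: inner_diff_left) argo
      qed
      have "(1/5) ^ n / (3 * T) * (1 / (3 * T) ^ (n + 1)) \<le> (1/5) ^ n / (3 * T) * (inverse (1 + 81 * (y \<bullet> e * T\<^sup>2)\<^sup>2) ^ n + 1 / (3 * T) ^ (n + 1))"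
        using T by (intro mult_left_mono) auto
      also have "\<dots> \<le> slab_weight e e' y" unfolding n_def by (rule slab_weight_zone(2)[OF e(2) T m z' zb])
      finally show ?thesis .
    qed
    have "ennreal (a / T ^ (n + 2)) \<le> ennreal (a2 / T ^ (n + 2))" using T by (intro ennreal_leI divide_right_mono) (auto simp: a_def)
    also have "a2 / T ^ (n + 2) = (1/5) ^ n / (3 * T) * (1 / (3 * T) ^ (n + 1)) * V"
      using T by (simp add: a2_def field_simps power_mult_distrib)
    also have "ennreal \<dots> = ennreal ((1/5) ^ n / (3 * T) * (1 / (3 * T) ^ (n + 1))) * emeasure lborel (ball (p - (1/2) *\<^sub>R e) (1/4))"
      unfolding V_def n_def using T by (subst ennreal_mult') (auto simp: emeasure_ball)
    also have "\<dots> \<le> (\<integral>\<^sup>+y\<in>ball (p - (1/2) *\<^sub>R e) (1/4). ennreal (slab_weight e e' y) \<partial>lborel)"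
      by (rule set_nn_integral_ge[OF _ low2]) auto
    finally show "ennreal (a / T ^ (DIM('a) + 2)) \<le> (\<integral>\<^sup>+y\<in>ball (m *\<^sub>R e' - (1/2) *\<^sub>R e) (1/4). ennreal (slab_weight e e' y) \<partial>lborel)"
      by (simp add: n_def p_def)
  qed
qed

lemma ennreal_divide_left_mono:
  fixes a N :: ennreal
  assumes "N \<le> ennreal M" "0 < M"
  shows "a / ennreal M \<le> a / N"
proof (cases N)
  case (real r)
  show ?thesis
  proof (cases "r = 0")
    case True
    then show ?thesis using real by (cases "a = 0") (simp_all add: divide_ennreal_def ennreal_mult_top)
  next
    case False
    then have "0 < r" "r \<le> M" using real assms by simp_all
    then have "inverse (ennreal M) \<le> inverse N" using assms(2) real
      by (simp add: inverse_ennreal ennreal_leI)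
    then show ?thesis unfolding divide_ennreal_def by (rule mult_left_mono) simp
  qed
qed (use assms in \<open>simp add: top_unique\<close>)

text \<open>The common ball \<open>F\<close> has mass at least, and each dilated tangent ball mass
  at most, of order \<open>1 / T ^ (n + 2)\<close>, so the maximal function is bounded below on
  \<open>E\<close> by a constant. The mass of \<open>E\<close> is at least of order
  \<open>1 / T ^ 3\<close>, and comparing it with the mass of a cap gives
  \<open>T ^ (n - 1)\<close>, the required power of \<open>k - 1\<close>.\<close>

lemma slab_measure_test_sets:
  fixes e e' :: "real^'n"
  assumes e: "e \<in> Basis" "e' \<in> Basis" "e \<noteq> e'" and c0: "0 < c0"
    and \<mu>: "\<mu> = density lborel (\<lambda>x. ennreal (c0 * slab_weight e e' x))"
  shows "\<exists>B>0. \<forall>k. 1 < k \<and> k \<le> 3/2 \<longrightarrow> maximal_test_sets k \<mu> B ((k - 1) powr (- ((real CARD('n) - 1) / 2)))"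
proof -
  have D: "DIM(real^'n) = CARD('n)" by simp
  define n where "n = DIM(real^'n)"
  have n: "0 < n" by (simp add: n_def)
  obtain A where A: "0 < A" and up: "\<forall>T k m x. 1 \<le> T \<and> k = 1 + 1 / T\<^sup>2 \<and> k \<le> 3/2 \<and> m\<^sup>2 = T - 1 \<and> \<bar>x \<bullet> e' - m\<bar> \<le> 1/4 \<and>
     (\<forall>b\<in>Basis. b \<noteq> e \<longrightarrow> b \<noteq> e' \<longrightarrow> \<bar>x \<bullet> b\<bar> \<le> 1) \<longrightarrow>
     (\<integral>\<^sup>+y\<in>ball (x - (x \<bullet> e + 1/2) *\<^sub>R e) (k / 2). ennreal (slab_weight e e' y) \<partial>lborel) \<le> ennreal (A / T ^ (DIM(real^'n) + 2))"
    by (rule exE[OF slab_weight_dilated_ball[OF e]], erule conjE, rule that, assumption, assumption)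
  obtain a where a: "0 < a" and low: "\<forall>T m. 1 \<le> T \<and> m\<^sup>2 = T - 1 \<longrightarrow>
     (\<exists>E. E \<in> sets borel \<and>
       (\<forall>x\<in>E. -1 / T\<^sup>2 < x \<bullet> e \<and> x \<bullet> e < 0 \<and> (\<forall>b\<in>Basis. b \<noteq> e \<longrightarrow> \<bar>(x - m *\<^sub>R e') \<bullet> b\<bar> \<le> 1 / (4 * DIM(real^'n)))) \<and>
       ennreal (a / T ^ 3) \<le> (\<integral>\<^sup>+y\<in>E. ennreal (slab_weight e e' y) \<partial>lborel)) \<and>
     ennreal (a / T ^ (DIM(real^'n) + 2)) \<le> (\<integral>\<^sup>+y\<in>ball (m *\<^sub>R e' - (1/2) *\<^sub>R e) (1/4). ennreal (slab_weight e e' y) \<partial>lborel)"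
    by (rule exE[OF slab_weight_lower[OF e]], erule conjE, rule that, assumption, assumption)
  have em: "emeasure \<mu> X = ennreal c0 * (\<integral>\<^sup>+y\<in>X. ennreal (slab_weight e e' y) \<partial>lborel)" if X [measurable]: "X \<in> sets borel" for X
  proof -
    have "emeasure \<mu> X = (\<integral>\<^sup>+y\<in>X. ennreal (c0 * slab_weight e e' y) \<partial>lborel)"
      unfolding \<mu> by (rule emeasure_density) (simp_all add: X)
    also have "\<dots> = (\<integral>\<^sup>+y. ennreal c0 * (ennreal (slab_weight e e' y) * indicator X y) \<partial>lborel)"
      using c0 by (simp add: ennreal_mult' mult.assoc)
    also have "\<dots> = ennreal c0 * (\<integral>\<^sup>+y\<in>X. ennreal (slab_weight e e' y) \<partial>lborel)" by (rule nn_integral_cmult) measurable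
    finally show ?thesis .
  qed
  have s: "sets \<mu> = sets borel" by (simp add: \<mu>)
  interpret finite_measure \<mu>
  proof
    have "emeasure \<mu> UNIV = ennreal c0 * (\<integral>\<^sup>+y. ennreal (slab_weight e e' y) \<partial>lborel)" using em[of UNIV] by simp
    also have "\<dots> < \<infinity>" using nn_integral_slab_weight_finite[of e e'] by (simp add: ennreal_mult_less_top)
    finally show "emeasure \<mu> (space \<mu>) \<noteq> \<infinity>" by (simp add: \<mu>)
  qed
  have ge: "c0 * v \<le> measure \<mu> X" if "X \<in> sets borel" "ennreal v \<le> (\<integral>\<^sup>+y\<in>X. ennreal (slab_weight e e' y) \<partial>lborel)" "0 \<le> v" for X v
  proof -
    have "ennreal (c0 * v) \<le> emeasure \<mu> X"
      unfolding em[OF that(1)] using c0 that(2) by (simp add: ennreal_mult' mult_left_mono)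
    then show ?thesis by (simp add: emeasure_eq_measure)
  qed
  show ?thesis
  proof (rule exI[of _ "a / A"], rule conjI, use a A in simp, intro allI impI, elim conjE)
    fix k :: real assume k: "1 < k" "k \<le> 3/2"
    \<comment> \<open>\<open>1 / T\<^sup>2 = k - 1\<close>: the slab is used at the place where its
      width equals the excess of the dilation.\<close>
    define T where "T = (k - 1) powr (- (1/2))"
    have T0: "0 < T" using k by (simp add: T_def)
    have "T\<^sup>2 = (k - 1) powr (- (1/2) + - (1/2))" by (simp only: T_def power2_eq_square powr_add)
    then have T2: "1 / T\<^sup>2 = k - 1" using k by (simp add: powr_minus_divide)
    have T: "1 \<le> T"
    proof (rule ccontr)
      assume "\<not> 1 \<le> T"
      then have "T\<^sup>2 < 1" using T0 by (simp add: power_less_one_iff)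
      then have "1 < 1 / T\<^sup>2" using T0 by simp
      then show False using T2 k by linarith
    qed
    have kT: "k = 1 + 1 / T\<^sup>2" using T2 by simp
    have Tn: "T ^ (n - 1) = (k - 1) powr (- ((real CARD('n) - 1) / 2))"
    proof -
      have "T ^ (n - 1) = (k - 1) powr (- (1/2) * real (n - 1))" using k by (simp add: T_def powr_power mult.commute)
      also have "real (n - 1) = real CARD('n) - 1" using n by (simp add: n_def of_nat_diff)
      finally show ?thesis by (simp add: field_simps)
    qed
    define m where "m = sqrt (T - 1)"
    have m: "m\<^sup>2 = T - 1" using T by (simp add: m_def)
    obtain E where E: "E \<in> sets borel"
      "\<forall>x\<in>E. -1 / T\<^sup>2 < x \<bullet> e \<and> x \<bullet> e < 0 \<and> (\<forall>b\<in>Basis. b \<noteq> e \<longrightarrow> \<bar>(x - m *\<^sub>R e') \<bullet> b\<bar> \<le> 1 / (4 * DIM(real^'n)))"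
      "ennreal (a / T ^ 3) \<le> (\<integral>\<^sup>+y\<in>E. ennreal (slab_weight e e' y) \<partial>lborel)"
      and D: "ennreal (a / T ^ (n + 2)) \<le> (\<integral>\<^sup>+y\<in>ball (m *\<^sub>R e' - (1/2) *\<^sub>R e) (1/4). ennreal (slab_weight e e' y) \<partial>lborel)"
      using low[rule_format, of T m] T m unfolding n_def by blast
    define F where "F = ball (m *\<^sub>R e' - (1/2) *\<^sub>R e) (1/4)"
    have F [measurable]: "F \<in> sets borel" by (simp add: F_def)
    define M where "M = c0 * (A / T ^ (n + 2))"
    have M: "0 < M" using c0 A T0 by (simp add: M_def)
    have muE: "c0 * (a / T ^ 3) \<le> measure \<mu> E" using ge[OF E(1,3)] a T0 by simp
    have muF: "c0 * (a / T ^ (n + 2)) \<le> measure \<mu> F" using ge[OF F D[folded F_def]] a T0 by simp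
    have F0: "0 < measure \<mu> F" by (rule less_le_trans[OF _ muF]) (use c0 a T0 in simp)
    have max: "ennreal (measure \<mu> F / M) \<le> maximal_op k \<mu> (indicator F) x" if x: "x \<in> E" for x
    proof -
      have xe: "-1 < x \<bullet> e" "x \<bullet> e < 0" using E(2) x T2 k by force+
      define c where "c = x - (x \<bullet> e + 1/2) *\<^sub>R e"
      have xb: "\<bar>(x - m *\<^sub>R e') \<bullet> b\<bar> \<le> 1 / (4 * real n)" if "b \<in> Basis" "b \<noteq> e" for b
        using bspec[OF E(2) x] that by (simp add: n_def)
      have h: "1 / (4 * real n) \<le> 1/4" using n by (simp add: field_simps)
      have ee: "e \<bullet> e = 1" "e' \<bullet> e' = 1" using e by (auto simp: inner_Basis)
      have ne: "norm e = 1" using e(1) by simp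
      have "x - c = (x \<bullet> e + 1/2) *\<^sub>R e" by (simp add: c_def)
      then have "norm (x - c) = \<bar>x \<bullet> e + 1/2\<bar>" using ne by simp
      then have "dist c x < 1/2" using xe by (simp add: dist_norm norm_minus_commute) argo
      then have xc: "x \<in> ball c (1/2)" by simp
      have "norm (c - (m *\<^sub>R e' - (1/2) *\<^sub>R e)) \<le> (\<Sum>b\<in>Basis. \<bar>(c - (m *\<^sub>R e' - (1/2) *\<^sub>R e)) \<bullet> b\<bar>)" by (rule norm_le_l1)
      also have "\<dots> \<le> (\<Sum>b\<in>(Basis::(real^'n) set). 1 / (4 * real n))"
      proof (rule sum_mono)
        fix b :: "real^'n" assume b: "b \<in> Basis"
        show "\<bar>(c - (m *\<^sub>R e' - (1/2) *\<^sub>R e)) \<bullet> b\<bar> \<le> 1 / (4 * real n)"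
        proof (cases "b = e")
          case True
          have "(c - (m *\<^sub>R e' - (1/2) *\<^sub>R e)) \<bullet> e = 0" using e by (simp add: c_def inner_simps ee inner_Basis)
          then show ?thesis using True by simp
        next
          case False
          then have "(c - (m *\<^sub>R e' - (1/2) *\<^sub>R e)) \<bullet> b = (x - m *\<^sub>R e') \<bullet> b" using b e(1) by (simp add: c_def inner_simps inner_Basis)
          then show ?thesis using xb[OF b False] by simp
        qed
      qed
      also have "\<dots> = 1/4" using n by (simp add: n_def)
      finally have cF: "dist c (m *\<^sub>R e' - (1/2) *\<^sub>R e) \<le> 1/4" by (simp add: dist_norm)
      have FB: "F \<subseteq> ball c (1/2)"
      proof
        fix y assume "y \<in> F"
        then have "dist (m *\<^sub>R e' - (1/2) *\<^sub>R e) y < 1/4" by (simp add: F_def)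
        with cF dist_triangle[of c y "m *\<^sub>R e' - (1/2) *\<^sub>R e"] show "y \<in> ball c (1/2)" unfolding mem_ball by linarith
      qed
      have x': "\<bar>x \<bullet> e' - m\<bar> \<le> 1/4" using order_trans[OF xb[OF e(2) e(3)[symmetric]] h] by (simp add: inner_diff_left ee)
      have x'': "\<forall>b\<in>Basis. b \<noteq> e \<longrightarrow> b \<noteq> e' \<longrightarrow> \<bar>x \<bullet> b\<bar> \<le> 1"
      proof (intro ballI impI)
        fix b :: "real^'n" assume b: "b \<in> Basis" "b \<noteq> e" "b \<noteq> e'"
        have "e' \<bullet> b = 0" using b e by (simp add: inner_Basis)
        then show "\<bar>x \<bullet> b\<bar> \<le> 1" using order_trans[OF xb[OF b(1,2)] h] by (simp add: inner_diff_left)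
      qed
      have "(\<integral>\<^sup>+y\<in>ball c (k / 2). ennreal (slab_weight e e' y) \<partial>lborel) \<le> ennreal (A / T ^ (n + 2))"
        unfolding c_def n_def
        by (rule mp[OF spec[OF spec[OF spec[OF spec[OF up]]]], of T k m]) (intro conjI T kT k(2) m x' x'')
      then have "emeasure \<mu> (ball c (k / 2)) \<le> ennreal c0 * ennreal (A / T ^ (n + 2))"
        unfolding em[OF borel_open[OF open_ball]] by (rule mult_left_mono) simp
      then have kB: "emeasure \<mu> (ball c (k * (1/2))) \<le> ennreal M" using c0 by (simp add: M_def ennreal_mult'[symmetric])
      have "ennreal (measure \<mu> F / M) = emeasure \<mu> F / ennreal M"
        using M by (simp add: emeasure_eq_measure divide_ennreal)
      also have "\<dots> \<le> emeasure \<mu> F / emeasure \<mu> (ball c (k * (1/2)))"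
        by (rule ennreal_divide_left_mono[OF kB M])
      also have "emeasure \<mu> F = (\<integral>\<^sup>+y\<in>ball c (1/2). ennreal \<bar>indicator F y\<bar> \<partial>\<mu>)"
      proof -
        have "(\<integral>\<^sup>+y\<in>ball c (1/2). ennreal \<bar>indicator F y\<bar> \<partial>\<mu>) = (\<integral>\<^sup>+y. indicator F y \<partial>\<mu>)"
          by (rule nn_integral_cong) (use FB in \<open>auto simp: indicator_def\<close>)
        then show ?thesis by (simp add: s)
      qed
      also have "\<dots> / emeasure \<mu> (ball c (k * (1/2))) \<le> maximal_op k \<mu> (indicator F) x"
        by (rule average_le_maximal_op[OF _ xc]) simp
      finally show ?thesis .
    qed
    have 1: "a / A \<le> measure \<mu> F / M"
    proof -
      have "a / A = c0 * (a / T ^ (n + 2)) / M" using c0 A T0 by (simp add: M_def field_simps)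
      also have "\<dots> \<le> measure \<mu> F / M" using muF M by (intro divide_right_mono) auto
      finally show ?thesis .
    qed
    have 2: "a / A * T ^ (n - 1) * measure \<mu> F \<le> measure \<mu> F / M * measure \<mu> E"
    proof -
      have Tn2: "T ^ (n + 2) = T ^ 3 * T ^ (n - 1)" using n by (simp add: power_add[symmetric])
      have "a / A * T ^ (n - 1) = c0 * (a / T ^ 3) / M" unfolding M_def Tn2 using c0 A T0 by (simp add: field_simps)
      also have "\<dots> \<le> measure \<mu> E / M" using muE M by (intro divide_right_mono) auto
      finally have "a / A * T ^ (n - 1) * measure \<mu> F \<le> measure \<mu> E / M * measure \<mu> F" by (rule mult_right_mono) simp
      then show ?thesis by (simp add: mult.commute)
    qed
    show "maximal_test_sets k \<mu> (a / A) ((k - 1) powr (- ((real CARD('n) - 1) / 2)))"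
      unfolding maximal_test_sets_def Tn[symmetric]
      by (intro exI[of _ F] exI[of _ E] exI[of _ "measure \<mu> F / M"] conjI ballI F E(1) F0 1 2 max) (use F0 M in simp)
  qed
qed

lemma extremal_measure:
  assumes dim: "2 \<le> CARD('n)"
  shows "\<exists>C>0. \<exists>w :: real^'n \<Rightarrow> real. \<exists>\<mu> B. C_infinity w \<and> (\<forall>x. 0 < w x \<and> w x \<le> C) \<and>
    \<mu> = density lborel (\<lambda>x. ennreal (w x)) \<and> prob_space \<mu> \<and> 0 < B \<and>
    (\<forall>k. 1 < k \<and> k \<le> 3/2 \<longrightarrow> maximal_test_sets k \<mu> B ((k - 1) powr (- ((real CARD('n) - 1) / 2))))"
proof -
  have "2 \<le> card (Basis :: (real^'n) set)" using dim by simp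
  then obtain e e' :: "real^'n" where e: "e \<in> Basis" "e' \<in> Basis" "e \<noteq> e'"
    by (meson card_2_iff' obtain_subset_with_card_n subsetD)
  define I where "I = (\<integral>\<^sup>+x. ennreal (slab_weight e e' x) \<partial>lborel)"
  have I: "I < \<infinity>" unfolding I_def by (rule nn_integral_slab_weight_finite)
  have I0: "I \<noteq> 0"
  proof
    assume "I = 0"
    then have "AE x in lborel. ennreal (slab_weight e e' x) = 0" unfolding I_def by (subst (asm) nn_integral_0_iff_AE) simp_all
    then have "AE x in (lborel :: (real^'n) measure). False"
    proof (rule eventually_mono)
      fix x assume "ennreal (slab_weight e e' x) = 0"
      then have "slab_weight e e' x \<le> 0" by (simp add: ennreal_eq_0_iff)
      with slab_weight_le(1)[of e e' x] show False by linarith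
    qed
    then have "emeasure (lborel :: (real^'n) measure) UNIV = 0" by (simp add: AE_iff_null null_sets_def)
    then show False by simp
  qed
  obtain i where i: "I = ennreal i" "0 < i" using I I0 by (cases I) (auto simp: less_le)
  \<comment> \<open>Division by the total mass makes \<open>w\<close> a probability density;
    \<open>i\<close>, and with it the bound \<open>2 / i\<close> for \<open>w\<close>, is fixed
    before \<open>k\<close> and \<open>p\<close> appear.\<close>
  define w where "w x = 1 / i * slab_weight e e' x" for x
  define \<mu> where "\<mu> = density lborel (\<lambda>x. ennreal (w x))"
  have c0: "0 < 1 / i" using i by simp
  obtain B where B: "0 < B" and test: "\<forall>k. 1 < k \<and> k \<le> 3/2 \<longrightarrow> maximal_test_sets k \<mu> B ((k - 1) powr (- ((real CARD('n) - 1) / 2)))"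
    by (rule exE[OF slab_measure_test_sets[OF e c0 \<mu>_def[unfolded w_def]]], erule conjE, rule that, assumption, assumption)
  have "(\<integral>\<^sup>+x. ennreal (w x) \<partial>lborel) = (\<integral>\<^sup>+x. ennreal (1 / i) * ennreal (slab_weight e e' x) \<partial>lborel)"
    unfolding w_def using c0 by (intro nn_integral_cong ennreal_mult') simp
  also have "\<dots> = ennreal (1 / i) * I" unfolding I_def by (rule nn_integral_cmult) measurable
  also have "\<dots> = 1" using i by (simp add: ennreal_mult'[symmetric])
  finally have "prob_space \<mu>"
    unfolding \<mu>_def by (intro prob_spaceI) (simp add: emeasure_density w_def[abs_def])
  moreover have "C_infinity w" unfolding C_infinity_def w_def
    by (intro allI C_times_mult C_times_const C_times_slab_weight)
  moreover have "0 < w x \<and> w x \<le> 1 / i * 2" for x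
    unfolding w_def using c0 slab_weight_le[of e e' x] by (intro conjI mult_pos_pos mult_left_mono) auto
  moreover have "0 < 1 / i * 2" using i by simp
  ultimately show ?thesis using B test \<mu>_def by blast
qed

theorem theorem3:
  fixes \<sigma> :: real
  assumes "2 \<le> CARD('n::finite)"
    and "\<sigma> = (real CARD('n) - 1) / 2"
  shows
    "(\<exists>C>0. \<forall>k (\<mu> :: (real ^ 'n) measure) f l.
        1 < k \<and> k \<le> 3 / 2 \<and> radon_measure \<mu> \<and> integrable \<mu> f \<and> 0 < l \<longrightarrow>
        emeasure \<mu> {x. ennreal l < maximal_op k \<mu> f x}
          \<le> ennreal (C * (k - 1) powr (- \<sigma>) / l) * (\<integral>\<^sup>+x. ennreal \<bar>f x\<bar> \<partial>\<mu>))
     \<and>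
     (\<exists>c>0. \<forall>k. 1 < k \<and> k \<le> 3 / 2 \<longrightarrow>
        ennreal (c * (k - 1) powr (- \<sigma>))
          \<le> (SUP \<mu>\<in>{\<mu> :: (real ^ 'n) measure. radon_measure \<mu>}. maximal_weak_const k \<mu>))
     \<and>
     (\<forall>p>1. \<exists>c C. 0 < c \<and> c \<le> C \<and> (\<forall>k. 1 < k \<and> k \<le> 3 / 2 \<longrightarrow>
        ennreal (c * (k - 1) powr (- \<sigma> / p))
          \<le> (SUP \<mu>\<in>{\<mu> :: (real ^ 'n) measure. radon_measure \<mu>}. maximal_op_norm k \<mu> p) \<and>
        (SUP \<mu>\<in>{\<mu> :: (real ^ 'n) measure. radon_measure \<mu>}. maximal_op_norm k \<mu> p)
          \<le> ennreal (C * (k - 1) powr (- \<sigma> / p))))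
     \<and>
     (\<forall>p>1. \<exists>C>0. \<forall>k (\<mu> :: (real ^ 'n) measure).
        1 < k \<and> k \<le> 3 / 2 \<and> radon_measure \<mu> \<longrightarrow>
        fefferman_stein_ineq k \<mu> p (C * (k - 1) powr (- \<sigma>)))
     \<and>
     (\<forall>p>1. \<forall>\<tau><\<sigma>. \<forall>C. \<not> (\<forall>k (\<mu> :: (real ^ 'n) measure).
        1 < k \<and> k \<le> 3 / 2 \<and> radon_measure \<mu> \<longrightarrow>
        fefferman_stein_ineq k \<mu> p (C * (k - 1) powr (- \<tau>))))
     \<and>
     (\<exists>C>0. \<exists>w :: real ^ 'n \<Rightarrow> real. \<exists>\<mu>.
        C_infinity w \<and> (\<forall>x. 0 < w x \<and> w x \<le> C) \<and>
        \<mu> = density lborel (\<lambda>x. ennreal (w x)) \<and> prob_space \<mu> \<and>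
        (\<exists>c>0. \<forall>k. 1 < k \<and> k \<le> 3 / 2 \<longrightarrow>
           ennreal (c * (k - 1) powr (- \<sigma>)) \<le> maximal_weak_const k \<mu>) \<and>
        (\<forall>p>1. \<exists>c>0. \<forall>k. 1 < k \<and> k \<le> 3 / 2 \<longrightarrow>
           ennreal (c * (k - 1) powr (- \<sigma> / p)) \<le> maximal_op_norm k \<mu> p) \<and>
        (\<forall>p>1. \<forall>\<tau><\<sigma>. \<forall>C. \<not> (\<forall>k. 1 < k \<and> k \<le> 3 / 2 \<longrightarrow>
           fefferman_stein_ineq k \<mu> p (C * (k - 1) powr (- \<tau>)))))"
proof -
  have \<sigma>: "\<sigma> = (real CARD('n) - 1) / 2" by (rule assms(2))
  have \<sigma>': "- ((real CARD('n) - 1) / 2) = - \<sigma>" using \<sigma> by simp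
  obtain C0 w and \<mu>0 :: "(real^'n) measure" and B where C0: "0 < C0" and w: "C_infinity w" "\<forall>x. 0 < w x \<and> w x \<le> C0"
    and \<mu>0: "\<mu>0 = density lborel (\<lambda>x. ennreal (w x))" and pr: "prob_space \<mu>0" and B: "0 < B"
    and test: "\<forall>k. 1 < k \<and> k \<le> 3/2 \<longrightarrow> maximal_test_sets k \<mu>0 B ((k - 1) powr (- \<sigma>))"
    using extremal_measure[OF assms(1)] unfolding \<sigma>' by blast
  have s: "sets \<mu>0 = sets borel" by (simp add: \<mu>0)
  have fin: "finite_measure \<mu>0" using pr by (rule prob_space.finite_measure)
  have rad: "radon_measure \<mu>0" by (rule radon_measure_finite[OF s fin])
  have weak: "ennreal (B / 2 * (k - 1) powr (- \<sigma>)) \<le> maximal_weak_const k \<mu>0" if "1 < k \<and> k \<le> 3/2" for k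
    by (rule weak_const_ge_test[OF s fin test[rule_format, OF that]])
  have norm: "ennreal (B * (k - 1) powr (- \<sigma> / p)) \<le> maximal_op_norm k \<mu>0 p" if "1 < p" "1 < k \<and> k \<le> 3/2" for k p
    using op_norm_ge_test[OF s fin test[rule_format, OF that(2)] B _ that(1)] by (simp add: powr_powr)
  have sharp: "\<not> (\<forall>k. 1 < k \<and> k \<le> 3/2 \<longrightarrow> fefferman_stein_ineq k \<mu>0 p (C * (k - 1) powr (- \<tau>)))"
    if "1 < p" "\<tau> < \<sigma>" for p \<tau> C
    by (rule fefferman_stein_power_sharp[OF s fin B that]) (use test in blast)
  have upper: "\<exists>C>0. \<forall>k (\<mu> :: (real ^ 'n) measure). 1 < k \<and> k \<le> 3 / 2 \<and> radon_measure \<mu> \<longrightarrow>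
      fefferman_stein_ineq k \<mu> p (C * (k - 1) powr (- \<sigma>)) \<and>
      maximal_op_norm k \<mu> p \<le> ennreal (C powr (1 / p) * (k - 1) powr (- \<sigma> / p))" if "1 < p" for p
    using fefferman_stein_upper[OF assms(1) that] unfolding \<sigma>' .
  show ?thesis
  proof (intro conjI)
    show "\<exists>C>0. \<forall>k (\<mu> :: (real ^ 'n) measure) f l.
        1 < k \<and> k \<le> 3 / 2 \<and> radon_measure \<mu> \<and> integrable \<mu> f \<and> 0 < l \<longrightarrow>
        emeasure \<mu> {x. ennreal l < maximal_op k \<mu> f x}
          \<le> ennreal (C * (k - 1) powr (- \<sigma>) / l) * (\<integral>\<^sup>+x. ennreal \<bar>f x\<bar> \<partial>\<mu>)"
      using weak_type_upper[OF assms(1)] unfolding \<sigma>' .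
    show "\<exists>c>0. \<forall>k. 1 < k \<and> k \<le> 3 / 2 \<longrightarrow>
        ennreal (c * (k - 1) powr (- \<sigma>))
          \<le> (SUP \<mu>\<in>{\<mu> :: (real ^ 'n) measure. radon_measure \<mu>}. maximal_weak_const k \<mu>)"
    proof (intro exI[of _ "B / 2"] conjI allI impI)
      fix k :: real assume "1 < k \<and> k \<le> 3 / 2"
      then show "ennreal (B / 2 * (k - 1) powr (- \<sigma>))
          \<le> (SUP \<mu>\<in>{\<mu> :: (real ^ 'n) measure. radon_measure \<mu>}. maximal_weak_const k \<mu>)"
        by (intro SUP_upper2[of \<mu>0] weak) (simp_all add: rad)
    qed (use B in simp)
    show "\<forall>p>1. \<exists>c C. 0 < c \<and> c \<le> C \<and> (\<forall>k. 1 < k \<and> k \<le> 3 / 2 \<longrightarrow>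
        ennreal (c * (k - 1) powr (- \<sigma> / p))
          \<le> (SUP \<mu>\<in>{\<mu> :: (real ^ 'n) measure. radon_measure \<mu>}. maximal_op_norm k \<mu> p) \<and>
        (SUP \<mu>\<in>{\<mu> :: (real ^ 'n) measure. radon_measure \<mu>}. maximal_op_norm k \<mu> p)
          \<le> ennreal (C * (k - 1) powr (- \<sigma> / p)))"
    proof (intro allI impI)
      fix p :: real assume p: "1 < p"
      obtain C where C: "0 < C" "\<forall>k (\<mu> :: (real ^ 'n) measure). 1 < k \<and> k \<le> 3 / 2 \<and> radon_measure \<mu> \<longrightarrow>
        fefferman_stein_ineq k \<mu> p (C * (k - 1) powr (- \<sigma>)) \<and>
        maximal_op_norm k \<mu> p \<le> ennreal (C powr (1 / p) * (k - 1) powr (- \<sigma> / p))"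
        by (rule exE[OF upper[OF p]], erule conjE, rule that, assumption, assumption)
      \<comment> \<open>The maximum secures the required order of the lower and the upper
        constant.\<close>
      define C' where "C' = max B (C powr (1 / p))"
      have up: "maximal_op_norm k \<mu> p \<le> ennreal (C' * (k - 1) powr (- \<sigma> / p))"
        if "1 < k \<and> k \<le> 3 / 2" "radon_measure \<mu>" for k and \<mu> :: "(real^'n) measure"
      proof -
        have "maximal_op_norm k \<mu> p \<le> ennreal (C powr (1 / p) * (k - 1) powr (- \<sigma> / p))" using C(2) that by blast
        also have "\<dots> \<le> ennreal (C' * (k - 1) powr (- \<sigma> / p))" by (intro ennreal_leI mult_right_mono) (auto simp: C'_def)
        finally show ?thesis .
      qed
      show "\<exists>c C. 0 < c \<and> c \<le> C \<and> (\<forall>k. 1 < k \<and> k \<le> 3 / 2 \<longrightarrow>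
        ennreal (c * (k - 1) powr (- \<sigma> / p))
          \<le> (SUP \<mu>\<in>{\<mu> :: (real ^ 'n) measure. radon_measure \<mu>}. maximal_op_norm k \<mu> p) \<and>
        (SUP \<mu>\<in>{\<mu> :: (real ^ 'n) measure. radon_measure \<mu>}. maximal_op_norm k \<mu> p)
          \<le> ennreal (C * (k - 1) powr (- \<sigma> / p)))"
      proof (rule exI[of _ B], rule exI[of _ C'], intro conjI allI impI)
        fix k :: real assume k: "1 < k \<and> k \<le> 3 / 2"
        show "ennreal (B * (k - 1) powr (- \<sigma> / p))
          \<le> (SUP \<mu>\<in>{\<mu> :: (real ^ 'n) measure. radon_measure \<mu>}. maximal_op_norm k \<mu> p)"
          by (intro SUP_upper2[of \<mu>0] norm p k) (simp add: rad)
        show "(SUP \<mu>\<in>{\<mu> :: (real ^ 'n) measure. radon_measure \<mu>}. maximal_op_norm k \<mu> p)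
          \<le> ennreal (C' * (k - 1) powr (- \<sigma> / p))"
          by (intro SUP_least up k) simp
      qed (use B in \<open>simp_all add: C'_def\<close>)
    qed
    show "\<forall>p>1. \<exists>C>0. \<forall>k (\<mu> :: (real ^ 'n) measure).
        1 < k \<and> k \<le> 3 / 2 \<and> radon_measure \<mu> \<longrightarrow>
        fefferman_stein_ineq k \<mu> p (C * (k - 1) powr (- \<sigma>))"
      using upper by meson
    show "\<forall>p>1. \<forall>\<tau><\<sigma>. \<forall>C. \<not> (\<forall>k (\<mu> :: (real ^ 'n) measure).
        1 < k \<and> k \<le> 3 / 2 \<and> radon_measure \<mu> \<longrightarrow>
        fefferman_stein_ineq k \<mu> p (C * (k - 1) powr (- \<tau>)))"
      using sharp rad by meson
    show "\<exists>C>0. \<exists>w :: real ^ 'n \<Rightarrow> real. \<exists>\<mu>.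
        C_infinity w \<and> (\<forall>x. 0 < w x \<and> w x \<le> C) \<and>
        \<mu> = density lborel (\<lambda>x. ennreal (w x)) \<and> prob_space \<mu> \<and>
        (\<exists>c>0. \<forall>k. 1 < k \<and> k \<le> 3 / 2 \<longrightarrow>
           ennreal (c * (k - 1) powr (- \<sigma>)) \<le> maximal_weak_const k \<mu>) \<and>
        (\<forall>p>1. \<exists>c>0. \<forall>k. 1 < k \<and> k \<le> 3 / 2 \<longrightarrow>
           ennreal (c * (k - 1) powr (- \<sigma> / p)) \<le> maximal_op_norm k \<mu> p) \<and>
        (\<forall>p>1. \<forall>\<tau><\<sigma>. \<forall>C. \<not> (\<forall>k. 1 < k \<and> k \<le> 3 / 2 \<longrightarrow>
           fefferman_stein_ineq k \<mu> p (C * (k - 1) powr (- \<tau>))))"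
    proof (rule exI[of _ C0], rule conjI, rule C0, rule exI[of _ w], rule exI[of _ \<mu>0], intro conjI)
      show "\<exists>c>0. \<forall>k. 1 < k \<and> k \<le> 3 / 2 \<longrightarrow>
           ennreal (c * (k - 1) powr (- \<sigma>)) \<le> maximal_weak_const k \<mu>0"
        using weak B by (intro exI[of _ "B / 2"]) simp
      show "\<forall>p>1. \<exists>c>0. \<forall>k. 1 < k \<and> k \<le> 3 / 2 \<longrightarrow>
           ennreal (c * (k - 1) powr (- \<sigma> / p)) \<le> maximal_op_norm k \<mu>0 p"
        using norm B by blast
      show "\<forall>p>1. \<forall>\<tau><\<sigma>. \<forall>C. \<not> (\<forall>k. 1 < k \<and> k \<le> 3 / 2 \<longrightarrow>
           fefferman_stein_ineq k \<mu>0 p (C * (k - 1) powr (- \<tau>)))"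
        using sharp by blast
    qed (use w \<mu>0 pr in auto)
  qed
qed

end
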